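(* Let $M$ be a connected $C^\infty$-smooth Riemannian manifold of dimension $n\ge 2$ and let $f_1,\dots,f_s$ be $C^\infty$-smooth vector fields on $M$, bounded on $M$ together with their covariant derivatives of each order. Let $B\subset\bigcup_{N\ge1}\{1,\dots,s\}^N$ be a finite set of multi-indices and let $P_t^{v(\cdot)}$ be a flow on $M$ generated by the extended control system $$\dot x=\sum_{\beta\in B}X^\beta(x)v_\beta(t),\qquad X^\beta=[f_{\beta_1},[f_{\beta_2},[\dots,f_{\beta_N}]\dots]],$$ and an extended control $v(t)=(v_\beta(t))_{\beta\in B}$, $t\in[0,T]$. Then for each $\varepsilon>0$, $r\ge0$ and compact $K\subset M$ there exists a control $u(t)=(u_1(t),\dots,u_s(t))$ such that the flow $P_t^{u(\cdot)}$ generated by the control system $$\dot x=\sum_{j=1}^s f_j(x)u_j(t)$$ and the control $u(\cdot)$ satisfies $$\|P_t^{v(\cdot)}-P_t^{u(\cdot)}\|_{r,K}<\varepsilon\qquad\forall t\in[0,T].$$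
   Context: For a one-element multi-index $\beta=(j)$, $X^\beta=f_j$; by default the fields $f_1,\dots,f_s$ are included in the family $\{X^\beta:\beta\in B\}$. Controls $u(\cdot)$ and extended controls $v(\cdot)$ are bounded measurable functions on $[0,T]$ with values in $\mathbb{R}^s$ and $\mathbb{R}^B$ respectively. The flow generated by an equation and a control sends $x_0$ to the value at time $t$ of the solution with $x(0)=x_0$. $\|\cdot\|_{r,K}$ are the usual $C^r$ seminorms on the compact $K$: for vector fields $\|X\|_{r,K}=\sup_{x\in K}\sum_{0\le|\beta|\le r}|D^\beta X(x)|$, the sum of the sizes of the (covariant) derivatives of order up to $r$. For the difference of two maps $P,Q$ into $M$ the same expression is used after fixing a smooth closed embedding $\iota:M\to\mathbb{R}^m$, i.e. $\|P-Q\|_{r,K}$ is the sum-of-derivatives seminorm, over orders $\le r$, of $\iota\circ P-\iota\circ Q$ on $K$. *)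

theory Defs
  imports "HOL-Analysis.Analysis"
begin

section \<open>Smooth maps between Euclidean spaces\<close>

text \<open>For open \<open>S\<close>, \<open>k_smooth_on S f k\<close> says that \<open>f\<close> is of class \<open>C\<^sup>k\<close> on \<open>S\<close>.\<close>

primrec k_smooth_on ::
  "'a::real_normed_vector set \<Rightarrow> ('a \<Rightarrow> 'b::real_normed_vector) \<Rightarrow> nat \<Rightarrow> bool" where
  "k_smooth_on S f 0 \<longleftrightarrow> continuous_on S f"
| "k_smooth_on S f (Suc k) \<longleftrightarrow>
     (\<forall>x\<in>S. f differentiable (at x)) \<and>
     (\<forall>v. k_smooth_on S (\<lambda>x. frechet_derivative f (at x) v) k)"

definition smooth_on :: "'a::real_normed_vector set \<Rightarrow> ('a \<Rightarrow> 'b::real_normed_vector) \<Rightarrow> bool" where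
  "smooth_on S f \<longleftrightarrow> (\<forall>k. k_smooth_on S f k)"


section \<open>Manifolds\<close>

text \<open>The underlying set of the manifold is the whole type \<open>'a\<close>; its dimension is \<open>CARD('n)\<close>.
  A chart is a pair of a domain and a coordinate map, the latter being irrelevant off the domain.\<close>

type_synonym ('a, 'n) chart = "'a set \<times> ('a \<Rightarrow> real ^ 'n)"

abbreviation domain :: "('a, 'n::finite) chart \<Rightarrow> 'a set" where
  "domain c \<equiv> fst c"

abbreviation coord :: "('a, 'n::finite) chart \<Rightarrow> 'a \<Rightarrow> real ^ 'n" where
  "coord c \<equiv> snd c"

definition param :: "('a, 'n::finite) chart \<Rightarrow> real ^ 'n \<Rightarrow> 'a" where
  "param c = inv_into (domain c) (coord c)"

definition is_chart :: "('a::topological_space, 'n::finite) chart \<Rightarrow> bool" where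
  "is_chart c \<longleftrightarrow> open (domain c) \<and> open (coord c ` domain c) \<and>
     homeomorphism (domain c) (coord c ` domain c) (coord c) (param c)"

definition smooth_atlas :: "('a::topological_space, 'n::finite) chart set \<Rightarrow> bool" where
  "smooth_atlas A \<longleftrightarrow>
     (\<forall>c\<in>A. is_chart c) \<and> (\<Union>c\<in>A. domain c) = UNIV \<and>
     (\<forall>c\<in>A. \<forall>d\<in>A. smooth_on (coord c ` (domain c \<inter> domain d)) (coord d \<circ> param c))"

text \<open>All pointwise sizes below are independent of the chart in which they are computed.\<close>

definition chart_at :: "('a, 'n::finite) chart set \<Rightarrow> 'a \<Rightarrow> ('a, 'n) chart" where
  "chart_at A p = (SOME c. c \<in> A \<and> p \<in> domain c)"

definition smooth_map ::
  "('a, 'n::finite) chart set \<Rightarrow> ('a \<Rightarrow> 'b::real_normed_vector) \<Rightarrow> bool" where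
  "smooth_map A F \<longleftrightarrow> (\<forall>c\<in>A. smooth_on (coord c ` domain c) (F \<circ> param c))"

definition chart_deriv ::
  "('a, 'n::finite) chart \<Rightarrow> ('a \<Rightarrow> 'b::real_normed_vector) \<Rightarrow> 'a \<Rightarrow> real ^ 'n \<Rightarrow> 'b" where
  "chart_deriv c F p = frechet_derivative (F \<circ> param c) (at (coord c p))"

definition partial ::
  "('a, 'n::finite) chart \<Rightarrow> 'n \<Rightarrow> ('a \<Rightarrow> 'b::real_normed_vector) \<Rightarrow> 'a \<Rightarrow> 'b" where
  "partial c i F p = chart_deriv c F p (axis i 1)"

definition smooth_closed_embedding ::
  "('a::topological_space, 'n::finite) chart set \<Rightarrow> ('a \<Rightarrow> 'b::real_normed_vector) \<Rightarrow> bool" where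
  "smooth_closed_embedding A \<iota> \<longleftrightarrow>
     smooth_map A \<iota> \<and> (\<forall>c\<in>A. \<forall>p\<in>domain c. inj (chart_deriv c \<iota> p)) \<and>
     inj \<iota> \<and> homeomorphism UNIV (range \<iota>) \<iota> (inv \<iota>) \<and> closed (range \<iota>)"


section \<open>Vector fields and Lie brackets\<close>

text \<open>A vector field is given by its components in every chart of the atlas:
  \<open>X c p\<close> represents, in the chart \<open>c\<close>, the tangent vector at \<open>p\<close>.\<close>

type_synonym ('a, 'n) vfield = "('a, 'n) chart \<Rightarrow> 'a \<Rightarrow> real ^ 'n"

definition smooth_vfield ::
  "('a, 'n::finite) chart set \<Rightarrow> ('a, 'n) vfield \<Rightarrow> bool" where
  "smooth_vfield A X \<longleftrightarrow>
     (\<forall>c\<in>A. smooth_on (coord c ` domain c) (X c \<circ> param c)) \<and>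
     (\<forall>c\<in>A. \<forall>d\<in>A. \<forall>p\<in>domain c \<inter> domain d. X d p = chart_deriv c (coord d) p (X c p))"

text \<open>The sign is that of the commutator of derivations, \<open>[X, Y] = XY - YX\<close>.\<close>

definition lie_bracket ::
  "('a, 'n::finite) vfield \<Rightarrow> ('a, 'n) vfield \<Rightarrow> ('a, 'n) vfield" where
  "lie_bracket X Y = (\<lambda>c p. chart_deriv c (Y c) p (X c p) - chart_deriv c (X c) p (Y c p))"

text \<open>The value on the empty word is a dummy.\<close>

fun iterated_bracket ::
  "(nat \<Rightarrow> ('a, 'n::finite) vfield) \<Rightarrow> nat list \<Rightarrow> ('a, 'n) vfield" where
  "iterated_bracket f [] = (\<lambda>c p. 0)"
| "iterated_bracket f [j] = f j"
| "iterated_bracket f (j # k # \<beta>) = lie_bracket (f j) (iterated_bracket f (k # \<beta>))"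


section \<open>Riemannian metrics and covariant derivatives\<close>

text \<open>A metric is given by its Gram matrix in every chart.\<close>

type_synonym ('a, 'n) metric = "('a, 'n) chart \<Rightarrow> 'a \<Rightarrow> real ^ 'n ^ 'n"

definition metric_inner ::
  "('a, 'n::finite) metric \<Rightarrow> ('a, 'n) chart \<Rightarrow> 'a \<Rightarrow> real ^ 'n \<Rightarrow> real ^ 'n \<Rightarrow> real" where
  "metric_inner g c p v w = v \<bullet> (g c p *v w)"

definition riemannian_metric ::
  "('a, 'n::finite) chart set \<Rightarrow> ('a, 'n) metric \<Rightarrow> bool" where
  "riemannian_metric A g \<longleftrightarrow>
     (\<forall>c\<in>A. smooth_on (coord c ` domain c) (g c \<circ> param c)) \<and>
     (\<forall>c\<in>A. \<forall>p\<in>domain c. transpose (g c p) = g c p \<and>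
        (\<forall>v. v \<noteq> 0 \<longrightarrow> metric_inner g c p v v > 0)) \<and>
     (\<forall>c\<in>A. \<forall>d\<in>A. \<forall>p\<in>domain c \<inter> domain d. \<forall>v w.
        metric_inner g c p v w =
        metric_inner g d p (chart_deriv c (coord d) p v) (chart_deriv c (coord d) p w))"

text \<open>\<open>christoffel g c k i j\<close> is the symbol with upper index \<open>k\<close> and lower indices \<open>i\<close>, \<open>j\<close>
  of the Levi-Civita connection.\<close>

definition christoffel ::
  "('a, 'n::finite) metric \<Rightarrow> ('a, 'n) chart \<Rightarrow> 'n \<Rightarrow> 'n \<Rightarrow> 'n \<Rightarrow> 'a \<Rightarrow> real" where
  "christoffel g c k i j p =
     (\<Sum>l\<in>UNIV. matrix_inv (g c p) $ k $ l *
        (partial c i (\<lambda>q. g c q $ j $ l) p + partial c j (\<lambda>q. g c q $ i $ l) p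
         - partial c l (\<lambda>q. g c q $ i $ j) p)) / 2"

text \<open>Components in the chart \<open>c\<close> of the iterated covariant derivatives of a section \<open>F\<close> of a
  vector bundle, the list holding the covariant indices with the one of the last differentiation
  first. The map \<open>\<omega> i p\<close> is the \<open>i\<close>-th coefficient of the connection on that bundle: it is zero
  for maps into a fixed vector space and given by the Christoffel symbols for vector fields.\<close>

function cov_deriv ::
  "('a, 'n::finite) metric \<Rightarrow> ('a, 'n) chart \<Rightarrow> ('n \<Rightarrow> 'a \<Rightarrow> 'b \<Rightarrow> 'b) \<Rightarrow>
   ('a \<Rightarrow> 'b::real_normed_vector) \<Rightarrow> 'n list \<Rightarrow> 'a \<Rightarrow> 'b" where
  "cov_deriv g c \<omega> F [] = F"
| "cov_deriv g c \<omega> F (i # js) = (\<lambda>p.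
     partial c i (cov_deriv g c \<omega> F js) p + \<omega> i p (cov_deriv g c \<omega> F js p)
     - (\<Sum>m<length js. \<Sum>l\<in>UNIV.
          christoffel g c l i (js ! m) p *\<^sub>R cov_deriv g c \<omega> F (js[m := l]) p))"
  by pat_completeness auto
termination
  by (relation "Wellfounded.measure (\<lambda>(g, c, \<omega>, F, js). length js)") auto

text \<open>Norm at \<open>p\<close> of a covariant tensor of rank \<open>k\<close> with components \<open>T\<close> and values in a space with
  inner product \<open>h\<close>; the covariant indices are contracted with the inverse metric.\<close>

definition tensor_norm ::
  "('a, 'n::finite) metric \<Rightarrow> ('a, 'n) chart \<Rightarrow> 'a \<Rightarrow> ('b \<Rightarrow> 'b \<Rightarrow> real) \<Rightarrow> nat \<Rightarrow>
   ('n list \<Rightarrow> 'b) \<Rightarrow> real" where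
  "tensor_norm g c p h k T =
     sqrt (\<Sum>is\<in>{is. length is = k}. \<Sum>js\<in>{js. length js = k}.
       (\<Prod>m<k. matrix_inv (g c p) $ (is ! m) $ (js ! m)) * h (T is) (T js))"

definition vfield_deriv_norm ::
  "('a, 'n::finite) chart set \<Rightarrow> ('a, 'n) metric \<Rightarrow> nat \<Rightarrow> ('a, 'n) vfield \<Rightarrow> 'a \<Rightarrow> real" where
  "vfield_deriv_norm A g k X p =
     (let c = chart_at A p in
      tensor_norm g c p (metric_inner g c p) k
        (\<lambda>js. cov_deriv g c (\<lambda>i q Y. \<chi> a. \<Sum>b\<in>UNIV. christoffel g c a i b q * Y $ b) (X c) js p))"

definition map_deriv_norm ::
  "('a, 'n::finite) chart set \<Rightarrow> ('a, 'n) metric \<Rightarrow> nat \<Rightarrow> ('a \<Rightarrow> 'b::real_inner) \<Rightarrow> 'a \<Rightarrow> real" where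
  "map_deriv_norm A g k F p =
     (let c = chart_at A p in
      tensor_norm g c p inner k (\<lambda>js. cov_deriv g c (\<lambda>i q y. 0) F js p))"

definition bounded_with_derivatives ::
  "('a, 'n::finite) chart set \<Rightarrow> ('a, 'n) metric \<Rightarrow> ('a, 'n) vfield \<Rightarrow> bool" where
  "bounded_with_derivatives A g X \<longleftrightarrow> (\<forall>k. \<exists>C. \<forall>p. vfield_deriv_norm A g k X p \<le> C)"

text \<open>Taking values in \<open>ennreal\<close> makes the supremum meaningful for every \<open>K\<close>, the empty set
  included.\<close>

definition cr_seminorm ::
  "('a, 'n::finite) chart set \<Rightarrow> ('a, 'n) metric \<Rightarrow> nat \<Rightarrow> 'a set \<Rightarrow> ('a \<Rightarrow> 'b::real_inner) \<Rightarrow>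
   ennreal" where
  "cr_seminorm A g r K F = (SUP p\<in>K. ennreal (\<Sum>k\<le>r. map_deriv_norm A g k F p))"


section \<open>Control systems and flows\<close>

definition is_control :: "real \<Rightarrow> 'i set \<Rightarrow> ('i \<Rightarrow> real \<Rightarrow> real) \<Rightarrow> bool" where
  "is_control T J u \<longleftrightarrow>
     (\<forall>j\<in>J. u j \<in> borel_measurable (lebesgue_on {0..T}) \<and> bounded (u j ` {0..T}))"

definition control_field ::
  "'i set \<Rightarrow> ('i \<Rightarrow> ('a, 'n::finite) vfield) \<Rightarrow> ('i \<Rightarrow> real \<Rightarrow> real) \<Rightarrow> real \<Rightarrow> ('a, 'n) vfield" where
  "control_field J X u = (\<lambda>t c p. \<Sum>j\<in>J. u j t *\<^sub>R X j c p)"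

text \<open>Solutions are understood in the sense of Caratheodory, the right-hand side being merely
  measurable in time: in each chart the integral form of the equation holds on every time interval
  that the curve spends in the domain of the chart.\<close>

definition is_solution ::
  "('a::topological_space, 'n::finite) chart set \<Rightarrow> real \<Rightarrow> (real \<Rightarrow> ('a, 'n) vfield) \<Rightarrow>
   (real \<Rightarrow> 'a) \<Rightarrow> bool" where
  "is_solution A T Y x \<longleftrightarrow>
     continuous_on {0..T} x \<and>
     (\<forall>c\<in>A. \<forall>a b. 0 \<le> a \<and> a \<le> b \<and> b \<le> T \<and> x ` {a..b} \<subseteq> domain c \<longrightarrow>
        ((\<lambda>t. Y t c (x t)) has_integral (coord c (x b) - coord c (x a))) {a..b})"

text \<open>Initial points whose solution exists on all of \<open>[0, T]\<close>; the flow maps have this set as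
  their common domain.\<close>

definition flow_domain ::
  "('a::topological_space, 'n::finite) chart set \<Rightarrow> real \<Rightarrow> (real \<Rightarrow> ('a, 'n) vfield) \<Rightarrow> 'a set" where
  "flow_domain A T Y = {x0. \<exists>x. is_solution A T Y x \<and> x 0 = x0}"

definition is_flow ::
  "('a::topological_space, 'n::finite) chart set \<Rightarrow> real \<Rightarrow> (real \<Rightarrow> ('a, 'n) vfield) \<Rightarrow>
   (real \<Rightarrow> 'a \<Rightarrow> 'a) \<Rightarrow> bool" where
  "is_flow A T Y P \<longleftrightarrow>
     (\<forall>x0\<in>flow_domain A T Y. is_solution A T Y (\<lambda>t. P t x0) \<and> P 0 x0 = x0)"

end

theory Submission
 imports Defs
begin

text \<open>Nested brackets are eliminated one at a time, longest first. If the flow of a system with a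
 bracket \<open>[F, Y]\<close> carrying the coefficient \<open>w\<close> is to be imitated, one adds to the controls of \<open>F\<close> and
 \<open>Y\<close> rapidly oscillating terms of amplitude \<open>\<omega>\<close> and frequency \<open>\<omega>\<^sup>2\<close> whose product of primitive and
 derivative has mean \<open>w\<close>; a near-identity change of variables shows that every solution of the new
 system solves the old one up to an integrated error of order \<open>1 / \<omega>\<close>, so Gronwall's inequality
 gives uniform convergence on compact time intervals.

 Closeness of derivatives costs nothing extra: the derivative of a flow is the flow of the tangent
 lifts of the fields, the tangent lift commutes with brackets, and so \<open>C\<^sup>r\<close>-convergence is uniform
 convergence for the \<open>r\<close>-fold lift. The Banach space of bounded sequences is isomorphic to its
 square, which keeps all iterated lifts in a single type. Charts are glued by subdividing the time
 interval. Covariant derivatives are tensorial, so their norms may be computed in a fixed finite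
 family of charts covering the compact set, where they are bounded by the partial derivatives.\<close>

section \<open>A Banach space isomorphic to its square\<close>

text \<open>In a simply typed logic the tangent bundle of a space has a new type, so an induction
  over \<open>r\<close> that replaces a system by its tangent lift can only be stated if all lifts
  share one type; this is why the integral equations are treated in an infinite-dimensional space.
  The same control must serve every chart and every order of differentiation at once, so the
  property proved of a family of controls is quantified over all systems of fields with the given
  bracket relations. The velocity of the oscillating system has order \<omega>, hence a first-order
  change of variables would leave errors of order one. It is carried to second order: the new
  corrections have size 1 / \<omega>^2, and their derivatives along the velocity are again of order
  1 / \<omega>. The change of variables also differentiates the coefficient that is eliminated;
  therefore measurable coefficients are first replaced, in the mean, by members of a class closed
  under differentiation and products.\<close>

instantiation nat :: metric_space
begin

text \<open>The completeness instance for bounded continuous functions asks for a metric on the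
  domain. With this metric, which induces the discrete topology, every sequence is continuous, so
  \<open>linf\<close> consists of all bounded sequences.\<close>

definition dist_nat :: "nat \<Rightarrow> nat \<Rightarrow> real" where
 "dist_nat m n = \<bar>real m - real n\<bar>"

definition uniformity_nat :: "(nat \<times> nat) filter" where
 "uniformity_nat = (INF e\<in>{0 <..}. principal {(x, y). dist x y < e})"

instance
proof
 fix U :: "nat set"
 have "\<forall>\<^sub>F (x', y) in uniformity. x' = x \<longrightarrow> y \<in> U" if "x \<in> U" for x
  unfolding uniformity_nat_def
 proof (rule eventually_INF1[of 1])
  have "x = y" if "\<bar>real x - real y\<bar> < 1" for y using that by linarith
  then show "\<forall>\<^sub>F (x', y) in principal {(x, y). dist x y < 1}. x' = x \<longrightarrow> y \<in> U"
   using that by (auto simp: eventually_principal dist_nat_def)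
 qed simp
 then show "open U = (\<forall>x\<in>U. \<forall>\<^sub>F (x', y) in uniformity. x' = x \<longrightarrow> y \<in> U)"
  by (auto simp: open_discrete)
qed (auto simp: dist_nat_def uniformity_nat_def)

end

instance bcontfun :: (metric_space, banach) banach ..

type_synonym linf = "(nat, real) bcontfun"

lemma bcontfun_bounded:
 fixes f :: "nat \<Rightarrow> real"
 assumes "\<And>k. \<bar>f k\<bar> \<le> M"
 shows "apply_bcontfun (Bcontfun f) = f"
proof -
 have "f \<in> bcontfun"
  using assms by (auto simp: bcontfun_def bounded_iff)
 then show ?thesis by (rule Bcontfun_inverse)
qed

text \<open>The isomorphism with the square interleaves two sequences: the even entries form the
  \<open>base\<close>, a point, and the odd entries the \<open>fibre\<close>, a tangent vector at
  it. \<open>hor\<close> and \<open>ver\<close> are the two inclusions. All four maps have norm at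
  most one, so estimates pass through them without constants.\<close>

definition base :: "linf \<Rightarrow> linf" where
 "base X = Bcontfun (\<lambda>k. apply_bcontfun X (2 * k))"

definition fibre :: "linf \<Rightarrow> linf" where
 "fibre X = Bcontfun (\<lambda>k. apply_bcontfun X (2 * k + 1))"

definition hor :: "linf \<Rightarrow> linf" where
 "hor X = Bcontfun (\<lambda>k. if even k then apply_bcontfun X (k div 2) else 0)"

definition ver :: "linf \<Rightarrow> linf" where
 "ver X = Bcontfun (\<lambda>k. if odd k then apply_bcontfun X (k div 2) else 0)"

lemma linf_bound: "\<bar>apply_bcontfun (X::linf) k\<bar> \<le> norm X"
 using norm_bounded[of X k] by simp

lemma apply_base [simp]: "apply_bcontfun (base X) k = apply_bcontfun X (2 * k)"
 unfolding base_def by (subst bcontfun_bounded) (auto intro: linf_bound)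

lemma apply_fibre [simp]: "apply_bcontfun (fibre X) k = apply_bcontfun X (2 * k + 1)"
 unfolding fibre_def by (subst bcontfun_bounded) (auto intro: linf_bound)

lemma apply_hor [simp]:
 "apply_bcontfun (hor X) k = (if even k then apply_bcontfun X (k div 2) else 0)"
 unfolding hor_def by (subst bcontfun_bounded[where M = "norm X"]) (auto intro: linf_bound)

lemma apply_ver [simp]:
 "apply_bcontfun (ver X) k = (if odd k then apply_bcontfun X (k div 2) else 0)"
 unfolding ver_def by (subst bcontfun_bounded[where M = "norm X"]) (auto intro: linf_bound)

lemma bounded_linear_linfI:
 fixes h :: "linf \<Rightarrow> linf"
 assumes "\<And>X Y. h (X + Y) = h X + h Y" "\<And>r X. h (r *\<^sub>R X) = r *\<^sub>R h X"
  and "\<And>X k. \<bar>apply_bcontfun (h X) k\<bar> \<le> norm X"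
 shows "bounded_linear h"
 by (rule bounded_linear_intro[where K = 1]) (use assms in \<open>auto intro!: norm_bound\<close>)

lemma bounded_linear_base: "bounded_linear base"
 and bounded_linear_fibre: "bounded_linear fibre"
 and bounded_linear_hor: "bounded_linear hor"
 and bounded_linear_ver: "bounded_linear ver"
 by (auto intro!: bounded_linear_linfI bcontfun_eqI linf_bound)

lemma base_hor [simp]: "base (hor X) = X"
 and base_ver [simp]: "base (ver X) = 0"
 and fibre_hor [simp]: "fibre (hor X) = 0"
 and fibre_ver [simp]: "fibre (ver X) = X"
 by (auto intro!: bcontfun_eqI)

lemma hor_base_ver_fibre: "hor (base X) + ver (fibre X) = X"
 by (auto intro!: bcontfun_eqI simp: plus_bcontfun.rep_eq)

lemmas linf_add [simp] =
 linear_add[OF bounded_linear.linear[OF bounded_linear_base]]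
 linear_add[OF bounded_linear.linear[OF bounded_linear_fibre]]
 linear_add[OF bounded_linear.linear[OF bounded_linear_hor]]
 linear_add[OF bounded_linear.linear[OF bounded_linear_ver]]
 linear_diff[OF bounded_linear.linear[OF bounded_linear_base]]
 linear_diff[OF bounded_linear.linear[OF bounded_linear_fibre]]
 linear_diff[OF bounded_linear.linear[OF bounded_linear_hor]]
 linear_diff[OF bounded_linear.linear[OF bounded_linear_ver]]
 linear_scale[OF bounded_linear.linear[OF bounded_linear_base]]
 linear_scale[OF bounded_linear.linear[OF bounded_linear_fibre]]
 linear_scale[OF bounded_linear.linear[OF bounded_linear_hor]]
 linear_scale[OF bounded_linear.linear[OF bounded_linear_ver]]
 linear_0[OF bounded_linear.linear[OF bounded_linear_base]]
 linear_0[OF bounded_linear.linear[OF bounded_linear_fibre]]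
 linear_0[OF bounded_linear.linear[OF bounded_linear_hor]]
 linear_0[OF bounded_linear.linear[OF bounded_linear_ver]]
 linear_sum[OF bounded_linear.linear[OF bounded_linear_base]]
 linear_sum[OF bounded_linear.linear[OF bounded_linear_fibre]]

lemma linf_eqI: "base X = base Y \<Longrightarrow> fibre X = fibre Y \<Longrightarrow> X = Y"
 by (metis hor_base_ver_fibre)


lemma norm_base_le: "norm (base X) \<le> norm X"
 and norm_fibre_le: "norm (fibre X) \<le> norm X"
 and norm_hor_le: "norm (hor X) \<le> norm X"
 and norm_ver_le: "norm (ver X) \<le> norm X"
 by (auto intro!: norm_bound intro: linf_bound)

lemma norm_hor [simp]: "norm (hor X) = norm X"
 using norm_hor_le[of X] norm_base_le[of "hor X"] by simp

lemma norm_ver [simp]: "norm (ver X) = norm X"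
 using norm_ver_le[of X] norm_fibre_le[of "ver X"] by simp

section \<open>Finite-dimensional Euclidean spaces as retracts of \<open>linf\<close>\<close>

definition basis_enum :: "nat \<Rightarrow> 'v::euclidean_space" where
 "basis_enum = (SOME b. bij_betw b {..<DIM('v)} Basis)"

lemma basis_enum: "bij_betw (basis_enum :: nat \<Rightarrow> 'v::euclidean_space) {..<DIM('v)} Basis"
proof -
 have "\<exists>b. bij_betw b {..<DIM('v)} (Basis :: 'v set)"
  using ex_bij_betw_nat_finite[of "Basis :: 'v set"] by (auto simp: atLeast0LessThan)
 then show ?thesis unfolding basis_enum_def by (rule someI_ex)
qed

text \<open>Coordinates in an enumerated orthonormal basis, padded with zeros. The left inverse
  \<open>prj\<close> is defined on the whole of \<open>linf\<close>, so a map on a Euclidean space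
  extends to \<open>linf\<close> by ignoring all entries beyond the dimension.\<close>

definition emb :: "'v::euclidean_space \<Rightarrow> linf" where
 "emb y = Bcontfun (\<lambda>k. if k < DIM('v) then y \<bullet> basis_enum k else 0)"

definition prj :: "linf \<Rightarrow> 'v::euclidean_space" where
 "prj X = (\<Sum>k<DIM('v). apply_bcontfun X k *\<^sub>R basis_enum k)"

lemma basis_enum_in: "k < DIM('v::euclidean_space) \<Longrightarrow> (basis_enum k :: 'v) \<in> Basis"
 using basis_enum[where 'v = 'v] by (auto simp: bij_betw_def)

lemma apply_emb [simp]:
 "apply_bcontfun (emb (y::'v::euclidean_space)) k = (if k < DIM('v) then y \<bullet> basis_enum k else 0)"
 unfolding emb_def
proof (subst bcontfun_bounded[where M = "norm y"])
 fix k
 show "\<bar>if k < DIM('v) then y \<bullet> basis_enum k else 0\<bar> \<le> norm y"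
  using Basis_le_norm[OF basis_enum_in, of k y] by auto
qed auto

lemma bounded_linear_emb: "bounded_linear (emb :: 'v::euclidean_space \<Rightarrow> linf)"
proof (rule bounded_linear_intro[where K = 1])
 fix y :: 'v
 show "norm (emb y) \<le> norm y * 1"
  by (auto intro!: norm_bound Basis_le_norm[OF basis_enum_in])
qed (auto intro!: bcontfun_eqI simp: inner_add_left plus_bcontfun.rep_eq scaleR_bcontfun.rep_eq)

lemma bounded_linear_prj: "bounded_linear (prj :: linf \<Rightarrow> 'v::euclidean_space)"
proof (rule bounded_linear_intro[where K = "DIM('v)"])
 fix X :: linf
 have "norm (prj X :: 'v) \<le> (\<Sum>k<DIM('v). norm (apply_bcontfun X k *\<^sub>R (basis_enum k :: 'v)))"
  unfolding prj_def by (rule norm_sum)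
 also have "\<dots> \<le> (\<Sum>k<DIM('v). norm X)"
  by (intro sum_mono) (simp add: norm_Basis[OF basis_enum_in] linf_bound)
 finally show "norm (prj X :: 'v) \<le> norm X * DIM('v)" by (simp add: mult.commute)
qed (auto simp: prj_def scaleR_add_left sum.distrib scaleR_sum_right
   plus_bcontfun.rep_eq scaleR_bcontfun.rep_eq)

lemma prj_emb [simp]: "prj (emb y) = (y :: 'v::euclidean_space)"
proof -
 have "prj (emb y) = (\<Sum>k<DIM('v). (y \<bullet> basis_enum k) *\<^sub>R (basis_enum k :: 'v))"
  unfolding prj_def by (rule sum.cong) auto
 also have "\<dots> = (\<Sum>b\<in>Basis. (y \<bullet> b) *\<^sub>R b)"
  by (rule sum.reindex_bij_betw[OF basis_enum, of "\<lambda>b. (y \<bullet> b) *\<^sub>R b"])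
 finally show ?thesis by (simp add: euclidean_representation)
qed

section \<open>The tangent lift\<close>

abbreviation fd :: "('a::real_normed_vector \<Rightarrow> 'b::real_normed_vector) \<Rightarrow> 'a \<Rightarrow> 'a \<Rightarrow> 'b" where
 "fd F x \<equiv> frechet_derivative F (at x)"

lemma fd_works: "F differentiable (at x) \<Longrightarrow> (F has_derivative fd F x) (at x)"
 by (simp add: frechet_derivative_works)

lemma fd_eqI: "(F has_derivative F') (at x) \<Longrightarrow> fd F x = F'"
 by (simp add: frechet_derivative_at[symmetric])

text \<open>\<open>frechet_derivative\<close> selects an element from the set of derivatives, and
  that set depends only on the germ of the map. The equality therefore also covers points without a
  derivative, which lets lifts be compared without checking differentiability.\<close>

lemma fd_cong:
 assumes "open S" "x \<in> S" "\<And>y. y \<in> S \<Longrightarrow> F y = G y"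
 shows "fd F x = fd G x"
proof -
 have "(F has_derivative F') (at x) \<longleftrightarrow> (G has_derivative F') (at x)" for F'
  using assms has_derivative_transform_within_open[of F F' x UNIV S G]
   has_derivative_transform_within_open[of G F' x UNIV S F] by auto
 then show ?thesis unfolding frechet_derivative_def by simp
qed

lemma differentiable_cong:
 assumes "open S" "x \<in> S" "\<And>y. y \<in> S \<Longrightarrow> F y = G y" "F differentiable (at x)"
 shows "G differentiable (at x)"
 using assms has_derivative_transform_within_open[of F _ x UNIV S G]
 unfolding differentiable_def by auto

text \<open>In pairs this is the tangent map (x, v) -> (F x, DF(x) v). Applied to a vector field, it
  is the field that drives the flow together with its linearisation.\<close>

definition tlift :: "(linf \<Rightarrow> linf) \<Rightarrow> linf \<Rightarrow> linf" where
 "tlift F X = hor (F (base X)) + ver (fd F (base X) (fibre X))"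

lemma base_tlift [simp]: "base (tlift F X) = F (base X)"
 and fibre_tlift [simp]: "fibre (tlift F X) = fd F (base X) (fibre X)"
 by (auto simp: tlift_def)

text \<open>Class C^k phrased through the tangent map, so that the recursion stays inside maps from
  \<open>linf\<close> to itself instead of passing to operator-valued derivatives. Continuity of the
  tangent map means joint continuity of DF(x) v in (x, v). In infinite dimensions this is weaker
  than continuity of DF in the operator norm, but it still bounds DF locally.\<close>

primrec good :: "nat \<Rightarrow> linf set \<Rightarrow> (linf \<Rightarrow> linf) \<Rightarrow> bool" where
 "good 0 S F \<longleftrightarrow> continuous_on S F"
| "good (Suc k) S F \<longleftrightarrow> (\<forall>x\<in>S. F differentiable (at x)) \<and> good k (base -` S) (tlift F)"

lemma continuous_base: "continuous_on S base" and continuous_fibre: "continuous_on S fibre"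
 by (auto intro!: linear_continuous_on bounded_linear_base bounded_linear_fibre
   bounded_linear_hor bounded_linear_ver)

lemma open_base: "open S \<Longrightarrow> open (base -` S)"
 using continuous_base by (rule open_vimage[rotated])

lemma good_cong:
 assumes "open S" "\<And>x. x \<in> S \<Longrightarrow> F x = G x"
 shows "good k S F \<longleftrightarrow> good k S G"
 using assms
proof (induction k arbitrary: S F G)
 case 0
 then show ?case by (simp cong: continuous_on_cong)
next
 case (Suc k)
 have "tlift F X = tlift G X" if "X \<in> base -` S" for X
  using that Suc.prems fd_cong[of S "base X" F G] by (auto simp: tlift_def)
 then have "good k (base -` S) (tlift F) \<longleftrightarrow> good k (base -` S) (tlift G)"
  by (intro Suc.IH open_base Suc.prems(1))
 moreover have "F differentiable (at x) \<longleftrightarrow> G differentiable (at x)" if "x \<in> S" for x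
  using differentiable_cong[OF Suc.prems(1) that, of F G] Suc.prems(2)
   differentiable_cong[OF Suc.prems(1) that, of G F] by (metis (no_types))
 ultimately show ?case by simp
qed

lemma good_subset: "good k S F \<Longrightarrow> S' \<subseteq> S \<Longrightarrow> good k S' F"
proof (induction k arbitrary: S S' F)
 case 0
 then show ?case by (auto intro: continuous_on_subset)
next
 case (Suc k)
 then have "base -` S' \<subseteq> base -` S" by auto
 with Suc show ?case by auto
qed

lemma good_SucD: "good (Suc k) S F \<Longrightarrow> good k S F"
proof (induction k arbitrary: S F)
 case 0
 then show ?case
  by (auto intro!: continuous_at_imp_continuous_on differentiable_imp_continuous_within)
next
 case (Suc k)
 have "good k (base -` S) (tlift F)" using Suc by simp
 with Suc.prems show ?case by simp
qed

lemma good_le: "good k S F \<Longrightarrow> m \<le> k \<Longrightarrow> good m S F"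
 by (induction k) (use good_SucD le_Suc_eq in blast)+

lemma good_imp_continuous: "good k S F \<Longrightarrow> continuous_on S F"
 using good_le[of k S F 0] by simp

lemma tlift_linear: "bounded_linear h \<Longrightarrow> tlift h = (\<lambda>X. hor (h (base X)) + ver (h (fibre X)))"
 by (auto simp: tlift_def fd_eqI[OF bounded_linear_imp_has_derivative])

lemma bounded_linear_tlift: "bounded_linear h \<Longrightarrow> bounded_linear (tlift h)"
 unfolding tlift_linear
 by (intro bounded_linear_add bounded_linear_compose[OF bounded_linear_hor]
   bounded_linear_compose[OF bounded_linear_ver])
  (auto intro: bounded_linear_compose bounded_linear_base bounded_linear_fibre)

lemma good_linear: "bounded_linear h \<Longrightarrow> good k S h"
 by (induction k arbitrary: S h)
  (auto intro: linear_continuous_on bounded_linear_imp_differentiable bounded_linear_tlift)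

lemma good_const: "good k S (\<lambda>x. c)"
proof (induction k arbitrary: S c)
 case (Suc k)
 have "tlift (\<lambda>x. c) = (\<lambda>x. hor c)" by (auto simp: tlift_def fd_eqI[OF has_derivative_const])
 with Suc show ?case by simp
qed auto

lemma tlift_compose:
 assumes "H differentiable (at (base X))" "G differentiable (at (H (base X)))"
 shows "tlift (\<lambda>x. G (H x)) X = tlift G (tlift H X)"
proof -
 have "fd (\<lambda>x. G (H x)) (base X) = (\<lambda>v. fd G (H (base X)) (fd H (base X) v))"
  using has_derivative_compose[OF fd_works[OF assms(1)] fd_works[OF assms(2)]] by (rule fd_eqI)
 then show ?thesis by (simp add: tlift_def)
qed

text \<open>By the chain rule the tangent map of a composition is the composition of the tangent
  maps, so the step applies the induction hypothesis to the lifts over the lifted domains; no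
  formula for higher derivatives of a composition appears.\<close>

lemma good_compose:
 assumes "good k S' G" "good k S H" "H ` S \<subseteq> S'" "open S"
 shows "good k S (\<lambda>x. G (H x))"
 using assms
proof (induction k arbitrary: S S' G H)
 case 0
 then show ?case using continuous_on_compose2[of S' G S H] by simp
next
 case (Suc k)
 have d: "H differentiable (at x)" "G differentiable (at (H x))" if "x \<in> S" for x
  using Suc.prems that by auto
 have "good k (base -` S) (\<lambda>X. tlift G (tlift H X))"
  by (rule Suc.IH[where S' = "base -` S'"]) (use Suc.prems in \<open>auto simp: open_base\<close>)
 moreover have "good k (base -` S) (tlift (\<lambda>x. G (H x))) \<longleftrightarrow>
   good k (base -` S) (\<lambda>X. tlift G (tlift H X))"
  by (rule good_cong[OF open_base[OF Suc.prems(4)]]) (use d tlift_compose in auto)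
 moreover have "(\<lambda>x. G (H x)) differentiable (at x)" if "x \<in> S" for x
  using has_derivative_compose[OF fd_works fd_works, OF d[OF that]]
  by (auto simp: differentiable_def)
 ultimately show ?case by simp
qed

text \<open>By the product rule the tangent map of a bilinear expression is again a bounded bilinear
  expression, called \<open>b'\<close> below, in the tangent maps of its arguments. The induction
  therefore runs over all \<open>b\<close> at once.\<close>

lemma good_bilinear:
 assumes "bounded_bilinear b" "good k S F" "good k S G" "open S"
 shows "good k S (\<lambda>x. b (F x) (G x))"
 using assms
proof (induction k arbitrary: S b F G)
 case 0
 then show ?case by (simp add: bounded_bilinear.continuous_on)
next
 case (Suc k)
 interpret b: bounded_bilinear b by fact
 have d: "((\<lambda>x. b (F x) (G x)) has_derivative
   (\<lambda>v. b (F x) (fd G x v) + b (fd F x v) (G x))) (at x)" if "x \<in> S" for x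
  using Suc.prems that by (intro b.FDERIV fd_works) auto
 define b' where "b' X Y = hor (b (base X) (base Y)) +
   ver (b (base X) (fibre Y) + b (fibre X) (base Y))" for X Y
 have "bounded_bilinear b'"
 proof
  obtain K where K: "\<And>x y. norm (b x y) \<le> norm x * norm y * K" "0 < K"
   using b.pos_bounded by (metis mult.commute mult.left_commute)
  have "norm (b' X Y) \<le> norm X * norm Y * (3 * K)" for X Y
  proof -
   have *: "norm (b x y) \<le> norm X * norm Y * K" if "norm x \<le> norm X" "norm y \<le> norm Y" for x y
    using K(1)[of x y] mult_mono[OF that] \<open>0 < K\<close>
    by (meson mult_right_mono norm_ge_zero order_trans less_imp_le)
   have "norm (b' X Y) \<le> norm (b (base X) (base Y)) +
     (norm (b (base X) (fibre Y)) + norm (b (fibre X) (base Y)))"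
    unfolding b'_def by (intro norm_triangle_le add_mono) (auto intro: norm_triangle_ineq simp del: linf_add)
   with *[OF norm_base_le norm_base_le] *[OF norm_base_le norm_fibre_le]
    *[OF norm_fibre_le norm_base_le]
   show ?thesis by linarith
  qed
  then show "\<exists>K. \<forall>X Y. norm (b' X Y) \<le> norm X * norm Y * K" by blast
 qed (auto simp: b'_def b.add_left b.add_right b.scaleR_left b.scaleR_right scaleR_add_right
   b.sum_left)
 then have "good k (base -` S) (\<lambda>X. b' (tlift F X) (tlift G X))"
  using Suc.IH[where b = b' and F = "tlift F" and G = "tlift G" and S = "base -` S"] Suc.prems
  by (simp add: open_base)
 moreover have "tlift (\<lambda>x. b (F x) (G x)) X = b' (tlift F X) (tlift G X)"
  if "X \<in> base -` S" for X
  using that by (simp add: tlift_def[of "\<lambda>x. b (F x) (G x)"] b'_def fd_eqI[OF d])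
 ultimately have "good k (base -` S) (tlift (\<lambda>x. b (F x) (G x)))"
  by (subst good_cong[OF open_base[OF Suc.prems(4)]]) auto
 then show ?case using d by (auto simp: differentiable_def)
qed

lemma tlift_add:
 assumes "F differentiable (at (base X))" "G differentiable (at (base X))"
 shows "tlift (\<lambda>x. F x + G x) X = tlift F X + tlift G X"
proof -
 have "fd (\<lambda>x. F x + G x) (base X) = (\<lambda>v. fd F (base X) v + fd G (base X) v)"
  by (rule fd_eqI) (intro has_derivative_add fd_works assms)
 then show ?thesis by (simp add: tlift_def)
qed

lemma good_add:
 assumes "good k S F" "good k S G" "open S"
 shows "good k S (\<lambda>x. F x + G x)"
 using assms
proof (induction k arbitrary: S F G)
 case 0
 then show ?case by (simp add: continuous_on_add)
next
 case (Suc k)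
 have "good k (base -` S) (\<lambda>X. tlift F X + tlift G X)"
  using Suc.IH[of "base -` S" "tlift F" "tlift G"] Suc.prems by (simp add: open_base)
 then have "good k (base -` S) (tlift (\<lambda>x. F x + G x))"
  by (subst good_cong[OF open_base[OF Suc.prems(3)]]) (use tlift_add Suc.prems in auto)
 then show ?case using Suc.prems by simp
qed

lemma good_scaleR:
 assumes "good k S F" "open S"
 shows "good k S (\<lambda>x. r *\<^sub>R F x)"
 using good_compose[OF good_linear[OF bounded_linear_scaleR_right, of k UNIV r] assms(1) _ assms(2)]
 by simp

lemma good_diff:
 assumes "good k S F" "good k S G" "open S"
 shows "good k S (\<lambda>x. F x - G x)"
 using good_add[OF assms(1) good_scaleR[OF assms(2,3), of "-1"] assms(3)] by simp

lemma good_sum: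
 assumes "\<And>j. j \<in> J \<Longrightarrow> good k S (F j)" "open S"
 shows "good k S (\<lambda>x. \<Sum>j\<in>J. F j x)"
 using assms(1)
 by (induction J rule: infinite_finite_induct) (auto intro!: good_const good_add assms(2))

text \<open>The derivative along \<open>G\<close> is the fibre of the tangent map of
  \<open>F\<close> along the section x -> (x, G x), so its regularity is that of a
  composition.\<close>

lemma good_fd:
 assumes "good (Suc k) S F" "good k S G" "open S"
 shows "good k S (\<lambda>x. fd F x (G x))"
proof -
 have "good k S (\<lambda>x. ver (G x))"
  using good_compose[OF good_linear[OF bounded_linear_ver, of k UNIV] assms(2) _ assms(3)] by simp
 then have 1: "good k S (\<lambda>x. hor x + ver (G x))"
  using good_add[OF good_linear[OF bounded_linear_hor] _ assms(3)] by blast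
 have "good k S (\<lambda>x. tlift F (hor x + ver (G x)))"
  using assms by (intro good_compose[OF _ 1, where S' = "base -` S"]) auto
 then have "good k S (\<lambda>x. fibre (tlift F (hor x + ver (G x))))"
  by (intro good_compose[OF good_linear[OF bounded_linear_fibre, of k UNIV]]) (auto simp: assms)
 then show ?thesis by simp
qed

lemma base_power_vimage: "(base ^^ Suc k) -` S = (base ^^ k) -` (base -` S)"
 by (auto simp: funpow_swap1)

lemma good_funpow: "good (k + m) S F \<Longrightarrow> good m ((base ^^ k) -` S) ((tlift ^^ k) F)"
proof (induction k arbitrary: S F)
 case (Suc k)
 have "good m ((base ^^ k) -` (base -` S)) ((tlift ^^ k) (tlift F))"
  using Suc by simp
 then show ?case
  unfolding base_power_vimage by (simp add: funpow_Suc_right del: funpow.simps(2))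
qed simp

text \<open>Unfolding the recursion exposes the consequence used for limits: the
  \<open>k\<close>-fold tangent map itself is continuous over the preimage of
  \<open>S\<close>.\<close>

lemma good_iff_funpow:
 "good k S F \<longleftrightarrow> (\<forall>m<k. \<forall>x\<in>(base ^^ m) -` S. (tlift ^^ m) F differentiable (at x)) \<and>
   continuous_on ((base ^^ k) -` S) ((tlift ^^ k) F)"
proof (induction k arbitrary: S F)
 case (Suc k)
 show ?case
  unfolding good.simps Suc base_power_vimage All_less_Suc2
  by (auto simp: funpow_Suc_right funpow_swap1 simp del: funpow.simps(2))
qed simp

lemma linear_fd: "F differentiable (at x) \<Longrightarrow> bounded_linear (fd F x)"
 using fd_works has_derivative_bounded_linear by blast

lemma linear_fd_simps:
 assumes "F differentiable (at x)"
 shows "fd F x 0 = 0" "fd F x (v + w) = fd F x v + fd F x w"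
  "fd F x (v - w) = fd F x v - fd F x w" "fd F x (r *\<^sub>R v) = r *\<^sub>R fd F x v"
  "fd F x (sum f J) = (\<Sum>j\<in>J. fd F x (f j))"
 using bounded_linear.linear[OF linear_fd[OF assms]]
 by (auto simp: linear_0 linear_add linear_diff linear_scale linear_sum)

section \<open>Local Lipschitz and Taylor estimates\<close>

lemma norm_scaled_bound:
 fixes h :: "'a::real_normed_vector \<Rightarrow> 'b::real_normed_vector"
 assumes "linear h" "r > 0" "\<And>w. norm w \<le> r \<Longrightarrow> norm (h w) \<le> C"
 shows "norm (h w) \<le> C / r * norm w"
proof (cases "w = 0")
 case True
 then show ?thesis using assms(1) by (simp add: linear_0)
next
 case False
 have "norm (h ((r / norm w) *\<^sub>R w)) \<le> C"
  using False assms(2) by (intro assms(3)) simp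
 also have "h ((r / norm w) *\<^sub>R w) = (r / norm w) *\<^sub>R h w"
  using assms(1) by (simp add: linear_scale)
 finally show ?thesis using False assms(2) by (simp add: field_simps)
qed

text \<open>Continuity of the tangent map at (x, 0) keeps DF(y) w bounded by one for y near x and w
  of norm at most \<open>d0 / 4\<close>. By homogeneity this is the operator bound
  \<open>4 / d0\<close>, uniform near x, and the mean value inequality on the ball turns it into a
  Lipschitz constant.\<close>

lemma good_lipschitz:
 assumes "good (Suc 0) S F" "open S" "x \<in> S"
 obtains \<delta> L where "\<delta> > 0" "L \<ge> 0" "ball x \<delta> \<subseteq> S"
  "\<And>y w. y \<in> ball x \<delta> \<Longrightarrow> norm (fd F y w) \<le> L * norm w"
  "\<And>y z. y \<in> ball x \<delta> \<Longrightarrow> z \<in> ball x \<delta> \<Longrightarrow> norm (F y - F z) \<le> L * norm (y - z)"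
proof -
 have d: "F differentiable (at y)" if "y \<in> S" for y
  using assms(1) that by simp
 have "continuous_on (base -` S) (tlift F)" using assms(1) by simp
 then have "isCont (tlift F) (hor x)"
  using assms(3) continuous_on_interior open_base[OF assms(2)] by (simp add: continuous_on_eq_continuous_at)
 then obtain d0 where d0: "d0 > 0"
  "\<And>X. dist X (hor x) < d0 \<Longrightarrow> dist (tlift F X) (tlift F (hor x)) < 1"
  unfolding continuous_at_eps_delta by (metis zero_less_one)
 obtain d1 where d1: "d1 > 0" "ball x d1 \<subseteq> S" using assms(2,3) open_contains_ball by blast
 define \<delta> where "\<delta> = min (d0 / 2) d1"
 have sub: "ball x \<delta> \<subseteq> S" using d1 by (auto simp: \<delta>_def)
 have bnd: "norm (fd F y w) \<le> (4 / d0) * norm w" if y: "y \<in> ball x \<delta>" for y w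
 proof -
  have "norm (fd F y w) \<le> 1" if w: "norm w \<le> d0 / 4" for w
  proof -
   have "norm (hor y + ver w - hor x) \<le> norm (hor (y - x)) + norm (ver w)"
    using norm_triangle_ineq[of "hor (y - x)" "ver w"] by (simp add: algebra_simps)
   also have "\<dots> < d0"
    using y w d0(1) by (simp add: \<delta>_def dist_norm norm_minus_commute del: linf_add)
   finally have "norm (tlift F (hor y + ver w) - tlift F (hor x)) < 1"
    using d0(2)[of "hor y + ver w"] by (simp add: dist_norm)
   moreover have "norm (fibre (tlift F (hor y + ver w) - tlift F (hor x))) \<le>
     norm (tlift F (hor y + ver w) - tlift F (hor x))" by (rule norm_fibre_le)
   ultimately show ?thesis using linear_fd_simps(1)[OF d[OF assms(3)]] by simp
  qed
  then show ?thesis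
   using norm_scaled_bound[OF bounded_linear.linear[OF linear_fd[OF d[of y]]], of "d0 / 4" 1 w]
    y sub d0(1) by auto
 qed
 have "norm (F y - F z) \<le> (4 / d0) * norm (y - z)" if "y \<in> ball x \<delta>" "z \<in> ball x \<delta>" for y z
 proof (rule differentiable_bound[OF convex_ball _ _ that])
  fix u assume "u \<in> ball x \<delta>"
  then show "(F has_derivative fd F u) (at u within ball x \<delta>)"
   using d sub fd_works has_derivative_at_withinI by blast
  show "onorm (fd F u) \<le> 4 / d0"
   using bnd[OF \<open>u \<in> ball x \<delta>\<close>] by (intro onorm_bound) (use d0(1) in auto)
 qed
 with bnd sub d0(1) d1(1) that[of \<delta> "4 / d0"] show ?thesis by (auto simp: \<delta>_def)
qed

text \<open>The Lipschitz estimate for the tangent map near (x, 0) says that DF(y) w is Lipschitz in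
  y for short w, hence by homogeneity for all w. The Taylor bound is then the mean value inequality
  for \<open>F\<close> minus its linear part at y, on the segment from y to z.\<close>

lemma good_quadratic:
 assumes "good (Suc (Suc 0)) S F" "open S" "x \<in> S"
 obtains \<delta> M where "\<delta> > 0" "M \<ge> 0" "ball x \<delta> \<subseteq> S"
  "\<And>y z. y \<in> ball x \<delta> \<Longrightarrow> z \<in> ball x \<delta> \<Longrightarrow> norm (F z - F y - fd F y (z - y)) \<le> M * (norm (z - y))\<^sup>2"
  "\<And>y z w. y \<in> ball x \<delta> \<Longrightarrow> z \<in> ball x \<delta> \<Longrightarrow> norm (fd F z w - fd F y w) \<le> M * norm (z - y) * norm w"
proof -
 have d: "F differentiable (at y)" if "y \<in> S" for y
  using assms(1) that by simp
 have "good (Suc 0) (base -` S) (tlift F)" "hor x \<in> base -` S" using assms by auto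
 then obtain \<delta>' L where \<delta>': "\<delta>' > 0" "L \<ge> 0" "ball (hor x) \<delta>' \<subseteq> base -` S"
  and L: "\<And>Y Z. Y \<in> ball (hor x) \<delta>' \<Longrightarrow> Z \<in> ball (hor x) \<delta>' \<Longrightarrow>
   norm (tlift F Y - tlift F Z) \<le> L * norm (Y - Z)"
  using good_lipschitz[OF _ open_base[OF assms(2)], of "tlift F" "hor x"] by metis
 define \<delta> where "\<delta> = \<delta>' / 2"
 have mem: "hor y + ver w \<in> ball (hor x) \<delta>'" if "y \<in> ball x \<delta>" "norm w \<le> \<delta>' / 4" for y w
 proof -
  have "norm (hor y + ver w - hor x) \<le> norm (hor (y - x)) + norm (ver w)"
   using norm_triangle_ineq[of "hor (y - x)" "ver w"] by (simp add: algebra_simps)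
  also have "\<dots> < \<delta>'"
   using that \<delta>'(1) by (simp add: \<delta>_def dist_norm norm_minus_commute del: linf_add)
  finally show ?thesis by (simp add: dist_norm norm_minus_commute)
 qed
 have sub: "ball x \<delta> \<subseteq> S"
 proof
  fix y assume "y \<in> ball x \<delta>"
  then have "hor y \<in> ball (hor x) \<delta>'" using mem[of y 0] \<delta>'(1) by simp
  then show "y \<in> S" using \<delta>'(3) by auto
 qed
 have bnd: "norm (fd F z w - fd F y w) \<le> (4 * L / \<delta>' * norm (z - y)) * norm w"
  if y: "y \<in> ball x \<delta>" and z: "z \<in> ball x \<delta>" for y z w
 proof -
  have "norm (fd F z w - fd F y w) \<le> L * norm (z - y)" if w: "norm w \<le> \<delta>' / 4" for w
  proof -
   have "norm (fibre (tlift F (hor z + ver w) - tlift F (hor y + ver w))) \<le>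
     norm (tlift F (hor z + ver w) - tlift F (hor y + ver w))" by (rule norm_fibre_le)
   also have "\<dots> \<le> L * norm (hor z + ver w - (hor y + ver w))"
    by (rule L) (use mem y z w in auto)
   also have "norm (hor z + ver w - (hor y + ver w)) = norm (hor (z - y))" by simp
   finally show ?thesis by (simp del: linf_add) simp
  qed
  moreover have "linear (\<lambda>w. fd F z w - fd F y w)"
   using y z sub d by (auto intro!: bounded_linear.linear bounded_linear_sub linear_fd)
  ultimately show ?thesis
   using norm_scaled_bound[of "\<lambda>w. fd F z w - fd F y w" "\<delta>' / 4" "L * norm (z - y)" w] \<delta>'(1)
   by (simp add: mult_ac)
 qed
 have "norm (F z - F y - fd F y (z - y)) \<le> 4 * L / \<delta>' * (norm (z - y))\<^sup>2"
  if y: "y \<in> ball x \<delta>" and z: "z \<in> ball x \<delta>" for y z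
 proof -
  have seg: "closed_segment y z \<subseteq> ball x \<delta>"
   using closed_segment_subset[OF y z convex_ball] .
  have "norm ((F z - fd F y z) - (F y - fd F y y)) \<le>
    (4 * L / \<delta>' * norm (z - y)) * norm (z - y)"
  proof (rule differentiable_bound[where S = "closed_segment y z" and f' = "\<lambda>u w. fd F u w - fd F y w"])
   fix u assume u: "u \<in> closed_segment y z"
   then show "((\<lambda>u. F u - fd F y u) has_derivative (\<lambda>w. fd F u w - fd F y w))
     (at u within closed_segment y z)"
    using seg sub d y by (intro has_derivative_diff has_derivative_at_withinI[OF fd_works]
      bounded_linear_imp_has_derivative linear_fd) auto
   have "norm (u - y) \<le> norm (z - y)"
    using u segment_bound(1)[of u y z] by (simp add: norm_minus_commute)
   then have "4 * L / \<delta>' * norm (u - y) \<le> 4 * L / \<delta>' * norm (z - y)"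
    using \<delta>' by (intro mult_left_mono) auto
   then have "norm (fd F u w - fd F y w) \<le> 4 * L / \<delta>' * norm (z - y) * norm w" for w
    using bnd[of y u w] u seg y by (meson mult_right_mono norm_ge_zero order_trans subsetD)
   then show "onorm (\<lambda>w. fd F u w - fd F y w) \<le> 4 * L / \<delta>' * norm (z - y)"
    using \<delta>' by (intro onorm_bound) auto
  qed auto
  moreover have "y \<in> S" using y sub by auto
  moreover have "F z - fd F y z - (F y - fd F y y) = F z - F y - (fd F y z - fd F y y)"
   by simp
  ultimately show ?thesis
   using linear_fd_simps(3)[OF d, of y z y] by (simp add: power2_eq_square mult.assoc)
 qed
 with sub \<delta>' bnd that[of \<delta> "4 * L / \<delta>'"] show ?thesis by (auto simp: \<delta>_def)
qed

section \<open>Symmetry of second derivatives\<close>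

lemma second_difference:
 fixes f :: "'a::real_normed_vector \<Rightarrow> 'b::real_normed_vector"
 assumes "open S" "x \<in> S" "\<And>y. y \<in> S \<Longrightarrow> (f has_derivative f' y) (at y)"
  and A: "((\<lambda>y. f' y v) has_derivative A) (at x)" and "e > 0"
 shows "\<exists>d>0. \<forall>h. 0 < h \<and> h < d \<longrightarrow>
  norm (f (x + h *\<^sub>R v + h *\<^sub>R w) - f (x + h *\<^sub>R v) - f (x + h *\<^sub>R w) + f x - h\<^sup>2 *\<^sub>R A w)
   \<le> e * h\<^sup>2"
proof -
 define C where "C = norm v + norm w + 1"
 have C: "C > 0" by (simp add: C_def add_nonneg_pos)
 \<comment> \<open>All points met below lie within \<open>h * C\<close> of x, and the error of the
   linear approximation is incurred at two of them; this choice makes the sum equal to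
   \<open>e * h\<close>.\<close>
 define e' where "e' = e / (2 * C)"
 have "e' > 0" using C \<open>e > 0\<close> by (simp add: e'_def)
 have linA: "linear A" using A has_derivative_linear by blast
 obtain d0 where d0: "d0 > 0"
  "\<And>y. norm (y - x) < d0 \<Longrightarrow> norm (f' y v - f' x v - A (y - x)) \<le> e' * norm (y - x)"
  using A \<open>e' > 0\<close> unfolding has_derivative_at_alt by metis
 obtain d1 where d1: "d1 > 0" "ball x d1 \<subseteq> S" using assms(1,2) open_contains_ball by blast
 define d where "d = min d0 d1 / C"
 have "d > 0" using d0 d1 C by (simp add: d_def)
 moreover have "norm (f (x + h *\<^sub>R v + h *\<^sub>R w) - f (x + h *\<^sub>R v) - f (x + h *\<^sub>R w) + f x
   - h\<^sup>2 *\<^sub>R A w) \<le> e * h\<^sup>2" if h: "0 < h" "h < d" for h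
 proof -
  have hC: "h * C < d0" "h * C < d1"
   using h C by (auto simp: d_def field_simps)
  have n1: "norm (t *\<^sub>R v + s *\<^sub>R w) \<le> h * C" if "0 \<le> t" "t \<le> h" "0 \<le> s" "s \<le> h" for s t
  proof -
   have "norm (t *\<^sub>R v + s *\<^sub>R w) \<le> t * norm v + s * norm w"
    using that norm_triangle_ineq[of "t *\<^sub>R v" "s *\<^sub>R w"] by simp
   also have "\<dots> \<le> h * norm v + h * norm w"
    using that by (intro add_mono mult_right_mono) auto
   also have "\<dots> \<le> h * C" using h by (simp add: C_def algebra_simps)
   finally show ?thesis .
  qed
  \<comment> \<open>The second difference is the increment over [0, h] of a function of one
    variable, so the mean value inequality applies once the expected linear growth is
    subtracted.\<close>
  define g where "g t = f (x + t *\<^sub>R v + h *\<^sub>R w) - f (x + t *\<^sub>R v) - (t * h) *\<^sub>R A w" for t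
  have "norm (g h - g 0) \<le> (e * h) * norm (h - 0)"
  proof (rule differentiable_bound[where S = "{0..h}" and
     f' = "\<lambda>t r. r *\<^sub>R (f' (x + t *\<^sub>R v + h *\<^sub>R w) v - f' (x + t *\<^sub>R v) v - h *\<^sub>R A w)"])
   fix t assume t: "t \<in> {0..h}"
   let ?y1 = "x + t *\<^sub>R v + h *\<^sub>R w" and ?y2 = "x + t *\<^sub>R v"
   have n: "norm (?y1 - x) \<le> h * C" "norm (?y2 - x) \<le> h * C"
    using n1[of t h] n1[of t 0] t h by (auto simp: algebra_simps)
   then have S: "?y1 \<in> S" "?y2 \<in> S"
    using hC d1(2) by (auto simp: dist_norm norm_minus_commute subset_iff)
   have "((\<lambda>t. f (x + t *\<^sub>R v + h *\<^sub>R w)) has_derivative (\<lambda>r. f' ?y1 (r *\<^sub>R v))) (at t within {0..h})"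
    using assms(3)[OF S(1)]
    by (intro has_derivative_compose[where f = "\<lambda>t. x + t *\<^sub>R v + h *\<^sub>R w" and g = f])
     (auto intro!: derivative_eq_intros)
   moreover have "((\<lambda>t. f (x + t *\<^sub>R v)) has_derivative (\<lambda>r. f' ?y2 (r *\<^sub>R v))) (at t within {0..h})"
    using assms(3)[OF S(2)]
    by (intro has_derivative_compose[where f = "\<lambda>t. x + t *\<^sub>R v" and g = f])
     (auto intro!: derivative_eq_intros)
   moreover have "((\<lambda>t. (t * h) *\<^sub>R A w) has_derivative (\<lambda>r. (r * h) *\<^sub>R A w)) (at t within {0..h})"
    by (auto intro!: derivative_eq_intros)
   ultimately have "(g has_derivative (\<lambda>r. f' ?y1 (r *\<^sub>R v) - f' ?y2 (r *\<^sub>R v) - (r * h) *\<^sub>R A w))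
     (at t within {0..h})"
    unfolding g_def by (intro has_derivative_diff)
   then show "(g has_derivative (\<lambda>r. r *\<^sub>R (f' ?y1 v - f' ?y2 v - h *\<^sub>R A w))) (at t within {0..h})"
    using linear_scale[OF has_derivative_linear[OF assms(3)[OF S(1)]]]
     linear_scale[OF has_derivative_linear[OF assms(3)[OF S(2)]]]
    by (simp add: algebra_simps)
   have "norm (f' ?y1 v - f' ?y2 v - h *\<^sub>R A w) =
     norm ((f' ?y1 v - f' x v - A (?y1 - x)) - (f' ?y2 v - f' x v - A (?y2 - x)))"
   proof -
    have "A (?y1 - x) = A (?y2 - x) + h *\<^sub>R A w"
     using linear_add[OF linA, of "?y2 - x" "h *\<^sub>R w"] linear_scale[OF linA, of h w]
     by (simp add: algebra_simps)
    then show ?thesis by (simp add: algebra_simps)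
   qed
   also have "\<dots> \<le> e' * norm (?y1 - x) + e' * norm (?y2 - x)"
    by (intro norm_triangle_le_diff add_mono d0(2)) (use n hC in auto)
   also have "\<dots> \<le> e' * (h * C) + e' * (h * C)"
    using n \<open>e' > 0\<close> by (intro add_mono mult_left_mono) auto
   also have "\<dots> = e * h" using C by (simp add: e'_def field_simps)
   finally have "norm (f' ?y1 v - f' ?y2 v - h *\<^sub>R A w) \<le> e * h" .
   then show "onorm (\<lambda>r. r *\<^sub>R (f' ?y1 v - f' ?y2 v - h *\<^sub>R A w)) \<le> e * h"
    using \<open>e > 0\<close> h by (intro onorm_bound) (auto simp: mult.commute[of "\<bar>_\<bar>"] intro: mult_right_mono)
  qed (use h in auto)
  then show ?thesis using h
   by (simp add: g_def power2_eq_square algebra_simps)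
 qed
 ultimately show ?thesis by blast
qed

text \<open>The second difference of \<open>f\<close> along h v and h w is symmetric in v and w, and
  \<open>second_difference\<close> evaluates it in both ways, up to an error that is small compared
  with h^2.\<close>

lemma second_derivative_symmetric:
 fixes f :: "'a::real_normed_vector \<Rightarrow> 'b::real_normed_vector"
 assumes "open S" "x \<in> S" "\<And>y. y \<in> S \<Longrightarrow> (f has_derivative f' y) (at y)"
  and A: "((\<lambda>y. f' y v) has_derivative A) (at x)"
  and B: "((\<lambda>y. f' y w) has_derivative B) (at x)"
 shows "A w = B v"
proof -
 have "norm (A w - B v) \<le> 0 + e" if "e > 0" for e
 proof -
  let ?D = "\<lambda>h. f (x + h *\<^sub>R v + h *\<^sub>R w) - f (x + h *\<^sub>R v) - f (x + h *\<^sub>R w) + f x"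
  have e2: "e / 2 > 0" using that by simp
  obtain d1 where d1: "d1 > 0" "\<And>h. 0 < h \<and> h < d1 \<Longrightarrow> norm (?D h - h\<^sup>2 *\<^sub>R A w) \<le> e / 2 * h\<^sup>2"
   using second_difference[OF assms(1-3) A e2, of w] by blast
  obtain d2 where d2: "d2 > 0" "\<And>h. 0 < h \<and> h < d2 \<Longrightarrow>
    norm (f (x + h *\<^sub>R w + h *\<^sub>R v) - f (x + h *\<^sub>R w) - f (x + h *\<^sub>R v) + f x - h\<^sup>2 *\<^sub>R B v) \<le> e / 2 * h\<^sup>2"
   using second_difference[OF assms(1-3) B e2, of v] by blast
  define h where "h = min d1 d2 / 2"
  have h: "0 < h" "h < d1" "h < d2" using d1 d2 by (auto simp: h_def)
  have "norm (?D h - h\<^sup>2 *\<^sub>R B v) \<le> e / 2 * h\<^sup>2"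
   using d2(2)[of h] h by (simp add: algebra_simps)
  then have "norm ((?D h - h\<^sup>2 *\<^sub>R B v) - (?D h - h\<^sup>2 *\<^sub>R A w)) \<le> e / 2 * h\<^sup>2 + e / 2 * h\<^sup>2"
   using d1(2)[of h] h norm_triangle_ineq4[of "?D h - h\<^sup>2 *\<^sub>R B v" "?D h - h\<^sup>2 *\<^sub>R A w"]
   by linarith
  moreover have "(?D h - h\<^sup>2 *\<^sub>R B v) - (?D h - h\<^sup>2 *\<^sub>R A w) = h\<^sup>2 *\<^sub>R (A w - B v)"
   by (simp add: scaleR_diff_right)
  ultimately have "norm (h\<^sup>2 *\<^sub>R (A w - B v)) \<le> e / 2 * h\<^sup>2 + e / 2 * h\<^sup>2" by metis
  then have "h\<^sup>2 * norm (A w - B v) \<le> h\<^sup>2 * e" by (simp add: mult.commute)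
  then show ?thesis using h by simp
 qed
 then have "norm (A w - B v) \<le> 0" by (rule field_le_epsilon)
 then show ?thesis by simp
qed

definition d2 :: "('a::real_normed_vector \<Rightarrow> 'b::real_normed_vector) \<Rightarrow> 'a \<Rightarrow> 'a \<Rightarrow> 'a \<Rightarrow> 'b" where
 "d2 F x v w = fd (\<lambda>y. fd F y v) x w"

context
 fixes S F assumes F: "good (Suc (Suc 0)) S F" and S: "open S"
begin

private lemma d: "x \<in> S \<Longrightarrow> F differentiable (at x)"
 and dt: "base X \<in> S \<Longrightarrow> tlift F differentiable (at X)"
 using F by auto

text \<open>The map y -> DF(y) v is the fibre of the tangent map along the affine map y -> (y, v);
  this gives its differentiability and a formula for \<open>d2\<close>.\<close>

lemma fd_has_derivative:
 assumes "x \<in> S"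
 shows "((\<lambda>y. fd F y v) has_derivative (\<lambda>w. fibre (fd (tlift F) (hor x + ver v) (hor w)))) (at x)"
proof -
 have "((\<lambda>y. hor y + ver v) has_derivative hor) (at x)"
  by (auto intro!: derivative_eq_intros bounded_linear_imp_has_derivative bounded_linear_hor)
 from has_derivative_compose[OF this fd_works[OF dt]] assms
 have "((\<lambda>y. tlift F (hor y + ver v)) has_derivative (\<lambda>w. fd (tlift F) (hor x + ver v) (hor w))) (at x)"
  by simp
 from bounded_linear.has_derivative[OF bounded_linear_fibre this] show ?thesis by simp
qed

lemma d2_eq: "x \<in> S \<Longrightarrow> d2 F x v w = fibre (fd (tlift F) (hor x + ver v) (hor w))"
 unfolding d2_def by (simp add: fd_eqI[OF fd_has_derivative])

lemma d2_symmetric: "x \<in> S \<Longrightarrow> d2 F x v w = d2 F x w v"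
 using second_derivative_symmetric[OF S _ fd_works[OF d] fd_has_derivative fd_has_derivative]
 by (simp add: d2_eq)

text \<open>In its vector argument the tangent map is linear, so its derivative in a vertical
  direction is DF(x) itself.\<close>

lemma fd_tlift_ver:
 assumes "x \<in> S"
 shows "fibre (fd (tlift F) (hor x + ver v) (ver z)) = fd F x z"
proof -
 have "((\<lambda>z. hor x + ver z) has_derivative ver) (at v)"
  by (auto intro!: derivative_eq_intros bounded_linear_imp_has_derivative bounded_linear_ver)
 from has_derivative_compose[OF this fd_works[OF dt]] assms
 have "((\<lambda>z. tlift F (hor x + ver z)) has_derivative (\<lambda>w. fd (tlift F) (hor x + ver v) (ver w))) (at v)"
  by simp
 from bounded_linear.has_derivative[OF bounded_linear_fibre this]
 have "(fd F x has_derivative (\<lambda>w. fibre (fd (tlift F) (hor x + ver v) (ver w)))) (at v)"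
  by simp
 moreover have "(fd F x has_derivative fd F x) (at v)"
  by (rule bounded_linear_imp_has_derivative[OF linear_fd[OF d[OF assms]]])
 ultimately show ?thesis using has_derivative_unique by metis
qed

lemma fibre_fd_tlift:
 assumes "x \<in> S"
 shows "fibre (fd (tlift F) (hor x + ver v) (hor w + ver z)) = d2 F x v w + fd F x z"
 using linear_fd_simps(2)[OF dt, of "hor x + ver v" "hor w" "ver z"] assms
 by (simp add: d2_eq fd_tlift_ver)

lemma fd_along_has_derivative:
 assumes "x \<in> S" "G differentiable (at x)"
 shows "((\<lambda>y. fd F y (G y)) has_derivative (\<lambda>w. d2 F x (G x) w + fd F x (fd G x w))) (at x)"
proof -
 have "((\<lambda>y. hor y + ver (G y)) has_derivative (\<lambda>w. hor w + ver (fd G x w))) (at x)"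
  by (intro has_derivative_add bounded_linear_imp_has_derivative bounded_linear_hor
    bounded_linear.has_derivative[OF bounded_linear_ver] fd_works assms)
 from has_derivative_compose[OF this fd_works[OF dt]] assms
 have "((\<lambda>y. tlift F (hor y + ver (G y))) has_derivative
   (\<lambda>w. fd (tlift F) (hor x + ver (G x)) (hor w + ver (fd G x w)))) (at x)" by simp
 from bounded_linear.has_derivative[OF bounded_linear_fibre this]
 show ?thesis using assms(1) by (simp add: fibre_fd_tlift)
qed

end

section \<open>Lie brackets\<close>

abbreviation smooth :: "linf set \<Rightarrow> (linf \<Rightarrow> linf) \<Rightarrow> bool" where
 "smooth S F \<equiv> \<forall>k. good k S F"

lemma smooth_tlift: "smooth S F \<Longrightarrow> smooth (base -` S) (tlift F)"
 by (meson good.simps(2))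

lemma smooth_funpow: "smooth S F \<Longrightarrow> smooth ((base ^^ k) -` S) ((tlift ^^ k) F)"
 by (meson good_funpow)

lemma smooth_differentiable: "smooth S F \<Longrightarrow> x \<in> S \<Longrightarrow> F differentiable (at x)"
 by (meson good.simps(2))

definition bracket :: "(linf \<Rightarrow> linf) \<Rightarrow> (linf \<Rightarrow> linf) \<Rightarrow> linf \<Rightarrow> linf" where
 "bracket F G x = fd G x (F x) - fd F x (G x)"

lemma smooth_bracket:
 assumes "open S" "smooth S F" "smooth S G"
 shows "smooth S (bracket F G)"
 unfolding bracket_def[abs_def] using assms by (auto intro!: good_diff good_fd)


text \<open>The base parts agree at once. In the fibres both sides contain one second derivative of
  each field, but with the two directions interchanged: the lift of the bracket differentiates DG(x)
  F(x) in the direction w, the bracket of the lifts differentiates DG(x) w along F. Symmetry of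
  second derivatives closes the gap.\<close>

lemma tlift_bracket:
 assumes S: "open S" and F: "smooth S F" and G: "smooth S G" and X: "base X \<in> S"
 shows "tlift (bracket F G) X = bracket (tlift F) (tlift G) X"
proof -
 define x w where "x = base X" and "w = fibre X"
 have Xeq: "X = hor x + ver w" by (simp add: x_def w_def hor_base_ver_fibre)
 have x: "x \<in> S" using X by (simp add: x_def)
 have *: "fd (\<lambda>y. fd F y (G y)) x = (\<lambda>w. d2 F x (G x) w + fd F x (fd G x w))"
  if "smooth S F" "smooth S G" for F G
  using that x S smooth_differentiable by (intro fd_eqI fd_along_has_derivative) blast+
 have **: "(\<lambda>y. fd F y (G y)) differentiable (at x)" if "smooth S F" "smooth S G" for F G
  using that x S good_fd[of 1 S F G] by (metis One_nat_def good.simps(2))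
 have "fd (bracket F G) x w =
   (d2 G x (F x) w + fd G x (fd F x w)) - (d2 F x (G x) w + fd F x (fd G x w))"
  unfolding bracket_def[abs_def]
  using has_derivative_diff[OF fd_works[OF **[OF G F]] fd_works[OF **[OF F G]]]
  by (simp add: fd_eqI * F G)
 also have "\<dots> = (d2 G x w (F x) + fd G x (fd F x w)) - (d2 F x w (G x) + fd F x (fd G x w))"
  using d2_symmetric[of S G x "F x" w] d2_symmetric[of S F x "G x" w] F G S x by simp
 also have "\<dots> = fibre (bracket (tlift F) (tlift G) X)"
 proof -
  have "tlift H (hor x + ver w) = hor (H x) + ver (fd H x w)" for H
   by (simp add: tlift_def)
  moreover have "good (Suc (Suc 0)) S F" "good (Suc (Suc 0)) S G" using F G by blast+
  ultimately show ?thesis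
   unfolding bracket_def Xeq
   using fibre_fd_tlift[of S G x w "F x" "fd F x w"] fibre_fd_tlift[of S F x w "G x" "fd G x w"]
    S x by simp
 qed
 finally have 1: "fibre (tlift (bracket F G) X) = fibre (bracket (tlift F) (tlift G) X)"
  by (simp add: x_def w_def)
 have "base (fd (tlift F) X W) = fd F (base X) (base W)" if "smooth S F" for F W
 proof -
  have "((\<lambda>X. base (tlift F X)) has_derivative (\<lambda>W. base (fd (tlift F) X W))) (at X)"
   using X smooth_differentiable[OF smooth_tlift[OF that], of X]
   by (intro bounded_linear.has_derivative[OF bounded_linear_base] fd_works) simp
  then have 1: "((\<lambda>X. F (base X)) has_derivative (\<lambda>W. base (fd (tlift F) X W))) (at X)"
   by simp
  have 2: "((\<lambda>X. F (base X)) has_derivative (\<lambda>W. fd F (base X) (base W))) (at X)"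
   using has_derivative_compose[OF bounded_linear_imp_has_derivative[OF bounded_linear_base]
     fd_works[OF smooth_differentiable[OF that X]]] .
  show ?thesis using fun_cong[OF has_derivative_unique[OF 1 2], of W] .
 qed
 note bF = this[OF F] and bG = this[OF G]
 have "base (tlift (bracket F G) X) = base (bracket (tlift F) (tlift G) X)"
  by (simp add: bracket_def bF bG)
 then show ?thesis using 1 by (rule linf_eqI)
qed

lemma funpow_tlift_bracket:
 assumes "open S" "smooth S F" "smooth S G" "(base ^^ k) X \<in> S"
 shows "(tlift ^^ k) (bracket F G) X = bracket ((tlift ^^ k) F) ((tlift ^^ k) G) X"
 using assms(4)
proof (induction k arbitrary: X)
 case (Suc k)
 let ?S = "(base ^^ k) -` S"
 have cont: "continuous_on UNIV (base ^^ k)"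
  by (induction k) (auto intro: continuous_on_compose2[OF continuous_base] continuous_on_id simp: o_def)
 have op: "open ?S" using assms(1) cont by (rule open_vimage)
 have bX: "base X \<in> ?S" using Suc.prems by (simp add: funpow_swap1)
 have "fd ((tlift ^^ k) (bracket F G)) (base X) =
   fd (bracket ((tlift ^^ k) F) ((tlift ^^ k) G)) (base X)"
  by (rule fd_cong[OF op bX]) (use Suc.IH in simp)
 then have "(tlift ^^ Suc k) (bracket F G) X = tlift (bracket ((tlift ^^ k) F) ((tlift ^^ k) G)) X"
  using Suc.IH[of "base X"] bX by (simp add: tlift_def[of "(tlift ^^ k) (bracket F G)"]
    tlift_def[of "bracket ((tlift ^^ k) F) ((tlift ^^ k) G)"])
 also have "\<dots> = bracket ((tlift ^^ Suc k) F) ((tlift ^^ Suc k) G) X"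
  by (simp only: funpow.simps o_apply tlift_bracket[OF op smooth_funpow[OF assms(2)]
     smooth_funpow[OF assms(3)] bX])
 finally show ?case .
qed simp

text \<open>Differentiating the relation between \<open>F\<close> and \<open>F'\<close> in the
  direction \<open>G\<close>, and vice versa, produces the second derivative of \<tau> in the same
  two directions, which drops out of the difference by symmetry.\<close>

lemma bracket_related:
 assumes S: "open S" "open S'" and "smooth S \<tau>" "\<tau> ` S \<subseteq> S'"
  and F: "smooth S F" "smooth S' F'" "\<And>x. x \<in> S \<Longrightarrow> fd \<tau> x (F x) = F' (\<tau> x)"
  and G: "smooth S G" "smooth S' G'" "\<And>x. x \<in> S \<Longrightarrow> fd \<tau> x (G x) = G' (\<tau> x)"
  and x: "x \<in> S"
 shows "fd \<tau> x (bracket F G x) = bracket F' G' (\<tau> x)"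
proof -
 have *: "d2 \<tau> x (F x) (G x) + fd \<tau> x (fd F x (G x)) = fd F' (\<tau> x) (G' (\<tau> x))"
  if F: "smooth S F" "smooth S' F'" "\<And>x. x \<in> S \<Longrightarrow> fd \<tau> x (F x) = F' (\<tau> x)"
   and G: "smooth S G" "smooth S' G'" "\<And>x. x \<in> S \<Longrightarrow> fd \<tau> x (G x) = G' (\<tau> x)" for F F' G G'
 proof -
  have "((\<lambda>y. fd \<tau> y (F y)) has_derivative (\<lambda>w. d2 \<tau> x (F x) w + fd \<tau> x (fd F x w))) (at x)"
   using assms(3) F(1) S x by (intro fd_along_has_derivative smooth_differentiable[of S]) auto
  from fun_cong[OF fd_eqI[OF this], of "G x"]
  have 1: "fd (\<lambda>y. fd \<tau> y (F y)) x (G x) = d2 \<tau> x (F x) (G x) + fd \<tau> x (fd F x (G x))" .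
  have "((\<lambda>y. F' (\<tau> y)) has_derivative (\<lambda>w. fd F' (\<tau> x) (fd \<tau> x w))) (at x)"
   using assms(3,4) F(2) x
   by (intro has_derivative_compose[OF fd_works fd_works] smooth_differentiable[of S]
     smooth_differentiable[of S']) auto
  from fun_cong[OF fd_eqI[OF this], of "G x"]
  have "fd (\<lambda>y. F' (\<tau> y)) x (G x) = fd F' (\<tau> x) (fd \<tau> x (G x))" .
  moreover have "fd (\<lambda>y. fd \<tau> y (F y)) x = fd (\<lambda>y. F' (\<tau> y)) x"
   by (rule fd_cong[OF S(1) x]) (rule F(3))
  ultimately show ?thesis using 1 G(3)[OF x] by simp
 qed
 have "fd \<tau> x (bracket F G x) = fd \<tau> x (fd G x (F x)) - fd \<tau> x (fd F x (G x))"
  using linear_fd_simps(3)[OF smooth_differentiable[OF assms(3) x]] by (simp add: bracket_def)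
 also have "\<dots> = bracket F' G' (\<tau> x)"
  using *[OF F G] *[OF G F] d2_symmetric[of S \<tau> x "F x" "G x"] assms(3) S x
  unfolding bracket_def by (metis add_diff_cancel_left)
 finally show ?thesis .
qed

section \<open>Maps between Euclidean spaces\<close>

definition elift :: "('v::euclidean_space \<Rightarrow> 'w::euclidean_space) \<Rightarrow> linf \<Rightarrow> linf" where
 "elift G X = emb (G (prj X))"

lemma elift_has_derivative:
 fixes G :: "'v::euclidean_space \<Rightarrow> 'w::euclidean_space"
 assumes "G differentiable (at (prj X))"
 shows "(elift G has_derivative (\<lambda>W. emb (fd G (prj X) (prj W)))) (at X)"
 unfolding elift_def[abs_def]
 by (rule bounded_linear.has_derivative[OF bounded_linear_emb
    has_derivative_compose[OF bounded_linear_imp_has_derivative[OF bounded_linear_prj]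
     fd_works[OF assms]]])

lemma elift_differentiable:
 fixes G :: "'v::euclidean_space \<Rightarrow> 'w::euclidean_space"
 assumes "elift G differentiable (at (emb y))"
 shows "G differentiable (at y)"
proof -
 have "((\<lambda>y. prj (elift G (emb y)) :: 'w) has_derivative (\<lambda>v. prj (fd (elift G) (emb y) (emb v)))) (at y)"
  by (rule bounded_linear.has_derivative[OF bounded_linear_prj
     has_derivative_compose[OF bounded_linear_imp_has_derivative[OF bounded_linear_emb]
      fd_works[OF assms]]])
 then show ?thesis by (auto simp: elift_def differentiable_def)
qed

lemma smooth_onD: "smooth_on S G \<Longrightarrow> x \<in> S \<Longrightarrow> G differentiable (at x)"
 unfolding smooth_on_def by (meson k_smooth_on.simps(2))

lemma smooth_on_fd:
 assumes "smooth_on S G"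
 shows "smooth_on S (\<lambda>x. fd G x v)"
 unfolding smooth_on_def
proof
 fix k
 have "k_smooth_on S G (Suc k)" using assms unfolding smooth_on_def by blast
 then show "k_smooth_on S (\<lambda>x. fd G x v) k" by simp
qed

lemmas emb_simps =
 linear_0[OF bounded_linear.linear[OF bounded_linear_emb]]
 linear_add[OF bounded_linear.linear[OF bounded_linear_emb]]
 linear_diff[OF bounded_linear.linear[OF bounded_linear_emb]]
 linear_scale[OF bounded_linear.linear[OF bounded_linear_emb]]
 linear_sum[OF bounded_linear.linear[OF bounded_linear_emb]]

lemma open_prj: "open S \<Longrightarrow> open (prj -` S)"
 by (rule open_vimage) (auto intro: linear_continuous_on bounded_linear_prj)

lemma bounded_bilinear_coeff: "bounded_bilinear (\<lambda>X Y :: linf. (prj X \<bullet> (l :: 'v::euclidean_space)) *\<^sub>R Y)"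
 by (rule bounded_bilinear.comp1[OF bounded_bilinear_scaleR])
  (rule bounded_linear_compose[OF bounded_linear_inner_left bounded_linear_prj])

text \<open>Expanding the derivative in a basis writes the tangent map of \<open>elift G\<close> as
  a combination of lifts of directional derivatives of \<open>G\<close>, with coefficients linear in
  the fibre. These directional derivatives are smooth again, so the induction runs over all smooth
  \<open>G\<close>.\<close>

lemma good_elift:
 fixes G :: "'v::euclidean_space \<Rightarrow> 'w::euclidean_space"
 assumes "open S" "smooth_on S G"
 shows "good k (prj -` S) (elift G)"
 using assms(2)
proof (induction k arbitrary: G)
 case 0
 have "continuous_on S G" using 0 unfolding smooth_on_def by (metis k_smooth_on.simps(1))
 then have "continuous_on (prj -` S) (\<lambda>X. G (prj X))"
  by (rule continuous_on_compose2) (auto intro: linear_continuous_on bounded_linear_prj)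
 then show ?case
  unfolding elift_def[abs_def] good.simps
  by (rule continuous_on_compose2[OF linear_continuous_on[OF bounded_linear_emb]]) auto
next
 case (Suc k)
 let ?S = "prj -` S :: linf set"
 have d: "(elift G has_derivative (\<lambda>W. emb (fd G (prj X) (prj W)))) (at X)" if "X \<in> ?S" for X
  using that smooth_onD[OF Suc.prems] by (intro elift_has_derivative) auto
 define F where "F X = hor (elift G (base X)) +
  (\<Sum>l\<in>Basis. (prj (fibre X) \<bullet> l) *\<^sub>R ver (elift (\<lambda>y. fd G y l) (base X)))" for X
 have op: "open (base -` ?S)" using open_base[OF open_prj[OF assms(1)]] .
 have gb: "good k (base -` ?S) (\<lambda>X. h (elift G (base X)))"
  if "bounded_linear h" "smooth_on S G" for h and G :: "'v \<Rightarrow> 'w"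
  by (rule good_compose[OF good_linear[OF that(1)], where S' = UNIV])
   (auto intro!: op good_compose[OF Suc.IH[OF that(2)] good_linear[OF bounded_linear_base]])
 have "good k (base -` ?S) F"
  unfolding F_def[abs_def]
  by (intro good_add good_sum good_bilinear[OF bounded_bilinear_coeff] gb good_linear
    bounded_linear_hor bounded_linear_ver bounded_linear_fibre op Suc.prems smooth_on_fd)
 moreover have "tlift (elift G) X = F X" if "X \<in> base -` ?S" for X
 proof -
  let ?L = "fd G (prj (base X))" and ?w = "prj (fibre X) :: 'v"
  have lin: "bounded_linear ?L" using that smooth_onD[OF Suc.prems] by (intro linear_fd) auto
  have "?L ?w = ?L (\<Sum>l\<in>Basis. (?w \<bullet> l) *\<^sub>R l)" by (simp only: euclidean_representation)
  also have "\<dots> = (\<Sum>l\<in>Basis. (?w \<bullet> l) *\<^sub>R ?L l)"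
   using lin by (simp add: linear_simps linear_sum bounded_linear.linear)
  finally have *: "?L ?w = (\<Sum>l\<in>Basis. (?w \<bullet> l) *\<^sub>R ?L l)" .
  have "fd (elift G) (base X) (fibre X) = emb (?L ?w)"
   using fd_eqI[OF d, of "base X"] that by simp
  also have "\<dots> = (\<Sum>l\<in>Basis. (?w \<bullet> l) *\<^sub>R elift (\<lambda>y. fd G y l) (base X))"
   unfolding * by (simp add: elift_def emb_simps)
  finally show ?thesis
   by (simp add: tlift_def F_def linear_sum[OF bounded_linear.linear[OF bounded_linear_ver]])
 qed
 ultimately have "good k (base -` ?S) (tlift (elift G))"
  by (subst good_cong[OF op]) auto
 then show ?case using d by (auto simp: differentiable_def)
qed

primrec ddir :: "('v::real_normed_vector \<Rightarrow> 'w::real_normed_vector) \<Rightarrow> 'v list \<Rightarrow> 'v \<Rightarrow> 'w" where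
 "ddir G [] = G"
| "ddir G (v # vs) = (\<lambda>y. fd (ddir G vs) y v)"

text \<open>A point of the iterated tangent space over y that carries one constant direction per
  level: each new vector is inserted at the outermost level, with zeros in all its inner fibre
  slots.\<close>

primrec jet_point :: "'v::euclidean_space list \<Rightarrow> 'v \<Rightarrow> linf" where
 "jet_point [] y = emb y"
| "jet_point (v # vs) y = hor (jet_point vs y) + ver ((hor ^^ length vs) (emb v))"

lemma base_jet_point: "(base ^^ length vs) (jet_point vs y) = emb y"
 by (induction vs) (auto simp: funpow_swap1)

lemma bounded_linear_funpow: "bounded_linear h \<Longrightarrow> bounded_linear (h ^^ k)" for h :: "'a::real_normed_vector \<Rightarrow> 'a"
 by (induction k) (auto simp: o_def id_def intro: bounded_linear_compose bounded_linear_ident)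

lemma jet_point_has_derivative:
 "(jet_point vs has_derivative (\<lambda>w. (hor ^^ length vs) (emb w))) (at y)"
proof (induction vs)
 case Nil
 then show ?case
  by (simp add: bounded_linear_imp_has_derivative bounded_linear_emb jet_point.simps(1)[abs_def])
next
 case (Cons v vs)
 then show ?case
  using has_derivative_add[OF bounded_linear.has_derivative[OF bounded_linear_hor Cons]
    has_derivative_const[of "ver ((hor ^^ length vs) (emb v))"]]
  by simp
qed

text \<open>A further tangent lift differentiates the previous expression in the direction stored in
  the outermost fibre of the jet point, and this direction is the derivative of the inner jet point
  when y moves along v. Thus closeness of iterated lifts yields closeness of iterated directional
  derivatives.\<close>

lemma ddir_conv_tlift:
 fixes G :: "'v::euclidean_space \<Rightarrow> 'w::euclidean_space"
 assumes "open U" "good (length vs) (prj -` U) (elift G)" "y \<in> U"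
 shows "ddir G vs y =
  prj ((fibre ^^ length vs) ((tlift ^^ length vs) (elift G) (jet_point vs y)))"
 using assms(2,3)
proof (induction vs arbitrary: y)
 case Nil
 then show ?case by (simp add: elift_def)
next
 case (Cons v vs)
 let ?k = "length vs"
 let ?h = "\<lambda>X. prj ((fibre ^^ ?k) ((tlift ^^ ?k) (elift G) X)) :: 'w"
 have g: "good (?k + Suc 0) (prj -` U) (elift G)" using Cons.prems by simp
 have y: "jet_point vs y \<in> (base ^^ ?k) -` (prj -` U)"
  using Cons.prems by (simp add: base_jet_point)
 have "(tlift ^^ ?k) (elift G) differentiable (at (jet_point vs y))"
  using good_funpow[OF g] y by simp
 note * = has_derivative_compose[OF jet_point_has_derivative fd_works[OF this]]
 have "((\<lambda>y. ?h (jet_point vs y)) has_derivative (\<lambda>w. prj ((fibre ^^ ?k)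
   (fd ((tlift ^^ ?k) (elift G)) (jet_point vs y) ((hor ^^ ?k) (emb w)))))) (at y)"
  by (intro bounded_linear.has_derivative[OF bounded_linear_prj]
    bounded_linear.has_derivative[OF bounded_linear_funpow[OF bounded_linear_fibre]] *)
 from fd_eqI[OF this] have "fd (\<lambda>y. ?h (jet_point vs y)) y v =
   prj ((fibre ^^ ?k) (fd ((tlift ^^ ?k) (elift G)) (jet_point vs y) ((hor ^^ ?k) (emb v))))"
  by simp
 moreover have "fd (ddir G vs) y = fd (\<lambda>y. ?h (jet_point vs y)) y"
  using Cons good_le[OF Cons.prems(1), of ?k] by (intro fd_cong[OF assms(1)]) auto
 moreover have "(fibre ^^ Suc ?k) Z = (fibre ^^ ?k) (fibre Z)" for Z
  by (simp add: funpow_swap1)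
 ultimately show ?case by (simp only: ddir.simps jet_point.simps list.size add_Suc_right add_0_right
    funpow.simps(2)[of ?k tlift] o_apply fibre_tlift) simp
qed


section \<open>Integral equations with bounded integrable controls\<close>

text \<open>On a short interval \<open>h\<close> is uniformly close to a constant, and
  \<open>u\<close> times a constant vector is integrable. Bisection patches these into integrable
  functions uniformly close to the product, and integrability passes to uniform limits, also for
  values in a Banach space.\<close>

lemma scaleR_continuous_integrable:
 fixes u :: "real \<Rightarrow> real" and h :: "real \<Rightarrow> 'e::banach"
 assumes ab: "a \<le> b" and u: "u integrable_on {a..b}" "\<And>t. t \<in> {a..b} \<Longrightarrow> \<bar>u t\<bar> \<le> M"
  and h: "continuous_on {a..b} h"
 shows "(\<lambda>t. u t *\<^sub>R h t) integrable_on {a..b}"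
proof -
 define M' where "M' = \<bar>M\<bar> + 1"
 have M': "M' > 0" "\<And>t. t \<in> {a..b} \<Longrightarrow> \<bar>u t\<bar> \<le> M'" using u(2) by (force simp: M'_def)+
 have "\<exists>g. (\<forall>t\<in>cbox a b. norm (u t *\<^sub>R h t - g t) \<le> e) \<and> g integrable_on cbox a b" if "e > 0" for e
 proof -
  define P where "P c d \<longleftrightarrow> (a \<le> c \<longrightarrow> c \<le> d \<longrightarrow> d \<le> b \<longrightarrow>
   (\<exists>g. (\<forall>t\<in>{c..d}. norm (u t *\<^sub>R h t - g t) \<le> e) \<and> g integrable_on {c..d}))" for c d
  from ab have "P a b"
  proof (induction rule: Bolzano)
   case (trans c m d)
   show ?case unfolding P_def
   proof (intro impI)
    assume cd: "a \<le> c" "c \<le> d" "d \<le> b"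
    obtain g1 where g1: "\<forall>t\<in>{c..m}. norm (u t *\<^sub>R h t - g1 t) \<le> e" "g1 integrable_on {c..m}"
     using trans cd unfolding P_def by auto
    obtain g2 where g2: "\<forall>t\<in>{m..d}. norm (u t *\<^sub>R h t - g2 t) \<le> e" "g2 integrable_on {m..d}"
     using trans cd unfolding P_def by auto
    note g = g1 g2
    define g where "g t = (if t \<le> m then g1 t else g2 t)" for t
    have "g integrable_on {c..m}" using g(2) by (rule integrable_eq) (auto simp: g_def)
    moreover have "g integrable_on {m..d}"
     by (rule integrable_spike[OF g(4), of "{m}"]) (auto simp: g_def)
    ultimately have "g integrable_on {c..d}"
     using trans by (intro Henstock_Kurzweil_Integration.integrable_combine[of c m d]) auto
    moreover have "\<forall>t\<in>{c..d}. norm (u t *\<^sub>R h t - g t) \<le> e" using g by (auto simp: g_def)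
    ultimately show "\<exists>g. (\<forall>t\<in>{c..d}. norm (u t *\<^sub>R h t - g t) \<le> e) \<and> g integrable_on {c..d}"
     by blast
   qed
  next
   case (local x)
   have "e / M' > 0" using M' that by simp
   then obtain d where d: "d > 0" "\<And>t. t \<in> {a..b} \<Longrightarrow> dist t x < d \<Longrightarrow> dist (h t) (h x) < e / M'"
    using h local unfolding continuous_on_iff by (metis atLeastAtMost_iff)
   have "P c d'" if "c \<le> x" "x \<le> d'" "d' - c < d" for c d'
    unfolding P_def
   proof (intro impI exI[of _ "\<lambda>t. u t *\<^sub>R h x"] conjI ballI)
    fix t assume cd: "a \<le> c" "d' \<le> b" and t: "t \<in> {c..d'}"
    then have t': "t \<in> {a..b}" "dist t x < d" using that by (auto simp: dist_real_def)
    have "norm (u t *\<^sub>R h t - u t *\<^sub>R h x) = \<bar>u t\<bar> * norm (h t - h x)"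
     by (simp add: scaleR_diff_right[symmetric] del: scaleR_diff_right)
    also have "\<dots> \<le> M' * (e / M')"
     using M'(2)[OF t'(1)] d(2)[OF t'] M'(1) by (intro mult_mono) (auto simp: dist_norm)
    finally show "norm (u t *\<^sub>R h t - u t *\<^sub>R h x) \<le> e" using M' by simp
   next
    assume "a \<le> c" "d' \<le> b"
    then have "u integrable_on {c..d'}"
     by (intro integrable_on_subinterval[OF u(1)]) auto
    then show "(\<lambda>t. u t *\<^sub>R h x) integrable_on {c..d'}"
     by (rule integrable_on_scaleR_left)
   qed
   then show ?case using d(1) by blast
  qed
  then show ?thesis using ab by (auto simp: P_def)
 qed
 then show ?thesis using integrable_uniform_limit[of a b "\<lambda>t. u t *\<^sub>R h t"] by simp
qed

lemma gronwall:
 fixes \<phi> :: "real \<Rightarrow> real"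
 assumes \<phi>: "continuous_on {a..b} \<phi>" and K: "K \<ge> 0"
  and le: "\<And>t. t \<in> {a..b} \<Longrightarrow> \<phi> t \<le> C + K * integral {a..t} \<phi>" and t: "t \<in> {a..b}"
 shows "\<phi> t \<le> C * exp (K * (t - a))"
proof -
 \<comment> \<open>The integrating factor turns the integral bound into a nonincreasing function,
   which starts with the value \<open>C\<close>.\<close>
 define \<psi> where "\<psi> t = (C + K * integral {a..t} \<phi>) * exp (- K * (t - a))" for t
 have I: "((\<lambda>t. integral {a..t} \<phi>) has_real_derivative \<phi> s) (at s within {a..b})" if "s \<in> {a..b}" for s
  using integral_has_real_derivative[OF \<phi> that] .
 have D: "(\<psi> has_real_derivative (K * \<phi> s * exp (- K * (s - a)) -
   K * (C + K * integral {a..s} \<phi>) * exp (- K * (s - a)))) (at s within {a..b})" if "s \<in> {a..b}" for s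
  unfolding \<psi>_def by (rule derivative_eq_intros I[OF that] refl | simp add: algebra_simps)+
 have "\<psi> t \<le> \<psi> a"
 proof (cases "a < t")
  case True
  show ?thesis
  proof (rule DERIV_nonpos_imp_decreasing_open[of a t])
   show "a \<le> t" using True by simp
   fix s assume s: "a < s" "s < t"
   then have "s \<in> {a..b}" "at s within {a..b} = at s"
    using t by (auto intro!: at_within_interior)
   moreover have "K * \<phi> s * exp (- K * (s - a)) \<le> K * (C + K * integral {a..s} \<phi>) * exp (- K * (s - a))"
    using le[of s] K calculation by (intro mult_right_mono mult_left_mono) auto
   ultimately show "\<exists>y. (\<psi> has_real_derivative y) (at s) \<and> y \<le> 0"
    using D[of s] by (metis diff_le_0_iff_le)
  next
   have "continuous_on {a..b} \<psi>"
    using D by (intro DERIV_continuous_on) 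
   then show "continuous_on {a..t} \<psi>" using t by (auto intro: continuous_on_subset)
  qed
 qed (use t in auto)
 moreover have "\<psi> a = C" by (simp add: \<psi>_def)
 moreover have "\<psi> t * exp (K * (t - a)) = C + K * integral {a..t} \<phi>"
  by (simp add: \<psi>_def mult.assoc exp_add[symmetric] algebra_simps)
 ultimately have "C + K * integral {a..t} \<phi> \<le> C * exp (K * (t - a))"
  by (metis mult_right_mono exp_ge_zero)
 then show ?thesis using le[OF t] by simp
qed

text \<open>A contraction on the whole interval at once: in the norm weighted by exp(-\<Lambda> (t -
  a)) the integral operator has Lipschitz constant at most L / \<Lambda>, and \<Lambda> = 2 L + 1
  makes this at most 1/2. The weight is built into the unknown, so the ordinary space of bounded
  continuous functions can be used.\<close>

lemma picard:
 fixes H :: "real \<Rightarrow> 'e::banach \<Rightarrow> 'e"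
 assumes ab: "a \<le> b" and L: "L \<ge> 0"
  and int: "\<And>y. continuous_on {a..b} y \<Longrightarrow> (\<lambda>s. H s (y s)) integrable_on {a..b}"
  and lip: "\<And>s y z. s \<in> {a..b} \<Longrightarrow> norm (H s y - H s z) \<le> L * norm (y - z)"
 obtains y where "continuous_on {a..b} y"
  "\<And>t. t \<in> {a..b} \<Longrightarrow> ((\<lambda>s. H s (y s)) has_integral (y t - y0)) {a..t}"
proof -
 define \<Lambda> where "\<Lambda> = 2 * L + 1"
 have \<Lambda>: "\<Lambda> > 0" "L / \<Lambda> \<le> 1 / 2" using L by (auto simp: \<Lambda>_def field_simps)
 \<comment> \<open>Clamping time to [a, b] turns functions on the interval into bounded continuous
   functions on the line, as the type of the fixed point demands.\<close>
 define c where "c t = max a (min b t)" for t :: real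
 have c: "c t \<in> {a..b}" "t \<in> {a..b} \<Longrightarrow> c t = t" for t using ab by (auto simp: c_def)
 have contc: "continuous_on UNIV c" unfolding c_def by (intro continuous_intros)
 define I where "I z t = integral {a..t} (\<lambda>s. H s (exp (\<Lambda> * (s - a)) *\<^sub>R apply_bcontfun z s))"
  for z :: "real \<Rightarrow>\<^sub>C 'e" and t
 have sub: "(\<lambda>s. H s (exp (\<Lambda> * (s - a)) *\<^sub>R apply_bcontfun z s)) integrable_on {a..b}" for z
  by (intro int continuous_intros continuous_on_apply_bcontfun)
 have subt: "(\<lambda>s. H s (exp (\<Lambda> * (s - a)) *\<^sub>R apply_bcontfun z s)) integrable_on {a..t}" if "t \<le> b" for z t
  by (rule integrable_on_subinterval[OF sub]) (use that in auto)
 have contI: "continuous_on {a..b} (I z)" for z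
  unfolding I_def by (rule indefinite_integral_continuous_1[OF sub])
 define \<Phi> where "\<Phi> z = Bcontfun (\<lambda>t. exp (- \<Lambda> * (c t - a)) *\<^sub>R (y0 + I z (c t)))" for z
 have "(\<lambda>t. exp (- \<Lambda> * (c t - a)) *\<^sub>R (y0 + I z (c t))) \<in> bcontfun" for z
 proof -
  have "continuous_on {a..b} (\<lambda>t. exp (- \<Lambda> * (t - a)) *\<^sub>R (y0 + I z t))"
   by (intro continuous_intros contI)
  then have "bounded ((\<lambda>t. exp (- \<Lambda> * (t - a)) *\<^sub>R (y0 + I z t)) ` {a..b})"
   by (intro compact_imp_bounded compact_continuous_image) auto
  then have "bounded (range (\<lambda>t. exp (- \<Lambda> * (c t - a)) *\<^sub>R (y0 + I z (c t))))"
   by (rule bounded_subset) (use c in auto)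
  moreover have "continuous_on UNIV (\<lambda>t. I z (c t))"
   by (rule continuous_on_compose2[OF contI contc]) (use c in auto)
  ultimately show ?thesis
   unfolding bcontfun_def by (auto intro!: continuous_intros contc)
 qed
 then have \<Phi>: "apply_bcontfun (\<Phi> z) t = exp (- \<Lambda> * (c t - a)) *\<^sub>R (y0 + I z (c t))" for z t
  unfolding \<Phi>_def by (simp add: Bcontfun_inverse)
 have "dist (\<Phi> z) (\<Phi> z') \<le> 1 / 2 * dist z z'" for z z'
 proof (rule dist_bound)
  fix t
  define \<tau> where "\<tau> = c t"
  have \<tau>: "a \<le> \<tau>" "\<tau> \<le> b" using c(1)[of t] by (auto simp: \<tau>_def)
  define D where "D = dist z z'"
  have "((\<lambda>s. L * D / \<Lambda> * exp (\<Lambda> * (s - a))) has_vector_derivative L * exp (\<Lambda> * (s - a)) * D)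
    (at s within {a..\<tau>})" for s
   unfolding has_real_derivative_iff_has_vector_derivative[symmetric]
   by (rule derivative_eq_intros refl | use \<Lambda> in simp)+
  from fundamental_theorem_of_calculus[OF \<tau>(1) this]
  have J: "((\<lambda>s. L * exp (\<Lambda> * (s - a)) * D) has_integral L * D / \<Lambda> * (exp (\<Lambda> * (\<tau> - a)) - 1)) {a..\<tau>}"
   by (simp add: algebra_simps)
  have "norm (I z \<tau> - I z' \<tau>) = norm (integral {a..\<tau>}
    (\<lambda>s. H s (exp (\<Lambda> * (s - a)) *\<^sub>R apply_bcontfun z s) - H s (exp (\<Lambda> * (s - a)) *\<^sub>R apply_bcontfun z' s)))"
   unfolding I_def by (subst integral_diff) (use subt \<tau> in auto)
  also have "\<dots> \<le> integral {a..\<tau>} (\<lambda>s. L * exp (\<Lambda> * (s - a)) * D)"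
  proof (rule integral_norm_bound_integral)
   fix s assume "s \<in> {a..\<tau>}"
   then have "norm (H s (exp (\<Lambda> * (s - a)) *\<^sub>R apply_bcontfun z s) -
     H s (exp (\<Lambda> * (s - a)) *\<^sub>R apply_bcontfun z' s)) \<le>
     L * norm (exp (\<Lambda> * (s - a)) *\<^sub>R (apply_bcontfun z s - apply_bcontfun z' s))"
    using lip[of s "exp (\<Lambda> * (s - a)) *\<^sub>R apply_bcontfun z s" "exp (\<Lambda> * (s - a)) *\<^sub>R apply_bcontfun z' s"]
     \<tau> by (simp add: scaleR_diff_right)
   also have "\<dots> \<le> L * (exp (\<Lambda> * (s - a)) * D)"
    using L dist_bounded[of z s z'] by (auto simp: D_def dist_norm intro!: mult_left_mono)
   finally show "norm (H s (exp (\<Lambda> * (s - a)) *\<^sub>R apply_bcontfun z s) -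
     H s (exp (\<Lambda> * (s - a)) *\<^sub>R apply_bcontfun z' s)) \<le> L * exp (\<Lambda> * (s - a)) * D" by simp
  qed (use subt \<tau> J in \<open>auto intro!: integrable_diff\<close>)
  also have "\<dots> = L * D / \<Lambda> * (exp (\<Lambda> * (\<tau> - a)) - 1)" using J by (rule integral_unique)
  also have "\<dots> \<le> 1 / 2 * D * exp (\<Lambda> * (\<tau> - a))"
  proof -
   have "L / \<Lambda> * D * (exp (\<Lambda> * (\<tau> - a)) - 1) \<le> 1 / 2 * D * exp (\<Lambda> * (\<tau> - a))"
    using \<Lambda> L \<tau> by (intro mult_mono) (auto simp: D_def)
   then show ?thesis by simp
  qed
  finally have *: "norm (I z \<tau> - I z' \<tau>) \<le> 1 / 2 * D * exp (\<Lambda> * (\<tau> - a))" .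
  have "dist (apply_bcontfun (\<Phi> z) t) (apply_bcontfun (\<Phi> z') t) =
    exp (- \<Lambda> * (\<tau> - a)) * norm (I z \<tau> - I z' \<tau>)"
   by (simp add: \<Phi> dist_norm \<tau>_def[symmetric] scaleR_diff_right[symmetric] del: scaleR_diff_right)
  also have "\<dots> \<le> exp (- \<Lambda> * (\<tau> - a)) * (1 / 2 * D * exp (\<Lambda> * (\<tau> - a)))"
   using * by (intro mult_left_mono) auto
  also have "\<dots> = 1 / 2 * D * exp (- \<Lambda> * (\<tau> - a) + \<Lambda> * (\<tau> - a))"
   unfolding exp_add by simp
  also have "\<dots> = 1 / 2 * D" by simp
  finally show "dist (apply_bcontfun (\<Phi> z) t) (apply_bcontfun (\<Phi> z') t) \<le> 1 / 2 * dist z z'"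
   by (simp add: D_def)
 qed
 then have "\<exists>!z. \<Phi> z = z" by (intro banach_fix_type[of "1 / 2"]) auto
 then obtain z where z: "\<Phi> z = z" by blast
 define y where "y t = exp (\<Lambda> * (t - a)) *\<^sub>R apply_bcontfun z t" for t
 have "y t = y0 + I z t" if "t \<in> {a..b}" for t
  using \<Phi>[of z t] c(2)[OF that] by (simp add: y_def z exp_minus)
 moreover have "((\<lambda>s. H s (y s)) has_integral I z t) {a..t}" if "t \<in> {a..b}" for t
  unfolding I_def y_def by (rule integrable_integral[OF subt]) (use that in auto)
 moreover have "continuous_on {a..b} y"
  unfolding y_def by (intro continuous_intros continuous_on_apply_bcontfun)
 ultimately show ?thesis by (intro that[of y]) auto
qed

text \<open>At the first time where the value \<rho> is reached, the weak bound holds up to that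
  time, and the step property gives the strict bound there, a contradiction. It turns estimates
  valid only inside a tube into the fact that the tube is never left.\<close>

lemma bootstrap:
 fixes g :: "real \<Rightarrow> real"
 assumes g: "continuous_on {a..b} g" and "g a < \<rho>"
  and step: "\<And>t1. t1 \<in> {a..b} \<Longrightarrow> (\<And>t. t \<in> {a..t1} \<Longrightarrow> g t \<le> \<rho>) \<Longrightarrow> g t1 < \<rho>"
  and t: "t \<in> {a..b}"
 shows "g t < \<rho>"
proof (rule ccontr)
 assume "\<not> g t < \<rho>"
 define C where "C = {t \<in> {a..b}. \<rho> \<le> g t}"
 have "C \<noteq> {}" using t \<open>\<not> g t < \<rho>\<close> by (auto simp: C_def)
 have "closed C"
  unfolding C_def by (intro continuous_on_closed_Collect_le g continuous_intros)
 then have "compact ({a..b} \<inter> C)" by (intro compact_Int_closed) auto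
 moreover have "{a..b} \<inter> C = C" by (auto simp: C_def)
 ultimately have "compact C" by simp
 then obtain t1 where t1: "t1 \<in> C" "\<And>s. s \<in> C \<Longrightarrow> t1 \<le> s"
  using compact_attains_inf[OF \<open>compact C\<close> \<open>C \<noteq> {}\<close>] by blast
 have "\<exists>s\<ge>a. s \<le> t1 \<and> g s = \<rho>"
  using t1(1) assms(2) by (intro IVT' continuous_on_subset[OF g]) (auto simp: C_def)
 then obtain s where "a \<le> s" "s \<le> t1" "g s = \<rho>" by blast
 with t1 have "g t1 = \<rho>" by (force simp: C_def)
 moreover have "g t \<le> \<rho>" if "t \<in> {a..t1}" for t
  using t1 that \<open>g t1 = \<rho>\<close> by (cases "t = t1") (force simp: C_def)+
 ultimately show False using step[of t1] t1(1) by (auto simp: C_def)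
qed

section \<open>Controlled systems as integral equations\<close>

definition rhs :: "'i set \<Rightarrow> ('i \<Rightarrow> real \<Rightarrow> real) \<Rightarrow> ('i \<Rightarrow> 'e \<Rightarrow> 'e::real_vector) \<Rightarrow> real \<Rightarrow> 'e \<Rightarrow> 'e" where
 "rhs J u f t x = (\<Sum>j\<in>J. u j t *\<^sub>R f j x)"

definition admissible :: "'i set \<Rightarrow> ('i \<Rightarrow> real \<Rightarrow> real) \<Rightarrow> real \<Rightarrow> real \<Rightarrow> bool" where
 "admissible J u a b \<longleftrightarrow> (\<forall>j\<in>J. u j integrable_on {a..b} \<and> bounded (u j ` {a..b}))"

definition isol ::
 "'i set \<Rightarrow> ('i \<Rightarrow> real \<Rightarrow> real) \<Rightarrow> ('i \<Rightarrow> linf \<Rightarrow> linf) \<Rightarrow> linf set \<Rightarrow> real \<Rightarrow> real \<Rightarrow> (real \<Rightarrow> linf) \<Rightarrow> bool" where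
 "isol J u f S a b x \<longleftrightarrow> continuous_on {a..b} x \<and> x ` {a..b} \<subseteq> S \<and>
   (\<forall>t\<in>{a..b}. ((\<lambda>s. rhs J u f s (x s)) has_integral (x t - x a)) {a..t})"

lemma admissible_bound:
 assumes "admissible J u a b" "finite J"
 obtains M where "M > 0" "\<And>j t. j \<in> J \<Longrightarrow> t \<in> {a..b} \<Longrightarrow> \<bar>u j t\<bar> \<le> M"
proof -
 have "\<forall>j\<in>J. \<exists>M. \<forall>t\<in>{a..b}. \<bar>u j t\<bar> \<le> M"
  using assms(1) by (auto simp: admissible_def bounded_iff)
 from bchoice[OF this] obtain m where m: "\<And>j t. j \<in> J \<Longrightarrow> t \<in> {a..b} \<Longrightarrow> \<bar>u j t\<bar> \<le> m j"
  by blast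
 show ?thesis
 proof (rule that[of "(\<Sum>j\<in>J. \<bar>m j\<bar>) + 1"])
  show "\<bar>u j t\<bar> \<le> (\<Sum>j\<in>J. \<bar>m j\<bar>) + 1" if "j \<in> J" "t \<in> {a..b}" for j t
   using m[OF that] member_le_sum[of j J "\<lambda>j. \<bar>m j\<bar>"] assms(2) that(1) by auto
 qed (simp add: add_nonneg_pos sum_nonneg)
qed

lemma admissible_subinterval:
 assumes "admissible J u a b" "a \<le> c" "d \<le> b"
 shows "admissible J u c d"
proof -
 have "{c..d} \<subseteq> {a..b}" using assms by auto
 then show ?thesis
  using assms(1) unfolding admissible_def
  by (meson bounded_subset image_mono integrable_on_subinterval)
qed


lemma rhs_integrable:
 assumes "a \<le> b" "admissible J u a b" "\<And>j. j \<in> J \<Longrightarrow> continuous_on {a..b} (\<lambda>s. h j s)"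
 shows "(\<lambda>s. \<Sum>j\<in>J. u j s *\<^sub>R (h j s :: 'e::banach)) integrable_on {a..b}"
proof (cases "finite J")
 case True
 then obtain M where "\<And>j t. j \<in> J \<Longrightarrow> t \<in> {a..b} \<Longrightarrow> \<bar>u j t\<bar> \<le> M"
  using admissible_bound[OF assms(2)] by metis
 then show ?thesis
  using assms by (intro integrable_sum True scaleR_continuous_integrable[where M = M])
   (auto simp: admissible_def)
qed auto

lemma isol_subinterval:
 assumes x: "isol J u f S a b x" and cd: "a \<le> c" "c \<le> d" "d \<le> b"
 shows "isol J u f S c d x"
 unfolding isol_def
proof (intro conjI ballI)
 have I: "((\<lambda>s. rhs J u f s (x s)) has_integral (x t - x a)) {a..t}" if "t \<in> {a..b}" for t
  using x that by (simp add: isol_def)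
 fix t assume t: "t \<in> {c..d}"
 have It: "((\<lambda>s. rhs J u f s (x s)) has_integral (x t - x a)) {a..t}"
  and Ic: "((\<lambda>s. rhs J u f s (x s)) has_integral (x c - x a)) {a..c}"
  using I t cd by auto
 have "(\<lambda>s. rhs J u f s (x s)) integrable_on {c..t}"
  by (rule integrable_on_subinterval[OF has_integral_integrable[OF It]]) (use t cd in auto)
 then obtain i where i: "((\<lambda>s. rhs J u f s (x s)) has_integral i) {c..t}" by blast
 have "((\<lambda>s. rhs J u f s (x s)) has_integral (x c - x a + i)) {a..t}"
  using cd t by (intro has_integral_combine[OF _ _ Ic i]) auto
 then have "x c - x a + i = x t - x a"
  using has_integral_unique[OF _ It] by auto
 then have "i = x t - x c" by (simp add: algebra_simps)
 then show "((\<lambda>s. rhs J u f s (x s)) has_integral (x t - x c)) {c..t}" using i by simp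
next
 show "continuous_on {c..d} x" "x ` {c..d} \<subseteq> S"
  using x cd by (auto simp: isol_def intro: continuous_on_subset)
qed

lemma isol_cong:
 assumes "\<And>t. t \<in> {a..b} \<Longrightarrow> x t = y t" "\<And>j z. j \<in> J \<Longrightarrow> z \<in> S \<Longrightarrow> f j z = g j z"
 shows "isol J u f S a b x \<longleftrightarrow> isol J u g S a b y"
proof -
 have *: "isol J u g S a b y"
  if "\<And>t. t \<in> {a..b} \<Longrightarrow> x t = y t" "\<And>j z. j \<in> J \<Longrightarrow> z \<in> S \<Longrightarrow> f j z = g j z" "isol J u f S a b x"
  for x y :: "real \<Rightarrow> linf" and f g :: "'a \<Rightarrow> linf \<Rightarrow> linf"
  unfolding isol_def
 proof (intro conjI ballI)
  show "continuous_on {a..b} y"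
   using that(1,3) continuous_on_cong[OF refl, of "{a..b}" x y] by (simp add: isol_def)
  show "y ` {a..b} \<subseteq> S" using that by (auto simp: isol_def image_subset_iff)
  fix t assume t: "t \<in> {a..b}"
  then have "((\<lambda>s. rhs J u f s (x s)) has_integral (y t - y a)) {a..t}"
   using that by (auto simp: isol_def)
  then show "((\<lambda>s. rhs J u g s (y s)) has_integral (y t - y a)) {a..t}"
   by (rule has_integral_eq[rotated])
    (use that t in \<open>auto simp: rhs_def isol_def image_subset_iff intro!: sum.cong\<close>)
 qed
 from *[of x y f g] *[of y x g f] show ?thesis using assms by auto
qed

section \<open>Stability and differentiability of flows\<close>

text \<open>A single number M stands for a bound and, through 1 / M, for a radius; this is why the
  local properties below are arranged to be monotone in M. The local constants, for the points of a
  subcover and for the members of the family, are finite in number and are replaced by the sum of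
  their absolute values.\<close>

lemma compact_family_uniform:
 fixes K :: "'a::metric_space set" and P :: "'i \<Rightarrow> 'a \<Rightarrow> real \<Rightarrow> bool"
 assumes "compact K" "finite J"
  and loc: "\<And>j p. j \<in> J \<Longrightarrow> p \<in> K \<Longrightarrow> \<exists>\<delta>>0. \<exists>M. \<forall>q\<in>ball p \<delta>. P j q M"
  and mono: "\<And>j q M M'. P j q M \<Longrightarrow> M \<le> M' \<Longrightarrow> P j q M'"
 obtains M where "M > 0" "\<And>j q. j \<in> J \<Longrightarrow> q \<in> K \<Longrightarrow> P j q M"
proof -
 have "\<exists>M. \<forall>q\<in>K. P j q M" if j: "j \<in> J" for j
 proof -
  have "\<forall>p\<in>K. \<exists>\<delta>. \<exists>M. \<delta> > 0 \<and> (\<forall>q\<in>ball p \<delta>. P j q M)" using loc[OF j] by blast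
  then obtain \<delta> M where \<delta>M: "\<And>p. p \<in> K \<Longrightarrow> \<delta> p > 0 \<and> (\<forall>q\<in>ball p (\<delta> p). P j q (M p))"
   by metis
  have "K \<subseteq> (\<Union>p\<in>K. ball p (\<delta> p))" using \<delta>M by force
  from compactE_image[OF \<open>compact K\<close> _ this]
  obtain C where C: "C \<subseteq> K" "finite C" "K \<subseteq> (\<Union>p\<in>C. ball p (\<delta> p))" by auto
  have "P j q (\<Sum>p\<in>C. \<bar>M p\<bar>)" if "q \<in> K" for q
  proof -
   obtain p where p: "p \<in> C" "q \<in> ball p (\<delta> p)" using C(3) \<open>q \<in> K\<close> by blast
   have "M p \<le> (\<Sum>p\<in>C. \<bar>M p\<bar>)"
    using member_le_sum[OF p(1), of "\<lambda>p. \<bar>M p\<bar>"] C(2) by auto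
   with p C(1) \<delta>M show ?thesis using mono by blast
  qed
  then show ?thesis by blast
 qed
 then obtain M where M: "\<And>j q. j \<in> J \<Longrightarrow> q \<in> K \<Longrightarrow> P j q (M j)" by metis
 show ?thesis
 proof (rule that[of "(\<Sum>j\<in>J. \<bar>M j\<bar>) + 1"])
  fix j q assume "j \<in> J" "q \<in> K"
  moreover from \<open>j \<in> J\<close> have "M j \<le> (\<Sum>j\<in>J. \<bar>M j\<bar>) + 1"
   using member_le_sum[of j J "\<lambda>j. \<bar>M j\<bar>"] \<open>finite J\<close> by auto
  ultimately show "P j q ((\<Sum>j\<in>J. \<bar>M j\<bar>) + 1)" using M mono by blast
 qed (simp add: add_nonneg_pos sum_nonneg)
qed

definition lip_at :: "(linf \<Rightarrow> linf) \<Rightarrow> linf \<Rightarrow> real \<Rightarrow> bool" where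
 "lip_at f q M \<longleftrightarrow> M > 0 \<and> (\<forall>y\<in>cball q (1 / M). norm (f y) \<le> M) \<and>
   (\<forall>y\<in>cball q (1 / M). \<forall>w. norm (fd f y w) \<le> M * norm w) \<and>
   (\<forall>y\<in>cball q (1 / M). \<forall>z\<in>cball q (1 / M). norm (f y - f z) \<le> M * norm (y - z))"

lemma lip_at_mono: "lip_at f q M \<Longrightarrow> M \<le> M' \<Longrightarrow> lip_at f q M'"
proof -
 assume *: "lip_at f q M" "M \<le> M'"
 then have "M > 0" by (simp add: lip_at_def)
 then have sub: "cball q (1 / M') \<subseteq> cball q (1 / M)"
  using * by (intro subset_cball) (auto simp: frac_le)
 have "norm (f y) \<le> M'" if "y \<in> cball q (1 / M')" for y
  using * sub that unfolding lip_at_def by (meson order_trans subsetD)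
 moreover have "norm (f y - f z) \<le> M' * norm (y - z)"
  if "y \<in> cball q (1 / M')" "z \<in> cball q (1 / M')" for y z
  using * sub that unfolding lip_at_def by (meson order_trans subsetD mult_right_mono norm_ge_zero)
 moreover have "norm (fd f y w) \<le> M' * norm w" if "y \<in> cball q (1 / M')" for y w
  using * sub that unfolding lip_at_def by (meson order_trans subsetD mult_right_mono norm_ge_zero)
 ultimately show ?thesis using * \<open>M > 0\<close> by (simp add: lip_at_def)
qed

lemma lip_at_local:
 assumes "good (Suc 0) S f" "open S" "p \<in> S"
 shows "\<exists>\<delta>>0. \<exists>M. \<forall>q\<in>ball p \<delta>. lip_at f q M"
proof -
 obtain \<delta> L where \<delta>: "\<delta> > 0" "L \<ge> 0" "ball p \<delta> \<subseteq> S"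
  and L': "\<And>y w. y \<in> ball p \<delta> \<Longrightarrow> norm (fd f y w) \<le> L * norm w"
  and L: "\<And>y z. y \<in> ball p \<delta> \<Longrightarrow> z \<in> ball p \<delta> \<Longrightarrow> norm (f y - f z) \<le> L * norm (y - z)"
  using good_lipschitz[OF assms] by metis
 define M where "M = 2 / \<delta> + L + (norm (f p) + L * \<delta>)"
 have "2 / \<delta> \<le> M" "L \<le> M" "norm (f p) + L * \<delta> \<le> M" "M > 0"
  using \<delta> by (auto simp: M_def add_pos_nonneg)
 have "lip_at f q M" if q: "q \<in> ball p (\<delta> / 2)" for q
 proof -
  have "1 / M \<le> \<delta> / 2" using \<open>2 / \<delta> \<le> M\<close> \<open>M > 0\<close> \<delta> by (simp add: field_simps)
  then have sub: "y \<in> ball p \<delta>" if "y \<in> cball q (1 / M)" for y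
   using q that dist_triangle[of p y q] by (auto simp: dist_commute)
  have "norm (f y) \<le> M" if "y \<in> cball q (1 / M)" for y
  proof -
   have "norm (f y) \<le> norm (f p) + norm (f y - f p)" by (metis add.commute diff_add_cancel norm_triangle_ineq)
   also have "norm (f y - f p) \<le> L * norm (y - p)" using sub[OF that] \<delta> by (intro L) auto
   also have "\<dots> \<le> L * \<delta>"
    using sub[OF that] \<delta> by (intro mult_left_mono) (auto simp: dist_norm norm_minus_commute)
   finally show ?thesis using \<open>norm (f p) + L * \<delta> \<le> M\<close> by simp
  qed
  moreover have "norm (f y - f z) \<le> M * norm (y - z)"
   if "y \<in> cball q (1 / M)" "z \<in> cball q (1 / M)" for y z
   using L[OF sub[OF that(1)] sub[OF that(2)]] \<open>L \<le> M\<close> mult_right_mono[OF \<open>L \<le> M\<close> norm_ge_zero[of "y - z"]]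
   by linarith
  moreover have "norm (fd f y w) \<le> M * norm w" if "y \<in> cball q (1 / M)" for y w
   using L'[OF sub[OF that], of w] mult_right_mono[OF \<open>L \<le> M\<close> norm_ge_zero[of w]] by linarith
  ultimately show ?thesis using \<open>M > 0\<close> by (simp add: lip_at_def)
 qed
 then show ?thesis using \<delta>(1) by (meson half_gt_zero)
qed

definition tube :: "'i set \<Rightarrow> ('i \<Rightarrow> linf \<Rightarrow> linf) \<Rightarrow> linf set \<Rightarrow> linf \<Rightarrow> real \<Rightarrow> bool" where
 "tube J f S q M \<longleftrightarrow> M > 0 \<and> cball q (1 / M) \<subseteq> S \<and> (\<forall>j\<in>J. lip_at (f j) q M)"

lemma tube_mono: "tube J f S q M \<Longrightarrow> M \<le> M' \<Longrightarrow> tube J f S q M'"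
 using subset_cball[of "1 / M'" "1 / M" q]
 by (auto simp: tube_def frac_le dest: lip_at_mono)

lemma tube_exists:
 assumes "compact K" "K \<subseteq> S" "open S" "finite J" "\<And>j. j \<in> J \<Longrightarrow> good (Suc 0) S (f j)"
 obtains M where "\<And>q. q \<in> K \<Longrightarrow> tube J f S q M" "M > 0"
proof -
 have loc: "\<exists>\<delta>>0. \<exists>M. \<forall>q\<in>ball p \<delta>. lip_at (f j) q M" if "j \<in> J" "p \<in> K" for j p
  using lip_at_local[OF assms(5)[OF that(1)] assms(3)] assms(2) that(2) by blast
 obtain M1 where M1: "M1 > 0" "\<And>j q. j \<in> J \<Longrightarrow> q \<in> K \<Longrightarrow> lip_at (f j) q M1"
  by (rule compact_family_uniform[where P = "\<lambda>j. lip_at (f j)", OF assms(1,4)])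
   (blast intro: loc lip_at_mono)+
 obtain e where e: "e > 0" "(\<Union>x\<in>K. cball x e) \<subseteq> S"
  using compact_subset_open_imp_cball_epsilon_subset[OF assms(1,3,2)] by blast
 define M where "M = max M1 (1 / e)"
 have "M > 0" "1 / M \<le> e" using M1(1) e(1) by (auto simp: M_def field_simps max_def)
 have "tube J f S q M" if "q \<in> K" for q
  unfolding tube_def
 proof (intro conjI ballI \<open>M > 0\<close>)
  have "cball q (1 / M) \<subseteq> cball q e" using \<open>1 / M \<le> e\<close> by (rule subset_cball)
  then show "cball q (1 / M) \<subseteq> S" using e(2) that by blast
  show "lip_at (f j) q M" if "j \<in> J" for j
   using lip_at_mono[OF M1(2)[OF that \<open>q \<in> K\<close>]] by (simp add: M_def)
 qed
 then show ?thesis using that \<open>M > 0\<close> by blast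
qed

lemma norm_rhs_diff_le:
 assumes "\<And>j. j \<in> J \<Longrightarrow> \<bar>v j t\<bar> \<le> V" "\<And>j. j \<in> J \<Longrightarrow> norm (f j y - f j z) \<le> D" "V \<ge> 0"
 shows "norm (rhs J v f t y - rhs J v f t z) \<le> real (card J) * V * D"
proof -
 have "norm (rhs J v f t y - rhs J v f t z) = norm (\<Sum>j\<in>J. v j t *\<^sub>R (f j y - f j z))"
  by (simp add: rhs_def sum_subtractf scaleR_diff_right)
 also have "\<dots> \<le> (\<Sum>j\<in>J. V * D)"
 proof (rule sum_norm_le)
  fix j assume "j \<in> J"
  then show "norm (v j t *\<^sub>R (f j y - f j z)) \<le> V * D"
   using assms by (auto intro!: mult_mono)
 qed
 finally show ?thesis by simp
qed

lemma norm_rhs_le: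
 assumes "\<And>j. j \<in> J \<Longrightarrow> \<bar>v j t\<bar> \<le> V" "\<And>j. j \<in> J \<Longrightarrow> norm (f j y) \<le> D" "V \<ge> 0"
 shows "norm (rhs J v f t y) \<le> real (card J) * V * D"
 unfolding rhs_def
proof (rule order_trans[OF sum_norm_le[of _ _ "\<lambda>_. V * D"]])
 fix j assume "j \<in> J"
 then show "norm (v j t *\<^sub>R f j y) \<le> V * D" using assms by (auto intro!: mult_mono)
qed simp

lemma rhs_path_integrable:
 assumes "a \<le> b" "admissible J u a b" "\<And>j. j \<in> J \<Longrightarrow> continuous_on S (f j)"
  and "continuous_on {a..b} y" "y ` {a..b} \<subseteq> S"
 shows "(\<lambda>s. rhs J u f s (y s) :: linf) integrable_on {a..b}"
 unfolding rhs_def using assms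
 by (intro rhs_integrable continuous_on_compose2[OF assms(3)]) auto

text \<open>Gronwall's inequality for an approximate solution. The defect is measured after
  integration in time and not pointwise: for rapidly oscillating controls the velocities stay far
  apart while the integrated defect tends to zero.\<close>

lemma isol_deviation:
 assumes ab: "a \<le> b" and J: "finite J" and v: "admissible J v a b"
  and V: "\<And>j t. j \<in> J \<Longrightarrow> t \<in> {a..b} \<Longrightarrow> \<bar>v j t\<bar> \<le> V" "V \<ge> 0"
  and f: "\<And>j. j \<in> J \<Longrightarrow> continuous_on S (f j)"
  and x: "isol J v f S a b x" and tube: "\<And>t. t \<in> {a..b} \<Longrightarrow> tube J f S (x t) M"
  and y: "continuous_on {a..b} y" "\<And>t. t \<in> {a..b} \<Longrightarrow> norm (y t - x t) \<le> 1 / M"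
  and dev: "\<And>t. t \<in> {a..b} \<Longrightarrow> norm (y t - y a - integral {a..t} (\<lambda>s. rhs J v f s (y s))) \<le> \<delta>"
  and t: "t \<in> {a..b}"
 shows "norm (y t - x t) \<le> (norm (y a - x a) + \<delta>) * exp (real (card J) * V * M * (t - a))"
proof (rule gronwall[where b = b])
 have M: "M > 0" using tube[of a] ab by (auto simp: tube_def)
 show "continuous_on {a..b} (\<lambda>t. norm (y t - x t))"
  using x y(1) by (intro continuous_intros) (auto simp: isol_def)
 show "0 \<le> real (card J) * V * M" using V M by simp
 fix t assume t: "t \<in> {a..b}"
 have yc: "y s \<in> cball (x s) (1 / M)" "x s \<in> cball (x s) (1 / M)" if "s \<in> {a..b}" for s
  using y(2)[OF that] M by (auto simp: dist_norm norm_minus_commute)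
 have yS: "y ` {a..b} \<subseteq> S" using yc tube by (force simp: tube_def)
 have xs: "continuous_on {a..b} x" "x ` {a..b} \<subseteq> S" using x by (auto simp: isol_def)
 have sub: "continuous_on {a..t} y" "y ` {a..t} \<subseteq> S" "continuous_on {a..t} x" "x ` {a..t} \<subseteq> S"
  using y(1) yS xs t by (auto intro: continuous_on_subset)
 have vt: "admissible J v a t" using admissible_subinterval[OF v, of a t] t by simp
 have iy: "(\<lambda>s. rhs J v f s (y s)) integrable_on {a..t}"
  and ix: "(\<lambda>s. rhs J v f s (x s)) integrable_on {a..t}"
  using t rhs_path_integrable[OF _ vt f] sub by auto
 have nc: "(\<lambda>s. real (card J) * V * (M * norm (y s - x s))) integrable_on {a..t}"
  by (intro integrable_continuous_real continuous_intros sub)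
 have "norm (integral {a..t} (\<lambda>s. rhs J v f s (y s)) - integral {a..t} (\<lambda>s. rhs J v f s (x s)))
   \<le> integral {a..t} (\<lambda>s. real (card J) * V * (M * norm (y s - x s)))"
  unfolding integral_diff[OF iy ix, symmetric]
 proof (rule integral_norm_bound_integral[OF integrable_diff[OF iy ix] nc])
  fix s assume "s \<in> {a..t}"
  then have s: "s \<in> {a..b}" using t by auto
  show "norm (rhs J v f s (y s) - rhs J v f s (x s)) \<le> real (card J) * V * (M * norm (y s - x s))"
  proof (rule norm_rhs_diff_le)
   show "\<bar>v j s\<bar> \<le> V" if "j \<in> J" for j using V(1)[OF that s] .
   show "norm (f j (y s) - f j (x s)) \<le> M * norm (y s - x s)" if "j \<in> J" for j
    using tube[OF s] yc[OF s] that by (auto simp: tube_def lip_at_def)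
  qed fact
 qed
 also have "\<dots> = real (card J) * V * M * integral {a..t} (\<lambda>s. norm (y s - x s))"
  by (simp add: mult.assoc flip: integral_mult_right)
 finally have *: "norm (integral {a..t} (\<lambda>s. rhs J v f s (y s)) - integral {a..t} (\<lambda>s. rhs J v f s (x s)))
   \<le> real (card J) * V * M * integral {a..t} (\<lambda>s. norm (y s - x s))" .
 have "integral {a..t} (\<lambda>s. rhs J v f s (x s)) = x t - x a"
  using x t by (auto simp: isol_def intro: integral_unique)
 then have eq: "y t - x t = (y a - x a) + (y t - y a - integral {a..t} (\<lambda>s. rhs J v f s (y s))) +
   (integral {a..t} (\<lambda>s. rhs J v f s (y s)) - integral {a..t} (\<lambda>s. rhs J v f s (x s)))"
   (is "_ = ?A + ?B + ?C")
  by simp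
 have "norm (?A + ?B + ?C) \<le> norm ?A + norm ?B + norm ?C"
  using norm_triangle_ineq[of "?A + ?B" ?C] norm_triangle_ineq[of ?A ?B] by linarith
 then show "norm (y t - x t) \<le> norm (y a - x a) + \<delta> +
   real (card J) * V * M * integral {a..t} (\<lambda>t. norm (y t - x t))"
  using dev[OF t] * unfolding eq[symmetric] by linarith
qed fact

definition radial :: "real \<Rightarrow> 'e::real_normed_vector \<Rightarrow> 'e" where
 "radial r w = (if norm w \<le> r then w else (r / norm w) *\<^sub>R w)"

lemma norm_radial: "r > 0 \<Longrightarrow> norm (radial r w) \<le> r"
 by (auto simp: radial_def)

text \<open>The triangle inequality alone yields the constant 2. In a supremum norm the radial
  retraction need not be nonexpansive as it is in Hilbert space.\<close>

lemma radial_lipschitz: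
 assumes r: "r > 0"
 shows "norm (radial r v - radial r w) \<le> 2 * norm (v - w)"
proof -
 have *: "norm (radial r v - radial r w) \<le> 2 * norm (v - w)" if "norm w \<le> norm v" for v w :: 'a
 proof (cases "norm v \<le> r")
  case True
  then show ?thesis using that by (simp add: radial_def)
 next
  case v: False
  then have v0: "norm v > 0" using r by linarith
  have 1: "norm (v - (r / norm v) *\<^sub>R v) = norm v - r"
  proof -
   have "v - (r / norm v) *\<^sub>R v = (1 - r / norm v) *\<^sub>R v" by (simp add: scaleR_diff_left)
   moreover have "1 - r / norm v \<ge> 0" using v v0 by simp
   ultimately have "norm (v - (r / norm v) *\<^sub>R v) = (1 - r / norm v) * norm v"
    by (simp only: norm_scaleR abs_of_nonneg)
   then show ?thesis using v0 by (simp add: left_diff_distrib)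
  qed
  have 2: "norm v - norm w \<le> norm (v - w)" by (rule norm_triangle_ineq2)
  show ?thesis
  proof (cases "norm w \<le> r")
   case True
   have "(r / norm v) *\<^sub>R v - w = (v - w) - (v - (r / norm v) *\<^sub>R v)" by simp
   then have "norm ((r / norm v) *\<^sub>R v - w) \<le> norm (v - w) + (norm v - r)"
    using norm_triangle_ineq4[of "v - w" "v - (r / norm v) *\<^sub>R v"] 1 by simp
   moreover have "radial r v = (r / norm v) *\<^sub>R v" "radial r w = w"
    using True v by (auto simp: radial_def)
   ultimately show ?thesis using True 2 by simp
  next
   case False
   then have w0: "norm w > 0" using r by linarith
   have "(r / norm v) *\<^sub>R v - (r / norm w) *\<^sub>R w =
     (r / norm v) *\<^sub>R (v - w) - (r / norm w - r / norm v) *\<^sub>R w"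
    by (simp add: scaleR_diff_right scaleR_diff_left)
   moreover have "norm ((r / norm v) *\<^sub>R (v - w)) \<le> norm (v - w)"
   proof -
    have "r / norm v * norm (v - w) \<le> 1 * norm (v - w)"
     using v v0 by (intro mult_right_mono) auto
    then show ?thesis using r by simp
   qed
   moreover have "norm ((r / norm w - r / norm v) *\<^sub>R w) \<le> norm (v - w)"
   proof -
    have "r / norm w - r / norm v \<ge> 0" using that v0 w0 r by (simp add: frac_le)
    then have "norm ((r / norm w - r / norm v) *\<^sub>R w) = r * (norm v - norm w) / norm v"
     using v0 w0 by (simp add: field_simps)
    also have "\<dots> = (r / norm v) * (norm v - norm w)" by simp
    also have "\<dots> \<le> 1 * (norm v - norm w)"
     using v v0 that by (intro mult_right_mono) auto
    finally show ?thesis using 2 by simp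
   qed
   ultimately show ?thesis
    using v False norm_triangle_ineq4[of "(r / norm v) *\<^sub>R (v - w)" "(r / norm w - r / norm v) *\<^sub>R w"]
    by (simp add: radial_def)
  qed
 qed
 show ?thesis
  using *[of w v] *[of v w] by (cases "norm w \<le> norm v") (auto simp: norm_minus_commute)
qed

text \<open>The vector fields are cut off radially around the given solution, so that Picard's theorem
 produces a solution on the whole interval; the a priori estimate then shows that the solution
 never leaves the region where the cut-off is inactive.\<close>

lemma isol_stability:
 assumes ab: "a \<le> b" and J: "finite J" and v: "admissible J v a b" and u: "admissible J u a b"
  and V: "\<And>j t. j \<in> J \<Longrightarrow> t \<in> {a..b} \<Longrightarrow> \<bar>v j t\<bar> \<le> V" "V \<ge> 0"
  and f: "\<And>j. j \<in> J \<Longrightarrow> continuous_on S (f j)"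
  and x: "isol J v f S a b x" and tube: "\<And>t. t \<in> {a..b} \<Longrightarrow> tube J f S (x t) M"
  and dev: "\<And>t1 y t. t1 \<in> {a..b} \<Longrightarrow> isol J u f S a t1 y \<Longrightarrow> y a = y0 \<Longrightarrow>
   (\<And>t. t \<in> {a..t1} \<Longrightarrow> norm (y t - x t) \<le> 1 / M) \<Longrightarrow> t \<in> {a..t1} \<Longrightarrow>
   norm (y t - y0 - integral {a..t} (\<lambda>s. rhs J v f s (y s))) \<le> \<delta>"
  and small: "(norm (y0 - x a) + \<delta>) * exp (real (card J) * V * M * (b - a)) < 1 / M" and \<delta>: "\<delta> \<ge> 0"
 obtains y where "isol J u f S a b y" "y a = y0"
  "\<And>t. t \<in> {a..b} \<Longrightarrow> norm (y t - x t) \<le> (norm (y0 - x a) + \<delta>) * exp (real (card J) * V * M * (b - a))"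
  "\<And>t. t \<in> {a..b} \<Longrightarrow> norm (y t - x t) \<le> 1 / M"
proof -
 have M: "M > 0" using tube[of a] ab by (auto simp: tube_def)
 obtain U where U: "U > 0" "\<And>j t. j \<in> J \<Longrightarrow> t \<in> {a..b} \<Longrightarrow> \<bar>u j t\<bar> \<le> U"
  using admissible_bound[OF u J] by metis
 define c where "c s z = x s + radial (1 / M) (z - x s)" for s and z :: linf
 have c: "c s z \<in> cball (x s) (1 / M)" "s \<in> {a..b} \<Longrightarrow> c s z \<in> S" for s z
 proof -
  show 1: "c s z \<in> cball (x s) (1 / M)" using norm_radial[of "1 / M" "z - x s"] M
   by (simp add: c_def dist_norm)
  then show "c s z \<in> S" if "s \<in> {a..b}" using tube[OF that] by (auto simp: tube_def)
 qed
 have cc: "c s z = z" if "norm (z - x s) \<le> 1 / M" for s z using that by (simp add: c_def radial_def)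
 define H where "H s z = rhs J u f s (c s z)" for s z
 have contr: "continuous_on UNIV (radial (1 / M) :: linf \<Rightarrow> linf)"
 proof (rule continuous_onI)
  fix p :: linf and e :: real assume "e > 0"
  show "\<exists>d>0. \<forall>q\<in>UNIV. dist q p < d \<longrightarrow> dist (radial (1 / M) q) (radial (1 / M) p) \<le> e"
  proof (intro exI[of _ "e / 2"] conjI ballI impI)
   fix q assume "dist q p < e / 2"
   then show "dist (radial (1 / M) q) (radial (1 / M) p) \<le> e"
    using radial_lipschitz[of "1 / M" q p] M by (simp add: dist_norm)
  qed (use \<open>e > 0\<close> in simp)
 qed
 have xc: "continuous_on {a..b} x" using x by (simp add: isol_def)
 \<comment> \<open>The factor 2 in the Lipschitz constant is that of the radial retraction.\<close>
 obtain y where y: "continuous_on {a..b} y"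
  "\<And>t. t \<in> {a..b} \<Longrightarrow> ((\<lambda>s. H s (y s)) has_integral (y t - y0)) {a..t}"
 proof (rule picard[OF ab, of "real (card J) * U * (M * 2)" H y0])
  show "0 \<le> real (card J) * U * (M * 2)" using U M by simp
  show "(\<lambda>s. H s (y s)) integrable_on {a..b}" if "continuous_on {a..b} y" for y
   unfolding H_def
  proof (rule rhs_path_integrable[OF ab u f])
   show "continuous_on {a..b} (\<lambda>s. c s (y s))"
    unfolding c_def
    by (intro continuous_intros xc continuous_on_compose2[OF contr]) (auto intro!: continuous_intros that xc)
   show "(\<lambda>s. c s (y s)) ` {a..b} \<subseteq> S" using c(2) by auto
  qed
  fix s y z assume s: "s \<in> {a..b}"
  have "norm (H s y - H s z) \<le> real (card J) * U * (M * (2 * norm (y - z)))"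
   unfolding H_def
  proof (rule norm_rhs_diff_le)
   show "\<bar>u j s\<bar> \<le> U" if "j \<in> J" for j using U(2)[OF that s] .
   show "norm (f j (c s y) - f j (c s z)) \<le> M * (2 * norm (y - z))" if "j \<in> J" for j
   proof -
    have "norm (f j (c s y) - f j (c s z)) \<le> M * norm (c s y - c s z)"
     using tube[OF s] that c(1) by (auto simp: tube_def lip_at_def)
    also have "norm (c s y - c s z) \<le> 2 * norm (y - z)"
     using radial_lipschitz[of "1 / M" "y - x s" "z - x s"] M by (simp add: c_def)
    finally show ?thesis using M by simp
   qed
  qed (use U in simp)
  then show "norm (H s y - H s z) \<le> real (card J) * U * (M * 2) * norm (y - z)" by (simp add: mult_ac)
 qed (rule that)
 have ya: "y a = y0"
  using has_integral_unique[OF y(2)[of a], of 0] ab has_integral_refl(2)[of "\<lambda>s. H s (y s)" a] by simp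
 define E where "E = (norm (y0 - x a) + \<delta>) * exp (real (card J) * V * M * (b - a))"
 have part: "isol J u f S a t1 y" if t1: "t1 \<in> {a..b}" "\<And>t. t \<in> {a..t1} \<Longrightarrow> norm (y t - x t) \<le> 1 / M" for t1
  unfolding isol_def
 proof (intro conjI ballI)
  show "continuous_on {a..t1} y" using y(1) t1(1) by (auto intro: continuous_on_subset)
  show "y ` {a..t1} \<subseteq> S" using c(2) cc[OF t1(2)] t1(1) by (metis atLeastAtMost_iff image_subsetI order_trans)
  fix t assume t: "t \<in> {a..t1}"
  then have "((\<lambda>s. H s (y s)) has_integral (y t - y a)) {a..t}" using y(2)[of t] t1 ya by simp
  then show "((\<lambda>s. rhs J u f s (y s)) has_integral (y t - y a)) {a..t}"
   by (rule has_integral_eq[rotated]) (use t t1(2) cc in \<open>auto simp: H_def\<close>)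
 qed
 have est: "norm (y t - x t) \<le> E"
  if t1: "t1 \<in> {a..b}" "\<And>t. t \<in> {a..t1} \<Longrightarrow> norm (y t - x t) \<le> 1 / M" and t: "t \<in> {a..t1}" for t1 t
 proof -
  have "norm (y t - x t) \<le> (norm (y a - x a) + \<delta>) * exp (real (card J) * V * M * (t - a))"
  proof (rule isol_deviation[where b = t1 and S = S])
   show "admissible J v a t1" using admissible_subinterval[OF v] t1(1) by simp
   show "isol J v f S a t1 x" using isol_subinterval[OF x, of a t1] t1(1) by simp
   show "continuous_on {a..t1} y" using y(1) t1(1) by (auto intro: continuous_on_subset)
   show "norm (y t - y a - integral {a..t} (\<lambda>s. rhs J v f s (y s))) \<le> \<delta>" if "t \<in> {a..t1}" for t
    using dev[OF t1(1) part[OF t1] ya t1(2) that] ya by simp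
  qed (use t1 t V J f tube in auto)
  also have "\<dots> \<le> E"
   unfolding E_def ya using t t1(1) V(2) M \<delta>
   by (intro mult_left_mono) (auto intro!: mult_left_mono add_nonneg_nonneg)
  finally show ?thesis .
 qed
 have E: "E < 1 / M" using small by (simp add: E_def)
 have le: "norm (y t - x t) < 1 / M" if "t \<in> {a..b}" for t
 proof (rule bootstrap[of a b "\<lambda>t. norm (y t - x t)", OF _ _ _ that])
  show "continuous_on {a..b} (\<lambda>t. norm (y t - x t))" by (intro continuous_intros y xc)
  have "1 \<le> exp (real (card J) * V * M * (b - a))" using V(2) M ab by simp
  then have "norm (y0 - x a) + \<delta> \<le> E"
   unfolding E_def using \<delta>
    mult_left_mono[of 1 "exp (real (card J) * V * M * (b - a))" "norm (y0 - x a) + \<delta>"] by simp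
  then show "norm (y a - x a) < 1 / M" unfolding ya using E \<delta> by linarith
  fix t1 assume "t1 \<in> {a..b}" "\<And>t. t \<in> {a..t1} \<Longrightarrow> norm (y t - x t) \<le> 1 / M"
  from est[OF this, of t1] this(1) E show "norm (y t1 - x t1) < 1 / M" by simp
 qed
 have "isol J u f S a b y" using part[of b] le ab by (simp add: less_imp_le)
 moreover have "norm (y t - x t) \<le> E" if "t \<in> {a..b}" for t
  using est[of b t] le ab that by (simp add: less_imp_le)
 ultimately show ?thesis using that[of y] ya le by (auto simp: E_def less_imp_le)
qed

definition ode :: "'i set \<Rightarrow> ('i \<Rightarrow> real \<Rightarrow> real) \<Rightarrow> ('i \<Rightarrow> linf \<Rightarrow> linf) \<Rightarrow> linf set \<Rightarrow> real \<Rightarrow> real \<Rightarrow> bool" where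
 "ode J u f S a b \<longleftrightarrow> a \<le> b \<and> finite J \<and> open S \<and> admissible J u a b \<and> (\<forall>j\<in>J. smooth S (f j))"

lemma odeD:
 assumes "ode J u f S a b"
 shows "a \<le> b" "finite J" "open S" "admissible J u a b" "\<And>j k. j \<in> J \<Longrightarrow> good k S (f j)"
  "\<And>j. j \<in> J \<Longrightarrow> continuous_on S (f j)" "\<And>j x. j \<in> J \<Longrightarrow> x \<in> S \<Longrightarrow> f j differentiable (at x)"
 using assms by (auto simp: ode_def intro: good_imp_continuous smooth_differentiable)

lemma ode_tlift: "ode J u f S a b \<Longrightarrow> ode J u (\<lambda>j. tlift (f j)) (base -` S) a b"
 by (auto simp: ode_def intro: open_base) (meson good.simps(2))

lemma isol_tube:
 assumes "ode J u f S a b" "isol J u f S a b x"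
 obtains M where "\<And>t. t \<in> {a..b} \<Longrightarrow> tube J f S (x t) M" "M > 0"
proof -
 have "compact (x ` {a..b})" "x ` {a..b} \<subseteq> S"
  using assms(2) by (auto simp: isol_def intro: compact_continuous_image)
 then obtain M where "\<And>q. q \<in> x ` {a..b} \<Longrightarrow> tube J f S q M" "M > 0"
  by (rule tube_exists[OF _ _ odeD(3,2)[OF assms(1)]]) (blast intro: odeD(5)[OF assms(1)])+
 then show ?thesis by (intro that[of M]) auto
qed

text \<open>Stability with unchanged controls: the defect vanishes and only the distance of the
  initial values is propagated.\<close>

lemma isol_near:
 assumes o: "ode J u f S a b" and x: "isol J u f S a b x"
 obtains \<delta> C where "\<delta> > 0" "C > 0" "\<And>y0. norm (y0 - x a) < \<delta> \<Longrightarrow>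
  \<exists>y. isol J u f S a b y \<and> y a = y0 \<and> (\<forall>t\<in>{a..b}. norm (y t - x t) \<le> C * norm (y0 - x a))"
proof -
 obtain M where M: "\<And>t. t \<in> {a..b} \<Longrightarrow> tube J f S (x t) M" "M > 0" by (rule isol_tube[OF o x]) blast
 obtain U where U: "U > 0" "\<And>j t. j \<in> J \<Longrightarrow> t \<in> {a..b} \<Longrightarrow> \<bar>u j t\<bar> \<le> U"
  using admissible_bound[OF odeD(4,2)[OF o]] by metis
 define C where "C = exp (real (card J) * U * M * (b - a))"
 have "\<exists>y. isol J u f S a b y \<and> y a = y0 \<and> (\<forall>t\<in>{a..b}. norm (y t - x t) \<le> C * norm (y0 - x a))"
  if y0: "norm (y0 - x a) < 1 / (M * C)" for y0
 proof (rule isol_stability[OF odeD(1,2,4)[OF o] odeD(4)[OF o] U(2) _ odeD(6)[OF o] x M(1)])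
  show "(norm (y0 - x a) + 0) * exp (real (card J) * U * M * (b - a)) < 1 / M"
   using y0 M(2) unfolding C_def[symmetric] by (simp add: field_simps C_def)
  fix t1 y t assume *: "t1 \<in> {a..b}" "isol J u f S a t1 y" "y a = y0" "t \<in> {a..t1}"
  then have "integral {a..t} (\<lambda>s. rhs J u f s (y s)) = y t - y a"
   by (auto simp: isol_def intro: integral_unique)
  then show "norm (y t - y0 - integral {a..t} (\<lambda>s. rhs J u f s (y s))) \<le> 0"
   using *(3) by simp
 next
  fix y assume "isol J u f S a b y" "y a = y0"
   "\<And>t. t \<in> {a..b} \<Longrightarrow> norm (y t - x t) \<le> (norm (y0 - x a) + 0) * exp (real (card J) * U * M * (b - a))"
  then show ?thesis by (auto simp: C_def mult.commute)
 qed (use U in auto)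
 moreover have "C > 0" "1 / (M * C) > 0" using M(2) by (auto simp: C_def)
 ultimately show ?thesis using that by blast
qed

text \<open>The Lipschitz bound is known only in a tube around x, so y must first be kept inside it.
  On each initial segment where y stays there, Gronwall's inequality gives distance zero, and the
  continuity argument extends this to the whole interval.\<close>

lemma isol_unique:
 assumes o: "ode J u f S a b" and x: "isol J u f S a b x" and y: "isol J u f S a b y"
  and "x a = y a" and t: "t \<in> {a..b}"
 shows "x t = y t"
proof -
 obtain M where M: "\<And>t. t \<in> {a..b} \<Longrightarrow> tube J f S (x t) M" "M > 0" by (rule isol_tube[OF o x]) blast
 obtain U where U: "U > 0" "\<And>j t. j \<in> J \<Longrightarrow> t \<in> {a..b} \<Longrightarrow> \<bar>u j t\<bar> \<le> U"
  using admissible_bound[OF odeD(4,2)[OF o]] by metis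
 have le0: "norm (y t - x t) \<le> 0" if t1: "t1 \<in> {a..b}"
  "\<And>t. t \<in> {a..t1} \<Longrightarrow> norm (y t - x t) \<le> 1 / M" and t: "t \<in> {a..t1}" for t1 t
 proof -
  have "norm (y t - x t) \<le> (norm (y a - x a) + 0) * exp (real (card J) * U * M * (t - a))"
  proof (rule isol_deviation[where b = t1 and S = S])
   show "admissible J u a t1" using admissible_subinterval[OF odeD(4)[OF o]] t1(1) by simp
   show "isol J u f S a t1 x" using isol_subinterval[OF x, of a t1] t1(1) by simp
   show "continuous_on {a..t1} y"
    using y t1(1) by (auto simp: isol_def intro: continuous_on_subset)
   show "norm (y t - y a - integral {a..t} (\<lambda>s. rhs J u f s (y s))) \<le> 0" if "t \<in> {a..t1}" for t
   proof -
    have "integral {a..t} (\<lambda>s. rhs J u f s (y s)) = y t - y a"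
     using y that t1(1) by (auto simp: isol_def intro: integral_unique)
    then show ?thesis by simp
   qed
  qed (use t1 t U M odeD[OF o] in auto)
  then show ?thesis using assms(4) by simp
 qed
 have lt: "norm (y s - x s) < 1 / M" if "s \<in> {a..b}" for s
 proof (rule bootstrap[of a b "\<lambda>t. norm (y t - x t)", OF _ _ _ that])
  show "continuous_on {a..b} (\<lambda>t. norm (y t - x t))"
   using x y by (intro continuous_intros) (auto simp: isol_def)
  show "norm (y a - x a) < 1 / M" using assms(4) M(2) by simp
  fix t1 assume "t1 \<in> {a..b}" "\<And>t. t \<in> {a..t1} \<Longrightarrow> norm (y t - x t) \<le> 1 / M"
  from le0[OF this, of t1] this(1) M(2) show "norm (y t1 - x t1) < 1 / M"
   by (simp add: less_eq_real_def)
 qed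
 have "norm (y t - x t) \<le> 0"
  by (rule le0[of b t]) (use lt t in \<open>auto simp: less_imp_le\<close>)
 then show ?thesis by simp
qed

section \<open>Flows, their domains and their continuity\<close>

definition flow_dom where
 "flow_dom J u f S a b = {x0. \<exists>x. isol J u f S a b x \<and> x a = x0}"

definition flow where
 "flow J u f S a b t x0 = (SOME x. isol J u f S a b x \<and> x a = x0) t"

lemma flow_isol:
 assumes "x0 \<in> flow_dom J u f S a b"
 shows "isol J u f S a b (\<lambda>t. flow J u f S a b t x0)" "flow J u f S a b a x0 = x0"
proof -
 have "\<exists>x. isol J u f S a b x \<and> x a = x0" using assms by (simp add: flow_dom_def)
 from someI_ex[OF this]
 show "isol J u f S a b (\<lambda>t. flow J u f S a b t x0)" "flow J u f S a b a x0 = x0"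
  by (auto simp: flow_def)
qed

lemma flow_eqI:
 assumes "ode J u f S a b" "isol J u f S a b x" "t \<in> {a..b}"
 shows "flow J u f S a b t (x a) = x t" "x a \<in> flow_dom J u f S a b"
proof -
 show d: "x a \<in> flow_dom J u f S a b" using assms(2) by (auto simp: flow_dom_def)
 show "flow J u f S a b t (x a) = x t"
  using isol_unique[OF assms(1) flow_isol(1)[OF d] assms(2) _ assms(3)] flow_isol(2)[OF d] by simp
qed

lemma flow_near:
 assumes o: "ode J u f S a b" and "x0 \<in> flow_dom J u f S a b"
 obtains \<delta> C where "\<delta> > 0" "C > 0" "ball x0 \<delta> \<subseteq> flow_dom J u f S a b"
  "\<And>y0 t. y0 \<in> ball x0 \<delta> \<Longrightarrow> t \<in> {a..b} \<Longrightarrow>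
   norm (flow J u f S a b t y0 - flow J u f S a b t x0) \<le> C * norm (y0 - x0)"
proof -
 note x = flow_isol[OF assms(2)]
 obtain \<delta> C where \<delta>: "\<delta> > 0" "C > 0" "\<And>y0. norm (y0 - x0) < \<delta> \<Longrightarrow>
  \<exists>y. isol J u f S a b y \<and> y a = y0 \<and> (\<forall>t\<in>{a..b}. norm (y t - flow J u f S a b t x0) \<le> C * norm (y0 - x0))"
  using isol_near[OF o x(1)] x(2) by metis
 have *: "y0 \<in> flow_dom J u f S a b \<and> (\<forall>t\<in>{a..b}.
   norm (flow J u f S a b t y0 - flow J u f S a b t x0) \<le> C * norm (y0 - x0))" if "y0 \<in> ball x0 \<delta>" for y0
 proof -
  have "norm (y0 - x0) < \<delta>" using that by (simp add: dist_norm norm_minus_commute)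
  from \<delta>(3)[OF this] obtain y where y: "isol J u f S a b y" "y a = y0"
   "\<forall>t\<in>{a..b}. norm (y t - flow J u f S a b t x0) \<le> C * norm (y0 - x0)" by blast
  have "flow J u f S a b t y0 = y t" if "t \<in> {a..b}" for t
   using flow_eqI(1)[OF o y(1) that] y(2) by simp
  moreover have "y0 \<in> flow_dom J u f S a b" using y by (auto simp: flow_dom_def)
  ultimately show ?thesis using y(3) by simp
 qed
 then show ?thesis using that[OF \<delta>(1,2)] by blast
qed

lemma open_flow_dom: "ode J u f S a b \<Longrightarrow> open (flow_dom J u f S a b)"
 unfolding open_contains_ball by (metis flow_near)

lemma continuous_flow:
 assumes o: "ode J u f S a b" and t: "t \<in> {a..b}"
 shows "continuous_on (flow_dom J u f S a b) (flow J u f S a b t)"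
 unfolding continuous_on_iff
proof (intro ballI allI impI)
 fix x0 and e :: real assume x0: "x0 \<in> flow_dom J u f S a b" and e: "e > 0"
 obtain \<delta> C where \<delta>: "\<delta> > 0" "C > 0" "\<And>y0 t. y0 \<in> ball x0 \<delta> \<Longrightarrow> t \<in> {a..b} \<Longrightarrow>
   norm (flow J u f S a b t y0 - flow J u f S a b t x0) \<le> C * norm (y0 - x0)"
  using flow_near[OF o x0] by metis
 have "dist (flow J u f S a b t y0) (flow J u f S a b t x0) < e"
  if "dist y0 x0 < min \<delta> (e / C)" for y0
  using \<delta>(3)[of y0 t] that t \<delta>(2) by (auto simp: dist_norm norm_minus_commute field_simps)
 then show "\<exists>d>0. \<forall>x'\<in>flow_dom J u f S a b. dist x' x0 < d \<longrightarrow>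
   dist (flow J u f S a b t x') (flow J u f S a b t x0) < e"
  using \<delta>(1,2) e by (intro exI[of _ "min \<delta> (e / C)"]) auto
qed

section \<open>The linearised equation and differentiability of flows\<close>

definition lin_sol where
 "lin_sol J u f a b x w \<longleftrightarrow> continuous_on {a..b} w \<and>
   (\<forall>t\<in>{a..b}. ((\<lambda>s. \<Sum>j\<in>J. u j s *\<^sub>R fd (f j) (x s) (w s)) has_integral (w t - w a)) {a..t})"

text \<open>The lifted system splits into the original equation for the base and its linearisation
  along the base for the fibre. Existence, uniqueness and estimates can thus be carried over between
  the linearised equation and the flow of the lifted system.\<close>

lemma isol_tlift_iff:
 "isol J u (\<lambda>j. tlift (f j)) (base -` S) a b X \<longleftrightarrow>
   isol J u f S a b (\<lambda>t. base (X t)) \<and> lin_sol J u f a b (\<lambda>t. base (X t)) (\<lambda>t. fibre (X t))"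
proof -
 have rhsT: "base (rhs J u (\<lambda>j. tlift (f j)) s Y) = rhs J u f s (base Y)"
  "fibre (rhs J u (\<lambda>j. tlift (f j)) s Y) = (\<Sum>j\<in>J. u j s *\<^sub>R fd (f j) (base Y) (fibre Y))" for s Y
  by (auto simp: rhs_def)
 have "((\<lambda>s. rhs J u (\<lambda>j. tlift (f j)) s (X s)) has_integral (X t - X a)) {a..t} \<longleftrightarrow>
   ((\<lambda>s. rhs J u f s (base (X s))) has_integral (base (X t) - base (X a))) {a..t} \<and>
   ((\<lambda>s. \<Sum>j\<in>J. u j s *\<^sub>R fd (f j) (base (X s)) (fibre (X s))) has_integral
    (fibre (X t) - fibre (X a))) {a..t}" (is "?L \<longleftrightarrow> ?R1 \<and> ?R2") for t
 proof
  assume ?L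
  from has_integral_linear[OF this bounded_linear_base] has_integral_linear[OF this bounded_linear_fibre]
  show "?R1 \<and> ?R2" by (simp add: o_def rhsT)
 next
  assume R: "?R1 \<and> ?R2"
  from has_integral_add[OF has_integral_linear[OF conjunct1[OF R] bounded_linear_hor]
    has_integral_linear[OF conjunct2[OF R] bounded_linear_ver]]
  have "((\<lambda>s. hor (base (rhs J u (\<lambda>j. tlift (f j)) s (X s))) + ver (fibre (rhs J u (\<lambda>j. tlift (f j)) s (X s))))
    has_integral (hor (base (X t - X a)) + ver (fibre (X t - X a)))) {a..t}"
   unfolding rhsT o_def linf_add(5,6) .
  then show ?L by (simp only: hor_base_ver_fibre)
 qed
 moreover have "continuous_on {a..b} X \<longleftrightarrow>
   continuous_on {a..b} (\<lambda>t. base (X t)) \<and> continuous_on {a..b} (\<lambda>t. fibre (X t))"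
 proof
  assume "continuous_on {a..b} X"
  then show "continuous_on {a..b} (\<lambda>t. base (X t)) \<and> continuous_on {a..b} (\<lambda>t. fibre (X t))"
   by (intro conjI bounded_linear.continuous_on[OF bounded_linear_base]
     bounded_linear.continuous_on[OF bounded_linear_fibre])
 next
  assume "continuous_on {a..b} (\<lambda>t. base (X t)) \<and> continuous_on {a..b} (\<lambda>t. fibre (X t))"
  then have "continuous_on {a..b} (\<lambda>t. hor (base (X t)) + ver (fibre (X t)))"
   by (intro continuous_on_add bounded_linear.continuous_on[OF bounded_linear_hor]
     bounded_linear.continuous_on[OF bounded_linear_ver]) auto
  then show "continuous_on {a..b} X" by (simp only: hor_base_ver_fibre)
 qed
 ultimately show ?thesis
  unfolding isol_def lin_sol_def by (auto simp: image_subset_iff)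
qed

lemma continuous_fd:
 assumes "good (Suc 0) S F" "continuous_on T x" "continuous_on T w" "x ` T \<subseteq> S"
 shows "continuous_on T (\<lambda>s. fd F (x s) (w s))"
proof -
 have c: "continuous_on T (\<lambda>s. hor (x s) + ver (w s))"
  using assms by (intro continuous_on_add bounded_linear.continuous_on[OF bounded_linear_hor]
    bounded_linear.continuous_on[OF bounded_linear_ver])
 have "continuous_on (base -` S) (tlift F)" using assms(1) by simp
 then have "continuous_on T (\<lambda>s. tlift F (hor (x s) + ver (w s)))"
  by (rule continuous_on_compose2[OF _ c]) (use assms(4) in auto)
 from bounded_linear.continuous_on[OF bounded_linear_fibre this] show ?thesis by simp
qed

definition quad_at :: "(linf \<Rightarrow> linf) \<Rightarrow> linf \<Rightarrow> real \<Rightarrow> bool" where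
 "quad_at f q M \<longleftrightarrow> M > 0 \<and> (\<forall>w. norm (fd f q w) \<le> M * norm w) \<and>
   (\<forall>z\<in>ball q (1 / M). norm (f z - f q - fd f q (z - q)) \<le> M * (norm (z - q))\<^sup>2 \<and>
    (\<forall>w. norm (fd f z w - fd f q w) \<le> M * norm (z - q) * norm w))"

lemma quad_at_mono: "quad_at f q M \<Longrightarrow> M \<le> M' \<Longrightarrow> quad_at f q M'"
proof -
 assume *: "quad_at f q M" "M \<le> M'"
 then have "M > 0" by (simp add: quad_at_def)
 then have "1 / M' \<le> 1 / M" using *(2) by (simp add: frac_le)
 then have sub: "z \<in> ball q (1 / M') \<Longrightarrow> z \<in> ball q (1 / M)" for z by auto
 have m: "c \<le> M * r \<Longrightarrow> r \<ge> 0 \<Longrightarrow> c \<le> M' * r" for c r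
  using *(2) mult_right_mono[of M M' r] by linarith
 have "norm (fd f q w) \<le> M' * norm w" for w
  using * by (intro m) (auto simp: quad_at_def)
 moreover have "norm (f z - f q - fd f q (z - q)) \<le> M' * (norm (z - q))\<^sup>2"
  "norm (fd f z w - fd f q w) \<le> M' * norm (z - q) * norm w" if "z \<in> ball q (1 / M')" for z w
 proof -
  have "norm (f z - f q - fd f q (z - q)) \<le> M * (norm (z - q))\<^sup>2"
   "norm (fd f z w - fd f q w) \<le> M * (norm (z - q) * norm w)"
   using *(1) sub[OF that] by (auto simp: quad_at_def mult.assoc)
  from m[OF this(1)] m[OF this(2)]
  show "norm (f z - f q - fd f q (z - q)) \<le> M' * (norm (z - q))\<^sup>2"
   "norm (fd f z w - fd f q w) \<le> M' * norm (z - q) * norm w"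
   by (simp_all add: mult.assoc)
 qed
 ultimately show ?thesis using * \<open>M > 0\<close> by (simp add: quad_at_def)
qed

lemma quad_at_local:
 assumes "good (Suc (Suc 0)) S f" "open S" "p \<in> S"
 shows "\<exists>\<delta>>0. \<exists>M. \<forall>q\<in>ball p \<delta>. quad_at f q M"
proof -
 obtain \<delta>1 L where L: "\<delta>1 > 0" "L \<ge> 0" "\<And>y w. y \<in> ball p \<delta>1 \<Longrightarrow> norm (fd f y w) \<le> L * norm w"
  using good_lipschitz[OF good_SucD[OF assms(1)] assms(2,3)] by metis
 obtain \<delta>2 M0 where M0: "\<delta>2 > 0" "M0 \<ge> 0"
  "\<And>y z. y \<in> ball p \<delta>2 \<Longrightarrow> z \<in> ball p \<delta>2 \<Longrightarrow> norm (f z - f y - fd f y (z - y)) \<le> M0 * (norm (z - y))\<^sup>2"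
  "\<And>y z w. y \<in> ball p \<delta>2 \<Longrightarrow> z \<in> ball p \<delta>2 \<Longrightarrow> norm (fd f z w - fd f y w) \<le> M0 * norm (z - y) * norm w"
  using good_quadratic[OF assms] by metis
 define M where "M = 2 / \<delta>2 + L + M0"
 have M: "M > 0" "L \<le> M" "M0 \<le> M" "2 / \<delta>2 \<le> M" using L M0 by (auto simp: M_def add_pos_nonneg)
 then have "1 / M \<le> \<delta>2 / 2" using M0(1) by (simp add: field_simps)
 have m: "c \<le> M0 * r \<Longrightarrow> r \<ge> 0 \<Longrightarrow> c \<le> M * r" "c \<le> L * r \<Longrightarrow> r \<ge> 0 \<Longrightarrow> c \<le> M * r" for c r
  using M mult_right_mono[of M0 M r] mult_right_mono[of L M r] by linarith+
 have "quad_at f q M" if q: "q \<in> ball p (min \<delta>1 (\<delta>2 / 2))" for q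
 proof -
  have z: "z \<in> ball p \<delta>2" if "z \<in> ball q (1 / M)" for z
   using that q \<open>1 / M \<le> \<delta>2 / 2\<close> dist_triangle[of p z q] by auto
  have q': "q \<in> ball p \<delta>1" "q \<in> ball p \<delta>2" using q M0(1) by auto
  have "norm (fd f q w) \<le> M * norm w" for w
   by (rule m(2)[OF L(3)[OF q'(1)]]) simp
  moreover have "norm (f y - f q - fd f q (y - q)) \<le> M * (norm (y - q))\<^sup>2"
   "norm (fd f y w - fd f q w) \<le> M * norm (y - q) * norm w" if "y \<in> ball q (1 / M)" for y w
   using m(1)[OF M0(3)[OF q'(2) z[OF that]]] m(1)[OF M0(4)[OF q'(2) z[OF that], unfolded mult.assoc]]
   by (auto simp: mult.assoc)
  ultimately show ?thesis using M by (simp add: quad_at_def)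
 qed
 moreover have "min \<delta>1 (\<delta>2 / 2) > 0" using L(1) M0(1) by simp
 ultimately show ?thesis by blast
qed

lemma isol_quad:
 assumes o: "ode J u f S a b" and x: "isol J u f S a b x"
 obtains M where "M > 0" "\<And>j t. j \<in> J \<Longrightarrow> t \<in> {a..b} \<Longrightarrow> quad_at (f j) (x t) M"
proof -
 have K: "compact (x ` {a..b})" "x ` {a..b} \<subseteq> S"
  using x by (auto simp: isol_def intro: compact_continuous_image)
 have loc: "\<exists>\<delta>>0. \<exists>M. \<forall>q\<in>ball p \<delta>. quad_at (f j) q M" if "j \<in> J" "p \<in> x ` {a..b}" for j p
  using quad_at_local[OF odeD(5)[OF o that(1)] odeD(3)[OF o]] K(2) that(2) by blast
 obtain M where "M > 0" "\<And>j q. j \<in> J \<Longrightarrow> q \<in> x ` {a..b} \<Longrightarrow> quad_at (f j) q M"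
  by (rule compact_family_uniform[where P = "\<lambda>j. quad_at (f j)", OF K(1) odeD(2)[OF o]])
   (blast intro: loc quad_at_mono)+
 then show ?thesis using that by (metis image_eqI)
qed

text \<open>The linearised equation has a globally Lipschitz right-hand side, so Picard's theorem
  applies on the whole interval without any cut-off.\<close>

lemma lin_sol_exists:
 assumes o: "ode J u f S a b" and x: "isol J u f S a b x"
 obtains w where "lin_sol J u f a b x w" "w a = w0"
proof -
 obtain M where M: "M > 0" "\<And>j t. j \<in> J \<Longrightarrow> t \<in> {a..b} \<Longrightarrow> quad_at (f j) (x t) M"
  by (rule isol_quad[OF o x]) blast
 obtain U where U: "U > 0" "\<And>j t. j \<in> J \<Longrightarrow> t \<in> {a..b} \<Longrightarrow> \<bar>u j t\<bar> \<le> U"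
  using admissible_bound[OF odeD(4,2)[OF o]] by metis
 have xs: "continuous_on {a..b} x" "x ` {a..b} \<subseteq> S" using x by (auto simp: isol_def)
 define H where "H s w = (\<Sum>j\<in>J. u j s *\<^sub>R fd (f j) (x s) w)" for s w
 obtain w where w: "continuous_on {a..b} w"
  "\<And>t. t \<in> {a..b} \<Longrightarrow> ((\<lambda>s. H s (w s)) has_integral (w t - w0)) {a..t}"
 proof (rule picard[OF odeD(1)[OF o], of "real (card J) * (U * M)" H w0])
  show "(\<lambda>s. H s (y s)) integrable_on {a..b}" if "continuous_on {a..b} y" for y
   unfolding H_def
   by (rule rhs_integrable[OF odeD(1,4)[OF o]]) (rule continuous_fd[OF odeD(5)[OF o] xs(1) that xs(2)])
  show "norm (H s y - H s z) \<le> real (card J) * (U * M) * norm (y - z)" if s: "s \<in> {a..b}" for s y z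
  proof -
   have "norm (H s y - H s z) = norm (\<Sum>j\<in>J. u j s *\<^sub>R fd (f j) (x s) (y - z))"
    unfolding H_def using s xs(2) odeD(7)[OF o]
    by (simp add: sum_subtractf[symmetric] scaleR_diff_right[symmetric] image_subset_iff
      linear_fd_simps(3) del: scaleR_diff_right)
   also have "\<dots> \<le> (\<Sum>j\<in>J. U * (M * norm (y - z)))"
   proof (rule sum_norm_le)
    fix j assume j: "j \<in> J"
    then show "norm (u j s *\<^sub>R fd (f j) (x s) (y - z)) \<le> U * (M * norm (y - z))"
     using U(2)[OF j s] U(1) M(2)[OF j s] by (auto simp: quad_at_def intro!: mult_mono)
   qed
   finally show ?thesis by (simp add: mult_ac)
  qed
 qed (use U(1) M(1) in auto)
 have "w a = w0"
  using has_integral_unique[OF w(2)[of a], of 0] odeD(1)[OF o] has_integral_refl(2)[of "\<lambda>s. H s (w s)" a]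
  by simp
 then show ?thesis using that[of w] w by (simp add: lin_sol_def H_def)
qed

text \<open>Solutions of the linearised equation exist as long as the underlying curve does, so
  lifting a system does not shrink the set of initial points. Otherwise the domains would depend on
  the order of differentiation.\<close>

lemma flow_dom_tlift:
 assumes o: "ode J u f S a b"
 shows "flow_dom J u (\<lambda>j. tlift (f j)) (base -` S) a b = base -` flow_dom J u f S a b"
proof (intro equalityI subsetI)
 fix X assume "X \<in> flow_dom J u (\<lambda>j. tlift (f j)) (base -` S) a b"
 then show "X \<in> base -` flow_dom J u f S a b"
  unfolding flow_dom_def by (auto simp: isol_tlift_iff)
next
 fix X assume "X \<in> base -` flow_dom J u f S a b"
 then obtain x where x: "isol J u f S a b x" "x a = base X" by (auto simp: flow_dom_def)
 obtain w where "lin_sol J u f a b x w" "w a = fibre X" by (rule lin_sol_exists[OF o x(1)])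
 then have "isol J u (\<lambda>j. tlift (f j)) (base -` S) a b (\<lambda>t. hor (x t) + ver (w t))"
  "hor (x a) + ver (w a) = X"
  using x by (simp_all add: isol_tlift_iff hor_base_ver_fibre)
 then show "X \<in> flow_dom J u (\<lambda>j. tlift (f j)) (base -` S) a b" by (auto simp: flow_dom_def)
qed

lemma lin_sol_add:
 assumes o: "ode J u f S a b" and x: "isol J u f S a b x"
  and w: "lin_sol J u f a b x w" and w': "lin_sol J u f a b x w'"
 shows "lin_sol J u f a b x (\<lambda>t. w t + r *\<^sub>R w' t)"
 unfolding lin_sol_def
proof (intro conjI ballI)
 show "continuous_on {a..b} (\<lambda>t. w t + r *\<^sub>R w' t)"
  using w w' by (intro continuous_intros) (auto simp: lin_sol_def)
 fix t assume t: "t \<in> {a..b}"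
 have "((\<lambda>s. (\<Sum>j\<in>J. u j s *\<^sub>R fd (f j) (x s) (w s)) + r *\<^sub>R (\<Sum>j\<in>J. u j s *\<^sub>R fd (f j) (x s) (w' s)))
   has_integral ((w t - w a) + r *\<^sub>R (w' t - w' a))) {a..t}"
  using w w' t by (intro has_integral_add has_integral_cmul) (auto simp: lin_sol_def)
 moreover have "(\<Sum>j\<in>J. u j s *\<^sub>R fd (f j) (x s) (w s)) + r *\<^sub>R (\<Sum>j\<in>J. u j s *\<^sub>R fd (f j) (x s) (w' s)) =
   (\<Sum>j\<in>J. u j s *\<^sub>R fd (f j) (x s) (w s + r *\<^sub>R w' s))" if "s \<in> {a..t}" for s
 proof -
  have "f j differentiable (at (x s))" if "j \<in> J" for j
   using x odeD(7)[OF o that] \<open>s \<in> {a..t}\<close> t by (auto simp: isol_def image_subset_iff)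
  then show ?thesis
   by (simp add: scaleR_sum_right sum.distrib[symmetric] linear_fd_simps algebra_simps cong: sum.cong)
 qed
 ultimately show "((\<lambda>s. \<Sum>j\<in>J. u j s *\<^sub>R fd (f j) (x s) (w s + r *\<^sub>R w' s)) has_integral
   (w t + r *\<^sub>R w' t - (w a + r *\<^sub>R w' a))) {a..t}"
  by (subst has_integral_cong[where g = "\<lambda>s. (\<Sum>j\<in>J. u j s *\<^sub>R fd (f j) (x s) (w s)) +
     r *\<^sub>R (\<Sum>j\<in>J. u j s *\<^sub>R fd (f j) (x s) (w' s))"]) (auto simp: algebra_simps)
qed

text \<open>The candidate derivative is the solution of the linearised equation as a function of its
  initial value. Differentiability follows from Gronwall's inequality for y - x - w, whose
  inhomogeneity is the quadratic Taylor error of the fields.\<close>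

lemma flow_has_derivative:
 assumes o: "ode J u f S a b" and x0: "x0 \<in> flow_dom J u f S a b" and t: "t \<in> {a..b}"
 shows "(flow J u f S a b t has_derivative
  (\<lambda>w. fibre (flow J u (\<lambda>j. tlift (f j)) (base -` S) a b t (hor x0 + ver w)))) (at x0)"
proof -
 let ?T = "flow J u (\<lambda>j. tlift (f j)) (base -` S) a b"
 define x where "x t = flow J u f S a b t x0" for t
 have x: "isol J u f S a b x" "x a = x0"
  using flow_isol[OF x0] by (auto simp: x_def[abs_def])
 have oT: "ode J u (\<lambda>j. tlift (f j)) (base -` S) a b" using ode_tlift[OF o] .
 define W where "W w s = fibre (?T s (hor x0 + ver w))" for w s
 have lift: "isol J u (\<lambda>j. tlift (f j)) (base -` S) a b (\<lambda>s. hor (x s) + ver (w s))"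
  if "lin_sol J u f a b x w" for w
  using that x(1) by (simp add: isol_tlift_iff)
 have W_eq: "W (w a) s = w s" if "lin_sol J u f a b x w" "s \<in> {a..b}" for w s
  using flow_eqI(1)[OF oT lift[OF that(1)] that(2)] x(2) by (simp add: W_def)
 have W: "lin_sol J u f a b x (W w)" "W w a = w" for w
 proof -
  obtain w' where w': "lin_sol J u f a b x w'" "w' a = w" by (rule lin_sol_exists[OF o x(1)])
  have "W w s = w' s" if "s \<in> {a..b}" for s using W_eq[OF w'(1) that] w'(2) by simp
  then have "isol J u (\<lambda>j. tlift (f j)) (base -` S) a b (\<lambda>s. hor (x s) + ver (W w s))"
   using lift[OF w'(1)]
   by (subst isol_cong[where y = "\<lambda>s. hor (x s) + ver (w' s)" and g = "\<lambda>j. tlift (f j)"]) auto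
  then show "lin_sol J u f a b x (W w)" by (simp add: isol_tlift_iff)
  show "W w a = w" using \<open>\<And>s. s \<in> {a..b} \<Longrightarrow> W w s = w' s\<close> w'(2) odeD(1)[OF o] by simp
 qed
 have add: "W (w + r *\<^sub>R w') s = W w s + r *\<^sub>R W w' s" if "s \<in> {a..b}" for w w' r s
  using W_eq[OF lin_sol_add[OF o x(1) W(1) W(1)] that] by (simp add: W(2))
 have W0: "W 0 s = 0" if "s \<in> {a..b}" for s using add[OF that, of 0 "-1" 0] by simp
 have lin: "linear (\<lambda>w. W w s)" if "s \<in> {a..b}" for s
  using add[OF that, of _ 1] add[OF that, of 0] W0[OF that]
  by (intro linearI) (metis scaleR_one, metis add.left_neutral)
 have X0: "hor x0 \<in> flow_dom J u (\<lambda>j. tlift (f j)) (base -` S) a b"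
  using x0 by (simp add: flow_dom_tlift[OF o])
 obtain \<delta>' C' where C': "\<delta>' > 0" "C' > 0" "\<And>Y s. Y \<in> ball (hor x0) \<delta>' \<Longrightarrow> s \<in> {a..b} \<Longrightarrow>
   norm (?T s Y - ?T s (hor x0)) \<le> C' * norm (Y - hor x0)"
  using flow_near[OF oT X0] by metis
 \<comment> \<open>The lifted flow is Lipschitz near (x0, 0), where its fibre vanishes; linearity
   extends the resulting bound from short vectors to all w.\<close>
 have Wb: "norm (W w s) \<le> C' * norm w" if s: "s \<in> {a..b}" for w s
 proof -
  have "norm (W w s) \<le> C' * (\<delta>' / 2)" if w: "norm w \<le> \<delta>' / 2" for w
  proof -
   have "hor x0 + ver w \<in> ball (hor x0) \<delta>'" using w C'(1) by (simp add: dist_norm)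
   from C'(3)[OF this s] have "norm (?T s (hor x0 + ver w) - ?T s (hor x0)) \<le> C' * norm w" by simp
   moreover have "norm (fibre (?T s (hor x0 + ver w) - ?T s (hor x0))) \<le>
     norm (?T s (hor x0 + ver w) - ?T s (hor x0))" by (rule norm_fibre_le)
   moreover have "fibre (?T s (hor x0 + ver w) - ?T s (hor x0)) = W w s"
    using W0[OF s] by (simp add: W_def)
   moreover have "C' * norm w \<le> C' * (\<delta>' / 2)" using w C'(2) by (intro mult_left_mono) auto
   ultimately show ?thesis by simp
  qed
  from norm_scaled_bound[where h = "\<lambda>w. W w s" and r = "\<delta>' / 2" and w = w, OF lin[OF s] _ this] C'(1)
  show ?thesis by simp
 qed
 obtain M where M: "M > 0" "\<And>j t. j \<in> J \<Longrightarrow> t \<in> {a..b} \<Longrightarrow> quad_at (f j) (x t) M"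
  by (rule isol_quad[OF o x(1)]) blast
 obtain U where U: "U > 0" "\<And>j t. j \<in> J \<Longrightarrow> t \<in> {a..b} \<Longrightarrow> \<bar>u j t\<bar> \<le> U"
  using admissible_bound[OF odeD(4,2)[OF o]] by metis
 obtain \<delta> C where C: "\<delta> > 0" "C > 0" "ball x0 \<delta> \<subseteq> flow_dom J u f S a b"
  "\<And>y0 t. y0 \<in> ball x0 \<delta> \<Longrightarrow> t \<in> {a..b} \<Longrightarrow> norm (flow J u f S a b t y0 - x t) \<le> C * norm (y0 - x0)"
  using flow_near[OF o x0] unfolding x_def by metis
 \<comment> \<open>\<open>N\<close> is the rate in Gronwall's inequality. \<open>K\<close> is the
   resulting quadratic constant: an inhomogeneity N (C h)^2 acting for the time b - a, amplified by
   the exponential growth.\<close>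
 define N where "N = real (card J) * U * M"
 define K where "K = N * C\<^sup>2 * (b - a) * exp (N * (b - a))"
 have N: "N \<ge> 0" "K \<ge> 0" using U M odeD(1)[OF o] by (auto simp: N_def K_def)
 have rem: "norm (flow J u f S a b t y0 - x t - W (y0 - x0) t) \<le> K * (norm (y0 - x0))\<^sup>2"
  if y0: "y0 \<in> ball x0 (min \<delta> (1 / (M * C)))" for y0
 proof -
  define y where "y t = flow J u f S a b t y0" for t
  define w where "w = W (y0 - x0)"
  define h where "h = norm (y0 - x0)"
  have dom: "y0 \<in> flow_dom J u f S a b" using y0 C(3) by auto
  have y: "isol J u f S a b y" "y a = y0" using flow_isol[OF dom] by (auto simp: y_def[abs_def])
  have w: "lin_sol J u f a b x w" "w a = y0 - x0" using W by (auto simp: w_def)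
  have yx: "norm (y s - x s) \<le> C * h" if "s \<in> {a..b}" for s
   using C(4)[of y0 s] y0 that by (simp add: y_def h_def)
  have Ch: "C * h < 1 / M"
   using y0 C(2) M(1) by (simp add: h_def dist_norm norm_minus_commute field_simps)
  have cont: "continuous_on {a..b} x" "continuous_on {a..b} y" "continuous_on {a..b} w"
   using x y w by (auto simp: isol_def lin_sol_def)
  define \<rho> where "\<rho> s = norm (y s - x s - w s)" for s
  have \<rho>c: "continuous_on {a..b} \<rho>" unfolding \<rho>_def by (intro continuous_intros cont)
  have "\<rho> t \<le> (N * (C * h)\<^sup>2 * (b - a)) * exp (N * (t - a))"
  proof (rule gronwall[OF \<rho>c N(1) _ t])
   fix s assume s: "s \<in> {a..b}"
   let ?I = "\<lambda>r. rhs J u f r (y r) - rhs J u f r (x r) - (\<Sum>j\<in>J. u j r *\<^sub>R fd (f j) (x r) (w r))"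
   have I: "(?I has_integral ((y s - y a) - (x s - x a) - (w s - w a))) {a..s}"
    using x y w s by (intro has_integral_diff) (auto simp: isol_def lin_sol_def)
   have I': "(y s - y a) - (x s - x a) - (w s - w a) = y s - x s - w s"
    using x(2) y(2) w(2) by simp
   have nc: "(\<lambda>r. N * (C * h)\<^sup>2 + N * \<rho> r) integrable_on {a..s}"
    using s by (intro integrable_continuous_real continuous_intros continuous_on_subset[OF \<rho>c]) auto
   have "norm (integral {a..s} ?I) \<le> integral {a..s} (\<lambda>r. N * (C * h)\<^sup>2 + N * \<rho> r)"
   proof (rule integral_norm_bound_integral[OF has_integral_integrable[OF I] nc])
    fix r assume "r \<in> {a..s}"
    then have r: "r \<in> {a..b}" using s by auto
    have "norm (f j (y r) - f j (x r) - fd (f j) (x r) (w r)) \<le> M * ((C * h)\<^sup>2 + \<rho> r)" if j: "j \<in> J" for j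
    proof -
     have xr: "f j differentiable (at (x r))"
      using x(1) odeD(7)[OF o j] r by (auto simp: isol_def image_subset_iff)
     have "y r \<in> ball (x r) (1 / M)" using yx[OF r] Ch by (simp add: dist_norm norm_minus_commute)
     then have "norm (f j (y r) - f j (x r) - fd (f j) (x r) (y r - x r)) \<le> M * (norm (y r - x r))\<^sup>2"
      using M(2)[OF j r] by (simp add: quad_at_def)
     also have "\<dots> \<le> M * (C * h)\<^sup>2" using M(1) yx[OF r] by (intro mult_left_mono power_mono) auto
     finally have 1: "norm (f j (y r) - f j (x r) - fd (f j) (x r) (y r - x r)) \<le> M * (C * h)\<^sup>2" .
     have 2: "norm (fd (f j) (x r) (y r - x r - w r)) \<le> M * \<rho> r"
      using M(2)[OF j r] by (simp add: quad_at_def \<rho>_def)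
     have eq: "f j (y r) - f j (x r) - fd (f j) (x r) (w r) =
       (f j (y r) - f j (x r) - fd (f j) (x r) (y r - x r)) + fd (f j) (x r) (y r - x r - w r)"
      by (simp add: linear_fd_simps[OF xr])
     show ?thesis
      unfolding eq distrib_left
      using 1 2 norm_triangle_ineq[of "f j (y r) - f j (x r) - fd (f j) (x r) (y r - x r)"
        "fd (f j) (x r) (y r - x r - w r)"] by linarith
    qed
    then have "norm (\<Sum>j\<in>J. u j r *\<^sub>R (f j (y r) - f j (x r) - fd (f j) (x r) (w r))) \<le>
      (\<Sum>j\<in>J. U * (M * ((C * h)\<^sup>2 + \<rho> r)))"
     using U(2)[OF _ r] U(1) M(1) by (intro sum_norm_le) (auto intro!: mult_mono simp: \<rho>_def)
    also have "\<dots> = N * (C * h)\<^sup>2 + N * \<rho> r" by (simp add: N_def algebra_simps)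
    also have "(\<Sum>j\<in>J. u j r *\<^sub>R (f j (y r) - f j (x r) - fd (f j) (x r) (w r))) = ?I r"
     by (simp add: rhs_def sum_subtractf scaleR_diff_right)
    finally show "norm (?I r) \<le> N * (C * h)\<^sup>2 + N * \<rho> r" .
   qed
   also have "integral {a..s} (\<lambda>r. N * (C * h)\<^sup>2 + N * \<rho> r) =
     N * (C * h)\<^sup>2 * (s - a) + N * integral {a..s} \<rho>"
    using s by (subst Henstock_Kurzweil_Integration.integral_add)
     (auto intro!: integrable_continuous_real continuous_intros continuous_on_subset[OF \<rho>c])
   also have "N * (C * h)\<^sup>2 * (s - a) \<le> N * (C * h)\<^sup>2 * (b - a)"
    using s N by (intro mult_left_mono) auto
   finally have "norm (integral {a..s} ?I) \<le> N * (C * h)\<^sup>2 * (b - a) + N * integral {a..s} \<rho>"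
    by simp
   moreover have "norm (integral {a..s} ?I) = \<rho> s"
    using integral_unique[OF I] I' by (simp add: \<rho>_def)
   ultimately show "\<rho> s \<le> N * (C * h)\<^sup>2 * (b - a) + N * integral {a..s} \<rho>" by simp
  qed
  also have "\<dots> \<le> (N * (C * h)\<^sup>2 * (b - a)) * exp (N * (b - a))"
   using t N by (intro mult_left_mono) (auto intro!: mult_left_mono)
  also have "\<dots> = K * h\<^sup>2" by (simp add: K_def power_mult_distrib)
  finally show ?thesis by (simp add: \<rho>_def y_def w_def h_def)
 qed
 show ?thesis
  unfolding has_derivative_at_alt
 proof (intro conjI allI impI)
  show "bounded_linear (\<lambda>w. fibre (?T t (hor x0 + ver w)))"
   using lin[OF t] Wb[OF t] unfolding W_def
   by (intro bounded_linear_intro[where K = C']) (auto simp: linear_add linear_scale mult.commute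
     linear_add[of "\<lambda>w. fibre (?T t (hor x0 + ver w))"]
     linear_scale[of "\<lambda>w. fibre (?T t (hor x0 + ver w))"] simp del: linf_add)
  fix e :: real assume e: "e > 0"
  define d where "d = min (min \<delta> (1 / (M * C))) (e / (K + 1))"
  have "d > 0" using C M e N by (auto simp: d_def)
  moreover have "norm (flow J u f S a b t y - flow J u f S a b t x0 - fibre (?T t (hor x0 + ver (y - x0))))
    \<le> e * norm (y - x0)" if "norm (y - x0) < d" for y
  proof -
   have "norm (flow J u f S a b t y - flow J u f S a b t x0 - fibre (?T t (hor x0 + ver (y - x0))))
     \<le> K * (norm (y - x0))\<^sup>2"
    using rem[of y] that by (simp add: d_def x_def W_def dist_norm norm_minus_commute)
   also have "\<dots> = (K * norm (y - x0)) * norm (y - x0)" by (simp add: power2_eq_square)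
   also have "\<dots> \<le> e * norm (y - x0)"
   proof (rule mult_right_mono)
    have "K * norm (y - x0) \<le> K * (e / (K + 1))" using that N by (intro mult_left_mono) (auto simp: d_def)
    also have "\<dots> \<le> e" using N e by (simp add: field_simps)
    finally show "K * norm (y - x0) \<le> e" .
   qed simp
   finally show ?thesis .
  qed
  ultimately show "\<exists>d>0. \<forall>y. norm (y - x0) < d \<longrightarrow> norm (flow J u f S a b t y - flow J u f S a b t x0 -
    fibre (?T t (hor x0 + ver (y - x0)))) \<le> e * norm (y - x0)" by blast
 qed
qed

text \<open>The tangent lift of a flow is the flow of the lifted vector fields; smoothness of the flow
 thereby reduces to continuity.\<close>

lemma tlift_flow:
 assumes o: "ode J u f S a b" and X: "base X \<in> flow_dom J u f S a b" and t: "t \<in> {a..b}"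
 shows "tlift (flow J u f S a b t) X = flow J u (\<lambda>j. tlift (f j)) (base -` S) a b t X"
proof (rule linf_eqI)
 have Xd: "X \<in> flow_dom J u (\<lambda>j. tlift (f j)) (base -` S) a b"
  using X by (simp add: flow_dom_tlift[OF o])
 note iX = flow_isol[OF Xd]
 have "isol J u f S a b (\<lambda>t. base (flow J u (\<lambda>j. tlift (f j)) (base -` S) a b t X))"
  using iX(1) by (simp add: isol_tlift_iff)
 from flow_eqI(1)[OF o this t] iX(2)
 show "base (tlift (flow J u f S a b t) X) = base (flow J u (\<lambda>j. tlift (f j)) (base -` S) a b t X)"
  by simp
 show "fibre (tlift (flow J u f S a b t) X) = fibre (flow J u (\<lambda>j. tlift (f j)) (base -` S) a b t X)"
  using fd_eqI[OF flow_has_derivative[OF o X t]] by (simp add: hor_base_ver_fibre)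
qed

lemma good_flow:
 assumes "ode J u f S a b" "t \<in> {a..b}"
 shows "good k (flow_dom J u f S a b) (flow J u f S a b t)"
 using assms(1)
proof (induction k arbitrary: f S)
 case 0
 then show ?case using continuous_flow[OF 0 assms(2)] by simp
next
 case (Suc k)
 have "good k (base -` flow_dom J u f S a b) (flow J u (\<lambda>j. tlift (f j)) (base -` S) a b t)"
  using Suc.IH[OF ode_tlift[OF Suc.prems]] by (simp add: flow_dom_tlift[OF Suc.prems])
 then have "good k (base -` flow_dom J u f S a b) (tlift (flow J u f S a b t))"
  by (subst good_cong[OF open_base[OF open_flow_dom[OF Suc.prems]]])
   (auto simp: tlift_flow[OF Suc.prems _ assms(2)])
 then show ?case
  using flow_has_derivative[OF Suc.prems _ assms(2)] by (auto simp: differentiable_def)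
qed

lemma funpow_tlift_flow:
 assumes "ode J u f S a b" "t \<in> {a..b}" "(base ^^ k) X \<in> flow_dom J u f S a b"
 shows "(tlift ^^ k) (flow J u f S a b t) X =
   flow J u (\<lambda>j. (tlift ^^ k) (f j)) ((base ^^ k) -` S) a b t X"
  "X \<in> flow_dom J u (\<lambda>j. (tlift ^^ k) (f j)) ((base ^^ k) -` S) a b"
  "ode J u (\<lambda>j. (tlift ^^ k) (f j)) ((base ^^ k) -` S) a b"
proof -
 have "ode J u (\<lambda>j. (tlift ^^ k) (f j)) ((base ^^ k) -` S) a b \<and>
  flow_dom J u (\<lambda>j. (tlift ^^ k) (f j)) ((base ^^ k) -` S) a b = (base ^^ k) -` flow_dom J u f S a b \<and>
  (\<forall>X. (base ^^ k) X \<in> flow_dom J u f S a b \<longrightarrow> (tlift ^^ k) (flow J u f S a b t) X =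
   flow J u (\<lambda>j. (tlift ^^ k) (f j)) ((base ^^ k) -` S) a b t X)"
 proof (induction k)
  case 0
  then show ?case using assms(1) by simp
 next
  case (Suc k)
  let ?f = "\<lambda>j. (tlift ^^ k) (f j)" and ?S = "(base ^^ k) -` S"
  have o: "ode J u ?f ?S a b" using Suc by simp
  have v: "(base ^^ Suc k) -` T = base -` ((base ^^ k) -` T)" for T
   by (auto simp: funpow_swap1)
  have "(tlift ^^ Suc k) (flow J u f S a b t) X =
    flow J u (\<lambda>j. (tlift ^^ Suc k) (f j)) (base -` ?S) a b t X"
   if "(base ^^ Suc k) X \<in> flow_dom J u f S a b" for X
  proof -
   have b: "base X \<in> flow_dom J u ?f ?S a b" using that Suc by (simp add: funpow_swap1)
   have eq: "(tlift ^^ k) (flow J u f S a b t) Y = flow J u ?f ?S a b t Y"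
    if "Y \<in> flow_dom J u ?f ?S a b" for Y using Suc that by simp
   have "tlift ((tlift ^^ k) (flow J u f S a b t)) X = tlift (flow J u ?f ?S a b t) X"
    unfolding tlift_def[of "(tlift ^^ k) (flow J u f S a b t)"] tlift_def[of "flow J u ?f ?S a b t"]
    using fd_cong[OF open_flow_dom[OF o] b eq] eq[OF b] by simp
   also have "\<dots> = flow J u (\<lambda>j. tlift (?f j)) (base -` ?S) a b t X"
    by (rule tlift_flow[OF o b assms(2)])
   finally show ?thesis by simp
  qed
  moreover have "flow_dom J u (\<lambda>j. (tlift ^^ Suc k) (f j)) (base -` ?S) a b =
    base -` flow_dom J u ?f ?S a b" using flow_dom_tlift[OF o] by simp
  ultimately show ?case using ode_tlift[OF o] Suc unfolding v by simp
 qed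
 then show "(tlift ^^ k) (flow J u f S a b t) X =
   flow J u (\<lambda>j. (tlift ^^ k) (f j)) ((base ^^ k) -` S) a b t X"
  "X \<in> flow_dom J u (\<lambda>j. (tlift ^^ k) (f j)) ((base ^^ k) -` S) a b"
  "ode J u (\<lambda>j. (tlift ^^ k) (f j)) ((base ^^ k) -` S) a b"
  using assms(3) by auto
qed

text \<open>With merely measurable controls y need not be differentiable at every time, so the chain
  rule is replaced by an estimate of increments: the difference between \<tau> along y and the
  integral of the related right-hand side changes by O((t - s)^2), hence has derivative zero
  everywhere and is constant.\<close>

lemma isol_image:
 assumes o: "ode J u f S a b" and y: "isol J u f S a b y"
  and \<tau>: "good (Suc (Suc 0)) S \<tau>" "\<tau> ` S \<subseteq> S'"
  and rel: "\<And>j x. j \<in> J \<Longrightarrow> x \<in> S \<Longrightarrow> fd \<tau> x (f j x) = g j (\<tau> x)"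
 shows "isol J u g S' a b (\<lambda>t. \<tau> (y t))"
proof -
 have ys: "continuous_on {a..b} y" "y ` {a..b} \<subseteq> S" using y by (auto simp: isol_def)
 have \<tau>d: "\<tau> differentiable (at x)" if "x \<in> S" for x using \<tau>(1) that by simp
 have \<tau>c: "continuous_on {a..b} (\<lambda>t. \<tau> (y t))"
  using continuous_on_compose2[OF good_imp_continuous[OF \<tau>(1)] ys] .
 obtain M where M: "\<And>t. t \<in> {a..b} \<Longrightarrow> tube J f S (y t) M" "M > 0" by (rule isol_tube[OF o y]) blast
 obtain U where U: "U > 0" "\<And>j t. j \<in> J \<Longrightarrow> t \<in> {a..b} \<Longrightarrow> \<bar>u j t\<bar> \<le> U"
  using admissible_bound[OF odeD(4,2)[OF o]] by metis
 have K: "compact (y ` {a..b})" using ys by (intro compact_continuous_image) auto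
 have loc: "\<exists>\<delta>>0. \<exists>M. \<forall>q\<in>ball p \<delta>. quad_at \<tau> q M" if "j \<in> {()}" "p \<in> y ` {a..b}" for j p
  using quad_at_local[OF \<tau>(1) odeD(3)[OF o]] ys(2) that(2) by blast
 obtain Q where Q: "Q > 0" "\<And>j q. j \<in> {()} \<Longrightarrow> q \<in> y ` {a..b} \<Longrightarrow> quad_at \<tau> q Q"
  by (rule compact_family_uniform[where P = "\<lambda>j. quad_at \<tau>" and J = "{()}", OF K])
   (simp, (blast intro: loc quad_at_mono)+)
 define N where "N = real (card J) * U * M"
 have N: "N \<ge> 0" using U M by (simp add: N_def)
 define h where "h s = rhs J u f s (y s)" for s
 define k where "k s = rhs J u g s (\<tau> (y s))" for s
 have k: "k s = fd \<tau> (y s) (h s)" if "s \<in> {a..b}" for s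
 proof -
  have "y s \<in> S" using ys(2) that by auto
  then show ?thesis
   by (simp add: k_def h_def rhs_def linear_fd_simps[OF \<tau>d] rel cong: sum.cong)
 qed
 have hN: "norm (h s) \<le> N" if s: "s \<in> {a..b}" for s
 proof -
  have "norm (f j (y s)) \<le> M" if "j \<in> J" for j
   using M(1)[OF s] that M(2) by (auto simp: tube_def lip_at_def)
  then show ?thesis
   unfolding h_def N_def using U(1) by (intro norm_rhs_le U(2)[OF _ s]) auto
 qed
 have kint: "k integrable_on {a..b}"
 proof -
  have "(\<lambda>s. \<Sum>j\<in>J. u j s *\<^sub>R fd \<tau> (y s) (f j (y s))) integrable_on {a..b}"
   by (rule rhs_integrable[OF odeD(1,4)[OF o]])
    (rule continuous_fd[OF good_SucD[OF \<tau>(1)] ys(1) continuous_on_compose2[OF odeD(6)[OF o] ys] ys(2)])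
  then show ?thesis
   by (rule integrable_eq) (use ys(2) in \<open>auto simp: k_def rhs_def rel image_subset_iff cong: sum.cong\<close>)
 qed
 have yint: "(h has_integral (y t - y s)) {s..t}" if "a \<le> s" "s \<le> t" "t \<le> b" for s t
  using isol_subinterval[OF y that] that by (simp add: isol_def h_def[abs_def])
 have lipy: "norm (y t - y s) \<le> N * (t - s)" if "a \<le> s" "s \<le> t" "t \<le> b" for s t
  using has_integral_bound[of N h "y t - y s" s t] N yint[OF that] hN that by simp
 define I where "I t = integral {a..t} k" for t
 have Iint: "(k has_integral (I t - I s)) {s..t}" if "a \<le> s" "s \<le> t" "t \<le> b" for s t
 proof -
  have 1: "k integrable_on {a..t}" "k integrable_on {s..t}"
   by (rule integrable_on_subinterval[OF kint]; use that in auto)+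
  have "I s + integral {s..t} k = I t"
   unfolding I_def using that 1 by (intro Henstock_Kurzweil_Integration.integral_combine) auto
  then show ?thesis using integrable_integral[OF 1(2)] by (metis add_diff_cancel_left')
 qed
 define D where "D t = \<tau> (y t) - I t" for t
 \<comment> \<open>The factor 2 adds up two quadratic errors: the Taylor remainder of \<tau> at
   \<open>y s\<close>, and the variation of the derivative of \<tau> along the curve under the
   integral.\<close>
 define E where "E = Q * N\<^sup>2 * 2"
 have DD: "norm (D t - D s) \<le> E * (t - s)\<^sup>2"
  if st: "a \<le> s" "s \<le> t" "t \<le> b" and small: "(t - s) * N < 1 / Q" for s t
 proof -
  have sab: "s \<in> {a..b}" using st by simp
  have q: "quad_at \<tau> (y s) Q" using Q(2) sab by blast
  have near: "y r \<in> ball (y s) (1 / Q)" "norm (y r - y s) \<le> N * (t - s)" if "r \<in> {s..t}" for r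
  proof -
   have "norm (y r - y s) \<le> N * (r - s)" using lipy[of s r] st that by simp
   also have "\<dots> \<le> N * (t - s)" using that N by (intro mult_left_mono) auto
   finally show "norm (y r - y s) \<le> N * (t - s)" .
   then show "y r \<in> ball (y s) (1 / Q)" using small by (simp add: dist_norm norm_minus_commute mult.commute)
  qed
  have "norm (\<tau> (y t) - \<tau> (y s) - fd \<tau> (y s) (y t - y s)) \<le> Q * (norm (y t - y s))\<^sup>2"
   using q near(1)[of t] st by (simp add: quad_at_def)
  also have "\<dots> \<le> Q * (N * (t - s))\<^sup>2"
   using Q(1) near(2)[of t] st by (intro mult_left_mono power_mono) auto
  finally have 1: "norm (\<tau> (y t) - \<tau> (y s) - fd \<tau> (y s) (y t - y s)) \<le> Q * (N * (t - s))\<^sup>2" .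
  have lin: "bounded_linear (fd \<tau> (y s))" using ys(2) sab by (intro linear_fd \<tau>d) auto
  have "((\<lambda>r. fd \<tau> (y s) (h r) - k r) has_integral (fd \<tau> (y s) (y t - y s) - (I t - I s))) {s..t}"
   using has_integral_linear[OF yint[OF st] lin] by (intro has_integral_diff Iint st) (simp add: o_def)
  moreover have "norm (fd \<tau> (y s) (h r) - k r) \<le> Q * (N * (t - s)) * N" if r: "r \<in> {s..t}" for r
  proof -
   have rab: "r \<in> {a..b}" using r st by auto
   have "norm (fd \<tau> (y r) (h r) - fd \<tau> (y s) (h r)) \<le> Q * norm (y r - y s) * norm (h r)"
    using q near(1)[OF r] by (simp add: quad_at_def)
   also have "\<dots> \<le> Q * (N * (t - s)) * N"
    using Q(1) near(2)[OF r] hN[OF rab] N st by (intro mult_mono) auto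
   finally show ?thesis using k[OF rab] by (simp add: norm_minus_commute)
  qed
  moreover have "0 \<le> Q * (N * (t - s)) * N" using Q N st by simp
  ultimately have "norm (fd \<tau> (y s) (y t - y s) - (I t - I s)) \<le> Q * (N * (t - s)) * N * (t - s)"
   using has_integral_bound[of "Q * (N * (t - s)) * N" "\<lambda>r. fd \<tau> (y s) (h r) - k r" _ s t] st by simp
  moreover have eq: "D t - D s = (\<tau> (y t) - \<tau> (y s) - fd \<tau> (y s) (y t - y s)) +
    (fd \<tau> (y s) (y t - y s) - (I t - I s))" by (simp add: D_def)
  ultimately have "norm (D t - D s) \<le> Q * (N * (t - s))\<^sup>2 + Q * (N * (t - s)) * N * (t - s)"
   unfolding eq
   using 1 norm_triangle_ineq[of "\<tau> (y t) - \<tau> (y s) - fd \<tau> (y s) (y t - y s)"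
     "fd \<tau> (y s) (y t - y s) - (I t - I s)"] by linarith
  then show ?thesis by (simp add: E_def power2_eq_square algebra_simps)
 qed
 have E: "E \<ge> 0" using Q by (simp add: E_def)
 have "(D has_derivative (\<lambda>h. 0)) (at s within {a..b})" if s: "s \<in> {a..b}" for s
  unfolding has_derivative_within_alt
 proof (intro conjI allI impI)
  fix e :: real assume e: "e > 0"
  define d where "d = min (1 / (Q * (N + 1))) (e / (E + 1))"
  have "d > 0" using Q N E e by (simp add: d_def)
  moreover have "norm (D t - D s - 0) \<le> e * norm (t - s)" if t: "t \<in> {a..b}" "norm (t - s) < d" for t
  proof -
   have "\<bar>t - s\<bar> * N \<le> \<bar>t - s\<bar> * (N + 1)" by (intro mult_left_mono) auto
   also have "\<dots> < 1 / Q"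
   proof -
    have "Q * (N + 1) > 0" using Q(1) N by simp
    then have "\<bar>t - s\<bar> * (Q * (N + 1)) < 1"
     using t(2) pos_less_divide_eq[of "Q * (N + 1)" "\<bar>t - s\<bar>" 1] by (simp add: d_def)
    then show ?thesis using Q(1) by (simp add: field_simps)
   qed
   finally have "\<bar>t - s\<bar> * N < 1 / Q" .
   then have "norm (D t - D s) \<le> E * (t - s)\<^sup>2"
    using DD[of s t] DD[of t s] s t by (cases "s \<le> t") (auto simp: norm_minus_commute power2_commute)
   also have "\<dots> = E * \<bar>t - s\<bar> * \<bar>t - s\<bar>" by (simp add: power2_eq_square)
   also have "\<dots> \<le> e * \<bar>t - s\<bar>"
   proof (rule mult_right_mono)
    have "E * \<bar>t - s\<bar> \<le> E * (e / (E + 1))" using t(2) E by (intro mult_left_mono) (auto simp: d_def)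
    also have "\<dots> \<le> e" using E e by (simp add: field_simps)
    finally show "E * \<bar>t - s\<bar> \<le> e" .
   qed simp
   finally show ?thesis by simp
  qed
  ultimately show "\<exists>d>0. \<forall>t\<in>{a..b}. norm (t - s) < d \<longrightarrow> norm (D t - D s - 0) \<le> e * norm (t - s)"
   by blast
 qed (rule bounded_linear_zero)
 then have Dc: "D t = D a" if "t \<in> {a..b}" for t
  using has_derivative_zero_unique[OF convex_closed_interval[of a b], of D t a] that odeD(1)[OF o] by auto
 show ?thesis
  unfolding isol_def
 proof (intro conjI ballI \<tau>c)
  show "(\<lambda>t. \<tau> (y t)) ` {a..b} \<subseteq> S'" using ys \<tau>(2) by auto
  fix t assume t: "t \<in> {a..b}"
  have "I t - I a = \<tau> (y t) - \<tau> (y a)" using Dc[OF t] by (simp add: D_def algebra_simps)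
  then show "((\<lambda>s. rhs J u g s (\<tau> (y s))) has_integral (\<tau> (y t) - \<tau> (y a))) {a..t}"
   using Iint[of a t] t by (simp add: k_def[abs_def])
 qed
qed

section \<open>Approximation of controls\<close>

text \<open>A class of controls closed under derivatives, sums, products and multiplication by sines
  and cosines. Eliminating a bracket differentiates its coefficient and multiplies it by oscillating
  factors, so the result can be fed into the next elimination; the polynomials in the class supply
  density.\<close>

inductive elementary :: "(real \<Rightarrow> real) \<Rightarrow> bool" where
 elementary_const: "elementary (\<lambda>t. c)"
| elementary_ident: "elementary (\<lambda>t. t)"
| elementary_sin: "elementary (\<lambda>t. sin (c * t))"
| elementary_cos: "elementary (\<lambda>t. cos (c * t))"
| elementary_add: "elementary u \<Longrightarrow> elementary v \<Longrightarrow> elementary (\<lambda>t. u t + v t)"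
| elementary_mult: "elementary u \<Longrightarrow> elementary v \<Longrightarrow> elementary (\<lambda>t. u t * v t)"

lemma elementary_derivative:
 "elementary u \<Longrightarrow> \<exists>u'. elementary u' \<and> (\<forall>t. (u has_real_derivative u' t) (at t))"
proof (induction rule: elementary.induct)
 case (elementary_const c)
 show ?case by (rule exI[of _ "\<lambda>t. 0"]) (auto intro: elementary.intros)
next
 case elementary_ident
 show ?case by (rule exI[of _ "\<lambda>t. 1"]) (auto intro: elementary.intros)
next
 case (elementary_sin c)
 show ?case
  by (intro exI[of _ "\<lambda>t. c * cos (c * t)"] conjI elementary.intros)
   (auto intro!: derivative_eq_intros)
next
 case (elementary_cos c)
 show ?case
  by (intro exI[of _ "\<lambda>t. (- c) * sin (c * t)"] conjI elementary.intros)
   (auto intro!: derivative_eq_intros)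
next
 case (elementary_add u v)
 then obtain u' v' where *: "elementary u'" "elementary v'"
  "\<And>t. (u has_real_derivative u' t) (at t)" "\<And>t. (v has_real_derivative v' t) (at t)" by blast
 then show ?case
  by (intro exI[of _ "\<lambda>t. u' t + v' t"] conjI elementary.elementary_add) (auto intro: DERIV_add)
next
 case (elementary_mult u v)
 then obtain u' v' where *: "elementary u'" "elementary v'"
  "\<And>t. (u has_real_derivative u' t) (at t)" "\<And>t. (v has_real_derivative v' t) (at t)" by blast
 have "((\<lambda>t. u t * v t) has_real_derivative (u' t * v t + v' t * u t)) (at t)" for t
  using DERIV_mult[OF *(3,4)] .
 then show ?case using * elementary_mult.hyps
  by (intro exI[of _ "\<lambda>t. u' t * v t + v' t * u t"])
   (auto intro!: elementary.elementary_add elementary.elementary_mult)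
qed

lemma elementary_continuous:
 assumes "elementary u"
 shows "continuous_on S u"
proof -
 obtain u' where "\<And>t. (u has_real_derivative u' t) (at t)"
  using elementary_derivative[OF assms] by blast
 then show ?thesis
  by (intro continuous_at_imp_continuous_on ballI) (rule DERIV_isCont)
qed

lemma elementary_polynomial:
 fixes g :: "real \<Rightarrow> real"
 shows "real_polynomial_function g \<Longrightarrow> elementary g"
proof (induction rule: real_polynomial_function.induct)
 case (linear f)
 then have "f t = f 1 * t" for t
  using linear_scale[OF bounded_linear.linear[OF linear], of t 1] by simp
 then have *: "f = (\<lambda>t. f 1 * t)" by (rule ext)
 show ?case by (subst *) (intro elementary.intros)
qed (rule elementary.intros; assumption)+


lemma admissible_continuous:
 assumes "\<And>j. j \<in> J \<Longrightarrow> continuous_on {a..b} (u j)"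
 shows "admissible J u a b"
 unfolding admissible_def using assms
 by (auto intro: integrable_continuous_real compact_imp_bounded compact_continuous_image)

text \<open>Measurability provides continuous functions converging almost everywhere. Truncated at
  the bound of \<open>f\<close>, they converge in the mean by dominated convergence, and a
  polynomial then replaces the continuous approximation uniformly.\<close>

lemma L1_approximation:
 fixes f :: "real \<Rightarrow> real"
 assumes f: "f integrable_on {a..b}" and M: "\<And>t. t \<in> {a..b} \<Longrightarrow> \<bar>f t\<bar> \<le> M" and e: "e > 0" and ab: "a \<le> b"
 obtains g where "elementary g" "(\<lambda>t. \<bar>g t - f t\<bar>) integrable_on {a..b}"
  "integral {a..b} (\<lambda>t. \<bar>g t - f t\<bar>) \<le> e"
proof -
 have "f measurable_on {a..b}"
  using integrable_imp_measurable[OF f] by (subst measurable_on_iff_borel_measurable) auto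
 then obtain N g where N: "negligible N" and g: "\<And>n. continuous_on UNIV (g n)"
  "\<And>x. x \<notin> N \<Longrightarrow> (\<lambda>n. g n x) \<longlonglongrightarrow> (if x \<in> {a..b} then f x else 0)"
  unfolding measurable_on_def by metis
 define h where "h n x = max (- M) (min M (g n x))" for n :: nat and x
 have hc: "continuous_on S (h n)" for n S
  unfolding h_def by (intro continuous_intros continuous_on_subset[OF g(1)]) auto
 have abs_int: "(\<lambda>t. \<bar>u t - f t\<bar>) integrable_on {a..b}" if u: "continuous_on {a..b} u" for u
 proof -
  have "bounded (u ` {a..b})" by (intro compact_imp_bounded compact_continuous_image u) auto
  then obtain C where C: "\<forall>t\<in>{a..b}. \<bar>u t\<bar> \<le> C" unfolding bounded_iff by auto
  have "\<bar>u t - f t\<bar> \<le> C + M" if "t \<in> {a..b}" for t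
   using M[OF that] C that abs_triangle_ineq4[of "u t" "f t"] by force
  then have "(\<lambda>t. u t - f t) absolutely_integrable_on {a..b}"
   by (intro absolutely_integrable_integrable_bound[where g = "\<lambda>t. C + M"] integrable_diff f
     integrable_continuous_real u) auto
  then show ?thesis by (simp add: absolutely_integrable_on_def)
 qed
 \<comment> \<open>Setting the difference to zero on the null set makes it converge at every point,
   as dominated convergence requires here.\<close>
 define d where "d n x = (if x \<in> N then 0 else \<bar>h n x - f x\<bar>)" for n x
 have "(\<lambda>n. integral {a..b} (d n)) \<longlonglongrightarrow> integral {a..b} (\<lambda>x. 0)"
 proof (rule dominated_convergence(2)[where h = "\<lambda>x. 2 * M"])
  show "d n integrable_on {a..b}" for n
   by (rule integrable_spike[OF abs_int[OF hc[of _ n]] N]) (auto simp: d_def)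
  show "norm (d n x) \<le> 2 * M" if "x \<in> {a..b}" for n x
   using M[OF that] by (auto simp: d_def h_def)
  show "(\<lambda>n. d n x) \<longlonglongrightarrow> 0" if x: "x \<in> {a..b}" for x
  proof (cases "x \<in> N")
   case False
   then have "(\<lambda>n. h n x) \<longlonglongrightarrow> max (- M) (min M (f x))"
    unfolding h_def using g(2)[of x] x by (intro tendsto_intros) auto
   moreover have "max (- M) (min M (f x)) = f x" using M[OF x] by auto
   ultimately have "(\<lambda>n. \<bar>h n x - f x\<bar>) \<longlonglongrightarrow> \<bar>f x - f x\<bar>" by (intro tendsto_intros) auto
   then show ?thesis using False by (simp add: d_def)
  qed (simp add: d_def)
 qed auto
 then obtain n where n: "\<bar>integral {a..b} (d n)\<bar> < e / 2"
  using e by (auto simp: lim_sequentially dist_real_def dest!: spec[of _ "e / 2"])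
 have "integral {a..b} (\<lambda>x. \<bar>h n x - f x\<bar>) = integral {a..b} (d n)"
  by (rule integral_spike[OF N]) (auto simp: d_def)
 with n have n': "integral {a..b} (\<lambda>x. \<bar>h n x - f x\<bar>) < e / 2" by simp
 \<comment> \<open>The summand 1 in the denominator keeps the tolerance positive when a = b.\<close>
 obtain p where p: "real_polynomial_function p"
  "\<And>x. x \<in> {a..b} \<Longrightarrow> \<bar>h n x - p x\<bar> < e / (2 * (b - a + 1))"
  using Stone_Weierstrass_real_polynomial_function[of "{a..b}" "h n" "e / (2 * (b - a + 1))"] e hc ab
  by auto
 have ep: "elementary p" using p(1) by (rule elementary_polynomial)
 have pi: "(\<lambda>t. \<bar>p t - f t\<bar>) integrable_on {a..b}" by (rule abs_int[OF elementary_continuous[OF ep]])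
 have hi: "(\<lambda>t. \<bar>h n t - f t\<bar> + e / (2 * (b - a + 1))) integrable_on {a..b}"
  by (intro integrable_add abs_int[OF hc]) auto
 have "integral {a..b} (\<lambda>t. \<bar>p t - f t\<bar>) \<le> integral {a..b} (\<lambda>t. \<bar>h n t - f t\<bar> + e / (2 * (b - a + 1)))"
  by (rule integral_le[OF pi hi]) (use p(2) in force)
 also have "\<dots> = integral {a..b} (\<lambda>t. \<bar>h n t - f t\<bar>) + e / (2 * (b - a + 1)) * (b - a)"
  using ab by (subst Henstock_Kurzweil_Integration.integral_add) (auto intro: abs_int[OF hc])
 also have "e / (2 * (b - a + 1)) * (b - a) \<le> e / 2"
  using ab e by (simp add: field_simps)
 finally show ?thesis using that[OF ep pi] n' by linarith
qed

text \<open>Only the bracket relations along the words are recorded, not the origin of the fields,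
  so the fields in any chart and all their tangent lifts are instances.\<close>

definition bracket_family :: "nat list set \<Rightarrow> (nat list \<Rightarrow> linf \<Rightarrow> linf) \<Rightarrow> linf set \<Rightarrow> bool" where
 "bracket_family J X S \<longleftrightarrow> (\<forall>j\<in>J. smooth S (X j)) \<and>
   (\<forall>i \<gamma>. \<gamma> \<noteq> [] \<longrightarrow> i # \<gamma> \<in> J \<longrightarrow> (\<forall>x\<in>S. X (i # \<gamma>) x = bracket (X [i]) (X \<gamma>) x))"

abbreviation shadowed :: "'i set \<Rightarrow> linf set \<Rightarrow> ('i \<Rightarrow> linf \<Rightarrow> linf) \<Rightarrow> real \<Rightarrow> real \<Rightarrow> (real \<Rightarrow> linf) \<Rightarrow> real \<Rightarrow>
  ('i \<Rightarrow> real \<Rightarrow> real) \<Rightarrow> linf \<Rightarrow> bool" where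
 "shadowed J S X a b x \<epsilon> w y0 \<equiv> \<exists>y. isol J w X S a b y \<and> y a = y0 \<and> (\<forall>t\<in>{a..b}. norm (y t - x t) < \<epsilon>)"

text \<open>Quantified over all systems, domains and time intervals, this is a property of the
  controls alone: one family serves all charts and all orders of differentiation simultaneously. The
  radius \<delta> is chosen before the control, so a fixed neighbourhood of the initial point is
  handled for eventually all w.\<close>

definition tracks ::
 "nat list set \<Rightarrow> real \<Rightarrow> (nat list \<Rightarrow> real \<Rightarrow> real) \<Rightarrow> (nat list \<Rightarrow> real \<Rightarrow> real) filter \<Rightarrow> bool" where
 "tracks J T v \<F> \<longleftrightarrow> (\<forall>\<^sub>F w in \<F>. admissible J w 0 T) \<and>
   (\<forall>S X a b x \<epsilon>. open S \<longrightarrow> bracket_family J X S \<longrightarrow> 0 \<le> a \<longrightarrow> a \<le> b \<longrightarrow> b \<le> T \<longrightarrow>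
    isol J v X S a b x \<longrightarrow> \<epsilon> > 0 \<longrightarrow>
    (\<exists>\<delta>>0. \<forall>\<^sub>F w in \<F>. \<forall>y0. norm (y0 - x a) < \<delta> \<longrightarrow>
     (shadowed J S X a b x \<epsilon> w y0)))"

lemma tracksD:
 assumes "tracks J T v \<F>" "open S" "bracket_family J X S" "0 \<le> a" "a \<le> b" "b \<le> T" "isol J v X S a b x" "\<epsilon> > 0"
 shows "\<exists>\<delta>>0. \<forall>\<^sub>F w in \<F>. \<forall>y0. norm (y0 - x a) < \<delta> \<longrightarrow>
  (shadowed J S X a b x \<epsilon> w y0)"
 using assms unfolding tracks_def by blast

lemma tracks_sup:
 assumes F: "tracks J T v \<F>" and G: "tracks J T v \<G>"
 shows "tracks J T v (sup \<F> \<G>)"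
 unfolding tracks_def
proof (intro conjI allI impI)
 fix S X a b x and \<epsilon> :: real
 assume *: "open S" "bracket_family J X S" "0 \<le> a" "a \<le> b" "b \<le> T" "isol J v X S a b x" "\<epsilon> > 0"
 let ?P = "\<lambda>\<delta> w. \<forall>y0. norm (y0 - x a) < \<delta> \<longrightarrow>
     (shadowed J S X a b x \<epsilon> w y0)"
 obtain \<delta>1 \<delta>2 where "\<delta>1 > 0" "\<forall>\<^sub>F w in \<F>. ?P \<delta>1 w" "\<delta>2 > 0" "\<forall>\<^sub>F w in \<G>. ?P \<delta>2 w"
  using tracksD[OF F *] tracksD[OF G *] by blast
 then have "\<forall>\<^sub>F w in \<F>. ?P (min \<delta>1 \<delta>2) w" "\<forall>\<^sub>F w in \<G>. ?P (min \<delta>1 \<delta>2) w"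
  by (auto elim!: eventually_mono)
 then show "\<exists>\<delta>>0. \<forall>\<^sub>F w in sup \<F> \<G>. ?P \<delta> w"
  using \<open>\<delta>1 > 0\<close> \<open>\<delta>2 > 0\<close> by (intro exI[of _ "min \<delta>1 \<delta>2"]) (simp add: eventually_sup)
qed (use F G in \<open>auto simp: tracks_def eventually_sup\<close>)

lemma bracket_family_ode:
 assumes "bracket_family J X S" "open S" "finite J" "admissible J w 0 T" "0 \<le> a" "a \<le> b" "b \<le> T"
 shows "ode J w X S a b"
 using assms admissible_subinterval[of J w 0 T a b] by (auto simp: ode_def bracket_family_def)

text \<open>The case of a constant family. Joined to another family by \<open>tracks_sup\<close>, it
  makes the given control one of those whose jets converge, so that both can be compared with a
  common limit.\<close>

lemma tracks_self:
 assumes "finite J" "admissible J v 0 T"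
 shows "tracks J T v (principal {v})"
 unfolding tracks_def eventually_principal
proof (intro conjI allI impI)
 fix S X a b x and \<epsilon> :: real
 assume *: "open S" "bracket_family J X S" "0 \<le> a" "a \<le> b" "b \<le> T" "isol J v X S a b x" "\<epsilon> > 0"
 have o: "ode J v X S a b" using bracket_family_ode[OF *(2,1) assms *(3-5)] .
 obtain \<delta> C where \<delta>: "\<delta> > 0" "C > 0" "\<And>y0. norm (y0 - x a) < \<delta> \<Longrightarrow>
  \<exists>y. isol J v X S a b y \<and> y a = y0 \<and> (\<forall>t\<in>{a..b}. norm (y t - x t) \<le> C * norm (y0 - x a))"
  by (rule isol_near[OF o *(6)]) blast
 have "shadowed J S X a b x \<epsilon> v y0"
  if "norm (y0 - x a) < min \<delta> (\<epsilon> / C)" for y0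
 proof -
  have "C * norm (y0 - x a) < \<epsilon>" using that \<delta>(2) by (simp add: field_simps)
  with \<delta>(3)[of y0] that show ?thesis by (meson le_less_trans min_less_iff_conj)
 qed
 moreover have "min \<delta> (\<epsilon> / C) > 0" using \<delta>(1,2) *(7) by simp
 ultimately show "\<exists>\<delta>>0. \<forall>w\<in>{v}. \<forall>y0. norm (y0 - x a) < \<delta> \<longrightarrow>
     (shadowed J S X a b x \<epsilon> w y0)" by blast
qed (use assms in simp)

abbreviation small_defect :: "'i set \<Rightarrow> ('i \<Rightarrow> real \<Rightarrow> real) \<Rightarrow> (nat \<Rightarrow> 'i \<Rightarrow> real \<Rightarrow> real) \<Rightarrow> linf set \<Rightarrow>
  ('i \<Rightarrow> linf \<Rightarrow> linf) \<Rightarrow> real \<Rightarrow> real \<Rightarrow> (real \<Rightarrow> linf) \<Rightarrow> bool" where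
 "small_defect J v u S X a b x \<equiv> \<exists>M>0. \<exists>\<delta>. \<delta> \<longlonglongrightarrow> 0 \<and> (\<forall>n t1 y t. t1 \<in> {a..b} \<longrightarrow> isol J (u n) X S a t1 y \<longrightarrow>
    (\<forall>s\<in>{a..t1}. norm (y s - x s) \<le> 1 / M) \<longrightarrow> t \<in> {a..t1} \<longrightarrow>
    norm (y t - y a - integral {a..t} (\<lambda>s. rhs J v X s (y s))) \<le> \<delta> n)"

text \<open>Reduces tracking to an estimate of the integrated defect, which may be proved under the
  assumption that the solution is near the given one; the a priori estimate in
  \<open>isol_stability\<close> discharges that assumption.\<close>

lemma tracksI:
 assumes J: "finite J" and v: "admissible J v 0 T" and u: "\<And>n. admissible J (u n) 0 T"
  and dev: "\<And>S X a b x. open S \<Longrightarrow> bracket_family J X S \<Longrightarrow> 0 \<le> a \<Longrightarrow> a \<le> b \<Longrightarrow> b \<le> T \<Longrightarrow>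
   isol J v X S a b x \<Longrightarrow> small_defect J v u S X a b x"
 shows "tracks J T v (filtermap u sequentially)"
 unfolding tracks_def eventually_filtermap
proof (intro conjI allI impI)
 fix S X a b x and \<epsilon> :: real
 assume *: "open S" "bracket_family J X S" "0 \<le> a" "a \<le> b" "b \<le> T" "isol J v X S a b x" "\<epsilon> > 0"
 have o: "ode J v X S a b" using bracket_family_ode[OF *(2,1) J v *(3-5)] .
 obtain M0 \<delta> where M0: "M0 > 0" "\<delta> \<longlonglongrightarrow> 0" "\<And>n t1 y t. t1 \<in> {a..b} \<Longrightarrow> isol J (u n) X S a t1 y \<Longrightarrow>
    (\<forall>s\<in>{a..t1}. norm (y s - x s) \<le> 1 / M0) \<Longrightarrow> t \<in> {a..t1} \<Longrightarrow>
    norm (y t - y a - integral {a..t} (\<lambda>s. rhs J v X s (y s))) \<le> \<delta> n"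
  using dev[OF *(1-6)] by blast
 obtain M1 where M1: "\<And>t. t \<in> {a..b} \<Longrightarrow> tube J X S (x t) M1" "M1 > 0"
  by (rule isol_tube[OF o *(6)]) blast
 obtain V where V: "V > 0" "\<And>j t. j \<in> J \<Longrightarrow> t \<in> {a..b} \<Longrightarrow> \<bar>v j t\<bar> \<le> V"
  using admissible_bound[OF odeD(4)[OF o] J] by metis
 define M where "M = max M0 M1"
 have M: "tube J X S (x t) M" if "t \<in> {a..b}" for t
  using tube_mono[OF M1(1)[OF that]] by (simp add: M_def)
 have "M > 0" "1 / M \<le> 1 / M0" using M0(1) M1(2) by (auto simp: M_def frac_le)
 define E where "E = exp (real (card J) * V * M * (b - a))"
 have "E > 0" by (simp add: E_def)
 \<comment> \<open>Half of the admissible error is reserved for the initial distance and half for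
   the defect, each after amplification by \<open>E\<close>.\<close>
 define r where "r = min (1 / M) \<epsilon> / (2 * E)"
 have "r > 0" using \<open>M > 0\<close> \<open>E > 0\<close> *(7) by (simp add: r_def)
 have rE: "2 * r * E = min (1 / M) \<epsilon>" using \<open>E > 0\<close> by (simp add: r_def)
 have "\<forall>\<^sub>F n in sequentially. \<bar>\<delta> n\<bar> < r"
  using M0(2) \<open>r > 0\<close> by (auto simp: tendsto_iff dist_real_def)
 then have "\<forall>\<^sub>F n in sequentially. \<forall>y0. norm (y0 - x a) < r \<longrightarrow>
     (shadowed J S X a b x \<epsilon> (u n) y0)"
 proof (rule eventually_mono, intro allI impI)
  fix n y0 assume n: "\<bar>\<delta> n\<bar> < r" and y0: "norm (y0 - x a) < r"
  have "(norm (y0 - x a) + \<bar>\<delta> n\<bar>) * E < 2 * r * E"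
   using n y0 \<open>E > 0\<close> by (intro mult_strict_right_mono) auto
  then have lt: "(norm (y0 - x a) + \<bar>\<delta> n\<bar>) * E < 1 / M" "(norm (y0 - x a) + \<bar>\<delta> n\<bar>) * E < \<epsilon>"
   using rE by auto
  have ou: "admissible J (u n) a b" using admissible_subinterval[OF u *(3,5)] .
  show "shadowed J S X a b x \<epsilon> (u n) y0"
  proof (rule isol_stability[OF *(4) J odeD(4)[OF o] ou V(2) _ odeD(6)[OF o] *(6) M])
   show "(norm (y0 - x a) + \<bar>\<delta> n\<bar>) * exp (real (card J) * V * M * (b - a)) < 1 / M"
    using lt(1) by (simp add: E_def)
   fix t1 y t
   assume h: "t1 \<in> {a..b}" "isol J (u n) X S a t1 y" "y a = y0"
    "\<And>t. t \<in> {a..t1} \<Longrightarrow> norm (y t - x t) \<le> 1 / M" "t \<in> {a..t1}"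
   have "\<forall>s\<in>{a..t1}. norm (y s - x s) \<le> 1 / M0" using h(4) \<open>1 / M \<le> 1 / M0\<close> by force
   from M0(3)[OF h(1,2) this h(5)] h(3)
   show "norm (y t - y0 - integral {a..t} (\<lambda>s. rhs J v X s (y s))) \<le> \<bar>\<delta> n\<bar>" by simp
  next
   fix y assume "isol J (u n) X S a b y" "y a = y0"
    "\<And>t. t \<in> {a..b} \<Longrightarrow> norm (y t - x t) \<le>
     (norm (y0 - x a) + \<bar>\<delta> n\<bar>) * exp (real (card J) * V * M * (b - a))"
   then show ?thesis
    using lt(2) unfolding E_def by (intro exI[of _ y] conjI ballI) (auto intro: le_less_trans)
  qed (use V in auto)
 qed
 then show "\<exists>\<delta>>0. \<forall>\<^sub>F n in sequentially. \<forall>y0. norm (y0 - x a) < \<delta> \<longrightarrow>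
     (shadowed J S X a b x \<epsilon> (u n) y0)"
  using \<open>r > 0\<close> by blast
qed (use u in simp)

text \<open>The defect is the integral of u - v times the fields, and these are bounded in a tube
  around the given solution, so convergence of the controls in the mean is enough.\<close>

lemma tracks_elementary:
 assumes J: "finite J" and v: "admissible J v 0 T" and T: "T \<ge> 0"
 obtains u where "tracks J T v (filtermap u sequentially)" "\<And>n j. elementary (u n j)"
  "\<And>n j t. v j = (\<lambda>t. 0) \<Longrightarrow> u n j t = 0"
proof -
 define P where "P n j g \<longleftrightarrow> elementary g \<and> (v j = (\<lambda>t. 0) \<longrightarrow> (\<forall>t. g t = 0)) \<and> (j \<in> J \<longrightarrow>
   (\<lambda>t. \<bar>g t - v j t\<bar>) integrable_on {0..T} \<and> integral {0..T} (\<lambda>t. \<bar>g t - v j t\<bar>) \<le> 1 / real (Suc n))"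
  for n :: nat and j g
 have "\<exists>g. P n j g" for n j
  unfolding P_def
 proof (cases "j \<in> J \<and> v j \<noteq> (\<lambda>t. 0)")
  case True
  then have "v j integrable_on {0..T}" "bounded (v j ` {0..T})" using v by (auto simp: admissible_def)
  then obtain M where "\<And>t. t \<in> {0..T} \<Longrightarrow> \<bar>v j t\<bar> \<le> M" by (force simp: bounded_iff)
  from L1_approximation[OF \<open>v j integrable_on {0..T}\<close> this _ T, of "1 / real (Suc n)"]
  obtain g where "elementary g" "(\<lambda>t. \<bar>g t - v j t\<bar>) integrable_on {0..T}"
   "integral {0..T} (\<lambda>t. \<bar>g t - v j t\<bar>) \<le> 1 / real (Suc n)" by auto
  with True show "\<exists>g. elementary g \<and> (v j = (\<lambda>t. 0) \<longrightarrow> (\<forall>t. g t = 0)) \<and> (j \<in> J \<longrightarrow>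
   (\<lambda>t. \<bar>g t - v j t\<bar>) integrable_on {0..T} \<and> integral {0..T} (\<lambda>t. \<bar>g t - v j t\<bar>) \<le> 1 / real (Suc n))"
   by blast
 next
  case False
  then show "\<exists>g. elementary g \<and> (v j = (\<lambda>t. 0) \<longrightarrow> (\<forall>t. g t = 0)) \<and> (j \<in> J \<longrightarrow>
   (\<lambda>t. \<bar>g t - v j t\<bar>) integrable_on {0..T} \<and> integral {0..T} (\<lambda>t. \<bar>g t - v j t\<bar>) \<le> 1 / real (Suc n))"
   by (intro exI[of _ "\<lambda>t. 0"]) (auto intro: elementary.intros)
 qed
 then obtain u where "P n j (u n j)" for n j by metis
 then have u: "\<And>n j. elementary (u n j)" "\<And>n j t. v j = (\<lambda>t. 0) \<Longrightarrow> u n j t = 0"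
  "\<And>n j. j \<in> J \<Longrightarrow> (\<lambda>t. \<bar>u n j t - v j t\<bar>) integrable_on {0..T}"
  "\<And>n j. j \<in> J \<Longrightarrow> integral {0..T} (\<lambda>t. \<bar>u n j t - v j t\<bar>) \<le> 1 / real (Suc n)"
  by (auto simp: P_def)
 have "tracks J T v (filtermap u sequentially)"
 proof (rule tracksI[OF J v])
  show ua: "admissible J (u n) 0 T" for n
   by (intro admissible_continuous elementary_continuous u)
  fix S X a b x
  assume *: "open S" "bracket_family J X S" "0 \<le> a" "a \<le> b" "b \<le> T" "isol J v X S a b x"
  have o: "ode J v X S a b" using bracket_family_ode[OF *(2,1) J v *(3-5)] .
  obtain M where M: "\<And>t. t \<in> {a..b} \<Longrightarrow> tube J X S (x t) M" "M > 0"
   by (rule isol_tube[OF o *(6)]) blast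
  define \<delta> where "\<delta> n = real (card J) * M / real (Suc n)" for n
  have "\<delta> \<longlonglongrightarrow> 0" unfolding \<delta>_def
   using tendsto_mult[OF tendsto_const LIMSEQ_inverse_real_of_nat, of "real (card J) * M"]
   by (simp add: divide_inverse)
  moreover have "norm (y t - y a - integral {a..t} (\<lambda>s. rhs J v X s (y s))) \<le> \<delta> n"
   if h: "t1 \<in> {a..b}" "isol J (u n) X S a t1 y" "\<forall>s\<in>{a..t1}. norm (y s - x s) \<le> 1 / M" "t \<in> {a..t1}"
   for n t1 y t
  proof -
   have yc: "continuous_on {a..t} y" "y ` {a..t} \<subseteq> S"
    using h(2,4) by (auto simp: isol_def intro: continuous_on_subset)
   have t: "a \<le> t" "t \<le> T" using h *(5) by auto
   have 1: "((\<lambda>s. rhs J (u n) X s (y s)) has_integral (y t - y a)) {a..t}"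
    using h by (simp add: isol_def)
   have 2: "(\<lambda>s. rhs J v X s (y s)) integrable_on {a..t}"
    using rhs_path_integrable[OF t(1) admissible_subinterval[OF v *(3) t(2)] odeD(6)[OF o] yc] .
   have sub: "(\<lambda>s. \<bar>u n j s - v j s\<bar>) integrable_on {a..t}" if "j \<in> J" for j
    by (rule integrable_on_subinterval[OF u(3)[OF that]]) (use *(3) t in auto)
   have "norm (y t - y a - integral {a..t} (\<lambda>s. rhs J v X s (y s))) =
     norm (integral {a..t} (\<lambda>s. rhs J (u n) X s (y s) - rhs J v X s (y s)))"
    using integral_diff[OF has_integral_integrable[OF 1] 2] integral_unique[OF 1] by simp
   also have "\<dots> \<le> integral {a..t} (\<lambda>s. \<Sum>j\<in>J. \<bar>u n j s - v j s\<bar> * M)"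
   proof (rule integral_norm_bound_integral)
    fix s assume s: "s \<in> {a..t}"
    have "y s \<in> cball (x s) (1 / M)" "s \<in> {a..b}"
     using h s by (auto simp: dist_norm norm_minus_commute)
    then have "norm (X j (y s)) \<le> M" if "j \<in> J" for j
     using M(1) that by (auto simp: tube_def lip_at_def)
    then have "norm (\<Sum>j\<in>J. (u n j s - v j s) *\<^sub>R X j (y s)) \<le> (\<Sum>j\<in>J. \<bar>u n j s - v j s\<bar> * M)"
     by (intro sum_norm_le) (auto intro!: mult_left_mono)
    then show "norm (rhs J (u n) X s (y s) - rhs J v X s (y s)) \<le> (\<Sum>j\<in>J. \<bar>u n j s - v j s\<bar> * M)"
     by (simp add: rhs_def sum_subtractf scaleR_diff_left)
   next
    show "(\<lambda>s. \<Sum>j\<in>J. \<bar>u n j s - v j s\<bar> * M) integrable_on {a..t}"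
     by (intro integrable_sum J integrable_on_mult_left sub)
   qed (intro integrable_diff has_integral_integrable[OF 1] 2)
   also have "\<dots> = (\<Sum>j\<in>J. integral {a..t} (\<lambda>s. \<bar>u n j s - v j s\<bar>) * M)"
    by (subst integral_sum) (auto intro!: J integrable_on_mult_left sub)
   also have "\<dots> \<le> (\<Sum>j\<in>J. 1 / real (Suc n) * M)"
   proof (intro sum_mono mult_right_mono)
    fix j assume j: "j \<in> J"
    have "integral {a..t} (\<lambda>s. \<bar>u n j s - v j s\<bar>) \<le> integral {0..T} (\<lambda>s. \<bar>u n j s - v j s\<bar>)"
     by (intro integral_subset_le sub u(3) j) (use *(3) t in auto)
    then show "integral {a..t} (\<lambda>s. \<bar>u n j s - v j s\<bar>) \<le> 1 / real (Suc n)" using u(4)[OF j, of n] by simp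
   qed (use M in simp)
   also have "\<dots> = \<delta> n" by (simp add: \<delta>_def)
   finally show ?thesis .
  qed
  ultimately show "small_defect J v u S X a b x"
   using M(2) by blast
 qed
 then show ?thesis using that u(1,2) by blast
qed

section \<open>Elimination of a bracket by fast oscillations\<close>

lemma norm_add_mono: "norm a \<le> r \<Longrightarrow> norm b \<le> s \<Longrightarrow> norm (a + b) \<le> r + s"
 and norm_diff_mono: "norm a \<le> r \<Longrightarrow> norm b \<le> s \<Longrightarrow> norm (a - b) \<le> r + s"
 and norm_scaleR_mono: "\<bar>c\<bar> \<le> r \<Longrightarrow> norm a \<le> s \<Longrightarrow> norm (c *\<^sub>R a) \<le> r * s"
 for a b :: "'a::real_normed_vector"
 by (auto intro: norm_triangle_mono norm_triangle_le_diff mult_mono)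

lemma has_vector_derivative_along:
 assumes "(y has_vector_derivative r) (at t within A)" "G differentiable (at (y t))"
 shows "((\<lambda>s. G (y s)) has_vector_derivative fd G (y t) r) (at t within A)"
 using has_derivative_compose[OF assms(1)[unfolded has_vector_derivative_def] fd_works[OF assms(2)]]
 by (simp add: has_vector_derivative_def linear_fd_simps[OF assms(2)])

text \<open>\<open>FZ\<close> stands for DF applied to Z, and likewise for the other pairs. The
  corrections \<phi> F and \<psi> Y cancel the fast terms p F and q Y. The second-order ones cancel
  \<phi> p FF and \<psi> q YY and, as p \<psi> + q \<phi> is the derivative of \<phi> \<psi>, turn
  the mixed terms into \<phi> q (YF - FY). The last correction removes the oscillating part
  \<theta>' of \<phi> q, leaving w times the bracket and small terms.\<close>

lemma oscillation_identity:
 fixes Z F Y FF FY YF YY :: "'e::real_vector"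
 assumes y': "y' = Z + p *\<^sub>R F + q *\<^sub>R Y"
  and DF: "DF = FZ + p *\<^sub>R FF + q *\<^sub>R FY" and DY: "DY = YZ + p *\<^sub>R YF + q *\<^sub>R YY"
  and Br: "Br = YF - FY" and w: "\<phi> * q = w + \<theta>' + \<kappa>"
 shows "y' - (\<phi> *\<^sub>R DF + p *\<^sub>R F) - (\<psi> *\<^sub>R DY + q *\<^sub>R Y) + ((\<phi>\<^sup>2 / 2) *\<^sub>R D1 + (\<phi> * p) *\<^sub>R FF)
   + ((\<psi>\<^sup>2 / 2) *\<^sub>R D2 + (\<psi> * q) *\<^sub>R YY) + ((\<phi> * \<psi>) *\<^sub>R D3 + (p * \<psi> + q * \<phi>) *\<^sub>R YF)
   - (\<theta> *\<^sub>R D4 + \<theta>' *\<^sub>R Br) =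
  (Z + w *\<^sub>R Br) + (\<kappa> *\<^sub>R Br - \<phi> *\<^sub>R FZ - \<psi> *\<^sub>R YZ + (\<phi>\<^sup>2 / 2) *\<^sub>R D1 + (\<psi>\<^sup>2 / 2) *\<^sub>R D2
   + (\<phi> * \<psi>) *\<^sub>R D3 - \<theta> *\<^sub>R D4)"
proof -
 have "w = \<phi> * q - \<theta>' - \<kappa>" using w by simp
 then show ?thesis unfolding y' DF DY Br
  by (simp add: scaleR_add_left scaleR_diff_left scaleR_add_right scaleR_diff_right mult.commute)
qed

text \<open>With \<^term>\<open>\<phi>\<close> and \<^term>\<open>\<psi>\<close> of size \<^term>\<open>1 / \<omega>\<close> and frequency \<^term>\<open>\<omega>\<^sup>2\<close>, the product
 \<^term>\<open>\<phi> * \<psi>'\<close> has mean \<^term>\<open>w\<close>, whereas the primitives of all other oscillating terms are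
 small.\<close>

lemma oscillation_bounds:
 fixes \<omega> W w w' t :: real
 assumes "\<omega> \<ge> 1" "W \<ge> 1" "\<bar>w\<bar> \<le> W" "\<bar>w'\<bar> \<le> W"
 defines "\<phi> \<equiv> sqrt 2 / \<omega> * sin (\<omega>\<^sup>2 * t)"
  and "p \<equiv> sqrt 2 * \<omega> * cos (\<omega>\<^sup>2 * t)"
  and "\<psi> \<equiv> (- sqrt 2 / \<omega>) * (cos (\<omega>\<^sup>2 * t) * w)"
  and "q \<equiv> sqrt 2 * \<omega> * (sin (\<omega>\<^sup>2 * t) * w) + (- sqrt 2 / \<omega>) * (cos (\<omega>\<^sup>2 * t) * w')"
  and "\<theta> \<equiv> (- 1 / (2 * \<omega>\<^sup>2)) * (sin (2 * \<omega>\<^sup>2 * t) * w)"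
  and "\<theta>' \<equiv> - cos (2 * \<omega>\<^sup>2 * t) * w + (- 1 / (2 * \<omega>\<^sup>2)) * (sin (2 * \<omega>\<^sup>2 * t) * w')"
  and "\<kappa> \<equiv> (- 1 / (2 * \<omega>\<^sup>2)) * (sin (2 * \<omega>\<^sup>2 * t) * w')"
 shows "\<bar>\<phi>\<bar> \<le> 2 * W / \<omega>" "\<bar>\<psi>\<bar> \<le> 2 * W / \<omega>" "\<bar>p\<bar> \<le> 2 * W * \<omega>" "\<bar>q\<bar> \<le> 4 * W * \<omega>"
  "\<bar>\<theta>\<bar> \<le> W\<^sup>2 / \<omega>\<^sup>2" "\<bar>\<kappa>\<bar> \<le> W\<^sup>2 / \<omega>\<^sup>2" "\<bar>\<phi>\<^sup>2 / 2\<bar> \<le> 2 * W\<^sup>2 / \<omega>\<^sup>2" "\<bar>\<psi>\<^sup>2 / 2\<bar> \<le> 2 * W\<^sup>2 / \<omega>\<^sup>2"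
  "\<bar>\<phi> * \<psi>\<bar> \<le> 4 * W\<^sup>2 / \<omega>\<^sup>2" "\<phi> * q = w + \<theta>' + \<kappa>"
proof -
 have s2: "sqrt 2 \<le> 2" "sqrt 2 \<ge> 0" using real_sqrt_le_mono[of 2 4] by auto
 have \<omega>: "\<omega> > 0" "1 / \<omega> \<le> \<omega>" "W > 0" "W \<le> W\<^sup>2" "\<omega>\<^sup>2 > 0"
  using assms(1,2) by (auto simp: field_simps power2_eq_square mult_mono)
   (use mult_mono[of 1 \<omega> 1 \<omega>] in auto)
 have m: "\<bar>a * b\<bar> \<le> r * s" if "\<bar>a\<bar> \<le> r" "\<bar>b\<bar> \<le> s" for a b r s :: real
  using that by (simp add: abs_mult mult_mono)
 have c: "\<bar>sqrt 2 / \<omega>\<bar> \<le> 2 / \<omega>" "\<bar>- sqrt 2 / \<omega>\<bar> \<le> 2 / \<omega>" "\<bar>sqrt 2 * \<omega>\<bar> \<le> 2 * \<omega>"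
  using s2 \<omega> by (auto simp: divide_right_mono)
 show \<phi>: "\<bar>\<phi>\<bar> \<le> 2 * W / \<omega>"
 proof -
  have "\<bar>\<phi>\<bar> \<le> 2 / \<omega> * 1" unfolding \<phi>_def by (intro m c) auto
  also have "\<dots> \<le> 2 * W / \<omega>" using assms(2) \<omega> by (simp add: divide_right_mono)
  finally show ?thesis .
 qed
 show p: "\<bar>p\<bar> \<le> 2 * W * \<omega>"
 proof -
  have "\<bar>p\<bar> \<le> 2 * \<omega> * 1" unfolding p_def by (intro m c) auto
  also have "\<dots> \<le> 2 * W * \<omega>" using assms(2) \<omega> by simp
  finally show ?thesis .
 qed
 have cw: "\<bar>cos r * z\<bar> \<le> W" "\<bar>sin r * z\<bar> \<le> W" if "\<bar>z\<bar> \<le> W" for r z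
  using m[of "cos r" 1 z W] m[of "sin r" 1 z W] that by auto
 show \<psi>: "\<bar>\<psi>\<bar> \<le> 2 * W / \<omega>"
  unfolding \<psi>_def using m[OF c(2) cw(1)[OF assms(3)]] by simp
 show "\<bar>q\<bar> \<le> 4 * W * \<omega>"
 proof -
  have "\<bar>q\<bar> \<le> 2 * \<omega> * W + 2 / \<omega> * W"
   unfolding q_def by (intro order_trans[OF abs_triangle_ineq] add_mono m c cw assms)
  also have "2 / \<omega> * W \<le> 2 * \<omega> * W" using \<omega> mult_right_mono[OF \<omega>(2), of "2 * W"] by simp
  finally show ?thesis by simp
 qed
 have c2: "\<bar>- 1 / (2 * \<omega>\<^sup>2)\<bar> \<le> 1 / \<omega>\<^sup>2" using \<omega> by (simp add: field_simps)
 have "\<bar>\<theta>\<bar> \<le> 1 / \<omega>\<^sup>2 * W" "\<bar>\<kappa>\<bar> \<le> 1 / \<omega>\<^sup>2 * W"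
  unfolding \<theta>_def \<kappa>_def by (intro m c2 cw assms)+
 then show "\<bar>\<theta>\<bar> \<le> W\<^sup>2 / \<omega>\<^sup>2" "\<bar>\<kappa>\<bar> \<le> W\<^sup>2 / \<omega>\<^sup>2"
  using divide_right_mono[OF \<omega>(4), of "\<omega>\<^sup>2"] \<omega> by auto
 have "\<bar>\<phi> * \<phi>\<bar> \<le> (2 * W / \<omega>) * (2 * W / \<omega>)" "\<bar>\<psi> * \<psi>\<bar> \<le> (2 * W / \<omega>) * (2 * W / \<omega>)"
  "\<bar>\<phi> * \<psi>\<bar> \<le> (2 * W / \<omega>) * (2 * W / \<omega>)" by (intro m \<phi> \<psi>)+
 then show "\<bar>\<phi>\<^sup>2 / 2\<bar> \<le> 2 * W\<^sup>2 / \<omega>\<^sup>2" "\<bar>\<psi>\<^sup>2 / 2\<bar> \<le> 2 * W\<^sup>2 / \<omega>\<^sup>2" "\<bar>\<phi> * \<psi>\<bar> \<le> 4 * W\<^sup>2 / \<omega>\<^sup>2"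
  by (simp_all add: power2_eq_square field_simps)
 \<comment> \<open>The amplitude sqrt 2 is chosen because 2 sin^2 = 1 - cos of the doubled angle has
   mean one. The cosine part is contained in \<theta>', and \<kappa> accounts for the derivative of
   w.\<close>
 define s c where "s = sin (\<omega>\<^sup>2 * t)" and "c = cos (\<omega>\<^sup>2 * t)"
 have d: "sin (2 * \<omega>\<^sup>2 * t) = 2 * s * c" "cos (2 * \<omega>\<^sup>2 * t) = 1 - 2 * s\<^sup>2"
  using sin_double[of "\<omega>\<^sup>2 * t"] cos_double_sin[of "\<omega>\<^sup>2 * t"] by (simp_all add: s_def c_def mult.assoc)
 have sq: "sqrt 2 * sqrt 2 = 2" by simp
 have "\<phi> * q = (sqrt 2 * sqrt 2) * (s\<^sup>2 * w) - (sqrt 2 * sqrt 2) / \<omega>\<^sup>2 * (s * c * w')"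
  unfolding \<phi>_def q_def s_def[symmetric] c_def[symmetric]
  using \<omega> by (simp add: field_simps power2_eq_square)
 then have "\<phi> * q = 2 * s\<^sup>2 * w - 2 / \<omega>\<^sup>2 * (s * c * w')" unfolding sq by simp
 moreover have "(- 1 / (2 * \<omega>\<^sup>2)) * (2 * s * c * w') = - (1 / \<omega>\<^sup>2 * (s * c * w'))"
  using \<omega> by (simp add: field_simps)
 ultimately show "\<phi> * q = w + \<theta>' + \<kappa>"
  unfolding \<theta>'_def \<kappa>_def d by (simp add: algebra_simps)
qed

text \<open>Along a solution y for the new controls, the corrected curve z moves with the velocity
  of the old system up to a remainder Q of order 1 / \<omega>, and differs from y by a term e of
  order 1 / \<omega>. Integrating z' gives a defect of the same order.\<close>

lemma tracks_bracket:
 assumes J: "finite J" and \<beta>: "i # \<gamma> \<in> J" "\<gamma> \<noteq> []" "[i] \<in> J" "\<gamma> \<in> J"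
  and v: "\<And>j. elementary (v j)" and T: "T \<ge> 0"
 obtains u where "tracks J T v (filtermap u sequentially)" "\<And>n j. elementary (u n j)"
  "\<And>n t. u n (i # \<gamma>) t = 0" "\<And>n j. j \<noteq> [i] \<Longrightarrow> j \<noteq> \<gamma> \<Longrightarrow> j \<noteq> i # \<gamma> \<Longrightarrow> u n j = v j"
proof -
 let ?\<beta> = "i # \<gamma>"
 define w where "w = v ?\<beta>"
 obtain w' where w': "elementary w'" "\<And>t. (w has_real_derivative w' t) (at t)"
  using elementary_derivative[OF v] unfolding w_def by blast
 define \<omega> where "\<omega> n = real (Suc n)" for n
 have \<omega>: "\<omega> n \<ge> 1" for n by (simp add: \<omega>_def)
 define \<phi> where "\<phi> n t = sqrt 2 / \<omega> n * sin ((\<omega> n)\<^sup>2 * t)" for n t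
 define p where "p n t = sqrt 2 * \<omega> n * cos ((\<omega> n)\<^sup>2 * t)" for n t
 define \<psi> where "\<psi> n t = (- sqrt 2 / \<omega> n) * (cos ((\<omega> n)\<^sup>2 * t) * w t)" for n t
 define q where "q n t = sqrt 2 * \<omega> n * (sin ((\<omega> n)\<^sup>2 * t) * w t) +
  (- sqrt 2 / \<omega> n) * (cos ((\<omega> n)\<^sup>2 * t) * w' t)" for n t
 define \<theta> where "\<theta> n t = (- 1 / (2 * (\<omega> n)\<^sup>2)) * (sin (2 * (\<omega> n)\<^sup>2 * t) * w t)" for n t
 define \<theta>' where "\<theta>' n t = - cos (2 * (\<omega> n)\<^sup>2 * t) * w t +
  (- 1 / (2 * (\<omega> n)\<^sup>2)) * (sin (2 * (\<omega> n)\<^sup>2 * t) * w' t)" for n t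
 define \<kappa> where "\<kappa> n t = (- 1 / (2 * (\<omega> n)\<^sup>2)) * (sin (2 * (\<omega> n)\<^sup>2 * t) * w' t)" for n t
 have d: "(\<phi> n has_real_derivative p n t) (at t within A)"
  "(\<psi> n has_real_derivative q n t) (at t within A)"
  "(\<theta> n has_real_derivative \<theta>' n t) (at t within A)" for n t A
 proof -
  have w'': "(w has_real_derivative w' t) (at t within A)" for t
   using w'(2) by (rule has_field_derivative_at_within)
  have n0: "real n + 1 \<noteq> 0" by (simp add: add_nonneg_eq_0_iff)
  show "(\<phi> n has_real_derivative p n t) (at t within A)"
   unfolding \<phi>_def[abs_def] p_def using \<omega>[of n]
   by (auto intro!: derivative_eq_intros simp: power2_eq_square)
  show "(\<psi> n has_real_derivative q n t) (at t within A)"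
   unfolding \<psi>_def[abs_def] q_def using n0
   by (auto intro!: derivative_eq_intros w'' simp: \<omega>_def power2_eq_square divide_simps) (simp add: algebra_simps)
  show "(\<theta> n has_real_derivative \<theta>' n t) (at t within A)"
   unfolding \<theta>_def[abs_def] \<theta>'_def using n0
   by (auto intro!: derivative_eq_intros w'' simp: \<omega>_def power2_eq_square divide_simps) (simp add: algebra_simps)
 qed
 \<comment> \<open>The contributions are added rather than selected by cases because \<gamma> may be
   the word \<open>[i]\<close> itself; then p and q both go to the same control.\<close>
 define u where "u n j t = (if j = ?\<beta> then 0 else v j t) + (if j = [i] then p n t else 0)
  + (if j = \<gamma> then q n t else 0)" for n j t
 have pe: "elementary (p n)" "elementary (q n)" for n
  unfolding p_def[abs_def] q_def[abs_def] by (intro elementary.intros w' v[of ?\<beta>, folded w_def])+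
 have e0: "elementary (\<lambda>t. 0)" by (rule elementary_const)
 have ue: "elementary (u n j)" for n j
 proof -
  have "elementary (\<lambda>t. (if j = ?\<beta> then 0 else v j t))" "elementary (\<lambda>t. (if j = [i] then p n t else 0))"
   "elementary (\<lambda>t. (if j = \<gamma> then q n t else 0))"
   by (cases "j = ?\<beta>"; cases "j = [i]"; cases "j = \<gamma>"; simp add: e0 v pe)+
  then show ?thesis unfolding u_def[abs_def] by (intro elementary_add)
 qed
 have ne: "?\<beta> \<noteq> [i]" "?\<beta> \<noteq> \<gamma>" using \<beta>(2) by auto
 have adm: "admissible J v 0 T" "admissible J (u n) 0 T" for n
  by (intro admissible_continuous elementary_continuous v ue)+
 have "admissible {()} (\<lambda>_. w') 0 T"
  by (intro admissible_continuous elementary_continuous w')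
 then obtain W2 where W2: "\<And>t. t \<in> {0..T} \<Longrightarrow> \<bar>w' t\<bar> \<le> W2" by (rule admissible_bound) auto
 obtain V where V: "V > 0" "\<And>j t. j \<in> J \<Longrightarrow> t \<in> {0..T} \<Longrightarrow> \<bar>v j t\<bar> \<le> V"
  using admissible_bound[OF adm(1) J] by metis
 define W where "W = max 1 (max V W2)"
 have W: "W \<ge> 1" "\<And>t. t \<in> {0..T} \<Longrightarrow> \<bar>w t\<bar> \<le> W" "\<And>t. t \<in> {0..T} \<Longrightarrow> \<bar>w' t\<bar> \<le> W"
  using V(2)[OF \<beta>(1)] W2 by (force simp: W_def w_def)+
 have "tracks J T v (filtermap u sequentially)"
 proof (rule tracksI[OF J adm])
  fix S X a b x
  assume *: "open S" "bracket_family J X S" "0 \<le> a" "a \<le> b" "b \<le> T" "isol J v X S a b x"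
  have o: "ode J v X S a b" using bracket_family_ode[OF *(2,1) J adm(1) *(3-5)] .
  define F Y Br where "F = X [i]" and "Y = X \<gamma>" and "Br = X ?\<beta>"
  have sm: "smooth S F" "smooth S Y" "smooth S Br"
   using *(2) \<beta> by (auto simp: bracket_family_def F_def Y_def Br_def)
  have Br: "Br z = fd Y z (F z) - fd F z (Y z)" if "z \<in> S" for z
   using *(2) \<beta> that by (simp add: bracket_family_def F_def Y_def Br_def bracket_def)
  \<comment> \<open>The products DF F, DY Y and DY F of the second-order corrections. Treated as one
    more family of fields, they and their derivatives are bounded in a common tube with the given
    fields.\<close>
  define G where "G k = (if k = 0 then \<lambda>z. fd F z (F z) else if k = Suc 0 then \<lambda>z. fd Y z (Y z)
   else (\<lambda>z. fd Y z (F z)))" for k :: nat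
  have smG: "smooth S (G k)" for k
   unfolding G_def using sm *(1) by (auto intro!: good_fd)
  have xs: "compact (x ` {a..b})" "x ` {a..b} \<subseteq> S"
   using *(6) by (auto simp: isol_def intro: compact_continuous_image)
  obtain M1 where M1: "\<And>t. t \<in> {a..b} \<Longrightarrow> tube J X S (x t) M1" "M1 > 0"
   by (rule isol_tube[OF o *(6)]) blast
  obtain M2 where M2: "\<And>q. q \<in> x ` {a..b} \<Longrightarrow> tube {..<3} G S q M2" "M2 > 0"
   by (rule tube_exists[OF xs *(1), of "{..<3}" G]) (use smG in blast)+
  define M where "M = max M1 M2"
  have M: "M > 0" using M1 by (simp add: M_def)
  have t1: "tube J X S (x t) M" and t2: "tube {..<3} G S (x t) M" if "t \<in> {a..b}" for t
   using tube_mono[OF M1(1)[OF that]] tube_mono[OF M2(1)[of "x t"]] that by (auto simp: M_def)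
  have bd: "z \<in> S \<and> norm (H z) \<le> M \<and> (\<forall>r. norm (fd H z r) \<le> M * norm r)"
   if "t \<in> {a..b}" "z \<in> cball (x t) (1 / M)" "H \<in> X ` J \<union> G ` {..<3}" for t z H
   using t1[OF that(1)] t2[OF that(1)] that(2,3) by (auto simp: tube_def lip_at_def)
  have HX: "F \<in> X ` J \<union> G ` {..<3}" "Y \<in> X ` J \<union> G ` {..<3}" "Br \<in> X ` J \<union> G ` {..<3}"
   "G 0 \<in> X ` J \<union> G ` {..<3}" "G 1 \<in> X ` J \<union> G ` {..<3}" "G 2 \<in> X ` J \<union> G ` {..<3}"
   using \<beta> by (auto simp: F_def Y_def Br_def)
  define Z where "Z t z = rhs (J - {?\<beta>}) v X t z" for t z
  \<comment> \<open>\<open>Zb\<close> bounds the slow part of the velocity and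
    \<open>\<omega> n * Yb\<close> the whole velocity; \<open>C1\<close> and \<open>C2\<close>
    collect the bounds for \<open>Q\<close> and \<open>e\<close>. In both, 9 = 2 + 2 + 4 + 1 counts
    the bounds of the two squares, of the product and of \<theta>.\<close>
  define Zb where "Zb = real (card J) * V * M"
  define Yb where "Yb = Zb + 6 * W * M"
  define C1 where "C1 = W\<^sup>2 * M + 4 * W * (M * Zb) + 9 * W\<^sup>2 * (M * Yb)"
  define C2 where "C2 = 4 * W * M + 9 * W\<^sup>2 * M"
  define \<delta> where "\<delta> n = (2 * C2 + C1 * (b - a)) / \<omega> n" for n
  have pos: "Zb \<ge> 0" "Yb \<ge> 0" "C1 \<ge> 0" "C2 \<ge> 0" "W > 0"
   using V(1) M W(1) by (auto simp: Zb_def Yb_def C1_def C2_def intro!: add_nonneg_nonneg mult_nonneg_nonneg)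
  have "\<delta> \<longlonglongrightarrow> 0" unfolding \<delta>_def \<omega>_def
   using tendsto_mult[OF tendsto_const LIMSEQ_inverse_real_of_nat, of "2 * C2 + C1 * (b - a)"]
   by (simp add: divide_inverse)
  moreover have "norm (y t - y a - integral {a..t} (\<lambda>s. rhs J v X s (y s))) \<le> \<delta> n"
   if h: "t1 \<in> {a..b}" "isol J (u n) X S a t1 y" "\<forall>s\<in>{a..t1}. norm (y s - x s) \<le> 1 / M" "t \<in> {a..t1}"
   for n t1 y t
  proof -
   have t: "a \<le> t" "t \<le> b" using h by auto
   have y: "isol J (u n) X S a t y" using isol_subinterval[OF h(2), of a t] h(4) by simp
   have yc: "continuous_on {a..t} y" "y ` {a..t} \<subseteq> S" using y by (auto simp: isol_def)
   \<comment> \<open>All controls are continuous now, so y is continuously differentiable and the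
     change of variables can be differentiated pointwise.\<close>
   have rc: "continuous_on {a..t} (\<lambda>s. rhs J c X s (y s))" if "\<And>j. elementary (c j)" for c
    unfolding rhs_def using that
    by (intro continuous_intros elementary_continuous continuous_on_compose2[OF odeD(6)[OF o] yc]) auto
   define r where "r s = rhs J (u n) X s (y s)" for s
   have yd: "(y has_vector_derivative r s) (at s within {a..t})" if s: "s \<in> {a..t}" for s
   proof -
    have "((\<lambda>\<tau>. integral {a..\<tau>} r) has_vector_derivative r s) (at s within {a..t})"
     using integral_has_vector_derivative[OF rc[of "u n"] s] ue unfolding r_def[abs_def] by blast
    then have "((\<lambda>\<tau>. y a + integral {a..\<tau>} r) has_vector_derivative r s) (at s within {a..t})"
     by (auto intro!: derivative_eq_intros)
    then show ?thesis
    proof (rule has_vector_derivative_transform[OF s, rotated])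
     show "y \<tau> = y a + integral {a..\<tau>} r" if "\<tau> \<in> {a..t}" for \<tau>
     proof -
      have "(r has_integral (y \<tau> - y a)) {a..\<tau>}"
       using y that by (simp add: isol_def r_def[abs_def])
      from integral_unique[OF this] show ?thesis by simp
     qed
    qed
   qed
   have r_eq: "r s = Z s (y s) + p n s *\<^sub>R F (y s) + q n s *\<^sub>R Y (y s)" for s
   proof -
    have "r s = (\<Sum>j\<in>J. (if j = ?\<beta> then 0 else v j s *\<^sub>R X j (y s))) +
      (\<Sum>j\<in>J. if j = [i] then p n s *\<^sub>R X j (y s) else 0) +
      (\<Sum>j\<in>J. if j = \<gamma> then q n s *\<^sub>R X j (y s) else 0)"
     unfolding r_def rhs_def u_def sum.distrib[symmetric]
     by (rule sum.cong) (auto simp: scaleR_add_left)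
    also have "(\<Sum>j\<in>J. (if j = ?\<beta> then 0 else v j s *\<^sub>R X j (y s))) = Z s (y s)"
     unfolding Z_def rhs_def using J \<beta>(1)
     by (simp add: sum.remove[of J ?\<beta>])
    finally show ?thesis using J \<beta> by (simp add: F_def Y_def)
   qed
   have rv: "rhs J v X s (y s) = Z s (y s) + w s *\<^sub>R Br (y s)" for s
    using J \<beta>(1) by (simp add: rhs_def Z_def sum.remove[of J ?\<beta>] w_def Br_def add.commute)
   define Q where "Q s = \<kappa> n s *\<^sub>R Br (y s) - \<phi> n s *\<^sub>R fd F (y s) (Z s (y s)) - \<psi> n s *\<^sub>R fd Y (y s) (Z s (y s))
    + ((\<phi> n s)\<^sup>2 / 2) *\<^sub>R fd (G 0) (y s) (r s) + ((\<psi> n s)\<^sup>2 / 2) *\<^sub>R fd (G 1) (y s) (r s)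
    + (\<phi> n s * \<psi> n s) *\<^sub>R fd (G 2) (y s) (r s) - \<theta> n s *\<^sub>R fd Br (y s) (r s)" for s
   define e where "e s = \<phi> n s *\<^sub>R F (y s) + \<psi> n s *\<^sub>R Y (y s) - ((\<phi> n s)\<^sup>2 / 2) *\<^sub>R G 0 (y s)
    - ((\<psi> n s)\<^sup>2 / 2) *\<^sub>R G 1 (y s) - (\<phi> n s * \<psi> n s) *\<^sub>R G 2 (y s) + \<theta> n s *\<^sub>R Br (y s)" for s
   define z where "z s = y s - \<phi> n s *\<^sub>R F (y s) - \<psi> n s *\<^sub>R Y (y s) + ((\<phi> n s)\<^sup>2 / 2) *\<^sub>R G 0 (y s)
    + ((\<psi> n s)\<^sup>2 / 2) *\<^sub>R G 1 (y s) + (\<phi> n s * \<psi> n s) *\<^sub>R G 2 (y s) - \<theta> n s *\<^sub>R Br (y s)" for s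
   have ze: "y s - z s = e s" for s by (simp add: z_def e_def)
   have near: "y s \<in> cball (x s) (1 / M)" "s \<in> {a..b}" "s \<in> {0..T}" if "s \<in> {a..t}" for s
    using h that t *(3,5) by (auto simp: dist_norm norm_minus_commute)
   note ob = oscillation_bounds[OF \<omega>[of n] W(1) W(2,3)]
   have bnd: "\<bar>\<phi> n s\<bar> \<le> 2 * W / \<omega> n" "\<bar>\<psi> n s\<bar> \<le> 2 * W / \<omega> n" "\<bar>p n s\<bar> \<le> 2 * W * \<omega> n" "\<bar>q n s\<bar> \<le> 4 * W * \<omega> n"
    "\<bar>\<theta> n s\<bar> \<le> W\<^sup>2 / (\<omega> n)\<^sup>2" "\<bar>\<kappa> n s\<bar> \<le> W\<^sup>2 / (\<omega> n)\<^sup>2" "\<bar>(\<phi> n s)\<^sup>2 / 2\<bar> \<le> 2 * W\<^sup>2 / (\<omega> n)\<^sup>2"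
    "\<bar>(\<psi> n s)\<^sup>2 / 2\<bar> \<le> 2 * W\<^sup>2 / (\<omega> n)\<^sup>2" "\<bar>\<phi> n s * \<psi> n s\<bar> \<le> 4 * W\<^sup>2 / (\<omega> n)\<^sup>2"
    "\<phi> n s * q n s = w s + \<theta>' n s + \<kappa> n s" if "s \<in> {a..t}" for s
    unfolding \<phi>_def \<psi>_def p_def q_def \<theta>_def \<theta>'_def \<kappa>_def
    using ob[OF near(3)[OF that] near(3)[OF that], of s] by (simp_all only:)
   have zd: "(z has_vector_derivative (rhs J v X s (y s) + Q s)) (at s within {a..t})" if s: "s \<in> {a..t}" for s
   proof -
    have yS: "y s \<in> S" using yc s by auto
    have dif: "H differentiable (at (y s))" if "smooth S H" for H
     using smooth_differentiable[OF that yS] .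
    have al: "((\<lambda>s. H (y s)) has_vector_derivative fd H (y s) (r s)) (at s within {a..t})"
     if "smooth S H" for H by (rule has_vector_derivative_along[OF yd[OF s] dif[OF that]])
    have sq: "((\<lambda>s. (c s)\<^sup>2 / 2) has_real_derivative (c s * c')) (at s within {a..t})"
     if "(c has_real_derivative c') (at s within {a..t})" for c c'
     using that by (auto intro!: derivative_eq_intros)
    note pr = DERIV_mult[OF d(1)[of n s] d(2)[of n s]]
    have hz: "(z has_vector_derivative (r s - (\<phi> n s *\<^sub>R fd F (y s) (r s) + p n s *\<^sub>R F (y s))
     - (\<psi> n s *\<^sub>R fd Y (y s) (r s) + q n s *\<^sub>R Y (y s))
     + (((\<phi> n s)\<^sup>2 / 2) *\<^sub>R fd (G 0) (y s) (r s) + (\<phi> n s * p n s) *\<^sub>R G 0 (y s))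
     + (((\<psi> n s)\<^sup>2 / 2) *\<^sub>R fd (G 1) (y s) (r s) + (\<psi> n s * q n s) *\<^sub>R G 1 (y s))
     + ((\<phi> n s * \<psi> n s) *\<^sub>R fd (G 2) (y s) (r s) + (p n s * \<psi> n s + q n s * \<phi> n s) *\<^sub>R G 2 (y s))
     - (\<theta> n s *\<^sub>R fd Br (y s) (r s) + \<theta>' n s *\<^sub>R Br (y s)))) (at s within {a..t})"
     unfolding z_def[abs_def]
     by (intro has_vector_derivative_add has_vector_derivative_diff has_vector_derivative_scaleR
       al yd[OF s] sq d pr sm smG)
    have hF: "fd F (y s) (r s) = fd F (y s) (Z s (y s)) + p n s *\<^sub>R G 0 (y s) + q n s *\<^sub>R fd F (y s) (Y (y s))"
     and hY: "fd Y (y s) (r s) = fd Y (y s) (Z s (y s)) + p n s *\<^sub>R G 2 (y s) + q n s *\<^sub>R G 1 (y s)"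
     unfolding r_eq by (simp_all add: linear_fd_simps dif sm G_def)
    have hB: "Br (y s) = G 2 (y s) - fd F (y s) (Y (y s))" using Br[OF yS] by (simp add: G_def)
    show ?thesis
     using hz unfolding rv Q_def oscillation_identity[OF r_eq[of s] hF hY hB bnd(10)[OF s]] .
   qed
   have nr: "norm (r s) \<le> \<omega> n * Yb" "norm (Z s (y s)) \<le> Zb" if s: "s \<in> {a..t}" for s
   proof -
    have "norm (Z s (y s)) \<le> real (card (J - {?\<beta>})) * V * M"
     unfolding Z_def
    proof (rule norm_rhs_le)
     show "norm (X j (y s)) \<le> M" if "j \<in> J - {?\<beta>}" for j
      using bd[OF near(2,1)[OF s], of "X j"] that by auto
    qed (use V near(3)[OF s] in auto)
    also have "\<dots> \<le> Zb" unfolding Zb_def using J V(1) M by (intro mult_right_mono) (auto intro: card_mono)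
    finally show Zs: "norm (Z s (y s)) \<le> Zb" .
    have "norm (r s) \<le> Zb + 2 * W * \<omega> n * M + 4 * W * \<omega> n * M"
     unfolding r_eq using bd[OF near(2,1)[OF s]] HX
     by (intro norm_add_mono norm_scaleR_mono Zs bnd s) auto
    also have "Zb \<le> \<omega> n * Zb" using \<omega>[of n] pos by (simp add: mult_le_cancel_right1)
    finally show "norm (r s) \<le> \<omega> n * Yb" by (simp add: Yb_def algebra_simps)
   qed
   have le: "1 / (\<omega> n)\<^sup>2 \<le> 1 / \<omega> n" using \<omega>[of n] by (simp add: field_simps power2_eq_square)
   have \<omega>0: "\<omega> n > 0" using \<omega>[of n] by simp
   \<comment> \<open>The velocity of order \<omega> is multiplied only by coefficients of order 1 /
     \<omega>^2, whereas the coefficients of order 1 / \<omega> meet only the slow part; so every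
     term is O(1 / \<omega>).\<close>
   have Qb: "norm (Q s) \<le> C1 / \<omega> n" if s: "s \<in> {a..t}" for s
   proof -
    have fdb: "norm (fd H (y s) (r s)) \<le> M * (\<omega> n * Yb)" "norm (fd H (y s) (Z s (y s))) \<le> M * Zb"
     if "H \<in> X ` J \<union> G ` {..<3}" for H
    proof -
     have "norm (fd H (y s) z) \<le> M * norm z" for z using bd[OF near(2,1)[OF s] that] by blast
     then show "norm (fd H (y s) (r s)) \<le> M * (\<omega> n * Yb)" "norm (fd H (y s) (Z s (y s))) \<le> M * Zb"
      using nr[OF s] M by (meson mult_left_mono less_imp_le order_trans)+
    qed
    have "norm (Q s) \<le> W\<^sup>2 / (\<omega> n)\<^sup>2 * M + 2 * W / \<omega> n * (M * Zb) + 2 * W / \<omega> n * (M * Zb)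
     + 2 * W\<^sup>2 / (\<omega> n)\<^sup>2 * (M * (\<omega> n * Yb)) + 2 * W\<^sup>2 / (\<omega> n)\<^sup>2 * (M * (\<omega> n * Yb))
     + 4 * W\<^sup>2 / (\<omega> n)\<^sup>2 * (M * (\<omega> n * Yb)) + W\<^sup>2 / (\<omega> n)\<^sup>2 * (M * (\<omega> n * Yb))"
     unfolding Q_def using bd[OF near(2,1)[OF s]] HX
     by (intro norm_add_mono norm_diff_mono norm_scaleR_mono bnd fdb s) auto
    also have "\<dots> = W\<^sup>2 * M * (1 / (\<omega> n)\<^sup>2) + (4 * W * (M * Zb) + 9 * W\<^sup>2 * (M * Yb)) / \<omega> n"
     using \<omega>0 by (simp add: field_simps power2_eq_square)
    also have "\<dots> \<le> W\<^sup>2 * M * (1 / \<omega> n) + (4 * W * (M * Zb) + 9 * W\<^sup>2 * (M * Yb)) / \<omega> n"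
     using M by (intro add_right_mono mult_left_mono le) auto
    also have "\<dots> = C1 / \<omega> n" by (simp add: C1_def add_divide_distrib)
    finally show ?thesis .
   qed
   have eb: "norm (e s) \<le> C2 / \<omega> n" if s: "s \<in> {a..t}" for s
   proof -
    have "norm (e s) \<le> 2 * W / \<omega> n * M + 2 * W / \<omega> n * M + 2 * W\<^sup>2 / (\<omega> n)\<^sup>2 * M + 2 * W\<^sup>2 / (\<omega> n)\<^sup>2 * M
     + 4 * W\<^sup>2 / (\<omega> n)\<^sup>2 * M + W\<^sup>2 / (\<omega> n)\<^sup>2 * M"
     unfolding e_def using bd[OF near(2,1)[OF s]] HX
     by (intro norm_add_mono norm_diff_mono norm_scaleR_mono bnd s) auto
    also have "\<dots> = 4 * W * M / \<omega> n + 9 * W\<^sup>2 * M * (1 / (\<omega> n)\<^sup>2)" by (simp add: field_simps)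
    also have "\<dots> \<le> 4 * W * M / \<omega> n + 9 * W\<^sup>2 * M * (1 / \<omega> n)"
     using M by (intro add_left_mono mult_left_mono le) auto
    also have "\<dots> = C2 / \<omega> n" by (simp add: C2_def add_divide_distrib)
    finally show ?thesis .
   qed
   have ri: "(\<lambda>s. rhs J v X s (y s)) integrable_on {a..t}"
    by (rule integrable_continuous_real[OF rc[of v]]) (rule v)
   have "((\<lambda>s. rhs J v X s (y s) + Q s) has_integral (z t - z a)) {a..t}"
    by (rule fundamental_theorem_of_calculus[OF t(1) zd])
   from has_integral_diff[OF this integrable_integral[OF ri]]
   have "(Q has_integral (z t - z a - integral {a..t} (\<lambda>s. rhs J v X s (y s)))) {a..t}" by simp
   then have I: "norm (z t - z a - integral {a..t} (\<lambda>s. rhs J v X s (y s))) \<le> C1 / \<omega> n * (t - a)"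
    using has_integral_bound[of "C1 / \<omega> n" Q _ a t] Qb pos(3) \<omega>0 t(1) by simp
   have eq: "y t - y a - integral {a..t} (\<lambda>s. rhs J v X s (y s)) =
     (z t - z a - integral {a..t} (\<lambda>s. rhs J v X s (y s))) + e t - e a"
    by (simp flip: ze)
   have "norm (y t - y a - integral {a..t} (\<lambda>s. rhs J v X s (y s))) \<le>
     C1 / \<omega> n * (t - a) + C2 / \<omega> n + C2 / \<omega> n"
    unfolding eq using t(1) by (intro norm_diff_mono norm_add_mono I eb) auto
   also have "C1 / \<omega> n * (t - a) \<le> C1 / \<omega> n * (b - a)"
    using pos(3) \<omega>0 t(2) by (intro mult_left_mono) auto
   finally show ?thesis by (simp add: \<delta>_def add_divide_distrib)
  qed
  ultimately show "small_defect J v u S X a b x"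
   using M by blast
 qed
 then show ?thesis
  by (rule that) (use ue ne in \<open>auto simp: u_def[abs_def]\<close>)
qed

section \<open>Convergence of families of maps together with their derivatives\<close>

lemma norm_base_funpow_le: "norm ((base ^^ k) X) \<le> norm X"
 by (induction k) (auto intro: order_trans[OF norm_base_le])

lemma norm_hor_funpow [simp]: "norm ((hor ^^ k) X) = norm X"
 by (induction k) auto

lemma base_hor_funpow [simp]: "(base ^^ k) ((hor ^^ k) X) = X"
 by (induction k arbitrary: X) (auto simp: funpow_swap1)

lemma base_funpow_add: "(base ^^ k) (X + Y) = (base ^^ k) X + (base ^^ k) Y"
 and base_funpow_diff: "(base ^^ k) (X - Y) = (base ^^ k) X - (base ^^ k) Y"
 by (induction k) auto

lemma base_tlift_funpow: "(base ^^ k) ((tlift ^^ k) F X) = F ((base ^^ k) X)"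
proof (induction k arbitrary: X)
 case (Suc k)
 have b: "(base ^^ Suc k) Z = (base ^^ k) (base Z)" for Z by (simp add: funpow_swap1)
 show ?case unfolding b by (simp add: Suc)
qed simp

lemma open_base_funpow: "open S \<Longrightarrow> open ((base ^^ k) -` S)"
proof (induction k)
 case (Suc k)
 then show ?case using open_base[of "(base ^^ k) -` S"] unfolding base_power_vimage
  by (simp add: vimage_comp funpow_swap1 o_def)
qed simp

lemma funpow_tlift_cong:
 assumes "open S" "\<And>x. x \<in> S \<Longrightarrow> F x = G x" "(base ^^ k) X \<in> S"
 shows "(tlift ^^ k) F X = (tlift ^^ k) G X"
 using assms(3)
proof (induction k arbitrary: X)
 case (Suc k)
 have b: "base X \<in> (base ^^ k) -` S" using Suc.prems by (simp add: funpow_swap1)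
 have "fd ((tlift ^^ k) F) (base X) = fd ((tlift ^^ k) G) (base X)"
  by (rule fd_cong[OF open_base_funpow[OF assms(1)] b]) (use Suc.IH in simp)
 moreover have "(tlift ^^ k) F (base X) = (tlift ^^ k) G (base X)" using Suc.IH b by simp
 ultimately have "tlift ((tlift ^^ k) F) X = tlift ((tlift ^^ k) G) X"
  unfolding tlift_def[of "(tlift ^^ k) F"] tlift_def[of "(tlift ^^ k) G"] by simp
 then show ?case by simp
qed (use assms(2) in simp)

lemma funpow_tlift_compose:
 assumes "open S" "good k S G" "good k S' H" "G ` S \<subseteq> S'" "(base ^^ k) X \<in> S"
 shows "(tlift ^^ k) (\<lambda>x. H (G x)) X = (tlift ^^ k) H ((tlift ^^ k) G X)"
 using assms
proof (induction k arbitrary: S S' G H X)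
 case (Suc k)
 have eq: "tlift (\<lambda>x. H (G x)) Y = tlift H (tlift G Y)" if "Y \<in> base -` S" for Y
  using that Suc.prems by (intro tlift_compose) auto
 have bX: "(base ^^ k) X \<in> base -` S" using Suc.prems by simp
 have "(tlift ^^ k) (tlift (\<lambda>x. H (G x))) X = (tlift ^^ k) (\<lambda>Y. tlift H (tlift G Y)) X"
  by (rule funpow_tlift_cong[OF open_base[OF Suc.prems(1)] eq bX])
 also have "\<dots> = (tlift ^^ k) (tlift H) ((tlift ^^ k) (tlift G) X)"
  by (rule Suc.IH[OF open_base[OF Suc.prems(1)], of _ "base -` S'"]) (use Suc.prems bX in auto)
 finally show ?case by (simp only: funpow_Suc_right o_apply)
qed simp

lemma flow_dom_funpow:
 assumes "ode J u f S a b"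
 shows "flow_dom J u (\<lambda>j. (tlift ^^ k) (f j)) ((base ^^ k) -` S) a b = (base ^^ k) -` flow_dom J u f S a b"
  "ode J u (\<lambda>j. (tlift ^^ k) (f j)) ((base ^^ k) -` S) a b"
proof -
 have "ode J u (\<lambda>j. (tlift ^^ k) (f j)) ((base ^^ k) -` S) a b \<and>
  flow_dom J u (\<lambda>j. (tlift ^^ k) (f j)) ((base ^^ k) -` S) a b = (base ^^ k) -` flow_dom J u f S a b"
 proof (induction k)
  case 0
  then show ?case using assms by simp
 next
  case (Suc k)
  have v: "(base ^^ Suc k) -` T = base -` ((base ^^ k) -` T)" for T
   by (auto simp: funpow_swap1)
  show ?case unfolding v
   using flow_dom_tlift[of J u "\<lambda>j. (tlift ^^ k) (f j)" "(base ^^ k) -` S" a b]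
    ode_tlift[of J u "\<lambda>j. (tlift ^^ k) (f j)" "(base ^^ k) -` S" a b] Suc by simp
 qed
 then show "flow_dom J u (\<lambda>j. (tlift ^^ k) (f j)) ((base ^^ k) -` S) a b = (base ^^ k) -` flow_dom J u f S a b"
  "ode J u (\<lambda>j. (tlift ^^ k) (f j)) ((base ^^ k) -` S) a b" by auto
qed

section \<open>Continuous convergence of jets\<close>

abbreviation jet_near :: "nat \<Rightarrow> linf \<Rightarrow> real \<Rightarrow> (linf \<Rightarrow> linf) \<Rightarrow> linf \<Rightarrow> real \<Rightarrow> bool" where
 "jet_near k \<xi>0 \<delta> F L \<epsilon> \<equiv> good k (ball ((base ^^ k) \<xi>0) \<delta>) F \<and> (\<forall>\<xi>\<in>ball \<xi>0 \<delta>. norm ((tlift ^^ k) F \<xi> - L) < \<epsilon>)"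

text \<open>The limit is prescribed at the single point \<xi>0, but closeness is required in a ball
  around it: w runs along the filter while \<xi> tends to \<xi>0 jointly. Convergence of this kind
  is preserved under composition although nothing is known of limits away from \<xi>0.\<close>

definition jet_conv ::
 "'w filter \<Rightarrow> 't set \<Rightarrow> nat \<Rightarrow> ('w \<Rightarrow> 't \<Rightarrow> linf \<Rightarrow> linf) \<Rightarrow> linf \<Rightarrow> ('t \<Rightarrow> linf) \<Rightarrow> bool" where
 "jet_conv \<F> T k G \<xi>0 l \<longleftrightarrow> (\<forall>\<epsilon>>0. \<exists>\<delta>>0. \<forall>\<^sub>F w in \<F>. \<forall>t\<in>T.
   jet_near k \<xi>0 \<delta> (G w t) (l t) \<epsilon>)"

lemma jet_convD:
 assumes "jet_conv \<F> T k G \<xi>0 l" "\<epsilon> > 0"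
 obtains \<delta> where "\<delta> > 0" "\<forall>\<^sub>F w in \<F>. \<forall>t\<in>T. jet_near k \<xi>0 \<delta> (G w t) (l t) \<epsilon>"
 using assms unfolding jet_conv_def by blast

lemma jet_conv_shrink:
 assumes "\<delta> > 0" "\<delta>0 > 0" and ev: "\<forall>\<^sub>F w in \<F>. \<forall>t\<in>T. jet_near k \<xi>0 \<delta> (G w t) (l t) \<epsilon>"
 shows "\<forall>\<^sub>F w in \<F>. \<forall>t\<in>T. jet_near k \<xi>0 (min \<delta> \<delta>0) (G w t) (l t) \<epsilon>"
 by (rule eventually_mono[OF ev]) (auto intro: good_subset)

text \<open>A point near the base of \<xi>0 is the base of a jet equally near \<xi>0: the
  displacement is added horizontally, that is, with zero tangent components. Closeness of lifts
  therefore contains closeness of values.\<close>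

lemma jet_conv_mem:
 assumes "\<forall>\<xi>\<in>ball \<xi>0 \<delta>. norm ((tlift ^^ k) G \<xi> - l) < \<epsilon>" "X \<in> ball ((base ^^ k) \<xi>0) \<delta>"
 shows "G X \<in> ball ((base ^^ k) l) \<epsilon>"
proof -
 define \<xi> where "\<xi> = \<xi>0 + (hor ^^ k) (X - (base ^^ k) \<xi>0)"
 have b: "(base ^^ k) \<xi> = X" by (simp add: \<xi>_def base_funpow_add)
 have "\<xi> \<in> ball \<xi>0 \<delta>" using assms(2) by (simp add: \<xi>_def dist_norm norm_minus_commute)
 then have "norm ((tlift ^^ k) G \<xi> - l) < \<epsilon>" using assms(1) by blast
 moreover have "norm ((base ^^ k) ((tlift ^^ k) G \<xi> - l)) \<le> norm ((tlift ^^ k) G \<xi> - l)"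
  by (rule norm_base_funpow_le)
 moreover have "(base ^^ k) ((tlift ^^ k) G \<xi> - l) = G X - (base ^^ k) l"
  by (simp add: base_funpow_diff base_tlift_funpow b)
 ultimately show ?thesis by (simp add: dist_norm norm_minus_commute)
qed

lemma jet_conv_cong:
 assumes conv: "jet_conv \<F> T k G \<xi>0 l" and "\<delta>0 > 0"
  and eq: "\<forall>\<^sub>F w in \<F>. \<forall>t\<in>T. \<forall>X\<in>ball ((base ^^ k) \<xi>0) \<delta>0. G w t X = G' w t X"
 shows "jet_conv \<F> T k G' \<xi>0 l"
 unfolding jet_conv_def
proof (intro allI impI)
 fix \<epsilon> :: real assume "\<epsilon> > 0"
 from jet_convD[OF conv this] obtain \<delta> where \<delta>: "\<delta> > 0" and
  "\<forall>\<^sub>F w in \<F>. \<forall>t\<in>T. jet_near k \<xi>0 \<delta> (G w t) (l t) \<epsilon>" by blast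
 from jet_conv_shrink[OF \<delta> assms(2) this(2)] eq
 have "\<forall>\<^sub>F w in \<F>. \<forall>t\<in>T. jet_near k \<xi>0 (min \<delta> \<delta>0) (G' w t) (l t) \<epsilon>"
 proof eventually_elim
  case (elim w)
  show ?case
  proof (intro ballI conjI)
   fix t assume t: "t \<in> T"
   have e: "G w t X = G' w t X" if "X \<in> ball ((base ^^ k) \<xi>0) (min \<delta> \<delta>0)" for X
    using elim t that by auto
   have "good k (ball ((base ^^ k) \<xi>0) (min \<delta> \<delta>0)) (G w t) \<longleftrightarrow>
     good k (ball ((base ^^ k) \<xi>0) (min \<delta> \<delta>0)) (G' w t)"
    by (rule good_cong[OF open_ball]) (rule e)
   then show "good k (ball ((base ^^ k) \<xi>0) (min \<delta> \<delta>0)) (G' w t)" using elim t by blast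
   fix \<xi> assume \<xi>: "\<xi> \<in> ball \<xi>0 (min \<delta> \<delta>0)"
   have "dist ((base ^^ k) \<xi>0) ((base ^^ k) \<xi>) \<le> dist \<xi>0 \<xi>"
    using norm_base_funpow_le[of k "\<xi>0 - \<xi>"] by (simp add: dist_norm base_funpow_diff)
   then have "(base ^^ k) \<xi> \<in> ball ((base ^^ k) \<xi>0) (min \<delta> \<delta>0)" using \<xi> by auto
   then have "(tlift ^^ k) (G w t) \<xi> = (tlift ^^ k) (G' w t) \<xi>"
    by (rule funpow_tlift_cong[OF open_ball e, rotated])
   moreover have "norm ((tlift ^^ k) (G w t) \<xi> - l t) < \<epsilon>" using elim(1) t \<xi> by blast
   ultimately show "norm ((tlift ^^ k) (G' w t) \<xi> - l t) < \<epsilon>" by simp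
  qed
 qed
 then show "\<exists>\<delta>>0. \<forall>\<^sub>F w in \<F>. \<forall>t\<in>T. jet_near k \<xi>0 \<delta> (G' w t) (l t) \<epsilon>"
  using \<delta> \<open>\<delta>0 > 0\<close> by (intro exI[of _ "min \<delta> \<delta>0"]) auto
qed

lemma jet_conv_compose:
 assumes G: "jet_conv \<F> {s} k G \<xi>0 l" and H: "jet_conv \<F> T k H (l s) l'"
 shows "jet_conv \<F> T k (\<lambda>w t X. H w t (G w s X)) \<xi>0 l'"
 unfolding jet_conv_def
proof (intro allI impI)
 fix \<epsilon> :: real assume "\<epsilon> > 0"
 from jet_convD[OF H this] obtain \<delta>2 where \<delta>2: "\<delta>2 > 0" and
  ev2: "\<forall>\<^sub>F w in \<F>. \<forall>t\<in>T. jet_near k (l s) \<delta>2 (H w t) (l' t) \<epsilon>" by blast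
 from jet_convD[OF G \<delta>2] obtain \<delta>1 where \<delta>1: "\<delta>1 > 0" and
  ev1: "\<forall>\<^sub>F w in \<F>. \<forall>t\<in>{s}. jet_near k \<xi>0 \<delta>1 (G w t) (l t) \<delta>2" by blast
 from ev1 ev2 have "\<forall>\<^sub>F w in \<F>. \<forall>t\<in>T. jet_near k \<xi>0 \<delta>1 (\<lambda>X. H w t (G w s X)) (l' t) \<epsilon>"
 proof eventually_elim
  case (elim w)
  have g: "good k (ball ((base ^^ k) \<xi>0) \<delta>1) (G w s)"
   and n: "\<forall>\<xi>\<in>ball \<xi>0 \<delta>1. norm ((tlift ^^ k) (G w s) \<xi> - l s) < \<delta>2" using elim by auto
  have im: "G w s ` ball ((base ^^ k) \<xi>0) \<delta>1 \<subseteq> ball ((base ^^ k) (l s)) \<delta>2"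
   using jet_conv_mem[OF n] by blast
  show ?case
  proof (intro ballI conjI)
   fix t assume t: "t \<in> T"
   have h: "good k (ball ((base ^^ k) (l s)) \<delta>2) (H w t)" using elim t by blast
   show "good k (ball ((base ^^ k) \<xi>0) \<delta>1) (\<lambda>X. H w t (G w s X))"
    by (rule good_compose[OF h g im open_ball])
   fix \<xi> assume \<xi>: "\<xi> \<in> ball \<xi>0 \<delta>1"
   have "dist ((base ^^ k) \<xi>0) ((base ^^ k) \<xi>) \<le> dist \<xi>0 \<xi>"
    using norm_base_funpow_le[of k "\<xi>0 - \<xi>"] by (simp add: dist_norm base_funpow_diff)
   then have "(base ^^ k) \<xi> \<in> ball ((base ^^ k) \<xi>0) \<delta>1" using \<xi> by auto
   note * = funpow_tlift_compose[OF open_ball g h im this]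
   have "(tlift ^^ k) (G w s) \<xi> \<in> ball (l s) \<delta>2" using n \<xi> by (simp add: dist_norm norm_minus_commute)
   then show "norm ((tlift ^^ k) (\<lambda>X. H w t (G w s X)) \<xi> - l' t) < \<epsilon>"
    unfolding * using elim t by blast
  qed
 qed
 then show "\<exists>\<delta>>0. \<forall>\<^sub>F w in \<F>. \<forall>t\<in>T. jet_near k \<xi>0 \<delta> (\<lambda>X. H w t (G w s X)) (l' t) \<epsilon>" using \<delta>1 by blast
qed

text \<open>Stronger than uniform continuity on \<open>K\<close>, since \<eta> may leave
  \<open>K\<close>. The radius is again obtained as 1 / M from a uniform constant.\<close>

lemma continuous_near_compact:
 fixes F :: "'a::metric_space \<Rightarrow> 'b::metric_space"
 assumes "compact K" "K \<subseteq> S" "open S" "continuous_on S F" "\<epsilon> > 0"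
 obtains \<delta> where "\<delta> > 0" "\<And>p \<eta>. p \<in> K \<Longrightarrow> dist \<eta> p < \<delta> \<Longrightarrow> \<eta> \<in> S \<and> dist (F \<eta>) (F p) < \<epsilon>"
proof -
 define P where "P j q M \<longleftrightarrow> M > 0 \<and> (\<forall>\<eta>. dist \<eta> q < 1 / M \<longrightarrow> \<eta> \<in> S \<and> dist (F \<eta>) (F q) < \<epsilon>)"
  for j :: unit and q M
 have loc: "\<exists>\<delta>>0. \<exists>M. \<forall>q\<in>ball p \<delta>. P j q M" if "p \<in> K" for j p
 proof -
  have "p \<in> S" using assms(2) that by blast
  from openE[OF assms(3) this] obtain d1 where d1: "d1 > 0" "ball p d1 \<subseteq> S" .
  have "isCont F p" using assms(3,4) \<open>p \<in> S\<close> by (simp add: continuous_on_eq_continuous_at)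
  from this[unfolded continuous_at_eps_delta, rule_format, OF half_gt_zero[OF assms(5)]]
  obtain d2 where d2: "d2 > 0" "\<And>\<eta>. dist \<eta> p < d2 \<Longrightarrow> dist (F \<eta>) (F p) < \<epsilon> / 2" by blast
  define d where "d = min d1 d2"
  have d: "d > 0" using d1 d2 by (simp add: d_def)
  have "P j q (2 / d)" if q: "q \<in> ball p (d / 2)" for q
   unfolding P_def
  proof (intro conjI allI impI)
   fix \<eta> assume "dist \<eta> q < 1 / (2 / d)"
   then have "dist \<eta> p < d" using q dist_triangle[of \<eta> p q] by (simp add: dist_commute)
   moreover have "dist q p < d" using q d by (simp add: dist_commute)
   ultimately show "\<eta> \<in> S" "dist (F \<eta>) (F q) < \<epsilon>"
    using d1(2) d2(2)[of \<eta>] d2(2)[of q] dist_triangle2[of "F \<eta>" "F q" "F p"]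
    by (auto simp: d_def dist_commute)
  qed (use d in simp)
  then show ?thesis using d by (meson half_gt_zero)
 qed
 have mono: "P j q M'" if "P j q M" "M \<le> M'" for j q M M'
  using that frac_le[of 1 1 M M'] unfolding P_def by force
 obtain M where M: "M > 0" "\<And>j q. j \<in> {()} \<Longrightarrow> q \<in> K \<Longrightarrow> P j q M"
  by (rule compact_family_uniform[where P = P and J = "{()}", OF assms(1)])
   (simp, (blast intro: loc mono)+)
 show ?thesis
  by (rule that[of "1 / M"]) (use M in \<open>auto simp: P_def\<close>)
qed

text \<open>The lift of the fixed map \<open>H\<close> is continuous, and compactness of the set of
  limits makes its modulus of continuity uniform in t.\<close>

lemma jet_conv_post:
 assumes G: "jet_conv \<F> T k G \<xi>0 l" and S: "open S" and H: "smooth S H"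
  and l: "compact (l ` T)" "\<And>t. t \<in> T \<Longrightarrow> (base ^^ k) (l t) \<in> S"
 shows "jet_conv \<F> T k (\<lambda>w t X. H (G w t X)) \<xi>0 (\<lambda>t. (tlift ^^ k) H (l t))"
 unfolding jet_conv_def
proof (intro allI impI)
 fix \<epsilon> :: real assume \<epsilon>: "\<epsilon> > 0"
 have Hk: "good k S H" using H by blast
 have c: "continuous_on ((base ^^ k) -` S) ((tlift ^^ k) H)" using Hk by (simp add: good_iff_funpow)
 have sub: "l ` T \<subseteq> (base ^^ k) -` S" using l(2) by auto
 obtain \<delta>2 where \<delta>2: "\<delta>2 > 0" "\<And>p \<eta>. p \<in> l ` T \<Longrightarrow> dist \<eta> p < \<delta>2 \<Longrightarrow>
   \<eta> \<in> (base ^^ k) -` S \<and> dist ((tlift ^^ k) H \<eta>) ((tlift ^^ k) H p) < \<epsilon>"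
  by (rule continuous_near_compact[OF l(1) sub open_base_funpow[OF S] c \<epsilon>]) blast
 from jet_convD[OF G \<delta>2(1)] obtain \<delta> where \<delta>: "\<delta> > 0" and
  ev: "\<forall>\<^sub>F w in \<F>. \<forall>t\<in>T. jet_near k \<xi>0 \<delta> (G w t) (l t) \<delta>2" by blast
 from ev have "\<forall>\<^sub>F w in \<F>. \<forall>t\<in>T. jet_near k \<xi>0 \<delta> (\<lambda>X. H (G w t X)) ((tlift ^^ k) H (l t)) \<epsilon>"
 proof eventually_elim
  case (elim w)
  show ?case
  proof (intro ballI conjI)
   fix t assume t: "t \<in> T"
   have g: "good k (ball ((base ^^ k) \<xi>0) \<delta>) (G w t)"
    and n: "\<forall>\<xi>\<in>ball \<xi>0 \<delta>. norm ((tlift ^^ k) (G w t) \<xi> - l t) < \<delta>2" using elim t by auto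
   have im: "G w t ` ball ((base ^^ k) \<xi>0) \<delta> \<subseteq> S"
   proof (rule image_subsetI)
    fix X assume X: "X \<in> ball ((base ^^ k) \<xi>0) \<delta>"
    define \<xi> where "\<xi> = \<xi>0 + (hor ^^ k) (X - (base ^^ k) \<xi>0)"
    have b: "(base ^^ k) \<xi> = X" by (simp add: \<xi>_def base_funpow_add)
    have "\<xi> \<in> ball \<xi>0 \<delta>" using X by (simp add: \<xi>_def dist_norm norm_minus_commute)
    then have "(tlift ^^ k) (G w t) \<xi> \<in> (base ^^ k) -` S"
     using n \<delta>2(2)[of "l t"] t by (auto simp: dist_norm)
    then show "G w t X \<in> S" by (simp add: base_tlift_funpow b)
   qed
   show "good k (ball ((base ^^ k) \<xi>0) \<delta>) (\<lambda>X. H (G w t X))"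
    by (rule good_compose[OF Hk g im open_ball])
   fix \<xi> assume \<xi>: "\<xi> \<in> ball \<xi>0 \<delta>"
   have "dist ((base ^^ k) \<xi>0) ((base ^^ k) \<xi>) \<le> dist \<xi>0 \<xi>"
    using norm_base_funpow_le[of k "\<xi>0 - \<xi>"] by (simp add: dist_norm base_funpow_diff)
   then have "(base ^^ k) \<xi> \<in> ball ((base ^^ k) \<xi>0) \<delta>" using \<xi> by auto
   note * = funpow_tlift_compose[OF open_ball g Hk im this]
   show "norm ((tlift ^^ k) (\<lambda>X. H (G w t X)) \<xi> - (tlift ^^ k) H (l t)) < \<epsilon>"
    unfolding * using \<delta>2(2)[of "l t" "(tlift ^^ k) (G w t) \<xi>"] n \<xi> t by (simp add: dist_norm)
  qed
 qed
 then show "\<exists>\<delta>>0. \<forall>\<^sub>F w in \<F>. \<forall>t\<in>T. jet_near k \<xi>0 \<delta> (\<lambda>X. H (G w t X)) ((tlift ^^ k) H (l t)) \<epsilon>"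
  using \<delta> by blast
qed

lemma jet_conv_const:
 assumes "open S" "smooth S G" "(base ^^ k) \<xi>0 \<in> S"
 shows "jet_conv \<F> T k (\<lambda>w t. G) \<xi>0 (\<lambda>t. (tlift ^^ k) G \<xi>0)"
 unfolding jet_conv_def
proof (intro allI impI)
 fix \<epsilon> :: real assume \<epsilon>: "\<epsilon> > 0"
 have g: "good k S G" using assms(2) by blast
 have c: "continuous_on ((base ^^ k) -` S) ((tlift ^^ k) G)" using g by (simp add: good_iff_funpow)
 obtain d1 where d1: "d1 > 0" "\<And>p \<eta>. p \<in> {\<xi>0} \<Longrightarrow> dist \<eta> p < d1 \<Longrightarrow>
   \<eta> \<in> (base ^^ k) -` S \<and> dist ((tlift ^^ k) G \<eta>) ((tlift ^^ k) G p) < \<epsilon>"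
  by (rule continuous_near_compact[of "{\<xi>0}", OF _ _ open_base_funpow[OF assms(1)] c \<epsilon>])
   (use assms(3) in auto)
 obtain d2 where d2: "d2 > 0" "ball ((base ^^ k) \<xi>0) d2 \<subseteq> S" using assms(1,3) open_contains_ball by blast
 have "good k (ball ((base ^^ k) \<xi>0) (min d1 d2)) G"
  by (rule good_subset[OF g]) (use d2(2) in auto)
 moreover have "norm ((tlift ^^ k) G \<xi> - (tlift ^^ k) G \<xi>0) < \<epsilon>" if "\<xi> \<in> ball \<xi>0 (min d1 d2)" for \<xi>
  using d1(2)[of \<xi>0 \<xi>] that by (simp add: dist_norm norm_minus_commute)
 ultimately show "\<exists>\<delta>>0. \<forall>\<^sub>F w in \<F>. \<forall>t\<in>T. jet_near k \<xi>0 \<delta> G ((tlift ^^ k) G \<xi>0) \<epsilon>"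
  using d1(1) d2(1) by (intro exI[of _ "min d1 d2"]) auto
qed

lemma bracket_family_funpow:
 assumes "bracket_family J X S" "open S" "\<And>i \<gamma>. i # \<gamma> \<in> J \<Longrightarrow> \<gamma> \<noteq> [] \<Longrightarrow> [i] \<in> J \<and> \<gamma> \<in> J"
 shows "bracket_family J (\<lambda>j. (tlift ^^ k) (X j)) ((base ^^ k) -` S)"
 unfolding bracket_family_def
proof (intro conjI ballI allI impI)
 show "good m ((base ^^ k) -` S) ((tlift ^^ k) (X j))" if "j \<in> J" for j m
  using assms(1) that by (auto simp: bracket_family_def intro: good_funpow)
 fix i \<gamma> z assume h: "\<gamma> \<noteq> []" "i # \<gamma> \<in> J" "z \<in> (base ^^ k) -` S"
 have "(tlift ^^ k) (X (i # \<gamma>)) z = (tlift ^^ k) (bracket (X [i]) (X \<gamma>)) z"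
  by (rule funpow_tlift_cong[OF assms(2)]) (use assms(1) h in \<open>auto simp: bracket_family_def\<close>)
 also have "\<dots> = bracket ((tlift ^^ k) (X [i])) ((tlift ^^ k) (X \<gamma>)) z"
  using assms h by (intro funpow_tlift_bracket[OF assms(2)]) (auto simp: bracket_family_def)
 finally show "(tlift ^^ k) (X (i # \<gamma>)) z = bracket ((tlift ^^ k) (X [i])) ((tlift ^^ k) (X \<gamma>)) z" .
qed

text \<open>The \<open>k\<close>-fold lifts of the fields form a bracket family again, because
  lifting commutes with brackets, so the tracking property applies to them. As the flow of the
  lifted system is the lift of the flow, uniform shadowing there is convergence of
  \<open>k\<close>-jets.\<close>

lemma jet_conv_flow:
 assumes tr: "tracks J T v \<F>" and J: "finite J" and v: "admissible J v 0 T"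
  and cl: "\<And>i \<gamma>. i # \<gamma> \<in> J \<Longrightarrow> \<gamma> \<noteq> [] \<Longrightarrow> [i] \<in> J \<and> \<gamma> \<in> J"
  and S: "open S" and X: "bracket_family J X S" and ab: "0 \<le> a" "a \<le> b" "b \<le> T"
  and \<eta>: "(base ^^ k) \<eta> \<in> flow_dom J v X S a b"
 shows "jet_conv \<F> {a..b} k (\<lambda>w t. flow J w X S a b t) \<eta> (\<lambda>t. (tlift ^^ k) (flow J v X S a b t) \<eta>)"
  "\<exists>\<delta>>0. \<forall>\<^sub>F w in \<F>. ball ((base ^^ k) \<eta>) \<delta> \<subseteq> flow_dom J w X S a b"
  "continuous_on {a..b} (\<lambda>t. (tlift ^^ k) (flow J v X S a b t) \<eta>)"
proof -
 let ?X = "\<lambda>j. (tlift ^^ k) (X j)" and ?S = "(base ^^ k) -` S"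
 have o: "ode J v X S a b" using bracket_family_ode[OF X S J v ab] .
 define h where "h t = flow J v ?X ?S a b t \<eta>" for t
 have \<eta>d: "\<eta> \<in> flow_dom J v ?X ?S a b" using \<eta> by (simp add: flow_dom_funpow[OF o])
 have h: "isol J v ?X ?S a b h" "h a = \<eta>" using flow_isol[OF \<eta>d] by (auto simp: h_def[abs_def])
 have h_eq: "(tlift ^^ k) (flow J v X S a b t) \<eta> = h t" if "t \<in> {a..b}" for t
  using funpow_tlift_flow(1)[OF o that \<eta>] by (simp add: h_def)
 have "continuous_on {a..b} h" using h by (simp add: isol_def)
 then show "continuous_on {a..b} (\<lambda>t. (tlift ^^ k) (flow J v X S a b t) \<eta>)"
  using h_eq continuous_on_cong[OF refl, of "{a..b}" h "\<lambda>t. (tlift ^^ k) (flow J v X S a b t) \<eta>"] by simp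
 have bf: "bracket_family J ?X ?S" using bracket_family_funpow[OF X S cl] .
 have adm: "\<forall>\<^sub>F w in \<F>. admissible J w 0 T" using tr by (simp add: tracks_def)
 have main: "\<exists>\<delta>>0. \<forall>\<^sub>F w in \<F>. ball ((base ^^ k) \<eta>) \<delta> \<subseteq> flow_dom J w X S a b \<and> (\<forall>t\<in>{a..b}.
   jet_near k \<eta> \<delta> (flow J w X S a b t) (h t) \<epsilon>)" if \<epsilon>: "\<epsilon> > 0" for \<epsilon>
 proof -
  obtain \<delta> where \<delta>: "\<delta> > 0" and ev: "\<forall>\<^sub>F w in \<F>. \<forall>y0. norm (y0 - h a) < \<delta> \<longrightarrow>
    (shadowed J ?S ?X a b h \<epsilon> w y0)"
   using tracksD[OF tr open_base_funpow[OF S] bf ab h(1) \<epsilon>] by blast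
  from ev adm have "\<forall>\<^sub>F w in \<F>. ball ((base ^^ k) \<eta>) \<delta> \<subseteq> flow_dom J w X S a b \<and> (\<forall>t\<in>{a..b}.
   jet_near k \<eta> \<delta> (flow J w X S a b t) (h t) \<epsilon>)"
  proof eventually_elim
   case (elim w)
   have ow: "ode J w X S a b" using bracket_family_ode[OF X S J elim(2) ab] .
   have sol: "shadowed J ?S ?X a b h \<epsilon> w \<xi>"
    if "\<xi> \<in> ball \<eta> \<delta>" for \<xi>
    using elim(1) that h(2) by (simp add: dist_norm norm_minus_commute)
   have dom: "(base ^^ k) \<xi> \<in> flow_dom J w X S a b" if "\<xi> \<in> ball \<eta> \<delta>" for \<xi>
   proof -
    have "\<xi> \<in> flow_dom J w ?X ?S a b" using sol[OF that] by (auto simp: flow_dom_def[of _ _ ?X])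
    then show ?thesis by (simp add: flow_dom_funpow[OF ow])
   qed
   have sub: "ball ((base ^^ k) \<eta>) \<delta> \<subseteq> flow_dom J w X S a b"
   proof
    fix Z assume Z: "Z \<in> ball ((base ^^ k) \<eta>) \<delta>"
    define \<xi> where "\<xi> = \<eta> + (hor ^^ k) (Z - (base ^^ k) \<eta>)"
    have "(base ^^ k) \<xi> = Z" by (simp add: \<xi>_def base_funpow_add)
    moreover have "\<xi> \<in> ball \<eta> \<delta>" using Z by (simp add: \<xi>_def dist_norm norm_minus_commute)
    ultimately show "Z \<in> flow_dom J w X S a b" using dom by metis
   qed
   show ?case
   proof (intro conjI ballI sub)
    fix t assume t: "t \<in> {a..b}"
    show "good k (ball ((base ^^ k) \<eta>) \<delta>) (flow J w X S a b t)"
     by (rule good_subset[OF good_flow[OF ow t] sub])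
    fix \<xi> assume \<xi>: "\<xi> \<in> ball \<eta> \<delta>"
    obtain y where y: "isol J w ?X ?S a b y" "y a = \<xi>" "\<forall>t\<in>{a..b}. norm (y t - h t) < \<epsilon>"
     using sol[OF \<xi>] by blast
    have "(tlift ^^ k) (flow J w X S a b t) \<xi> = y t"
     using funpow_tlift_flow(1)[OF ow t dom[OF \<xi>]] flow_eqI(1)[OF flow_dom_funpow(2)[OF ow] y(1) t] y(2)
     by simp
    then show "norm ((tlift ^^ k) (flow J w X S a b t) \<xi> - h t) < \<epsilon>" using y(3) t by simp
   qed
  qed
  then show ?thesis using \<delta> by blast
 qed
 show "\<exists>\<delta>>0. \<forall>\<^sub>F w in \<F>. ball ((base ^^ k) \<eta>) \<delta> \<subseteq> flow_dom J w X S a b"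
  using main[of 1] by (auto elim!: eventually_mono)
 have "jet_conv \<F> {a..b} k (\<lambda>w t. flow J w X S a b t) \<eta> h"
  unfolding jet_conv_def
 proof (intro allI impI)
  fix \<epsilon> :: real assume "\<epsilon> > 0"
  from main[OF this] obtain \<delta> where "\<delta> > 0" and
   ev: "\<forall>\<^sub>F w in \<F>. ball ((base ^^ k) \<eta>) \<delta> \<subseteq> flow_dom J w X S a b \<and> (\<forall>t\<in>{a..b}.
   jet_near k \<eta> \<delta> (flow J w X S a b t) (h t) \<epsilon>)" by blast
  have "\<forall>\<^sub>F w in \<F>. \<forall>t\<in>{a..b}. jet_near k \<eta> \<delta> (flow J w X S a b t) (h t) \<epsilon>"
   by (rule eventually_mono[OF ev]) blast
  then show "\<exists>\<delta>>0. \<forall>\<^sub>F w in \<F>. \<forall>t\<in>{a..b}. jet_near k \<eta> \<delta> (flow J w X S a b t) (h t) \<epsilon>"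
   using \<open>\<delta> > 0\<close> by blast
 qed
 then show "jet_conv \<F> {a..b} k (\<lambda>w t. flow J w X S a b t) \<eta> (\<lambda>t. (tlift ^^ k) (flow J v X S a b t) \<eta>)"
  unfolding jet_conv_def by (simp add: h_eq)
qed

section \<open>Solutions and flows on the manifold\<close>

locale smooth_manifold =
 fixes A :: "('a::t2_space, 'n::finite) chart set"
 assumes atlas: "smooth_atlas A"
begin

lemma chart:
 assumes "c \<in> A"
 shows "open (domain c)" "open (coord c ` domain c)"
  "continuous_on (domain c) (coord c)" "continuous_on (coord c ` domain c) (param c)"
  "p \<in> domain c \<Longrightarrow> param c (coord c p) = p"
  "y \<in> coord c ` domain c \<Longrightarrow> param c y \<in> domain c"
  "y \<in> coord c ` domain c \<Longrightarrow> coord c (param c y) = y"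
proof -
 have "is_chart c" using assms atlas by (simp add: smooth_atlas_def)
 then show "open (domain c)" "open (coord c ` domain c)"
  "continuous_on (domain c) (coord c)" "continuous_on (coord c ` domain c) (param c)"
  "p \<in> domain c \<Longrightarrow> param c (coord c p) = p"
  "y \<in> coord c ` domain c \<Longrightarrow> param c y \<in> domain c"
  "y \<in> coord c ` domain c \<Longrightarrow> coord c (param c y) = y"
  by (auto simp: is_chart_def homeomorphism_def)
qed

lemma chart_exists: "\<exists>c\<in>A. p \<in> domain c"
 using atlas by (auto simp: smooth_atlas_def)

lemma coord_image: "c \<in> A \<Longrightarrow> coord c ` (domain c \<inter> V) = coord c ` domain c \<inter> param c -` V"
proof (intro equalityI subsetI)
 fix y assume "c \<in> A" "y \<in> coord c ` domain c \<inter> param c -` V"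
 then show "y \<in> coord c ` (domain c \<inter> V)"
  by (intro image_eqI[where x = "param c y"]) (auto simp: chart)
qed (auto simp: chart)

end

text \<open>Closure of \<open>J\<close> under tails, together with the letters split off, is what
  allows brackets to be peeled one letter at a time inside a finite index set.\<close>

locale control_manifold = smooth_manifold A for A :: "('a::t2_space, 'n::finite) chart set" +
 fixes f :: "nat \<Rightarrow> ('a, 'n) vfield"
  and J :: "nat list set"
  and T :: real
 assumes finite_words: "finite J"
  and words: "i # \<gamma> \<in> J \<Longrightarrow> \<gamma> \<noteq> [] \<Longrightarrow> [i] \<in> J \<and> \<gamma> \<in> J" "[] \<notin> J"
  and fields: "[i] \<in> J \<Longrightarrow> smooth_vfield A (f i)"
begin

text \<open>The part of the chart \<open>c\<close> over \<open>V\<close>, as a cylinder in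
  \<open>linf\<close>: only the finitely many entries read by \<open>prj\<close> are
  restricted.\<close>

definition reg :: "('a, 'n) chart \<Rightarrow> 'a set \<Rightarrow> linf set" where
 "reg c V = prj -` (coord c ` domain c \<inter> param c -` V)"

lemma reg_iff: "X \<in> reg c V \<longleftrightarrow> prj X \<in> coord c ` domain c \<and> param c (prj X) \<in> V"
 by (auto simp: reg_def)

lemma reg_emb: "c \<in> A \<Longrightarrow> p \<in> domain c \<Longrightarrow> emb (coord c p) \<in> reg c V \<longleftrightarrow> p \<in> V"
 by (simp add: reg_iff chart)

lemma open_reg: "c \<in> A \<Longrightarrow> open V \<Longrightarrow> open (reg c V)"
 unfolding reg_def by (intro open_prj continuous_open_preimage chart)


abbreviation cdom :: "('a, 'n) chart \<Rightarrow> linf set" where "cdom c \<equiv> reg c UNIV"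

definition chart_field :: "('a, 'n) chart \<Rightarrow> nat list \<Rightarrow> linf \<Rightarrow> linf" where
 "chart_field c \<beta> = elift (iterated_bracket f \<beta> c \<circ> param c)"

definition chart_change :: "('a, 'n) chart \<Rightarrow> ('a, 'n) chart \<Rightarrow> linf \<Rightarrow> linf" where
 "chart_change c d = elift (coord d \<circ> param c)"

lemma smooth_elift_reg:
 assumes "c \<in> A" "open V" "smooth_on (coord c ` (domain c \<inter> V)) (h \<circ> param c)"
 shows "smooth (reg c V) (elift (h \<circ> param c))"
 unfolding reg_def using assms unfolding coord_image[OF assms(1)]
 by (intro allI good_elift continuous_open_preimage chart)

lemma smooth_trans:
 assumes "c \<in> A" "d \<in> A"
 shows "smooth (reg c (domain d)) (chart_change c d)"
 unfolding chart_change_def using assms atlas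
 by (intro allI smooth_elift_reg[rule_format] chart) (auto simp: smooth_atlas_def)

lemma trans_mem: "c \<in> A \<Longrightarrow> d \<in> A \<Longrightarrow> X \<in> reg c (domain d \<inter> V) \<Longrightarrow> chart_change c d X \<in> reg d V"
 by (simp add: chart_change_def elift_def reg_iff chart)

lemma field_bracket:
 assumes c: "c \<in> A" and \<gamma>: "\<gamma> \<noteq> []" and sm: "smooth (cdom c) (chart_field c [i])" "smooth (cdom c) (chart_field c \<gamma>)"
  and z: "z \<in> cdom c"
 shows "chart_field c (i # \<gamma>) z = bracket (chart_field c [i]) (chart_field c \<gamma>) z"
proof -
 let ?G = "\<lambda>\<beta>. iterated_bracket f \<beta> c \<circ> param c" and ?y = "prj z :: real ^ 'n"
 have y: "?y \<in> coord c ` domain c" using z by (simp add: reg_iff)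
 have e: "emb ?y \<in> cdom c" using y by (simp add: reg_iff)
 have d: "?G \<beta> differentiable (at ?y)" if "smooth (cdom c) (chart_field c \<beta>)" for \<beta>
  by (rule elift_differentiable)
   (use smooth_differentiable[OF that e] in \<open>simp add: chart_field_def\<close>)
 have F: "fd (chart_field c \<beta>) z W = emb (fd (?G \<beta>) ?y (prj W))" if "smooth (cdom c) (chart_field c \<beta>)" for \<beta> W
  unfolding chart_field_def using fd_eqI[OF elift_has_derivative[OF d[OF that]]] by simp
 obtain k \<gamma>' where "\<gamma> = k # \<gamma>'" using \<gamma> by (cases \<gamma>) auto
 then have "iterated_bracket f (i # \<gamma>) = lie_bracket (f i) (iterated_bracket f \<gamma>)" by simp
 then have "chart_field c (i # \<gamma>) z = emb (fd (?G \<gamma>) ?y (?G [i] ?y) - fd (?G [i]) ?y (?G \<gamma> ?y))"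
  by (simp add: chart_field_def elift_def lie_bracket_def chart_deriv_def chart(7)[OF c y] o_def)
 also have "\<dots> = bracket (chart_field c [i]) (chart_field c \<gamma>) z"
  using F[OF sm(1)] F[OF sm(2)] by (simp add: bracket_def emb_simps) (simp add: chart_field_def elift_def)
 finally show ?thesis .
qed

text \<open>Smoothness and compatibility with changes of charts are proved together along the word:
  the step writes the field as a bracket, and relatedness of brackets requires smoothness of both
  shorter fields. For a single letter compatibility is the transformation rule of vector
  fields.\<close>

lemma field_props:
 assumes "\<beta> \<in> J"
 shows "(\<forall>c\<in>A. smooth (cdom c) (chart_field c \<beta>)) \<and>
  (\<forall>c\<in>A. \<forall>d\<in>A. \<forall>z\<in>reg c (domain d). fd (chart_change c d) z (chart_field c \<beta> z) = chart_field d \<beta> (chart_change c d z))"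
 using assms
proof (induction \<beta>)
 case Nil
 then show ?case using words(2) by simp
next
 case (Cons i \<gamma>)
 have i: "smooth_vfield A (f i)" using Cons.prems words(1)[of i \<gamma>] fields by (cases "\<gamma> = []") auto
 have sm1: "smooth (cdom c) (chart_field c [i])" if c: "c \<in> A" for c
  unfolding chart_field_def using c i
  by (intro allI smooth_elift_reg[rule_format]) (auto simp: smooth_vfield_def)
 have rel1: "fd (chart_change c d) z (chart_field c [i] z) = chart_field d [i] (chart_change c d z)"
  if c: "c \<in> A" and d: "d \<in> A" and z: "z \<in> reg c (domain d)" for c d z
 proof -
  let ?p = "param c (prj z)"
  have p: "?p \<in> domain c \<inter> domain d" "coord c ?p = prj z"
   using z c by (auto simp: reg_iff chart)
  have e: "emb (prj z :: real ^ 'n) \<in> reg c (domain d)" using z by (simp add: reg_iff)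
  have "(coord d \<circ> param c) differentiable (at (prj z))"
   by (rule elift_differentiable)
    (use smooth_differentiable[OF smooth_trans[OF c d] e] in \<open>simp add: chart_change_def\<close>)
  then have "fd (chart_change c d) z W = emb (fd (coord d \<circ> param c) (prj z) (prj W))" for W
   unfolding chart_change_def using fd_eqI[OF elift_has_derivative] by metis
  moreover have "f i d ?p = chart_deriv c (coord d) ?p (f i c ?p)"
   using i c d p unfolding smooth_vfield_def by blast
  ultimately show ?thesis using d p(1)
   by (simp add: chart_field_def elift_def chart_change_def chart chart_deriv_def p(2))
 qed
 show ?case
 proof (cases "\<gamma> = []")
  case True
  then show ?thesis using sm1 rel1 by simp
 next
  case False
  then have \<gamma>: "\<gamma> \<in> J" using Cons.prems words(1) by blast
  note IH = Cons.IH[OF \<gamma>]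
  have eq: "chart_field c (i # \<gamma>) z = bracket (chart_field c [i]) (chart_field c \<gamma>) z" if "c \<in> A" "z \<in> cdom c" for c z
   using IH by (intro field_bracket[OF that(1) False sm1[OF that(1)] _ that(2)]) (use that in auto)
  have sub: "reg c V \<subseteq> cdom c" for c V by (auto simp: reg_iff)
  have "smooth (cdom c) (chart_field c (i # \<gamma>))" if c: "c \<in> A" for c
  proof
   fix k
   have "good k (cdom c) (bracket (chart_field c [i]) (chart_field c \<gamma>))"
    using smooth_bracket[OF open_reg[OF c open_UNIV] sm1[OF c]] IH c by blast
   moreover have "good k (cdom c) (chart_field c (i # \<gamma>)) \<longleftrightarrow>
     good k (cdom c) (bracket (chart_field c [i]) (chart_field c \<gamma>))"
    by (rule good_cong[OF open_reg[OF c open_UNIV]]) (rule eq[OF c])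
   ultimately show "good k (cdom c) (chart_field c (i # \<gamma>))" by blast
  qed
  moreover have "fd (chart_change c d) z (chart_field c (i # \<gamma>) z) = chart_field d (i # \<gamma>) (chart_change c d z)"
   if c: "c \<in> A" and d: "d \<in> A" and z: "z \<in> reg c (domain d)" for c d z
  proof -
   have td: "chart_change c d ` reg c (domain d) \<subseteq> cdom d" using trans_mem[OF c d, of _ UNIV] by auto
   have "fd (chart_change c d) z (bracket (chart_field c [i]) (chart_field c \<gamma>) z) =
     bracket (chart_field d [i]) (chart_field d \<gamma>) (chart_change c d z)"
   proof (rule bracket_related[where S = "reg c (domain d)" and S' = "cdom d"])
    show "smooth (reg c (domain d)) (chart_field c [i])" "smooth (reg c (domain d)) (chart_field c \<gamma>)"
     using sm1[OF c] IH c good_subset[OF _ sub] by blast+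
   qed (use c d z td IH rel1 sm1 smooth_trans in \<open>auto intro!: open_reg chart\<close>)
   then show ?thesis using eq c d z sub td by (auto simp: image_subset_iff subset_iff)
  qed
  ultimately show ?thesis by blast
 qed
qed

lemma bracket_family_field: "c \<in> A \<Longrightarrow> bracket_family J (chart_field c) (cdom c)"
 unfolding bracket_family_def
proof (intro conjI ballI allI impI)
 assume c: "c \<in> A"
 show "good k (cdom c) (chart_field c j)" if "j \<in> J" for j k using field_props[OF that] c by blast
 fix i \<gamma> z assume "\<gamma> \<noteq> []" "i # \<gamma> \<in> J" "z \<in> cdom c"
 then show "chart_field c (i # \<gamma>) z = bracket (chart_field c [i]) (chart_field c \<gamma>) z"
  using field_props words(1) c by (intro field_bracket) blast+
qed

lemma ode_field:
 assumes "c \<in> A" "admissible J w a b" "a \<le> b" "open V"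
 shows "ode J w (chart_field c) (reg c V) a b"
proof -
 have "reg c V \<subseteq> cdom c" by (auto simp: reg_iff)
 then have "smooth (reg c V) (chart_field c j)" if "j \<in> J" for j
  using field_props[OF that] assms(1) good_subset by blast
 then show ?thesis using assms open_reg finite_words by (simp add: ode_def)
qed

section \<open>Solution curves and flows on the manifold\<close>

definition path :: "('a, 'n) chart \<Rightarrow> (real \<Rightarrow> 'a) \<Rightarrow> real \<Rightarrow> linf" where
 "path c x t = emb (coord c (x t))"

definition msol :: "(nat list \<Rightarrow> real \<Rightarrow> real) \<Rightarrow> real \<Rightarrow> real \<Rightarrow> (real \<Rightarrow> 'a) \<Rightarrow> bool" where
 "msol w a b x \<longleftrightarrow> continuous_on {a..b} x \<and> (\<forall>c\<in>A. \<forall>a' b'. a \<le> a' \<and> a' \<le> b' \<and> b' \<le> b \<and>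
   x ` {a'..b'} \<subseteq> domain c \<longrightarrow> isol J w (chart_field c) (cdom c) a' b' (path c x))"

lemma msol_isol:
 assumes "msol w a b x" "c \<in> A" "a \<le> a'" "a' \<le> b'" "b' \<le> b" "x ` {a'..b'} \<subseteq> domain c"
 shows "isol J w (chart_field c) (cdom c) a' b' (path c x)"
 using assms unfolding msol_def by blast

lemma msol_subinterval: "msol w a b x \<Longrightarrow> a \<le> c \<Longrightarrow> d \<le> b \<Longrightarrow> msol w c d x"
 unfolding msol_def by (auto intro: continuous_on_subset)

lemma continuous_chart_nbhd:
 fixes x :: "real \<Rightarrow> 'a"
 assumes x: "continuous_on {a..b} x" and r: "r \<in> {a..b}" and V: "open V" "x r \<in> V"
 obtains \<delta> where "\<delta> > 0" "\<And>t. t \<in> {a..b} \<Longrightarrow> \<bar>t - r\<bar> < \<delta> \<Longrightarrow> x t \<in> V"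
proof -
 have "\<forall>\<^sub>F t in at r within {a..b}. x t \<in> V"
  using x r V by (metis continuous_on_def topological_tendstoD)
 then obtain \<delta> where "\<delta> > 0" "\<And>t. t \<in> {a..b} \<Longrightarrow> t \<noteq> r \<Longrightarrow> dist t r < \<delta> \<Longrightarrow> x t \<in> V"
  unfolding eventually_at by blast
 then show ?thesis using that V(2) by (metis dist_real_def)
qed

text \<open>The property "agreement at the left end implies agreement throughout" survives
  bisection. Near a time where the curves agree it is uniqueness in one chart; near any other time
  the Hausdorff property is used.\<close>

lemma msol_unique:
 assumes adm: "admissible J w a b" and x: "msol w a b x" and y: "msol w a b y"
  and "x a = y a" and ab: "a \<le> b" and t: "t \<in> {a..b}"
 shows "x t = y t"
proof -
 have xc: "continuous_on {a..b} x" and yc: "continuous_on {a..b} y" using x y by (auto simp: msol_def)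
 define P where "P s t \<longleftrightarrow> (a \<le> s \<longrightarrow> s \<le> t \<longrightarrow> t \<le> b \<longrightarrow> x s = y s \<longrightarrow> (\<forall>r\<in>{s..t}. x r = y r))" for s t
 from ab have "P a b"
 proof (induction rule: Bolzano)
  case (trans p q r)
  show ?case unfolding P_def
  proof (intro impI ballI)
   fix s assume h: "a \<le> p" "p \<le> r" "r \<le> b" "x p = y p" "s \<in> {p..r}"
   have q: "a \<le> q" "q \<le> b" using trans(3,4) h by auto
   have 1: "\<forall>s\<in>{p..q}. x s = y s" using trans(1,3) h(1,4) q unfolding P_def by blast
   then have "x q = y q" using trans(3) by simp
   then have "\<forall>s\<in>{q..r}. x s = y s" using trans(2,4) h(3) q unfolding P_def by blast
   with 1 show "x s = y s" using h(5) by (cases "s \<le> q") auto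
  qed
 next
  case (local r)
  then have r: "r \<in> {a..b}" by simp
  show ?case
  proof (cases "x r = y r")
   case False
   then obtain U V where UV: "open U" "open V" "x r \<in> U" "y r \<in> V" "U \<inter> V = {}"
    using hausdorff by metis
   obtain d1 where d1: "d1 > 0" "\<And>t. t \<in> {a..b} \<Longrightarrow> \<bar>t - r\<bar> < d1 \<Longrightarrow> x t \<in> U"
    by (rule continuous_chart_nbhd[OF xc r UV(1,3)]) blast
   obtain d2 where d2: "d2 > 0" "\<And>t. t \<in> {a..b} \<Longrightarrow> \<bar>t - r\<bar> < d2 \<Longrightarrow> y t \<in> V"
    by (rule continuous_chart_nbhd[OF yc r UV(2,4)]) blast
   \<comment> \<open>Disjoint neighbourhoods keep the curves apart near r, so agreement at the left
     end is impossible and the claim holds vacuously.\<close>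
   have "P s t" if "s \<le> r" "r \<le> t" "t - s < min d1 d2" for s t
    unfolding P_def
   proof (intro impI)
    assume h: "a \<le> s" "s \<le> t" "t \<le> b" "x s = y s"
    then have "s \<in> {a..b}" "\<bar>s - r\<bar> < min d1 d2" using that by auto
    then have "x s \<in> U" "y s \<in> V" using d1(2)[of s] d2(2)[of s] by auto
    with h(4) UV(5) show "\<forall>r\<in>{s..t}. x r = y r" by auto
   qed
   then show ?thesis using d1(1) d2(1) by (intro exI[of _ "min d1 d2"]) auto
  next
   case True
   obtain c where c: "c \<in> A" "x r \<in> domain c" using chart_exists by blast
   obtain d1 where d1: "d1 > 0" "\<And>t. t \<in> {a..b} \<Longrightarrow> \<bar>t - r\<bar> < d1 \<Longrightarrow> x t \<in> domain c"
    by (rule continuous_chart_nbhd[OF xc r chart(1)[OF c(1)] c(2)]) blast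
   obtain d2 where d2: "d2 > 0" "\<And>t. t \<in> {a..b} \<Longrightarrow> \<bar>t - r\<bar> < d2 \<Longrightarrow> y t \<in> domain c"
    using c(2) True by (auto intro: continuous_chart_nbhd[OF yc r chart(1)[OF c(1)]])
   have "P s t" if "s \<le> r" "r \<le> t" "t - s < min d1 d2" for s t
    unfolding P_def
   proof (intro impI ballI)
    fix \<tau> assume h: "a \<le> s" "s \<le> t" "t \<le> b" "x s = y s" "\<tau> \<in> {s..t}"
    have X: "x ` {s..t} \<subseteq> domain c" and Y: "y ` {s..t} \<subseteq> domain c"
     using d1(2) d2(2) that h by auto
    have "path c x \<tau> = path c y \<tau>"
    proof (rule isol_unique[OF ode_field[OF c(1) admissible_subinterval[OF adm h(1,3)] h(2) open_UNIV]
       msol_isol[OF x c(1) h(1-3) X] msol_isol[OF y c(1) h(1-3) Y] _ h(5)])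
    qed (simp add: path_def h(4))
    then have "coord c (x \<tau>) = coord c (y \<tau>)" unfolding path_def by (metis prj_emb)
    then show "x \<tau> = y \<tau>" using X Y h(5) chart(5)[OF c(1)] by (metis image_subset_iff)
   qed
   then show ?thesis using d1(1) d2(1) by (intro exI[of _ "min d1 d2"]) auto
  qed
 qed
 then show ?thesis using t assms(4) by (auto simp: P_def)
qed

text \<open>A solution found in one chart satisfies the equation in every other chart it meets,
  because the fields in two charts are related by the transition map.\<close>

lemma msol_of_isol:
 assumes adm: "admissible J w a b" and c: "c \<in> A" and y: "isol J w (chart_field c) (cdom c) a b y"
 shows "msol w a b (\<lambda>t. param c (prj (y t)))"
 unfolding msol_def
proof (intro conjI ballI allI impI)
 have ys: "continuous_on {a..b} y" "y ` {a..b} \<subseteq> cdom c" using y by (auto simp: isol_def)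
 show "continuous_on {a..b} (\<lambda>t. param c (prj (y t)))"
  by (rule continuous_on_compose2[OF chart(4)[OF c]
     bounded_linear.continuous_on[OF bounded_linear_prj ys(1)]]) (use ys(2) in \<open>auto simp: reg_iff\<close>)
 fix d a' b' assume d: "d \<in> A" and h: "a \<le> a' \<and> a' \<le> b' \<and> b' \<le> b \<and> (\<lambda>t. param c (prj (y t))) ` {a'..b'} \<subseteq> domain d"
 have mem: "y t \<in> reg c (domain d)" if "t \<in> {a'..b'}" for t
  using that h ys(2) by (auto simp: reg_iff image_subset_iff)
 have iso: "isol J w (chart_field c) (reg c (domain d)) a' b' y"
  using isol_subinterval[OF y, of a' b'] h mem by (auto simp: isol_def)
 have ode: "ode J w (chart_field c) (reg c (domain d)) a' b'"
  using h by (intro ode_field c chart d admissible_subinterval[OF adm]) auto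
 have "isol J w (chart_field d) (cdom d) a' b' (\<lambda>t. chart_change c d (y t))"
 proof (rule isol_image[OF ode iso])
  show "good (Suc (Suc 0)) (reg c (domain d)) (chart_change c d)" using smooth_trans[OF c d] by blast
  show "chart_change c d ` reg c (domain d) \<subseteq> cdom d" using trans_mem[OF c d, of _ UNIV] by auto
  show "fd (chart_change c d) z (chart_field c j z) = chart_field d j (chart_change c d z)" if "j \<in> J" "z \<in> reg c (domain d)" for j z
   using field_props[OF that(1)] c d that(2) by blast
 qed
 then show "isol J w (chart_field d) (cdom d) a' b' (path d (\<lambda>t. param c (prj (y t))))"
  by (simp add: chart_change_def elift_def path_def[abs_def])
qed

lemma isol_glue:
 assumes x: "isol J w F S a m x" and y: "isol J w F S m b x" and am: "a \<le> m" "m \<le> b"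
 shows "isol J w F S a b x"
 unfolding isol_def
proof (intro conjI ballI)
 have "continuous_on ({a..m} \<union> {m..b}) x"
  using x y by (intro continuous_on_closed_Un) (auto simp: isol_def)
 then show "continuous_on {a..b} x" using ivl_disj_un_two_touch(4)[OF am] by simp
 show "x ` {a..b} \<subseteq> S"
  using x y unfolding isol_def ivl_disj_un_two_touch(4)[OF am, symmetric] by auto
 fix t assume t: "t \<in> {a..b}"
 show "((\<lambda>s. rhs J w F s (x s)) has_integral x t - x a) {a..t}"
 proof (cases "t \<le> m")
  case True
  then show ?thesis using x t by (simp add: isol_def)
 next
  case False
  have 1: "((\<lambda>s. rhs J w F s (x s)) has_integral x m - x a) {a..m}"
   and 2: "((\<lambda>s. rhs J w F s (x s)) has_integral x t - x m) {m..t}"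
   using x y am t False by (auto simp: isol_def)
  show ?thesis using has_integral_combine[OF am(1) _ 1 2] False by simp
 qed
qed

lemma msol_glue:
 assumes x: "msol w a m x" and y: "msol w m b y" and "x m = y m" and am: "a \<le> m" "m \<le> b"
 shows "msol w a b (\<lambda>t. if t \<le> m then x t else y t)"
 unfolding msol_def
proof (intro conjI ballI allI impI)
 let ?z = "\<lambda>t. if t \<le> m then x t else y t"
 have zx: "?z t = x t" if "t \<in> {a..m}" for t using that by simp
 have zy: "?z t = y t" if "t \<in> {m..b}" for t using that assms(3) by auto
 have "continuous_on ({a..m} \<union> {m..b}) ?z"
  using x y zx zy continuous_on_cong[OF refl, of "{a..m}" ?z x] continuous_on_cong[OF refl, of "{m..b}" ?z y]
  by (intro continuous_on_closed_Un) (auto simp: msol_def)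
 then show "continuous_on {a..b} ?z" using ivl_disj_un_two_touch(4)[OF am] by simp
 fix c a' b' assume c: "c \<in> A" and h: "a \<le> a' \<and> a' \<le> b' \<and> b' \<le> b \<and> ?z ` {a'..b'} \<subseteq> domain c"
 have left: "isol J w (chart_field c) (cdom c) a1 b1 (path c ?z)" if "a' \<le> a1" "a1 \<le> b1" "b1 \<le> b'" "b1 \<le> m" for a1 b1
 proof -
  have e: "t \<in> {a1..b1} \<Longrightarrow> ?z t = x t" for t using that by simp
  have "x ` {a1..b1} \<subseteq> ?z ` {a'..b'}" using e that by (auto simp: image_iff intro!: bexI)
  then have "x ` {a1..b1} \<subseteq> domain c" using h by blast
  then have "isol J w (chart_field c) (cdom c) a1 b1 (path c x)"
   using h that by (intro msol_isol[OF x c]) auto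
  then show ?thesis
   by (subst isol_cong[where y = "path c x" and g = "chart_field c"]) (use e in \<open>auto simp: path_def\<close>)
 qed
 have right: "isol J w (chart_field c) (cdom c) a1 b1 (path c ?z)" if "a' \<le> a1" "a1 \<le> b1" "b1 \<le> b'" "m \<le> a1" for a1 b1
 proof -
  have e: "t \<in> {a1..b1} \<Longrightarrow> ?z t = y t" for t using that zy[of t] h by auto
  have "y ` {a1..b1} \<subseteq> ?z ` {a'..b'}"
  proof
   fix p assume "p \<in> y ` {a1..b1}"
   then obtain t where t: "t \<in> {a1..b1}" "p = y t" by auto
   then have "p = ?z t" "t \<in> {a'..b'}" using e that by auto
   then show "p \<in> ?z ` {a'..b'}" by blast
  qed
  then have "y ` {a1..b1} \<subseteq> domain c" using h by blast
  then have "isol J w (chart_field c) (cdom c) a1 b1 (path c y)"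
   using h that by (intro msol_isol[OF y c]) auto
  then show ?thesis
   by (subst isol_cong[where y = "path c y" and g = "chart_field c"]) (use e in \<open>auto simp: path_def\<close>)
 qed
 show "isol J w (chart_field c) (cdom c) a' b' (path c ?z)"
 proof (cases "b' \<le> m \<or> m \<le> a'")
  case True
  then show ?thesis using left[of a' b'] right[of a' b'] h by auto
 next
  case False
  then show ?thesis using isol_glue[OF left[of a' m] right[of m b']] h by auto
 qed
qed

definition mdom :: "(nat list \<Rightarrow> real \<Rightarrow> real) \<Rightarrow> real \<Rightarrow> real \<Rightarrow> 'a set" where
 "mdom w a b = {y. \<exists>z. msol w a b z \<and> z a = y}"

definition mflow :: "(nat list \<Rightarrow> real \<Rightarrow> real) \<Rightarrow> real \<Rightarrow> real \<Rightarrow> real \<Rightarrow> 'a \<Rightarrow> 'a" where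
 "mflow w a b t y = (SOME z. msol w a b z \<and> z a = y) t"

lemma mflow_msol:
 assumes "y \<in> mdom w a b"
 shows "msol w a b (\<lambda>t. mflow w a b t y)" "mflow w a b a y = y"
proof -
 have "\<exists>z. msol w a b z \<and> z a = y" using assms by (simp add: mdom_def)
 from someI_ex[OF this] show "msol w a b (\<lambda>t. mflow w a b t y)" "mflow w a b a y = y"
  by (auto simp: mflow_def)
qed

lemma mflow_eqI:
 assumes "admissible J w a b" "a \<le> b" "msol w a b z" "t \<in> {a..b}"
 shows "mflow w a b t (z a) = z t" "z a \<in> mdom w a b"
proof -
 show d: "z a \<in> mdom w a b" using assms(3) by (auto simp: mdom_def)
 show "mflow w a b t (z a) = z t"
  using msol_unique[OF assms(1) mflow_msol(1)[OF d] assms(3) mflow_msol(2)[OF d] assms(2,4)] .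
qed

lemma mflow_trans:
 assumes adm: "admissible J w a b" and am: "a \<le> m" "m \<le> b"
  and y: "y \<in> mdom w a m" "mflow w a m m y \<in> mdom w m b"
 shows "y \<in> mdom w a b" "t \<in> {a..m} \<Longrightarrow> mflow w a b t y = mflow w a m t y"
  "t \<in> {m..b} \<Longrightarrow> mflow w a b t y = mflow w m b t (mflow w a m m y)"
proof -
 note 1 = mflow_msol[OF y(1)] and 2 = mflow_msol[OF y(2)]
 let ?z = "\<lambda>t. if t \<le> m then mflow w a m t y else mflow w m b t (mflow w a m m y)"
 have z: "msol w a b ?z" using msol_glue[OF 1(1) 2(1) _ am] 2(2) by simp
 have za: "?z a = y" using am 1(2) by simp
 show "y \<in> mdom w a b" using z za by (auto simp: mdom_def)
 have *: "mflow w a b t y = ?z t" if "t \<in> {a..b}" for t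
  using mflow_eqI(1)[OF adm _ z that] za am by simp
 show "mflow w a b t y = mflow w a m t y" if "t \<in> {a..m}" using *[of t] that am by simp
 show "mflow w a b t y = mflow w m b t (mflow w a m m y)" if "t \<in> {m..b}"
  using *[of t] that am 2(2) by (cases "t = m") auto
qed

end

lemma jet_conv_subset: "jet_conv \<F> T k G \<xi>0 l \<Longrightarrow> T' \<subseteq> T \<Longrightarrow> jet_conv \<F> T' k G \<xi>0 l"
 unfolding jet_conv_def
proof (intro allI impI)
 fix \<epsilon> :: real
 assume *: "\<forall>\<epsilon>>0. \<exists>\<delta>>0. \<forall>\<^sub>F w in \<F>. \<forall>t\<in>T. jet_near k \<xi>0 \<delta> (G w t) (l t) \<epsilon>" and "T' \<subseteq> T" "\<epsilon> > 0"
 obtain \<delta> where "\<delta> > 0" and ev: "\<forall>\<^sub>F w in \<F>. \<forall>t\<in>T. jet_near k \<xi>0 \<delta> (G w t) (l t) \<epsilon>" using *[rule_format, OF \<open>\<epsilon> > 0\<close>] by blast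
 have "\<forall>\<^sub>F w in \<F>. \<forall>t\<in>T'. jet_near k \<xi>0 \<delta> (G w t) (l t) \<epsilon>"
  by (rule eventually_mono[OF ev]) (use \<open>T' \<subseteq> T\<close> in blast)
 then show "\<exists>\<delta>>0. \<forall>\<^sub>F w in \<F>. \<forall>t\<in>T'. jet_near k \<xi>0 \<delta> (G w t) (l t) \<epsilon>" using \<open>\<delta> > 0\<close> by blast
qed

lemma jet_conv_Un:
 assumes "jet_conv \<F> D1 k G \<xi>0 l1" "jet_conv \<F> D2 k G \<xi>0 l2"
 shows "jet_conv \<F> (D1 \<union> D2) k G \<xi>0 (\<lambda>t. if t \<in> D1 then l1 t else l2 t)"
 unfolding jet_conv_def
proof (intro allI impI)
 fix \<epsilon> :: real assume \<epsilon>: "\<epsilon> > 0"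
 from jet_convD[OF assms(1) \<epsilon>] obtain \<delta>1 where 1: "\<delta>1 > 0" "\<forall>\<^sub>F w in \<F>. \<forall>t\<in>D1.
   jet_near k \<xi>0 \<delta>1 (G w t) (l1 t) \<epsilon>"
  by blast
 from jet_convD[OF assms(2) \<epsilon>] obtain \<delta>2 where 2: "\<delta>2 > 0" "\<forall>\<^sub>F w in \<F>. \<forall>t\<in>D2.
   jet_near k \<xi>0 \<delta>2 (G w t) (l2 t) \<epsilon>"
  by blast
 from jet_conv_shrink[OF 1(1) 2(1) 1(2)] jet_conv_shrink[OF 2(1) 1(1) 2(2)]
 have "\<forall>\<^sub>F w in \<F>. \<forall>t\<in>D1 \<union> D2. jet_near k \<xi>0 (min \<delta>1 \<delta>2) (G w t) (if t \<in> D1 then l1 t else l2 t) \<epsilon>"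
 proof eventually_elim
  case (elim w)
  then show ?case unfolding min.commute[of \<delta>2 \<delta>1] by (simp split: if_split) blast
 qed
 then show "\<exists>\<delta>>0. \<forall>\<^sub>F w in \<F>. \<forall>t\<in>D1 \<union> D2. jet_near k \<xi>0 \<delta> (G w t) (if t \<in> D1 then l1 t else l2 t) \<epsilon>"
  using 1(1) 2(1) by (intro exI[of _ "min \<delta>1 \<delta>2"]) auto
qed

section \<open>Convergence of flows, chart by chart and along the whole curve\<close>

context control_manifold
begin

text \<open>For \<open>h\<close> two choices occur: a coordinate map, when jets are handed over at
  an intermediate time, and the embedding, when they are evaluated.\<close>

definition rep :: "('a \<Rightarrow> 'w::euclidean_space) \<Rightarrow> ('a \<Rightarrow> 'a) \<Rightarrow> ('a, 'n) chart \<Rightarrow> linf \<Rightarrow> linf" where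
 "rep h \<Phi> c = elift (\<lambda>y. h (\<Phi> (param c y)))"

lemma flow_mflow:
 assumes adm: "admissible J w a b" and ab: "a \<le> b" and c: "c \<in> A" and p: "p \<in> domain c"
  and d: "emb (coord c p) \<in> flow_dom J w (chart_field c) (cdom c) a b" and t: "t \<in> {a..b}"
 shows "p \<in> mdom w a b"
  "mflow w a b t p = param c (prj (flow J w (chart_field c) (cdom c) a b t (emb (coord c p))))"
proof -
 let ?z = "\<lambda>t. param c (prj (flow J w (chart_field c) (cdom c) a b t (emb (coord c p))))"
 have z: "msol w a b ?z" using msol_of_isol[OF adm c flow_isol(1)[OF d]] .
 have za: "?z a = p" using flow_isol(2)[OF d] chart(5)[OF c p] by simp
 show "p \<in> mdom w a b" "mflow w a b t p = ?z t"
  using mflow_eqI[OF adm ab z t] za by simp_all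
qed

lemma continuous_flow_path:
 assumes "msol v a b x" "c \<in> A" "a \<le> b" "x ` {a..b} \<subseteq> domain c" "admissible J v a b" "t \<in> {a..b}"
 shows "path c x a \<in> flow_dom J v (chart_field c) (cdom c) a b"
  "flow J v (chart_field c) (cdom c) a b t (path c x a) = path c x t"
proof -
 have i: "isol J v (chart_field c) (cdom c) a b (path c x)" using msol_isol[OF assms(1,2)] assms(3,4) by simp
 show "path c x a \<in> flow_dom J v (chart_field c) (cdom c) a b"
  "flow J v (chart_field c) (cdom c) a b t (path c x a) = path c x t"
  using flow_eqI[OF ode_field[OF assms(2,5,3) open_UNIV] i assms(6)] by auto
qed

text \<open>While the curve stays in the chart \<open>c0\<close>, the flow read from
  \<open>c\<close> into \<open>h\<close> is a change of charts followed by the flow in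
  \<open>c0\<close> and by \<open>h\<close> read in \<open>c0\<close>; the corresponding convergence
  lemmas are composed. The agreement with the flow on the manifold is established near the base
  point only, which is enough for jets.\<close>

lemma local_jet_conv:
 assumes tr: "tracks J T v \<F>" and v: "admissible J v 0 T" and ab: "0 \<le> a" "a \<le> b" "b \<le> T"
  and x: "msol v a b x" and c0: "c0 \<in> A" "x ` {a..b} \<subseteq> domain c0" and c: "c \<in> A" "x a \<in> domain c"
  and \<xi>0: "prj ((base ^^ k) \<xi>0) = coord c (x a)"
  and D: "D \<subseteq> {a..b}" "compact D" and V: "open V" "x ` D \<subseteq> V"
  and h: "smooth_on (coord c0 ` (domain c0 \<inter> V)) (h \<circ> param c0)"
 obtains l where "jet_conv \<F> D k (\<lambda>w t. rep h (mflow w a b t) c) \<xi>0 l"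
  "\<And>t. t \<in> D \<Longrightarrow> (base ^^ k) (l t) = emb (h (x t))"
proof -
 let ?G = "chart_change c c0" and ?H = "elift (h \<circ> param c0)"
 let ?fl = "\<lambda>w t. flow J w (chart_field c0) (cdom c0) a b t"
 have adm: "admissible J v a b" using admissible_subinterval[OF v ab(1,3)] .
 have xa: "x a \<in> domain c0" using c0(2) ab(2) by auto
 have mem: "(base ^^ k) \<xi>0 \<in> reg c (domain c0)"
  using c xa by (simp add: reg_iff \<xi>0 chart)
 define \<eta> where "\<eta> = (tlift ^^ k) ?G \<xi>0"
 have b\<eta>: "(base ^^ k) \<eta> = path c0 x a"
  using c by (simp add: \<eta>_def base_tlift_funpow chart_change_def elift_def \<xi>0 path_def chart)
 have smG: "smooth (reg c (domain c0)) ?G" using smooth_trans[OF c(1) c0(1)] .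
 have opG: "open (reg c (domain c0))" using open_reg[OF c(1) chart(1)[OF c0(1)]] .
 note jc1 = jet_conv_const[OF opG smG mem, of \<F> "{a}", folded \<eta>_def]
 have dom: "(base ^^ k) \<eta> \<in> flow_dom J v (chart_field c0) (cdom c0) a b"
  unfolding b\<eta> using continuous_flow_path(1)[OF x c0(1) ab(2) c0(2) adm, of a] ab(2) by simp
 note jf = jet_conv_flow[OF tr finite_words v words(1) open_reg[OF c0(1) open_UNIV]
   bracket_family_field[OF c0(1)] ab dom]
 define l' where "l' t = (tlift ^^ k) (?fl v t) \<eta>" for t
 have bl': "(base ^^ k) (l' t) = path c0 x t" if "t \<in> D" for t
  using continuous_flow_path(2)[OF x c0(1) ab(2) c0(2) adm, of t] that D(1)
  by (auto simp: l'_def base_tlift_funpow b\<eta>)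
 have "compact (l' ` D)"
  using continuous_on_subset[OF jf(3) D(1)] D(2) unfolding l'_def[abs_def] by (rule compact_continuous_image)
 moreover have "(base ^^ k) (l' t) \<in> reg c0 V" if "t \<in> D" for t
  using that D(1) V(2) c0 reg_emb[OF c0(1), of "x t" V]
  by (auto simp: bl' path_def image_subset_iff subset_iff)
 ultimately have jc3: "jet_conv \<F> D k (\<lambda>w t X. ?H (?fl w t X)) \<eta> (\<lambda>t. (tlift ^^ k) ?H (l' t))"
  unfolding l'_def
  by (intro jet_conv_post[OF jet_conv_subset[OF jf(1) D(1)] open_reg[OF c0(1) V(1)]
     smooth_elift_reg[OF c0(1) V(1) h]]) (auto simp: l'_def)
 have jc4: "jet_conv \<F> D k (\<lambda>w t X. ?H (?fl w t (?G X))) \<xi>0 (\<lambda>t. (tlift ^^ k) ?H (l' t))"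
  by (rule jet_conv_compose[OF jc1 jc3])
 obtain \<delta>1 where \<delta>1: "\<delta>1 > 0" "\<forall>\<^sub>F w in \<F>. ball ((base ^^ k) \<eta>) \<delta>1 \<subseteq> flow_dom J w (chart_field c0) (cdom c0) a b"
  using jf(2) by blast
 have "open (reg c (domain c0) \<inter> ?G -` ball ((base ^^ k) \<eta>) \<delta>1)"
  using good_imp_continuous[OF smG[rule_format, of 0]] opG by (rule continuous_open_preimage) simp
 moreover have "(base ^^ k) \<xi>0 \<in> reg c (domain c0) \<inter> ?G -` ball ((base ^^ k) \<eta>) \<delta>1"
  using mem \<delta>1(1) by (simp add: \<eta>_def base_tlift_funpow)
 ultimately obtain \<delta>0 where \<delta>0: "\<delta>0 > 0"
  "ball ((base ^^ k) \<xi>0) \<delta>0 \<subseteq> reg c (domain c0) \<inter> ?G -` ball ((base ^^ k) \<eta>) \<delta>1"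
  by (rule openE)
 have adm': "\<forall>\<^sub>F w in \<F>. admissible J w 0 T" using tr by (simp add: tracks_def)
 have "\<forall>\<^sub>F w in \<F>. \<forall>t\<in>D. \<forall>X\<in>ball ((base ^^ k) \<xi>0) \<delta>0. ?H (?fl w t (?G X)) = rep h (mflow w a b t) c X"
  using \<delta>1(2) adm'
 proof eventually_elim
  case (elim w)
  show ?case
  proof (intro ballI)
   fix t X assume t: "t \<in> D" and X: "X \<in> ball ((base ^^ k) \<xi>0) \<delta>0"
   let ?p = "param c (prj X)"
   have p: "?p \<in> domain c0" using X \<delta>0(2) by (auto simp: reg_iff)
   have GX: "?G X = emb (coord c0 ?p)" by (simp add: chart_change_def elift_def)
   have "emb (coord c0 ?p) \<in> flow_dom J w (chart_field c0) (cdom c0) a b"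
    using X \<delta>0(2) elim(1) unfolding GX[symmetric] by auto
   from flow_mflow(2)[OF admissible_subinterval[OF elim(2) ab(1,3)] ab(2) c0(1) p this, of t] t D(1)
   show "?H (?fl w t (?G X)) = rep h (mflow w a b t) c X"
    by (auto simp: rep_def elift_def GX)
  qed
 qed
 then have "jet_conv \<F> D k (\<lambda>w t. rep h (mflow w a b t) c) \<xi>0 (\<lambda>t. (tlift ^^ k) ?H (l' t))"
  by (rule jet_conv_cong[OF jc4 \<delta>0(1)])
 moreover have "(base ^^ k) ((tlift ^^ k) ?H (l' t)) = emb (h (x t))" if "t \<in> D" for t
  using bl'[OF that] c0 that D(1) by (auto simp: base_tlift_funpow elift_def path_def chart image_subset_iff subset_iff)
 ultimately show ?thesis by (rule that)
qed

text \<open>The case \<open>k = 0\<close> of the convergence of flows, read in the chart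
  \<open>c0\<close>.\<close>

lemma local_existence:
 assumes tr: "tracks J T v \<F>" and v: "admissible J v 0 T" and ab: "0 \<le> a" "a \<le> b" "b \<le> T"
  and x: "msol v a b x" and c0: "c0 \<in> A" "x ` {a..b} \<subseteq> domain c0" and V: "open V" "x b \<in> V"
 obtains W where "open W" "x a \<in> W" "\<forall>\<^sub>F w in \<F>. \<forall>y\<in>W. y \<in> mdom w a b \<and> mflow w a b b y \<in> V"
proof -
 let ?fl = "\<lambda>w t. flow J w (chart_field c0) (cdom c0) a b t"
 have adm: "admissible J v a b" using admissible_subinterval[OF v ab(1,3)] .
 have xab: "x a \<in> domain c0" "x b \<in> domain c0" using c0(2) ab(2) by auto
 have dom: "(base ^^ 0) (path c0 x a) \<in> flow_dom J v (chart_field c0) (cdom c0) a b"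
  using continuous_flow_path(1)[OF x c0(1) ab(2) c0(2) adm, of a] ab(2) by simp
 note jf = jet_conv_flow[OF tr finite_words v words(1) open_reg[OF c0(1) open_UNIV]
   bracket_family_field[OF c0(1)] ab dom]
 have "path c0 x b \<in> reg c0 V" using reg_emb[OF c0(1) xab(2)] V(2) by (simp add: path_def)
 then obtain \<epsilon> where \<epsilon>: "\<epsilon> > 0" "ball (path c0 x b) \<epsilon> \<subseteq> reg c0 V"
  using openE[OF open_reg[OF c0(1) V(1)]] by blast
 obtain \<delta>1 where \<delta>1: "\<delta>1 > 0" "\<forall>\<^sub>F w in \<F>. ball (path c0 x a) \<delta>1 \<subseteq> flow_dom J w (chart_field c0) (cdom c0) a b"
  using jf(2) by auto
 from jet_convD[OF jf(1) \<epsilon>(1)] obtain \<delta>2 where "\<delta>2 > 0" and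
  ev: "\<forall>\<^sub>F w in \<F>. \<forall>t\<in>{a..b}. good 0 (ball ((base ^^ 0) (path c0 x a)) \<delta>2) (?fl w t) \<and>
   (\<forall>\<xi>\<in>ball (path c0 x a) \<delta>2. norm ((tlift ^^ 0) (?fl w t) \<xi> - (tlift ^^ 0) (?fl v t) (path c0 x a)) < \<epsilon>)"
  by blast
 have \<delta>2: "\<delta>2 > 0" "\<forall>\<^sub>F w in \<F>. \<forall>t\<in>{a..b}. \<forall>\<xi>\<in>ball (path c0 x a) \<delta>2.
   norm (?fl w t \<xi> - ?fl v t (path c0 x a)) < \<epsilon>"
  by fact (rule eventually_mono[OF ev], simp)
 define W where "W = domain c0 \<inter> (\<lambda>p. emb (coord c0 p)) -` ball (path c0 x a) (min \<delta>1 \<delta>2)"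
 have "open W"
  unfolding W_def using chart(1)[OF c0(1)]
  by (intro continuous_open_preimage bounded_linear.continuous_on[OF bounded_linear_emb] chart(3)[OF c0(1)]) auto
 moreover have "x a \<in> W" using xab \<delta>1(1) \<delta>2(1) by (simp add: W_def path_def)
 moreover have adm': "\<forall>\<^sub>F w in \<F>. admissible J w 0 T" using tr by (simp add: tracks_def)
 have "\<forall>\<^sub>F w in \<F>. \<forall>y\<in>W. y \<in> mdom w a b \<and> mflow w a b b y \<in> V"
  using \<delta>1(2) \<delta>2(2) adm'
 proof eventually_elim
  case (elim w)
  show ?case
  proof (intro ballI)
   fix y assume y: "y \<in> W"
   have yd: "y \<in> domain c0" "emb (coord c0 y) \<in> ball (path c0 x a) \<delta>1" "emb (coord c0 y) \<in> ball (path c0 x a) \<delta>2"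
    using y by (auto simp: W_def)
   have "emb (coord c0 y) \<in> flow_dom J w (chart_field c0) (cdom c0) a b" using elim(1) yd(2) by blast
   note m = flow_mflow[OF admissible_subinterval[OF elim(3) ab(1,3)] ab(2) c0(1) yd(1) this, of b]
   have "norm (?fl w b (emb (coord c0 y)) - path c0 x b) < \<epsilon>"
    using elim(2) yd(3) ab(2) continuous_flow_path(2)[OF x c0(1) ab(2) c0(2) adm, of b] by force
   then have "?fl w b (emb (coord c0 y)) \<in> reg c0 V"
    using \<epsilon>(2) by (auto simp: dist_norm norm_minus_commute)
   then show "y \<in> mdom w a b \<and> mflow w a b b y \<in> V" using m ab(2) by (auto simp: reg_iff)
  qed
 qed
 ultimately show ?thesis by (rule that)
qed

text \<open>The clauses support each other when intervals are joined: the first keeps intermediate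
  points where the next flow is defined, the second hands over jets at the end time in charts. The
  third is the wanted uniform convergence; its target is the embedding because the curve need not
  stay in one chart.\<close>

definition flow_conv ::
 "('a \<Rightarrow> real ^ 'm) \<Rightarrow> (nat list \<Rightarrow> real \<Rightarrow> real) filter \<Rightarrow> (real \<Rightarrow> 'a) \<Rightarrow> real \<Rightarrow> real \<Rightarrow> bool" where
 "flow_conv \<iota> \<F> x a b \<longleftrightarrow>
  (\<forall>V. open V \<longrightarrow> x b \<in> V \<longrightarrow> (\<exists>W. open W \<and> x a \<in> W \<and>
   (\<forall>\<^sub>F w in \<F>. \<forall>y\<in>W. y \<in> mdom w a b \<and> mflow w a b b y \<in> V))) \<and>
  (\<forall>c\<in>A. \<forall>d\<in>A. \<forall>k \<xi>0. x a \<in> domain c \<longrightarrow> x b \<in> domain d \<longrightarrow> prj ((base ^^ k) \<xi>0) = coord c (x a) \<longrightarrow>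
   (\<exists>l. prj ((base ^^ k) l) = coord d (x b) \<and>
    jet_conv \<F> {b} k (\<lambda>w t. rep (coord d) (mflow w a b t) c) \<xi>0 (\<lambda>_. l))) \<and>
  (\<forall>c\<in>A. \<forall>k \<xi>0. x a \<in> domain c \<longrightarrow> prj ((base ^^ k) \<xi>0) = coord c (x a) \<longrightarrow>
   (\<exists>l. jet_conv \<F> {a..b} k (\<lambda>w t. rep \<iota> (mflow w a b t) c) \<xi>0 l))"

lemma flow_conv_local:
 assumes tr: "tracks J T v \<F>" and v: "admissible J v 0 T" and ab: "0 \<le> a" "a \<le> b" "b \<le> T"
  and x: "msol v a b x" and c0: "c0 \<in> A" "x ` {a..b} \<subseteq> domain c0" and \<iota>: "smooth_map A \<iota>"
 shows "flow_conv \<iota> \<F> x a b"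
 unfolding flow_conv_def
proof (intro conjI allI ballI impI)
 show "\<exists>W. open W \<and> x a \<in> W \<and> (\<forall>\<^sub>F w in \<F>. \<forall>y\<in>W. y \<in> mdom w a b \<and> mflow w a b b y \<in> V)"
  if "open V" "x b \<in> V" for V
  by (rule local_existence[OF tr v ab x c0 that]) blast
 fix c and k :: nat and \<xi>0 assume c: "c \<in> A" "x a \<in> domain c" "prj ((base ^^ k) \<xi>0) = coord c (x a)"
 have "smooth_on (coord c0 ` (domain c0 \<inter> UNIV)) (\<iota> \<circ> param c0)"
  using \<iota> c0(1) by (simp add: smooth_map_def)
 then show "\<exists>l. jet_conv \<F> {a..b} k (\<lambda>w t. rep \<iota> (mflow w a b t) c) \<xi>0 l"
  by (rule local_jet_conv[OF tr v ab x c0 c order_refl compact_Icc open_UNIV subset_UNIV]) blast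
 fix d assume d: "d \<in> A" "x b \<in> domain d"
 have sm: "smooth_on (coord c0 ` (domain c0 \<inter> domain d)) (coord d \<circ> param c0)"
  using atlas c0(1) d(1) by (simp add: smooth_atlas_def)
 obtain l where l: "jet_conv \<F> {b} k (\<lambda>w t. rep (coord d) (mflow w a b t) c) \<xi>0 l"
  "\<And>t. t \<in> {b} \<Longrightarrow> (base ^^ k) (l t) = emb (coord d (x t))"
  by (rule local_jet_conv[OF tr v ab x c0 c _ _ chart(1)[OF d(1)] _ sm, of "{b}"])
   (use ab d in auto)
 have "jet_conv \<F> {b} k (\<lambda>w t. rep (coord d) (mflow w a b t) c) \<xi>0 (\<lambda>_. l b)"
  using l(1) by (simp add: jet_conv_def)
 moreover have "prj ((base ^^ k) (l b)) = coord d (x b)" using l(2)[of b] by simp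
 ultimately show "\<exists>l. prj ((base ^^ k) l) = coord d (x b) \<and>
   jet_conv \<F> {b} k (\<lambda>w t. rep (coord d) (mflow w a b t) c) \<xi>0 (\<lambda>_. l)" by blast
qed

lemma flow_conv_compose:
 fixes h :: "'a \<Rightarrow> 'w::euclidean_space"
 assumes e: "e \<in> A"
  and W: "\<forall>\<^sub>F w in \<F>. \<forall>y\<in>W. mflow w a m m y \<in> domain e \<and>
   (\<forall>t\<in>{m..b}. mflow w a b t y = mflow w m b t (mflow w a m m y))"
  and \<delta>0: "\<delta>0 > 0" "ball ((base ^^ k) \<xi>0) \<delta>0 \<subseteq> reg c W"
  and l1: "jet_conv \<F> {m} k (\<lambda>w t. rep (coord e) (mflow w a m t) c) \<xi>0 (\<lambda>_. l1)"
  and D: "D \<subseteq> {m..b}" and jc: "jet_conv \<F> D k (\<lambda>w t. rep h (mflow w m b t) e) l1 l"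
 shows "jet_conv \<F> D k (\<lambda>w t. rep h (mflow w a b t) c) \<xi>0 l"
proof (rule jet_conv_cong[OF jet_conv_compose[OF l1 jc] \<delta>0(1)])
 from W show "\<forall>\<^sub>F w in \<F>. \<forall>t\<in>D. \<forall>X\<in>ball ((base ^^ k) \<xi>0) \<delta>0.
   rep h (mflow w m b t) e (rep (coord e) (mflow w a m m) c X) = rep h (mflow w a b t) c X"
 proof eventually_elim
  case (elim w)
  show ?case
  proof (intro ballI)
   fix t X assume t: "t \<in> D" and X: "X \<in> ball ((base ^^ k) \<xi>0) \<delta>0"
   have p: "param c (prj X) \<in> W" using X \<delta>0(2) by (auto simp: reg_iff)
   then show "rep h (mflow w m b t) e (rep (coord e) (mflow w a m m) c X) = rep h (mflow w a b t) c X"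
    using elim t D chart(5)[OF e] by (auto simp: rep_def elift_def)
  qed
 qed
qed

text \<open>The jets at time m, read in a chart \<open>e\<close> around \<open>x m\<close>, are the
  initial jets for the second interval. For eventually all controls the composed flow and the flow
  over the joined interval agree near the initial point, by uniqueness of solutions.\<close>

lemma flow_conv_trans:
 assumes adm: "\<forall>\<^sub>F w in \<F>. admissible J w 0 T" and am: "0 \<le> a" "a \<le> m" "m \<le> b" "b \<le> T"
  and P1: "flow_conv \<iota> \<F> x a m" and P2: "flow_conv \<iota> \<F> x m b"
 shows "flow_conv \<iota> \<F> x a b"
proof -
 obtain e where e: "e \<in> A" "x m \<in> domain e" using chart_exists by blast
 have E1: "\<exists>W. open W \<and> x a \<in> W \<and> (\<forall>\<^sub>F w in \<F>. \<forall>y\<in>W. y \<in> mdom w a m \<and> mflow w a m m y \<in> V)"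
  if "open V" "x m \<in> V" for V using P1 that unfolding flow_conv_def by blast
 have E2: "\<exists>W. open W \<and> x m \<in> W \<and> (\<forall>\<^sub>F w in \<F>. \<forall>y\<in>W. y \<in> mdom w m b \<and> mflow w m b b y \<in> V)"
  if "open V" "x b \<in> V" for V using P2 that unfolding flow_conv_def by blast
 note C1 = P1[unfolded flow_conv_def, THEN conjunct2, THEN conjunct1, rule_format]
  and U1 = P1[unfolded flow_conv_def, THEN conjunct2, THEN conjunct2, rule_format]
  and C2 = P2[unfolded flow_conv_def, THEN conjunct2, THEN conjunct1, rule_format]
  and U2 = P2[unfolded flow_conv_def, THEN conjunct2, THEN conjunct2, rule_format]
 have glue: "\<exists>W. open W \<and> x a \<in> W \<and> (\<forall>\<^sub>F w in \<F>. \<forall>y\<in>W. mflow w a m m y \<in> domain e \<and> y \<in> mdom w a b \<and>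
   mflow w a b b y \<in> V \<and> (\<forall>t\<in>{a..m}. mflow w a b t y = mflow w a m t y) \<and>
   (\<forall>t\<in>{m..b}. mflow w a b t y = mflow w m b t (mflow w a m m y)))"
  if V: "open V" "x b \<in> V" for V
 proof -
  obtain W2 where W2: "open W2" "x m \<in> W2" "\<forall>\<^sub>F w in \<F>. \<forall>y\<in>W2. y \<in> mdom w m b \<and> mflow w m b b y \<in> V"
   using E2[OF V] by blast
  obtain W where W: "open W" "x a \<in> W"
   "\<forall>\<^sub>F w in \<F>. \<forall>y\<in>W. y \<in> mdom w a m \<and> mflow w a m m y \<in> domain e \<inter> W2"
   using E1[of "domain e \<inter> W2"] W2(1,2) e chart(1)[OF e(1)] by blast
  from W(3) W2(3) adm have "\<forall>\<^sub>F w in \<F>. \<forall>y\<in>W. mflow w a m m y \<in> domain e \<and> y \<in> mdom w a b \<and>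
   mflow w a b b y \<in> V \<and> (\<forall>t\<in>{a..m}. mflow w a b t y = mflow w a m t y) \<and>
   (\<forall>t\<in>{m..b}. mflow w a b t y = mflow w m b t (mflow w a m m y))"
  proof eventually_elim
   case (elim w)
   show ?case
   proof (intro ballI)
    fix y assume y: "y \<in> W"
    have h: "y \<in> mdom w a m" "mflow w a m m y \<in> domain e" "mflow w a m m y \<in> mdom w m b"
     "mflow w m b b (mflow w a m m y) \<in> V" using elim(1,2) y by auto
    have aw: "admissible J w a b" using admissible_subinterval[OF elim(3) am(1,4)] .
    note tr = mflow_trans[OF aw am(2,3) h(1,3)]
    show "mflow w a m m y \<in> domain e \<and> y \<in> mdom w a b \<and>
     mflow w a b b y \<in> V \<and> (\<forall>t\<in>{a..m}. mflow w a b t y = mflow w a m t y) \<and>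
     (\<forall>t\<in>{m..b}. mflow w a b t y = mflow w m b t (mflow w a m m y))"
     using tr h am by auto
   qed
  qed
  then show ?thesis using W(1,2) by blast
 qed
 obtain W where W: "open W" "x a \<in> W" and ev: "\<forall>\<^sub>F w in \<F>. \<forall>y\<in>W. mflow w a m m y \<in> domain e \<and>
   y \<in> mdom w a b \<and> mflow w a b b y \<in> UNIV \<and> (\<forall>t\<in>{a..m}. mflow w a b t y = mflow w a m t y) \<and>
   (\<forall>t\<in>{m..b}. mflow w a b t y = mflow w m b t (mflow w a m m y))"
  using glue[OF open_UNIV UNIV_I] by blast
 have W3: "\<forall>\<^sub>F w in \<F>. \<forall>y\<in>W. mflow w a m m y \<in> domain e \<and>
   (\<forall>t\<in>{m..b}. mflow w a b t y = mflow w m b t (mflow w a m m y))"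
  and W4: "\<forall>\<^sub>F w in \<F>. \<forall>y\<in>W. \<forall>t\<in>{a..m}. mflow w a b t y = mflow w a m t y"
  by (rule eventually_mono[OF ev], simp)+
 have near: "\<exists>\<delta>>0. ball ((base ^^ k) \<xi>0) \<delta> \<subseteq> reg c W"
  if "c \<in> A" "x a \<in> domain c" "prj ((base ^^ k) \<xi>0) = coord c (x a)" for c k \<xi>0
 proof -
  have "(base ^^ k) \<xi>0 \<in> reg c W" using that W(2) by (simp add: reg_iff chart)
  then show ?thesis using open_reg[OF that(1) W(1)] open_contains_ball by blast
 qed
 show ?thesis
  unfolding flow_conv_def
 proof (intro conjI allI ballI impI)
  show "\<exists>W. open W \<and> x a \<in> W \<and> (\<forall>\<^sub>F w in \<F>. \<forall>y\<in>W. y \<in> mdom w a b \<and> mflow w a b b y \<in> V)"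
   if V: "open V" "x b \<in> V" for V
  proof -
   obtain W where W: "open W" "x a \<in> W" and ev: "\<forall>\<^sub>F w in \<F>. \<forall>y\<in>W. mflow w a m m y \<in> domain e \<and>
     y \<in> mdom w a b \<and> mflow w a b b y \<in> V \<and> (\<forall>t\<in>{a..m}. mflow w a b t y = mflow w a m t y) \<and>
     (\<forall>t\<in>{m..b}. mflow w a b t y = mflow w m b t (mflow w a m m y))"
    using glue[OF V] by blast
   have "\<forall>\<^sub>F w in \<F>. \<forall>y\<in>W. y \<in> mdom w a b \<and> mflow w a b b y \<in> V"
    by (rule eventually_mono[OF ev]) simp
   then show ?thesis using W by blast
  qed
  fix c and k :: nat and \<xi>0 assume c: "c \<in> A" "x a \<in> domain c" "prj ((base ^^ k) \<xi>0) = coord c (x a)"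
  show "\<exists>l. prj ((base ^^ k) l) = coord d (x b) \<and>
    jet_conv \<F> {b} k (\<lambda>w t. rep (coord d) (mflow w a b t) c) \<xi>0 (\<lambda>_. l)"
   if d: "d \<in> A" "x b \<in> domain d" for d
  proof -
   obtain \<delta>0 where \<delta>0: "\<delta>0 > 0" "ball ((base ^^ k) \<xi>0) \<delta>0 \<subseteq> reg c W" using near[OF c] by blast
   obtain l1 where l1: "prj ((base ^^ k) l1) = coord e (x m)"
    "jet_conv \<F> {m} k (\<lambda>w t. rep (coord e) (mflow w a m t) c) \<xi>0 (\<lambda>_. l1)"
    using C1[OF c(1) e(1) c(2) e(2) c(3)] by blast
   obtain l2 where l2: "prj ((base ^^ k) l2) = coord d (x b)"
    "jet_conv \<F> {b} k (\<lambda>w t. rep (coord d) (mflow w m b t) e) l1 (\<lambda>_. l2)"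
    using C2[OF e(1) d(1) e(2) d(2) l1(1)] by blast
   have "jet_conv \<F> {b} k (\<lambda>w t. rep (coord d) (mflow w a b t) c) \<xi>0 (\<lambda>_. l2)"
    by (rule flow_conv_compose[OF e(1) W3 \<delta>0 l1(2) _ l2(2)]) (use am in simp)
   with l2(1) show ?thesis by blast
  qed
  obtain \<delta>0 where \<delta>0: "\<delta>0 > 0" "ball ((base ^^ k) \<xi>0) \<delta>0 \<subseteq> reg c W" using near[OF c] by blast
  obtain l1 where l1: "prj ((base ^^ k) l1) = coord e (x m)"
   "jet_conv \<F> {m} k (\<lambda>w t. rep (coord e) (mflow w a m t) c) \<xi>0 (\<lambda>_. l1)"
   using C1[OF c(1) e(1) c(2) e(2) c(3)] by blast
  obtain l2 where l2: "jet_conv \<F> {m..b} k (\<lambda>w t. rep \<iota> (mflow w m b t) e) l1 l2"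
   using U2[OF e l1(1)] by blast
  obtain l3 where l3: "jet_conv \<F> {a..m} k (\<lambda>w t. rep \<iota> (mflow w a m t) c) \<xi>0 l3"
   using U1[OF c] by blast
  have "jet_conv \<F> {a..m} k (\<lambda>w t. rep \<iota> (mflow w a b t) c) \<xi>0 l3"
  proof (rule jet_conv_cong[OF l3 \<delta>0(1)])
   from W4 show "\<forall>\<^sub>F w in \<F>. \<forall>t\<in>{a..m}. \<forall>X\<in>ball ((base ^^ k) \<xi>0) \<delta>0.
     rep \<iota> (mflow w a m t) c X = rep \<iota> (mflow w a b t) c X"
   proof eventually_elim
    case (elim w)
    show ?case
    proof (intro ballI)
     fix t X assume t: "t \<in> {a..m}" and X: "X \<in> ball ((base ^^ k) \<xi>0) \<delta>0"
     have "param c (prj X) \<in> W" using X \<delta>0(2) by (auto simp: reg_iff)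
     then show "rep \<iota> (mflow w a m t) c X = rep \<iota> (mflow w a b t) c X"
      using elim t by (auto simp: rep_def elift_def)
    qed
   qed
  qed
  from jet_conv_Un[OF this flow_conv_compose[OF e(1) W3 \<delta>0 l1(2) order_refl l2]]
  show "\<exists>l. jet_conv \<F> {a..b} k (\<lambda>w t. rep \<iota> (mflow w a b t) c) \<xi>0 l"
   using ivl_disj_un_two_touch(4)[OF am(2,3)] by auto
 qed
qed

lemma flow_conv_global:
 assumes tr: "tracks J T v \<F>" and v: "admissible J v 0 T" and T: "0 \<le> T"
  and x: "msol v 0 T x" and \<iota>: "smooth_map A \<iota>"
 shows "flow_conv \<iota> \<F> x 0 T"
proof -
 define P where "P a b \<longleftrightarrow> (0 \<le> a \<longrightarrow> a \<le> b \<longrightarrow> b \<le> T \<longrightarrow> flow_conv \<iota> \<F> x a b)" for a b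
 from T have "P 0 T"
 proof (induction rule: Bolzano)
  case (trans a m b)
  have "\<forall>\<^sub>F w in \<F>. admissible J w 0 T" using tr by (simp add: tracks_def)
  then show ?case
   unfolding P_def using trans flow_conv_trans[of \<F> a m b \<iota> x] by (auto simp: P_def)
 next
  case (local r)
  obtain c where c: "c \<in> A" "x r \<in> domain c" using chart_exists by blast
  have r: "r \<in> {0..T}" using local by simp
  have xc: "continuous_on {0..T} x" using x by (simp add: msol_def)
  obtain \<delta> where \<delta>: "\<delta> > 0" "\<And>t. t \<in> {0..T} \<Longrightarrow> \<bar>t - r\<bar> < \<delta> \<Longrightarrow> x t \<in> domain c"
   by (rule continuous_chart_nbhd[OF xc r chart(1)[OF c(1)] c(2)]) blast
  have "P a b" if "a \<le> r" "r \<le> b" "b - a < \<delta>" for a b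
   unfolding P_def
  proof (intro impI)
   assume h: "0 \<le> a" "a \<le> b" "b \<le> T"
   have "x ` {a..b} \<subseteq> domain c" using \<delta>(2) that h by auto
   then show "flow_conv \<iota> \<F> x a b"
    using flow_conv_local[OF tr v h msol_subinterval[OF x h(1,3)] c(1) _ \<iota>] by blast
  qed
  then show ?case using \<delta>(1) by blast
 qed
 then show ?thesis using T by (simp add: P_def)
qed

end

text \<open>\<open>elift G\<close> depends on its argument through \<open>prj\<close> alone, so
  regularity on a ball of \<open>linf\<close> spreads to the cylinder over the trace of that ball in
  the Euclidean space.\<close>

lemma good_elift_ball:
 fixes G :: "'v::euclidean_space \<Rightarrow> 'w::euclidean_space"
 assumes "good k (ball (emb y0) \<delta>) (elift G)"
 shows "good k (prj -` (emb -` ball (emb y0) \<delta> :: 'v set)) (elift G)"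
  "open (emb -` ball (emb y0) \<delta> :: 'v set)"
proof -
 show op: "open (emb -` ball (emb y0) \<delta> :: 'v set)"
  by (rule open_vimage) (auto intro: linear_continuous_on bounded_linear_emb)
 have lin: "bounded_linear (\<lambda>X. emb (prj X :: 'v))"
  by (rule bounded_linear_compose[OF bounded_linear_emb bounded_linear_prj])
 have "good k (prj -` (emb -` ball (emb y0) \<delta> :: 'v set)) (\<lambda>X. elift G (emb (prj X :: 'v)))"
  by (rule good_compose[where G = "elift G", OF assms good_linear[OF lin] _ open_prj[OF op]]) auto
 moreover have "(\<lambda>X. elift G (emb (prj X :: 'v))) = elift G" by (auto simp: elift_def)
 ultimately show "good k (prj -` (emb -` ball (emb y0) \<delta> :: 'v set)) (elift G)" by simp
qed

lemma eventually_compact_cover: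
 assumes "compact K" and loc: "\<And>p. p \<in> K \<Longrightarrow> \<exists>W. open W \<and> p \<in> W \<and> (\<forall>\<^sub>F w in \<F>. \<forall>q\<in>W \<inter> K. P w q)"
 shows "\<forall>\<^sub>F w in \<F>. \<forall>q\<in>K. P w q"
proof -
 have "\<forall>p\<in>K. \<exists>W. open W \<and> p \<in> W \<and> (\<forall>\<^sub>F w in \<F>. \<forall>q\<in>W \<inter> K. P w q)" using loc by blast
 from bchoice[OF this] obtain W where W: "\<And>p. p \<in> K \<Longrightarrow> open (W p) \<and> p \<in> W p \<and> (\<forall>\<^sub>F w in \<F>. \<forall>q\<in>W p \<inter> K. P w q)"
  by blast
 have "K \<subseteq> (\<Union>p\<in>K. W p)" using W by blast
 then obtain C where C: "C \<subseteq> K" "finite C" "K \<subseteq> (\<Union>p\<in>C. W p)"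
  using compactE_image[OF assms(1), of K W] W by metis
 have "\<forall>\<^sub>F w in \<F>. \<forall>p\<in>C. \<forall>q\<in>W p \<inter> K. P w q"
  using C(1) W by (intro eventually_ball_finite C(2)) blast
 then show ?thesis
  by (rule eventually_mono) (use C(3) in blast)
qed

section \<open>Closeness of flows on compact sets and elimination of all brackets\<close>

context control_manifold
begin

abbreviation jet_dist ::
 "('a \<Rightarrow> real ^ 'm) \<Rightarrow> ('a, 'n) chart \<Rightarrow> (real ^ 'n) list \<Rightarrow> (nat list \<Rightarrow> real \<Rightarrow> real) \<Rightarrow>
  (nat list \<Rightarrow> real \<Rightarrow> real) \<Rightarrow> real \<Rightarrow> 'a \<Rightarrow> real" where
 "jet_dist \<iota> c vs w v t q \<equiv> norm (ddir (\<lambda>y. \<iota> (mflow w 0 T t (param c y))) vs (coord c q)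
  - ddir (\<lambda>y. \<iota> (mflow v 0 T t (param c y))) vs (coord c q))"

lemma mdom_open_nbhd:
 fixes \<iota> :: "'a \<Rightarrow> real ^ 'm"
 assumes tr: "tracks J T v \<F>" and v: "admissible J v 0 T" and T: "0 \<le> T" and \<iota>: "smooth_map A \<iota>"
  and p: "p \<in> mdom v 0 T"
 obtains W where "open W" "p \<in> W" "\<forall>\<^sub>F w in \<F>. W \<subseteq> mdom w 0 T"
proof -
 note x = mflow_msol[OF p]
 have fc: "flow_conv \<iota> \<F> (\<lambda>t. mflow v 0 T t p) 0 T" using flow_conv_global[OF tr v T x(1) \<iota>] .
 obtain W where W: "open W" "p \<in> W" and ev: "\<forall>\<^sub>F w in \<F>. \<forall>y\<in>W. y \<in> mdom w 0 T \<and> mflow w 0 T T y \<in> UNIV"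
  using conjunct1[OF fc[unfolded flow_conv_def], rule_format, OF open_UNIV UNIV_I] x(2) by auto
 have "\<forall>\<^sub>F w in \<F>. W \<subseteq> mdom w 0 T" by (rule eventually_mono[OF ev]) blast
 then show ?thesis using W that by blast
qed

text \<open>Convergence provides some limit \<open>l\<close> that is not identified with the jet of
  the given flow. Adding \<open>v\<close> itself to the family of controls puts its jet within
  \<open>\<epsilon> / (2 * C)\<close> of the same \<open>l\<close>; here \<open>C\<close> is the
  norm of the map that reads a derivative off a lift.\<close>

lemma flow_jets_near:
 fixes \<iota> :: "'a \<Rightarrow> real ^ 'm"
 assumes tr: "tracks J T v \<F>" and v: "admissible J v 0 T" and T: "0 \<le> T" and \<iota>: "smooth_map A \<iota>"
  and c: "c \<in> A" and p: "p \<in> mdom v 0 T" "p \<in> domain c" and \<epsilon>: "\<epsilon> > 0"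
 obtains W where "open W" "p \<in> W" "\<forall>\<^sub>F w in \<F>. \<forall>q\<in>W \<inter> domain c. \<forall>t\<in>{0..T}.
   jet_dist \<iota> c vs w v t q < \<epsilon>"
proof -
 let ?k = "length vs" and ?\<G> = "sup (principal {v}) \<F>" and ?g = "\<lambda>w t y. \<iota> (mflow w 0 T t (param c y))"
 have tr': "tracks J T v ?\<G>" by (rule tracks_sup[OF tracks_self[OF finite_words v] tr])
 note x = mflow_msol[OF p(1)]
 have fc: "flow_conv \<iota> ?\<G> (\<lambda>t. mflow v 0 T t p) 0 T" using flow_conv_global[OF tr' v T x(1) \<iota>] .
 define \<xi>0 where "\<xi>0 = jet_point vs (coord c p)"
 have b\<xi>0: "(base ^^ ?k) \<xi>0 = emb (coord c p)" by (simp add: \<xi>0_def base_jet_point)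
 then have "prj ((base ^^ ?k) \<xi>0) = coord c (mflow v 0 T 0 p)" by (simp add: x(2))
 then obtain l where l: "jet_conv ?\<G> {0..T} ?k (\<lambda>w t. rep \<iota> (mflow w 0 T t) c) \<xi>0 l"
  using fc[unfolded flow_conv_def, THEN conjunct2, THEN conjunct2, rule_format, OF c] p(2) x(2) by metis
 have lin: "bounded_linear (\<lambda>X. prj ((fibre ^^ ?k) X) :: real ^ 'm)"
  by (rule bounded_linear_compose[OF bounded_linear_prj bounded_linear_funpow[OF bounded_linear_fibre]])
 then obtain C where C: "C > 0" "\<And>X. norm (prj ((fibre ^^ ?k) X) :: real ^ 'm) \<le> norm X * C"
  using bounded_linear.pos_bounded by blast
 have "\<epsilon> / (2 * C) > 0" using \<epsilon> C by simp
 from jet_convD[OF l this] obtain \<delta> where \<delta>: "\<delta> > 0" and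
  ev: "\<forall>\<^sub>F w in ?\<G>. \<forall>t\<in>{0..T}. good ?k (ball (emb (coord c p)) \<delta>) (elift (?g w t)) \<and>
   (\<forall>\<xi>\<in>ball \<xi>0 \<delta>. norm ((tlift ^^ ?k) (elift (?g w t)) \<xi> - l t) < \<epsilon> / (2 * C))"
  unfolding b\<xi>0 rep_def by blast
 define P where "P w \<longleftrightarrow> (\<forall>t\<in>{0..T}. good ?k (ball (emb (coord c p)) \<delta>) (elift (?g w t)) \<and>
   (\<forall>\<xi>\<in>ball \<xi>0 \<delta>. norm ((tlift ^^ ?k) (elift (?g w t)) \<xi> - l t) < \<epsilon> / (2 * C)))" for w
 have Pv: "P v" and Pw: "\<forall>\<^sub>F w in \<F>. P w" using ev by (auto simp: P_def eventually_sup eventually_principal)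
 have cj: "continuous_on UNIV (jet_point vs :: real ^ 'n \<Rightarrow> linf)"
  by (intro continuous_at_imp_continuous_on ballI) (rule has_derivative_continuous[OF jet_point_has_derivative])
 define W where "W = domain c \<inter> (\<lambda>q. jet_point vs (coord c q)) -` ball \<xi>0 \<delta>"
 have W: "open W"
  unfolding W_def by (intro continuous_open_preimage chart c open_ball)
   (rule continuous_on_compose2[OF cj chart(3)[OF c] subset_UNIV])
 have pW: "p \<in> W" using p(2) \<delta> by (simp add: W_def \<xi>0_def)
 have near: "norm (ddir (?g w t) vs (coord c q) - ddir (?g v t) vs (coord c q)) < \<epsilon>"
  if w: "P w" and q: "q \<in> W \<inter> domain c" and t: "t \<in> {0..T}" for w q t
 proof -
  let ?\<xi> = "jet_point vs (coord c q)"
  have \<xi>: "?\<xi> \<in> ball \<xi>0 \<delta>" using q by (simp add: W_def)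
  have "dist (emb (coord c p)) (emb (coord c q)) \<le> dist \<xi>0 ?\<xi>"
   using norm_base_funpow_le[of ?k "\<xi>0 - ?\<xi>"] by (simp add: dist_norm base_funpow_diff b\<xi>0 base_jet_point)
  then have U: "coord c q \<in> emb -` ball (emb (coord c p)) \<delta>" using \<xi> by simp
  have eq: "ddir (?g u t) vs (coord c q) = prj ((fibre ^^ ?k) ((tlift ^^ ?k) (elift (?g u t)) ?\<xi>))"
   and lt: "norm ((tlift ^^ ?k) (elift (?g u t)) ?\<xi> - l t) < \<epsilon> / (2 * C)" if "P u" for u
  proof -
   have g: "good ?k (ball (emb (coord c p)) \<delta>) (elift (?g u t))" using that t by (simp add: P_def)
   show "ddir (?g u t) vs (coord c q) = prj ((fibre ^^ ?k) ((tlift ^^ ?k) (elift (?g u t)) ?\<xi>))"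
    by (rule ddir_conv_tlift[OF good_elift_ball(2)[OF g] good_elift_ball(1)[OF g] U])
   show "norm ((tlift ^^ ?k) (elift (?g u t)) ?\<xi> - l t) < \<epsilon> / (2 * C)"
    using that t \<xi> unfolding P_def by blast
  qed
  let ?d = "(tlift ^^ ?k) (elift (?g w t)) ?\<xi> - (tlift ^^ ?k) (elift (?g v t)) ?\<xi>"
  have "norm ?d < \<epsilon> / (2 * C) + \<epsilon> / (2 * C)"
   using lt[OF w] lt[OF Pv] norm_triangle_ineq4[of "(tlift ^^ ?k) (elift (?g w t)) ?\<xi> - l t"
     "(tlift ^^ ?k) (elift (?g v t)) ?\<xi> - l t"] by simp
  then have "norm ?d * C < \<epsilon>" using C(1) by (simp add: field_simps)
  moreover have "ddir (?g w t) vs (coord c q) - ddir (?g v t) vs (coord c q) = prj ((fibre ^^ ?k) ?d)"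
   unfolding eq[OF w] eq[OF Pv] by (rule linear_diff[OF bounded_linear.linear[OF lin], symmetric])
  ultimately show ?thesis using C(2)[of ?d] by simp
 qed
 have "\<forall>\<^sub>F w in \<F>. \<forall>q\<in>W \<inter> domain c. \<forall>t\<in>{0..T}.
   norm (ddir (?g w t) vs (coord c q) - ddir (?g v t) vs (coord c q)) < \<epsilon>"
  by (rule eventually_mono[OF Pw]) (use near in blast)
 then show ?thesis by (rule that[OF W pW])
qed

text \<open>Convergence along the principal filter at \<open>v\<close> is exploited for its
  regularity part: the flow is of class C^k near p in chart coordinates, on a neighbourhood common
  to all times.\<close>

lemma flow_good:
 fixes \<iota> :: "'a \<Rightarrow> real ^ 'm"
 assumes v: "admissible J v 0 T" and T: "0 \<le> T" and \<iota>: "smooth_map A \<iota>"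
  and c: "c \<in> A" and p: "p \<in> mdom v 0 T" "p \<in> domain c"
 obtains U where "open U" "coord c p \<in> U"
  "\<And>t. t \<in> {0..T} \<Longrightarrow> good k (prj -` U) (elift (\<lambda>y. \<iota> (mflow v 0 T t (param c y))))"
proof -
 note x = mflow_msol[OF p(1)]
 define \<xi>0 where "\<xi>0 = (hor ^^ k) (emb (coord c p))"
 have fc: "flow_conv \<iota> (principal {v}) (\<lambda>t. mflow v 0 T t p) 0 T"
  using flow_conv_global[OF tracks_self[OF finite_words v] v T x(1) \<iota>] .
 have "prj ((base ^^ k) \<xi>0) = coord c (mflow v 0 T 0 p)" by (simp add: x(2) \<xi>0_def)
 then obtain l where l: "jet_conv (principal {v}) {0..T} k (\<lambda>w t. rep \<iota> (mflow w 0 T t) c) \<xi>0 l"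
  using fc[unfolded flow_conv_def, THEN conjunct2, THEN conjunct2, rule_format, OF c] p(2) x(2) by metis
 from jet_convD[OF l zero_less_one] obtain \<delta> where \<delta>: "\<delta> > 0" and
  ev: "\<forall>\<^sub>F w in principal {v}. \<forall>t\<in>{0..T}. jet_near k \<xi>0 \<delta> (rep \<iota> (mflow w 0 T t) c) (l t) 1"
  by blast
 have g: "good k (ball (emb (coord c p)) \<delta>) (elift (\<lambda>y. \<iota> (mflow v 0 T t (param c y))))" if "t \<in> {0..T}" for t
  using ev that by (simp add: eventually_principal \<xi>0_def rep_def)
 show ?thesis
  by (rule that[OF good_elift_ball(2)[OF g] _ good_elift_ball(1)[OF g]]) (use T \<delta> in auto)
qed

text \<open>The condition on the interior of the domain belongs to the relation because each
  approximation starts from the control just constructed, whose flow must again exist over the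
  compact sets.\<close>

definition jets_close ::
 "('a \<Rightarrow> real ^ 'm) \<Rightarrow> (('a, 'n) chart \<times> 'a set) set \<Rightarrow> (real ^ 'n) list set \<Rightarrow> real \<Rightarrow>
  (nat list \<Rightarrow> real \<Rightarrow> real) \<Rightarrow> (nat list \<Rightarrow> real \<Rightarrow> real) \<Rightarrow> bool" where
 "jets_close \<iota> \<P> VS \<epsilon> v w \<longleftrightarrow> (\<forall>(c, K)\<in>\<P>. K \<subseteq> interior (mdom w 0 T) \<and> (\<forall>vs\<in>VS. \<forall>q\<in>K. \<forall>t\<in>{0..T}.
   jet_dist \<iota> c vs w v t q < \<epsilon>))"

lemma jets_close_trans:
 assumes "jets_close \<iota> \<P> VS \<epsilon> u v" "jets_close \<iota> \<P> VS \<epsilon>' v w"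
 shows "jets_close \<iota> \<P> VS (\<epsilon> + \<epsilon>') u w"
 unfolding jets_close_def
proof (intro ballI, clarify, intro conjI ballI)
 fix c K assume cK: "(c, K) \<in> \<P>"
 show "K \<subseteq> interior (mdom w 0 T)" using assms(2) cK by (auto simp: jets_close_def)
 fix vs q t assume h: "vs \<in> VS" "q \<in> K" "t \<in> {0..T}"
 let ?d = "\<lambda>u. ddir (\<lambda>y. \<iota> (mflow u 0 T t (param c y))) vs (coord c q)"
 have "norm (?d v - ?d u) < \<epsilon>" "norm (?d w - ?d v) < \<epsilon>'"
  using assms cK h unfolding jets_close_def by fast+
 then show "norm (?d w - ?d u) < \<epsilon> + \<epsilon>'"
  using norm_triangle_ineq[of "?d w - ?d v" "?d v - ?d u"] by simp
qed

lemma tracks_jets_close: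
 assumes tr: "tracks J T v \<F>" and v: "admissible J v 0 T" and T: "0 \<le> T" and \<iota>: "smooth_map A \<iota>"
  and P: "finite \<P>" "\<And>c K. (c, K) \<in> \<P> \<Longrightarrow> c \<in> A \<and> compact K \<and> K \<subseteq> domain c \<and> K \<subseteq> mdom v 0 T"
  and VS: "finite VS" and \<epsilon>: "\<epsilon> > 0"
 shows "\<forall>\<^sub>F w in \<F>. jets_close \<iota> \<P> VS \<epsilon> v w"
proof -
 have "\<forall>\<^sub>F w in \<F>. K \<subseteq> interior (mdom w 0 T) \<and> (\<forall>vs\<in>VS. \<forall>q\<in>K. \<forall>t\<in>{0..T}.
   jet_dist \<iota> c vs w v t q < \<epsilon>)" if cK: "(c, K) \<in> \<P>" for c K
 proof (rule eventually_conj)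
  have K: "c \<in> A" "compact K" "K \<subseteq> domain c" "K \<subseteq> mdom v 0 T" using P(2)[OF cK] by auto
  have "\<forall>\<^sub>F w in \<F>. \<forall>q\<in>K. q \<in> interior (mdom w 0 T)"
  proof (rule eventually_compact_cover[OF K(2)])
   fix p assume "p \<in> K"
   then have "p \<in> mdom v 0 T" using K(4) by blast
   from mdom_open_nbhd[OF tr v T \<iota> this] obtain W where W: "open W" "p \<in> W"
    and ev: "\<forall>\<^sub>F w in \<F>. W \<subseteq> mdom w 0 T" by blast
   have "\<forall>\<^sub>F w in \<F>. \<forall>q\<in>W \<inter> K. q \<in> interior (mdom w 0 T)"
    by (rule eventually_mono[OF ev]) (use W(1) interior_maximal in blast)
   then show "\<exists>W. open W \<and> p \<in> W \<and> (\<forall>\<^sub>F w in \<F>. \<forall>q\<in>W \<inter> K. q \<in> interior (mdom w 0 T))"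
    using W by blast
  qed
  then show "\<forall>\<^sub>F w in \<F>. K \<subseteq> interior (mdom w 0 T)" by (rule eventually_mono) blast
  show "\<forall>\<^sub>F w in \<F>. \<forall>vs\<in>VS. \<forall>q\<in>K. \<forall>t\<in>{0..T}.
   jet_dist \<iota> c vs w v t q < \<epsilon>"
  proof (rule eventually_ball_finite[OF VS], intro ballI)
   fix vs
   show "\<forall>\<^sub>F w in \<F>. \<forall>q\<in>K. \<forall>t\<in>{0..T}.
    jet_dist \<iota> c vs w v t q < \<epsilon>"
   proof (rule eventually_compact_cover[OF K(2)])
    fix p assume p: "p \<in> K"
    then have p': "p \<in> mdom v 0 T" "p \<in> domain c" using K(3,4) by auto
    obtain W where W: "open W" "p \<in> W" and ev: "\<forall>\<^sub>F w in \<F>. \<forall>q\<in>W \<inter> domain c. \<forall>t\<in>{0..T}.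
     jet_dist \<iota> c vs w v t q < \<epsilon>"
     by (rule flow_jets_near[OF tr v T \<iota> K(1) p' \<epsilon>]) blast
    have "\<forall>\<^sub>F w in \<F>. \<forall>q\<in>W \<inter> K. \<forall>t\<in>{0..T}.
     jet_dist \<iota> c vs w v t q < \<epsilon>"
     by (rule eventually_mono[OF ev]) (use K(3) in blast)
    then show "\<exists>W. open W \<and> p \<in> W \<and> (\<forall>\<^sub>F w in \<F>. \<forall>q\<in>W \<inter> K. \<forall>t\<in>{0..T}.
     jet_dist \<iota> c vs w v t q < \<epsilon>)" using W by blast
   qed
  qed
 qed
 then have "\<forall>\<^sub>F w in \<F>. \<forall>cK\<in>\<P>. (case cK of (c, K) \<Rightarrow> K \<subseteq> interior (mdom w 0 T) \<and> (\<forall>vs\<in>VS. \<forall>q\<in>K. \<forall>t\<in>{0..T}.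
   jet_dist \<iota> c vs w v t q < \<epsilon>))"
  by (intro eventually_ball_finite P(1)) auto
 then show ?thesis by (simp only: jets_close_def)
qed

lemma tracks_obtain:
 assumes tr: "tracks J T v (filtermap u sequentially)" and v: "admissible J v 0 T" and T: "0 \<le> T"
  and \<iota>: "smooth_map A \<iota>"
  and P: "finite \<P>" "\<And>c K. (c, K) \<in> \<P> \<Longrightarrow> c \<in> A \<and> compact K \<and> K \<subseteq> domain c \<and> K \<subseteq> mdom v 0 T"
  and VS: "finite VS" and \<epsilon>: "\<epsilon> > 0"
 obtains n where "jets_close \<iota> \<P> VS \<epsilon> v (u n)"
proof -
 have "\<forall>\<^sub>F n in sequentially. jets_close \<iota> \<P> VS \<epsilon> v (u n)"
  using tracks_jets_close[OF tr v T \<iota> P VS \<epsilon>] by (simp add: eventually_filtermap)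
 then show ?thesis using that eventually_happens'[OF sequentially_bot] by blast
qed

text \<open>The longest bracket present in the control is eliminated first, since its elimination
 introduces a control for its tail.\<close>

lemma eliminate_brackets:
 assumes T: "0 \<le> T" and \<iota>: "smooth_map A \<iota>" and P: "finite \<P>" "\<And>c K. (c, K) \<in> \<P> \<Longrightarrow> c \<in> A \<and> compact K \<and> K \<subseteq> domain c"
  and VS: "finite VS"
  and D: "finite D" "D \<subseteq> {\<beta> \<in> J. 2 \<le> length \<beta>}" "\<And>i \<gamma>. i # \<gamma> \<in> D \<Longrightarrow> 2 \<le> length \<gamma> \<Longrightarrow> \<gamma> \<in> D"
  and v: "\<And>j. elementary (v j)" "\<And>\<beta>. \<beta> \<in> J \<Longrightarrow> 2 \<le> length \<beta> \<Longrightarrow> \<beta> \<notin> D \<Longrightarrow> v \<beta> = (\<lambda>t. 0)"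
  and K: "\<And>c K. (c, K) \<in> \<P> \<Longrightarrow> K \<subseteq> mdom v 0 T" and \<epsilon>: "\<epsilon> > 0"
 shows "\<exists>u. (\<forall>j. elementary (u j)) \<and> (\<forall>\<beta>\<in>J. 2 \<le> length \<beta> \<longrightarrow> u \<beta> = (\<lambda>t. 0)) \<and> jets_close \<iota> \<P> VS \<epsilon> v u"
 using D v K \<epsilon>
proof (induction "card D" arbitrary: D v \<epsilon>)
 case 0
 then have "D = {}" by simp
 have adm: "admissible J v 0 T" by (intro admissible_continuous elementary_continuous 0)
 have "\<forall>\<^sub>F w in principal {v}. jets_close \<iota> \<P> VS \<epsilon> v w"
  by (rule tracks_jets_close[OF tracks_self[OF finite_words adm] adm T \<iota> P(1) _ VS \<open>\<epsilon> > 0\<close>])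
   (use P(2) "0.prems"(6) in blast)
 then have "jets_close \<iota> \<P> VS \<epsilon> v v" by (simp add: eventually_principal)
 then show ?case by (intro exI[of _ v]) (use 0 \<open>D = {}\<close> in auto)
next
 case (Suc n)
 then have "D \<noteq> {}" by auto
 obtain \<beta> where \<beta>: "\<beta> \<in> D" "\<And>\<beta>'. \<beta>' \<in> D \<Longrightarrow> length \<beta>' \<le> length \<beta>"
 proof -
  have "Max (length ` D) \<in> length ` D" using Suc.prems(1) \<open>D \<noteq> {}\<close> by (intro Max_in) auto
  then obtain \<beta> where "\<beta> \<in> D" "length \<beta> = Max (length ` D)" by auto
  moreover have "length \<beta>' \<le> Max (length ` D)" if "\<beta>' \<in> D" for \<beta>'
   using Suc.prems(1) that by simp
  ultimately show ?thesis using that by simp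
 qed
 obtain i \<gamma> where i\<gamma>: "\<beta> = i # \<gamma>" using Suc.prems(2) \<beta>(1) by (cases \<beta>) auto
 have l: "2 \<le> length \<beta>" "\<beta> \<in> J" using Suc.prems(2) \<beta>(1) by auto
 then have \<gamma>: "\<gamma> \<noteq> []" using i\<gamma> by auto
 have wd: "[i] \<in> J" "\<gamma> \<in> J" using words(1)[of i \<gamma>] l i\<gamma> \<gamma> by auto
 obtain u where u: "tracks J T v (filtermap u sequentially)" "\<And>n j. elementary (u n j)"
  "\<And>n t. u n (i # \<gamma>) t = 0" "\<And>n j. j \<noteq> [i] \<Longrightarrow> j \<noteq> \<gamma> \<Longrightarrow> j \<noteq> i # \<gamma> \<Longrightarrow> u n j = v j"
  by (rule tracks_bracket[OF finite_words _ \<gamma> wd, where v = v and T = T]) (use l i\<gamma> Suc.prems(4) T in auto)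
 have adm: "admissible J v 0 T" by (intro admissible_continuous elementary_continuous Suc.prems(4))
 have \<epsilon>2: "\<epsilon> / 2 > 0" using Suc.prems(7) by simp
 have PK: "c \<in> A \<and> compact K \<and> K \<subseteq> domain c \<and> K \<subseteq> mdom v 0 T" if "(c, K) \<in> \<P>" for c K
  using P(2)[OF that] Suc.prems(6)[OF that] by blast
 obtain n' where n': "jets_close \<iota> \<P> VS (\<epsilon> / 2) v (u n')"
  by (rule tracks_obtain[OF u(1) adm T \<iota> P(1) PK VS \<epsilon>2])
 have "\<exists>u'. (\<forall>j. elementary (u' j)) \<and> (\<forall>\<beta>\<in>J. 2 \<le> length \<beta> \<longrightarrow> u' \<beta> = (\<lambda>t. 0)) \<and>
   jets_close \<iota> \<P> VS (\<epsilon> / 2) (u n') u'"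
 proof (rule Suc.hyps(1)[of "D - {\<beta>}"])
  show "n = card (D - {\<beta>})" using Suc.hyps(2) Suc.prems(1) \<beta>(1) by simp
  \<comment> \<open>A word of maximal length is not the tail of another word in \<open>D\<close>, so
    its removal keeps \<open>D\<close> closed under tails of length at least two.\<close>
  show "\<gamma>' \<in> D - {\<beta>}" if "i' # \<gamma>' \<in> D - {\<beta>}" "2 \<le> length \<gamma>'" for i' \<gamma>'
  proof -
   have "\<gamma>' \<in> D" using Suc.prems(3) that by blast
   moreover have "\<gamma>' \<noteq> \<beta>" using \<beta>(2)[of "i' # \<gamma>'"] that by auto
   ultimately show ?thesis by blast
  qed
  show "u n' \<beta>' = (\<lambda>t. 0)" if "\<beta>' \<in> J" "2 \<le> length \<beta>'" "\<beta>' \<notin> D - {\<beta>}" for \<beta>'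
  proof (cases "\<beta>' = \<beta>")
   case True
   then show ?thesis using u(3) i\<gamma> by auto
  next
   case False
   then have D': "\<beta>' \<notin> D" using that by blast
   then have "\<beta>' \<noteq> \<gamma>" using Suc.prems(3)[of i \<gamma>] \<beta>(1) i\<gamma> that(2) by auto
   moreover have "\<beta>' \<noteq> [i]" using that(2) by auto
   ultimately show ?thesis using u(4) False i\<gamma> Suc.prems(5)[OF that(1,2) D'] by simp
  qed
  show "K \<subseteq> mdom (u n') 0 T" if "(c, K) \<in> \<P>" for c K
   using n' that interior_subset unfolding jets_close_def by fast
 qed (use Suc.prems u(2) \<epsilon>2 in auto)
 then obtain u' where u': "\<forall>j. elementary (u' j)" "\<forall>\<beta>\<in>J. 2 \<le> length \<beta> \<longrightarrow> u' \<beta> = (\<lambda>t. 0)"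
  "jets_close \<iota> \<P> VS (\<epsilon> / 2) (u n') u'" by blast
 have "jets_close \<iota> \<P> VS \<epsilon> v u'" using jets_close_trans[OF n' u'(3)] by simp
 then show ?case using u'(1,2) by blast
qed

text \<open>Half of the error is spent on replacing the measurable coefficients by elementary ones,
  the other half on removing all words of length at least two.\<close>

lemma approximate_control:
 assumes T: "0 \<le> T" and \<iota>: "smooth_map A \<iota>"
  and P: "finite \<P>" "\<And>c K. (c, K) \<in> \<P> \<Longrightarrow> c \<in> A \<and> compact K \<and> K \<subseteq> domain c \<and> K \<subseteq> mdom v 0 T"
  and VS: "finite VS" and v: "admissible J v 0 T" and \<epsilon>: "\<epsilon> > 0"
 obtains u where "\<And>j. elementary (u j)" "\<And>\<beta>. \<beta> \<in> J \<Longrightarrow> 2 \<le> length \<beta> \<Longrightarrow> u \<beta> = (\<lambda>t. 0)"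
  "jets_close \<iota> \<P> VS \<epsilon> v u"
proof -
 have \<epsilon>2: "\<epsilon> / 2 > 0" using \<epsilon> by simp
 obtain u where u: "tracks J T v (filtermap u sequentially)" "\<And>n j. elementary (u n j)"
  by (rule tracks_elementary[OF finite_words v T]) blast
 obtain n where n: "jets_close \<iota> \<P> VS (\<epsilon> / 2) v (u n)"
  by (rule tracks_obtain[OF u(1) v T \<iota> P VS \<epsilon>2])
 have "\<exists>u'. (\<forall>j. elementary (u' j)) \<and> (\<forall>\<beta>\<in>J. 2 \<le> length \<beta> \<longrightarrow> u' \<beta> = (\<lambda>t. 0)) \<and>
   jets_close \<iota> \<P> VS (\<epsilon> / 2) (u n) u'"
 proof (rule eliminate_brackets[OF T \<iota> P(1) _ VS, of "{\<beta> \<in> J. 2 \<le> length \<beta>}"])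
  show "K \<subseteq> mdom (u n) 0 T" if "(c, K) \<in> \<P>" for c K
   using n that interior_subset unfolding jets_close_def by fast
  show "\<gamma> \<in> {\<beta> \<in> J. 2 \<le> length \<beta>}" if "i # \<gamma> \<in> {\<beta> \<in> J. 2 \<le> length \<beta>}" "2 \<le> length \<gamma>" for i \<gamma>
  proof -
   have "\<gamma> \<noteq> []" using that(2) by auto
   then show ?thesis using that words(1)[of i \<gamma>] by auto
  qed
 qed (use P(2) u(2) \<epsilon>2 finite_words in auto)
 then obtain u' where u': "\<forall>j. elementary (u' j)" "\<forall>\<beta>\<in>J. 2 \<le> length \<beta> \<longrightarrow> u' \<beta> = (\<lambda>t. 0)"
  "jets_close \<iota> \<P> VS (\<epsilon> / 2) (u n) u'" by blast
 have "jets_close \<iota> \<P> VS \<epsilon> v u'" using jets_close_trans[OF n u'(3)] by simp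
 then show ?thesis using that u'(1,2) by blast
qed

lemma is_solution_iff:
 assumes "T \<ge> 0"
 shows "is_solution A T (control_field J (iterated_bracket f) w) x \<longleftrightarrow> msol w 0 T x"
proof
 let ?Y = "control_field J (iterated_bracket f) w"
 have rhs: "rhs J w (chart_field c) s (path c x s) = emb (?Y s c (x s))" if "c \<in> A" "x s \<in> domain c" for c s
  using that by (simp add: rhs_def chart_field_def elift_def path_def control_field_def chart emb_simps)
 have intg: "((\<lambda>s. rhs J w (chart_field c) s (path c x s)) has_integral (path c x t - path c x a')) {a'..t} \<longleftrightarrow>
   ((\<lambda>s. ?Y s c (x s)) has_integral (coord c (x t) - coord c (x a'))) {a'..t}"
  if c: "c \<in> A" and X: "x ` {a'..t} \<subseteq> domain c" for c a' t
 proof -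
  have "((\<lambda>s. rhs J w (chart_field c) s (path c x s)) has_integral (path c x t - path c x a')) {a'..t} \<longleftrightarrow>
    ((\<lambda>s. emb (?Y s c (x s))) has_integral emb (coord c (x t) - coord c (x a'))) {a'..t}"
  proof -
   have "rhs J w (chart_field c) s (path c x s) = emb (?Y s c (x s))" if "s \<in> {a'..t}" for s
    using that X by (intro rhs c) auto
   then have "((\<lambda>s. rhs J w (chart_field c) s (path c x s)) has_integral I) {a'..t} \<longleftrightarrow>
     ((\<lambda>s. emb (?Y s c (x s))) has_integral I) {a'..t}" for I
    by (rule has_integral_cong)
   moreover have "path c x t - path c x a' = emb (coord c (x t) - coord c (x a'))"
    by (simp add: path_def emb_simps)
   ultimately show ?thesis by simp
  qed
  also have "\<dots> \<longleftrightarrow> ((\<lambda>s. ?Y s c (x s)) has_integral (coord c (x t) - coord c (x a'))) {a'..t}"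
  proof
   assume "((\<lambda>s. emb (?Y s c (x s))) has_integral emb (coord c (x t) - coord c (x a'))) {a'..t}"
   from has_integral_linear[OF this bounded_linear_prj[where 'v = "real ^ 'n"]]
   show "((\<lambda>s. ?Y s c (x s)) has_integral (coord c (x t) - coord c (x a'))) {a'..t}"
    unfolding o_def prj_emb .
  next
   assume "((\<lambda>s. ?Y s c (x s)) has_integral (coord c (x t) - coord c (x a'))) {a'..t}"
   from has_integral_linear[OF this bounded_linear_emb]
   show "((\<lambda>s. emb (?Y s c (x s))) has_integral emb (coord c (x t) - coord c (x a'))) {a'..t}"
    by (simp add: o_def)
  qed
  finally show ?thesis .
 qed
 {
  assume s: "is_solution A T ?Y x"
  then have xc: "continuous_on {0..T} x" by (simp add: is_solution_def)
  show "msol w 0 T x"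
   unfolding msol_def isol_def
  proof (intro conjI xc ballI allI impI)
   fix c a' b' assume c: "c \<in> A" and h: "0 \<le> a' \<and> a' \<le> b' \<and> b' \<le> T \<and> x ` {a'..b'} \<subseteq> domain c"
   have "continuous_on {a'..b'} (\<lambda>t. coord c (x t))"
    by (rule continuous_on_compose2[OF chart(3)[OF c] continuous_on_subset[OF xc]]) (use h in auto)
   then show "continuous_on {a'..b'} (path c x)"
    unfolding path_def[abs_def] by (rule bounded_linear.continuous_on[OF bounded_linear_emb])
   show "path c x ` {a'..b'} \<subseteq> cdom c" using h reg_emb[OF c] by (auto simp: path_def)
   fix t assume t: "t \<in> {a'..b'}"
   have X: "x ` {a'..t} \<subseteq> domain c" using h t by auto
   have "((\<lambda>s. ?Y s c (x s)) has_integral (coord c (x t) - coord c (x a'))) {a'..t}"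
    using s c h t X unfolding is_solution_def by auto
   then show "((\<lambda>s. rhs J w (chart_field c) s (path c x s)) has_integral (path c x t - path c x a')) {a'..t}"
    using intg[OF c X] by simp
  qed
 next
  assume m: "msol w 0 T x"
  show "is_solution A T ?Y x"
   unfolding is_solution_def
  proof (intro conjI ballI allI impI)
   show "continuous_on {0..T} x" using m by (simp add: msol_def)
   fix c a b assume c: "c \<in> A" and h: "0 \<le> a \<and> a \<le> b \<and> b \<le> T \<and> x ` {a..b} \<subseteq> domain c"
   then have "isol J w (chart_field c) (cdom c) a b (path c x)" by (intro msol_isol[OF m]) auto
   then show "((\<lambda>t. ?Y t c (x t)) has_integral (coord c (x b) - coord c (x a))) {a..b}"
    using intg[OF c, of a b] h by (auto simp: isol_def)
  qed
 }
qed

lemma flow_domain_eq: "T \<ge> 0 \<Longrightarrow> flow_domain A T (control_field J (iterated_bracket f) w) = mdom w 0 T"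
 by (simp add: flow_domain_def mdom_def is_solution_iff)

lemma is_flow_mflow: "T \<ge> 0 \<Longrightarrow> is_flow A T (control_field J (iterated_bracket f) w) (mflow w 0 T)"
 using mflow_msol by (simp add: is_flow_def flow_domain_eq is_solution_iff)

lemma is_flow_eq:
 assumes "T \<ge> 0" "admissible J w 0 T" "is_flow A T (control_field J (iterated_bracket f) w) P"
  and "p \<in> mdom w 0 T" "t \<in> {0..T}"
 shows "P t p = mflow w 0 T t p"
proof -
 have "msol w 0 T (\<lambda>t. P t p)" "P 0 p = p"
  using assms by (auto simp: is_flow_def flow_domain_eq is_solution_iff)
 then show ?thesis using mflow_eqI(1)[OF assms(2,1) _ assms(5)] by metis
qed

end

section \<open>Differential operators in charts\<close>

text \<open>Makes the closure properties of \<open>good\<close> available for maps between Euclidean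
  spaces.\<close>

definition ck :: "nat \<Rightarrow> 'v::euclidean_space set \<Rightarrow> ('v \<Rightarrow> 'w::euclidean_space) \<Rightarrow> bool" where
 "ck k U G \<longleftrightarrow> good k (prj -` U) (elift G)"

lemma ck_cong: "open U \<Longrightarrow> (\<And>y. y \<in> U \<Longrightarrow> G y = H y) \<Longrightarrow> ck k U G \<longleftrightarrow> ck k U H"
 unfolding ck_def by (rule good_cong) (auto simp: elift_def open_prj)

lemma ck_subset: "ck k U G \<Longrightarrow> V \<subseteq> U \<Longrightarrow> ck k V G"
 unfolding ck_def by (rule good_subset) auto

lemma ck_le: "ck k U G \<Longrightarrow> m \<le> k \<Longrightarrow> ck m U G"
 unfolding ck_def by (rule good_le)

lemma ck_smooth_on: "open U \<Longrightarrow> smooth_on U G \<Longrightarrow> ck k U G"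
 unfolding ck_def by (rule good_elift)

lemma ck_continuous:
 fixes G :: "'v::euclidean_space \<Rightarrow> 'w::euclidean_space"
 assumes "ck k U G"
 shows "continuous_on U G"
proof -
 have "continuous_on (prj -` U) (elift G)" using assms by (simp add: ck_def good_imp_continuous)
 moreover have "emb ` U \<subseteq> prj -` U" by auto
 ultimately have "continuous_on U (\<lambda>y. elift G (emb y))"
  by (rule continuous_on_compose2[OF _ linear_continuous_on[OF bounded_linear_emb]])
 from bounded_linear.continuous_on[OF bounded_linear_prj[where 'v = 'w] this] show ?thesis by (simp add: elift_def)
qed

lemma ck_differentiable: "ck (Suc k) U G \<Longrightarrow> y \<in> U \<Longrightarrow> G differentiable (at y)"
 by (rule elift_differentiable) (simp add: ck_def)

lemma ck_fd:
 assumes "ck (Suc k) U G" "open U"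
 shows "ck k U (\<lambda>y. fd G y v)"
proof -
 have fd: "good k (prj -` U) (\<lambda>X. fd (elift G) X (emb v))"
  by (rule good_fd[OF _ good_const open_prj]) (use assms in \<open>simp_all add: ck_def\<close>)
 have eq: "fd (elift G) X (emb v) = elift (\<lambda>y. fd G y v) X" if "X \<in> prj -` U" for X
  using fd_eqI[OF elift_has_derivative[OF ck_differentiable[OF assms(1), of "prj X"]]] that
  by (simp add: elift_def)
 show ?thesis
  unfolding ck_def by (rule iffD1[OF good_cong[OF open_prj[OF assms(2)] eq] fd])
qed

lemma ck_compose:
 assumes "ck k V G" "ck k U H" "H ` U \<subseteq> V" "open U"
 shows "ck k U (\<lambda>y. G (H y))"
proof -
 have "elift H ` (prj -` U) \<subseteq> prj -` V"
  by (rule image_subsetI) (use assms(3) in \<open>simp add: elift_def image_subset_iff\<close>)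
 then have "good k (prj -` U) (\<lambda>X. elift G (elift H X))"
  by (rule good_compose[OF assms(1,2)[unfolded ck_def] _ open_prj[OF assms(4)]])
 moreover have "(\<lambda>X. elift G (elift H X)) = elift (\<lambda>y. G (H y))" by (auto simp: elift_def)
 ultimately show ?thesis by (simp add: ck_def)
qed

lemma ck_linear:
 assumes "bounded_linear h"
 shows "ck k U h"
 unfolding ck_def elift_def[abs_def]
 by (intro good_linear bounded_linear_compose[OF bounded_linear_emb]
   bounded_linear_compose[OF assms bounded_linear_prj])

lemma ck_linear_image: "bounded_linear h \<Longrightarrow> ck k U G \<Longrightarrow> open U \<Longrightarrow> ck k U (\<lambda>y. h (G y))"
 by (rule ck_compose[where V = UNIV, OF ck_linear]) auto

lemma ck_const: "ck k U (\<lambda>y. a)"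
 unfolding ck_def elift_def[abs_def] by (rule good_const)

lemma ck_add: "ck k U G \<Longrightarrow> ck k U H \<Longrightarrow> open U \<Longrightarrow> ck k U (\<lambda>y. G y + H y)"
 unfolding ck_def elift_def[abs_def] by (simp add: emb_simps good_add open_prj)

lemma ck_diff: "ck k U G \<Longrightarrow> ck k U H \<Longrightarrow> open U \<Longrightarrow> ck k U (\<lambda>y. G y - H y)"
 unfolding ck_def elift_def[abs_def] by (simp add: emb_simps good_diff open_prj)

lemma ck_sum: "(\<And>i. i \<in> I \<Longrightarrow> ck k U (G i)) \<Longrightarrow> open U \<Longrightarrow> ck k U (\<lambda>y. \<Sum>i\<in>I. G i y)"
 unfolding ck_def elift_def[abs_def] by (simp add: emb_simps good_sum open_prj)

lemma ck_scaleR: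
 fixes G :: "'v::euclidean_space \<Rightarrow> 'w::euclidean_space"
 assumes "ck k U a" "ck k U G" "open U"
 shows "ck k U (\<lambda>y. a y *\<^sub>R G y)"
proof -
 have "bounded_bilinear (\<lambda>X Y :: linf. (prj X :: real) *\<^sub>R Y)"
  by (rule bounded_bilinear.comp1[OF bounded_bilinear_scaleR bounded_linear_prj])
 then have "good k (prj -` U) (\<lambda>X. (prj (elift a X) :: real) *\<^sub>R elift G X)"
  by (rule good_bilinear[OF _ assms(1,2)[unfolded ck_def] open_prj[OF assms(3)]])
 then show ?thesis by (simp add: ck_def elift_def[abs_def] emb_simps)
qed

lemma ck_mult: "ck k U a \<Longrightarrow> ck k U b \<Longrightarrow> open U \<Longrightarrow> ck k U (\<lambda>y. a y * b y :: real)"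
 using ck_scaleR[of k U a b] by simp

lemma ck_prod: "(\<And>i. i \<in> I \<Longrightarrow> ck k U (G i)) \<Longrightarrow> open U \<Longrightarrow> ck k U (\<lambda>y. \<Prod>i\<in>I. G i y :: real)"
 by (induction I rule: infinite_finite_induct) (auto intro: ck_const ck_mult)

text \<open>The tangent map of the reciprocal is polynomial in the reciprocal and the fibre, so the
  induction closes by the rule for bilinear expressions.\<close>

lemma ck_inverse: "ck k (- {0}) (inverse :: real \<Rightarrow> real)"
proof (induction k)
 case 0
 have "continuous_on (prj -` (- {0 :: real})) (\<lambda>X. inverse (prj X :: real))"
  by (intro continuous_on_inverse linear_continuous_on bounded_linear_prj) auto
 from bounded_linear.continuous_on[OF bounded_linear_emb this] show ?case
  by (simp add: ck_def elift_def[abs_def])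
next
 case (Suc k)
 let ?S = "prj -` (- {0 :: real})" and ?I = "elift (inverse :: real \<Rightarrow> real)"
  and ?m = "\<lambda>X Y :: linf. (prj X :: real) *\<^sub>R Y" and ?n = "\<lambda>X. emb (- prj (fibre X) :: real)"
 let ?F = "\<lambda>X. hor (?I (base X)) + ver (?m (?I (base X)) (?m (?I (base X)) (?n X)))"
 have m: "bounded_bilinear ?m"
  by (rule bounded_bilinear.comp1[OF bounded_bilinear_scaleR bounded_linear_prj])
 have S: "open ?S" by (rule open_prj) auto
 then have S': "open (base -` ?S)" by (rule open_base)
 have e: "(?I has_derivative (\<lambda>W. emb (- (inverse (prj X) * prj W * inverse (prj X)) :: real))) (at X)"
  if "X \<in> ?S" for X
 proof -
  have *: "(inverse has_derivative (\<lambda>h. - (inverse (prj X) * h * inverse (prj X)) :: real)) (at (prj X))"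
   by (rule has_derivative_inverse') (use that in auto)
  then have d: "(inverse :: real \<Rightarrow> real) differentiable (at (prj X))" unfolding differentiable_def by blast
  from elift_has_derivative[OF d] show ?thesis unfolding fd_eqI[OF *] .
 qed
 have i: "good k (base -` ?S) (\<lambda>X. ?I (base X))"
  by (rule good_compose[where G = ?I and S' = ?S, OF _ good_linear[OF bounded_linear_base] _ S'])
   (use Suc in \<open>auto simp: ck_def\<close>)
 have n: "good k (base -` ?S) ?n"
  by (intro good_linear bounded_linear_compose[OF bounded_linear_emb] bounded_linear_minus
    bounded_linear_compose[OF bounded_linear_prj bounded_linear_fibre])
 have mm: "good k (base -` ?S) (\<lambda>X. ?m (?I (base X)) (?m (?I (base X)) (?n X)))"
  by (rule good_bilinear[OF m i good_bilinear[OF m i n S'] S'])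
 have "good k (base -` ?S) ?F"
  by (rule good_add[OF good_compose[OF good_linear[OF bounded_linear_hor] i, where S' = UNIV]
     good_compose[OF good_linear[OF bounded_linear_ver] mm, where S' = UNIV] S'])
   (simp_all add: S')
 moreover have "tlift ?I X = ?F X" if "X \<in> base -` ?S" for X
 proof -
  have "base X \<in> ?S" using that by simp
  note * = fd_eqI[OF e[OF this]]
  show ?thesis unfolding tlift_def * by (simp add: elift_def emb_simps[symmetric] mult_ac)
 qed
 ultimately have "good k (base -` ?S) (tlift ?I)"
  using good_cong[OF S', of "tlift ?I" ?F k] by blast
 moreover have "?I differentiable (at X)" if "X \<in> ?S" for X
  using e[OF that] unfolding differentiable_def by blast
 ultimately show ?case by (simp add: ck_def)
qed

lemma ck_det:
 fixes M :: "'v::euclidean_space \<Rightarrow> real ^ 'n::finite ^ 'n"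
 assumes "\<And>i j. ck k U (\<lambda>y. M y $ i $ j)" "open U"
 shows "ck k U (\<lambda>y. det (M y))"
 unfolding det_def by (intro ck_sum ck_mult ck_const ck_prod assms)

lemma matrix_inv_eqI:
 fixes M :: "real ^ 'n::finite ^ 'n"
 assumes "M ** N = mat 1"
 shows "matrix_inv M = N"
proof -
 have "N ** M = mat 1" using assms matrix_left_right_inverse by blast
 then have "\<exists>N. M ** N = mat 1 \<and> N ** M = mat 1" using assms by blast
 then have "M ** matrix_inv M = mat 1 \<and> matrix_inv M ** M = mat 1"
  unfolding matrix_inv_def by (rule someI_ex)
 then show ?thesis using assms by (metis matrix_mul_assoc matrix_mul_lid matrix_mul_rid)
qed

lemma matrix_inv_right:
 fixes M :: "real ^ 'n::finite ^ 'n"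
 assumes "det M \<noteq> 0"
 shows "M ** matrix_inv M = mat 1"
proof -
 obtain N where "M ** N = mat 1" using assms invertible_det_nz[of M] by (auto simp: invertible_def)
 then show ?thesis using matrix_inv_eqI by metis
qed

text \<open>Cramer's rule makes the entries of the inverse rational in the entries of the matrix,
  which reduces their regularity to that of determinants and reciprocals.\<close>

lemma matrix_inv_entry:
 fixes M :: "real ^ 'n::finite ^ 'n"
 assumes "det M \<noteq> 0"
 shows "matrix_inv M $ k $ j = det (\<chi> i l. if l = k then axis j 1 $ i else M $ i $ l) * inverse (det M)"
proof -
 have "M ** matrix_inv M = mat 1"
  using assms by (rule matrix_inv_right)
 then have "M *v (matrix_inv M *v axis j 1) = axis j 1"
  by (simp add: matrix_vector_mul_assoc)
 then have "matrix_inv M *v axis j 1 = (\<chi> k. det (\<chi> i l. if l = k then axis j 1 $ i else M $ i $ l) / det M)"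
  using cramer[OF assms] by blast
 then show ?thesis by (simp add: matrix_vector_mult_basis column_def vec_eq_iff divide_inverse)
qed

lemma ck_matrix_inv:
 fixes M :: "'v::euclidean_space \<Rightarrow> real ^ 'n::finite ^ 'n"
 assumes M: "\<And>i j. ck k U (\<lambda>y. M y $ i $ j)" and U: "open U" and nz: "\<And>y. y \<in> U \<Longrightarrow> det (M y) \<noteq> 0"
 shows "ck k U (\<lambda>y. matrix_inv (M y) $ a $ b)"
proof -
 have e: "ck k U (\<lambda>y. (\<chi> i l. if l = a then axis b 1 $ i else M y $ i $ l) $ i $ j)" for i j
  using M ck_const by (cases "j = a") auto
 have "ck k U (\<lambda>y. det (\<chi> i l. if l = a then axis b 1 $ i else M y $ i $ l) * inverse (det (M y)))"
  by (intro ck_mult ck_det e ck_compose[OF ck_inverse] U M) (use nz in auto)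
 from iffD2[OF ck_cong[OF U matrix_inv_entry[OF nz]] this] show ?thesis by simp
qed

section \<open>Functions of class C^k on the manifold, read in charts\<close>

definition csm :: "nat \<Rightarrow> ('a, 'n::finite) chart \<Rightarrow> 'a set \<Rightarrow> ('a \<Rightarrow> 'b::euclidean_space) \<Rightarrow> bool" where
 "csm k c W H \<longleftrightarrow> ck k (coord c ` W) (\<lambda>y. H (param c y))"

lemma csm_le: "csm k c W H \<Longrightarrow> m \<le> k \<Longrightarrow> csm m c W H"
 unfolding csm_def by (rule ck_le)

lemma csm_subset: "csm k c W H \<Longrightarrow> V \<subseteq> W \<Longrightarrow> csm k c V H"
 unfolding csm_def by (rule ck_subset) auto

lemma csm_const: "csm k c W (\<lambda>q. a)"
 unfolding csm_def by (rule ck_const)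

lemma partial_eqI:
 "((\<lambda>y. H (param c y)) has_derivative L) (at (coord c q)) \<Longrightarrow> partial c i H q = L (axis i 1)"
 by (simp add: partial_def chart_deriv_def o_def fd_eqI)

lemma csm_has_derivative:
 assumes "csm (Suc 0) c W H" "q \<in> W"
 obtains L where "((\<lambda>y. H (param c y)) has_derivative L) (at (coord c q))" "\<And>i. partial c i H q = L (axis i 1)"
proof -
 have "((\<lambda>y. H (param c y)) has_derivative fd (\<lambda>y. H (param c y)) (coord c q)) (at (coord c q))"
  using assms by (intro fd_works ck_differentiable) (auto simp: csm_def)
 from that[OF this partial_eqI[OF this]] show ?thesis .
qed

lemma partial_sum:
 assumes "\<And>x. x \<in> I \<Longrightarrow> csm (Suc 0) c W (H x)" "q \<in> W"
 shows "partial c i (\<lambda>q. \<Sum>x\<in>I. H x q) q = (\<Sum>x\<in>I. partial c i (H x) q)"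
proof -
 have "\<exists>L. ((\<lambda>y. H x (param c y)) has_derivative L) (at (coord c q)) \<and> partial c i (H x) q = L (axis i 1)"
  if "x \<in> I" for x
  using csm_has_derivative[OF assms(1)[OF that] assms(2)] by metis
 then obtain L where L: "\<And>x. x \<in> I \<Longrightarrow> ((\<lambda>y. H x (param c y)) has_derivative L x) (at (coord c q))"
  "\<And>x. x \<in> I \<Longrightarrow> partial c i (H x) q = L x (axis i 1)" by metis
 have "partial c i (\<lambda>q. \<Sum>x\<in>I. H x q) q = (\<Sum>x\<in>I. L x (axis i 1))"
  by (rule partial_eqI) (rule has_derivative_sum[OF L(1)])
 then show ?thesis using L(2) by simp
qed

context smooth_manifold
begin

definition patch :: "('a, 'n) chart \<Rightarrow> 'a set \<Rightarrow> bool" where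
 "patch c W \<longleftrightarrow> c \<in> A \<and> open W \<and> W \<subseteq> domain c"

lemma patch_domain: "c \<in> A \<Longrightarrow> patch c (domain c)"
 by (simp add: patch_def chart)

lemma patch_image: "patch c W \<Longrightarrow> open (coord c ` W)"
proof -
 assume W: "patch c W"
 then have "coord c ` W = coord c ` domain c \<inter> param c -` W"
  using coord_image[of c W] by (simp add: patch_def Int_absorb1)
 then show ?thesis using W by (simp add: patch_def continuous_open_preimage chart)
qed

lemma patch_param: "patch c W \<Longrightarrow> q \<in> W \<Longrightarrow> param c (coord c q) = q"
 by (auto simp: patch_def chart)

lemma patch_coord: "patch c W \<Longrightarrow> y \<in> coord c ` W \<Longrightarrow> param c y \<in> W \<and> coord c (param c y) = y"
 by (auto simp: patch_def chart subset_iff)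


lemma partial_cong:
 assumes "patch c W" "q \<in> W" "\<And>q. q \<in> W \<Longrightarrow> H q = H' q"
 shows "partial c i H q = partial c i H' q"
proof -
 have "fd (H \<circ> param c) (coord c q) = fd (H' \<circ> param c) (coord c q)"
  by (rule fd_cong[OF patch_image[OF assms(1)]]) (use patch_coord[OF assms(1)] assms(2,3) in auto)
 then show ?thesis by (simp add: partial_def chart_deriv_def)
qed

lemma csm_add: "patch c W \<Longrightarrow> csm k c W G \<Longrightarrow> csm k c W H \<Longrightarrow> csm k c W (\<lambda>q. G q + H q)"
 unfolding csm_def by (intro ck_add patch_image)

lemma csm_diff: "patch c W \<Longrightarrow> csm k c W G \<Longrightarrow> csm k c W H \<Longrightarrow> csm k c W (\<lambda>q. G q - H q)"
 unfolding csm_def by (intro ck_diff patch_image)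

lemma csm_sum: "patch c W \<Longrightarrow> (\<And>i. i \<in> I \<Longrightarrow> csm k c W (G i)) \<Longrightarrow> csm k c W (\<lambda>q. \<Sum>i\<in>I. G i q)"
 unfolding csm_def by (intro ck_sum patch_image)

lemma csm_scaleR: "patch c W \<Longrightarrow> csm k c W a \<Longrightarrow> csm k c W H \<Longrightarrow> csm k c W (\<lambda>q. a q *\<^sub>R H q)"
 unfolding csm_def by (intro ck_scaleR patch_image)

lemma csm_mult: "patch c W \<Longrightarrow> csm k c W a \<Longrightarrow> csm k c W b \<Longrightarrow> csm k c W (\<lambda>q. a q * b q :: real)"
 unfolding csm_def by (intro ck_mult patch_image)

lemma csm_prod: "patch c W \<Longrightarrow> (\<And>i. i \<in> I \<Longrightarrow> csm k c W (G i)) \<Longrightarrow> csm k c W (\<lambda>q. \<Prod>i\<in>I. G i q :: real)"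
 unfolding csm_def by (intro ck_prod patch_image)

lemma csm_linear_image: "patch c W \<Longrightarrow> bounded_linear h \<Longrightarrow> csm k c W H \<Longrightarrow> csm k c W (\<lambda>q. h (H q))"
 unfolding csm_def by (rule ck_linear_image[OF _ _ patch_image])

lemma csm_partial:
 assumes W: "patch c W" and H: "csm (Suc k) c W H"
 shows "csm k c W (partial c i H)"
proof -
 have e: "partial c i H (param c y) = fd (\<lambda>y. H (param c y)) y (axis i 1)" if "y \<in> coord c ` W" for y
  using patch_coord[OF W that] by (simp add: partial_def chart_deriv_def o_def)
 show ?thesis
  unfolding csm_def
  by (rule iffD2[OF ck_cong[OF patch_image[OF W] e] ck_fd[OF H[unfolded csm_def] patch_image[OF W]]])
qed

lemma partial_scaleR:
 assumes W: "patch c W" and q: "q \<in> W" and "csm (Suc 0) c W a" "csm (Suc 0) c W H"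
 shows "partial c i (\<lambda>q. a q *\<^sub>R H q) q = a q *\<^sub>R partial c i H q + partial c i a q *\<^sub>R H q"
proof -
 obtain L where L: "((\<lambda>y. a (param c y)) has_derivative L) (at (coord c q))" "\<And>i. partial c i a q = L (axis i 1)"
  using csm_has_derivative[OF assms(3) q] by blast
 obtain M where M: "((\<lambda>y. H (param c y)) has_derivative M) (at (coord c q))" "\<And>i. partial c i H q = M (axis i 1)"
  using csm_has_derivative[OF assms(4) q] by blast
 show ?thesis
  using partial_eqI[OF has_derivative_scaleR[OF L(1) M(1)]] by (simp add: L(2) M(2) patch_param[OF W q])
qed

lemma partial_mult:
 assumes "patch c W" "q \<in> W" "csm (Suc 0) c W a" "csm (Suc 0) c W b"
 shows "partial c i (\<lambda>q. a q * b q :: real) q = a q * partial c i b q + partial c i a q * b q"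
 using partial_scaleR[OF assms] by simp

lemma partial_prod:
 assumes W: "patch c W" and q: "q \<in> W" and I: "\<And>x. x \<in> I \<Longrightarrow> csm (Suc 0) c W (G x)"
 shows "partial c i (\<lambda>q. \<Prod>x\<in>I. G x q :: real) q = (\<Sum>x\<in>I. partial c i (G x) q * (\<Prod>y\<in>I - {x}. G y q))"
proof -
 have "\<exists>L. ((\<lambda>y. G x (param c y)) has_derivative L) (at (coord c q)) \<and> partial c i (G x) q = L (axis i 1)"
  if "x \<in> I" for x
  using csm_has_derivative[OF I[OF that] q] by metis
 then obtain L where L: "\<And>x. x \<in> I \<Longrightarrow> ((\<lambda>y. G x (param c y)) has_derivative L x) (at (coord c q))"
  "\<And>x. x \<in> I \<Longrightarrow> partial c i (G x) q = L x (axis i 1)" by metis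
 show ?thesis
  using partial_eqI[OF has_derivative_prod[OF L(1)]] by (simp add: L(2) patch_param[OF W q])
qed

text \<open>The Jacobian of the change from \<open>c\<close> to \<open>d\<close>: the coordinate of
  \<open>d\<close> with index a is differentiated by the coordinate of \<open>c\<close> with index
  i. The index of \<open>c\<close> comes first because it is the one carried by covariant components
  in \<open>c\<close>.\<close>

definition jac :: "('a, 'n) chart \<Rightarrow> ('a, 'n) chart \<Rightarrow> 'n \<Rightarrow> 'n \<Rightarrow> 'a \<Rightarrow> real" where
 "jac c d i a q = partial c i (coord d) q $ a"

lemma csm_coord: "patch c W \<Longrightarrow> patch d W \<Longrightarrow> csm k c W (coord d)"
proof -
 assume W: "patch c W" "patch d W"
 then have "smooth_on (coord c ` (domain c \<inter> domain d)) (coord d \<circ> param c)"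
  using atlas by (auto simp: patch_def smooth_atlas_def)
 moreover have "patch c (domain c \<inter> domain d)" using W by (auto simp: patch_def chart)
 ultimately have "csm k c (domain c \<inter> domain d) (coord d)"
  unfolding csm_def by (intro ck_smooth_on patch_image) (auto simp: o_def)
 then show ?thesis by (rule csm_subset) (use W in \<open>auto simp: patch_def\<close>)
qed

lemma csm_jac: "patch c W \<Longrightarrow> patch d W \<Longrightarrow> csm k c W (jac c d i a)"
 unfolding jac_def[abs_def]
 by (intro csm_linear_image[where h = "\<lambda>x. x $ a"] bounded_linear_vec_nth csm_partial csm_coord)

lemma csm_change:
 assumes W: "patch c W" "patch d W" and H: "csm k c W H"
 shows "csm k d W H"
proof -
 have "ck k (coord d ` W) (\<lambda>y. H (param c (coord c (param d y))))"
  by (rule ck_compose[OF H[unfolded csm_def] csm_coord[OF W(2,1), unfolded csm_def] _ patch_image[OF W(2)]])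
   (use patch_coord[OF W(2)] in auto)
 moreover have "H (param c (coord c (param d y))) = H (param d y)" if "y \<in> coord d ` W" for y
  using patch_coord[OF W(2) that] patch_param[OF W(1)] by simp
 ultimately show ?thesis
  unfolding csm_def using ck_cong[OF patch_image[OF W(2)], of "\<lambda>y. H (param c (coord c (param d y)))" "\<lambda>y. H (param d y)" k] by blast
qed

lemma partial_change:
 assumes W: "patch c W" "patch d W" and q: "q \<in> W" and H: "csm (Suc 0) d W H"
 shows "partial c i H q = (\<Sum>a\<in>UNIV. jac c d i a q *\<^sub>R partial d a H q)"
proof -
 obtain L where L: "((\<lambda>y. coord d (param c y)) has_derivative L) (at (coord c q))" "\<And>i. partial c i (coord d) q = L (axis i 1)"
  using csm_has_derivative[OF csm_coord[OF W] q] by blast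
 obtain M where M: "((\<lambda>y. H (param d y)) has_derivative M) (at (coord d q))" "\<And>i. partial d i H q = M (axis i 1)"
  using csm_has_derivative[OF H q] by blast
 have "((\<lambda>y. H (param d (coord d (param c y)))) has_derivative (\<lambda>v. M (L v))) (at (coord c q))"
  by (rule has_derivative_compose[OF L(1)]) (simp add: M patch_param[OF W(1) q])
 from partial_eqI[where H = "\<lambda>q. H (param d (coord d q))", OF this]
 have "partial c i (\<lambda>q. H (param d (coord d q))) q = M (L (axis i 1))" .
 moreover have "partial c i (\<lambda>q. H (param d (coord d q))) q = partial c i H q"
  by (rule partial_cong[OF W(1) q]) (simp add: patch_param[OF W(2)])
 moreover have "L (axis i 1) = (\<Sum>a\<in>UNIV. jac c d i a q *\<^sub>R axis a 1)"
  using basis_expansion[of "L (axis i 1)"] by (simp add: jac_def L(2) scalar_mult_eq_scaleR)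
 ultimately show ?thesis
  using has_derivative_linear[OF M(1)] by (simp add: M(2) linear_sum linear_scale)
qed

lemma partial_commute:
 assumes W: "patch c W" and q: "q \<in> W" and H: "csm 2 c W H"
 shows "partial c i (partial c j H) q = partial c j (partial c i H) q"
proof -
 let ?H = "\<lambda>y. H (param c y)"
 have H1: "csm (Suc 0) c W (partial c j H)" for j using csm_partial[OF W] H by (simp add: numeral_2_eq_2)
 have d: "(?H has_derivative fd ?H y) (at y)" if "y \<in> coord c ` W" for y
  using csm_le[OF H, of "Suc 0"] that by (intro fd_works ck_differentiable) (auto simp: csm_def)
 have e: "partial c j H (param c y) = fd ?H y (axis j 1)" if "y \<in> coord c ` W" for y j
  using patch_coord[OF W that] by (simp add: partial_def chart_deriv_def o_def)
 have "\<exists>L. ((\<lambda>y. fd ?H y (axis j 1)) has_derivative L) (at (coord c q)) \<and> (\<forall>i. partial c i (partial c j H) q = L (axis i 1))" for j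
 proof -
  obtain L where L: "((\<lambda>y. partial c j H (param c y)) has_derivative L) (at (coord c q))"
   "\<And>i. partial c i (partial c j H) q = L (axis i 1)"
   using csm_has_derivative[OF H1 q] by blast
  have "((\<lambda>y. fd ?H y (axis j 1)) has_derivative L) (at (coord c q))"
   by (rule has_derivative_transform_within_open[OF L(1) patch_image[OF W]]) (use q e in auto)
  then show ?thesis using L(2) by blast
 qed
 then obtain L where L: "\<And>j. ((\<lambda>y. fd ?H y (axis j 1)) has_derivative L j) (at (coord c q))"
  "\<And>i j. partial c i (partial c j H) q = L j (axis i 1)" by metis
 show ?thesis
  using second_derivative_symmetric[OF patch_image[OF W] _ d L(1) L(1)] q by (simp add: L(2))
qed

text \<open>Symmetry of the second derivatives of the transition map. It enters the transformation
  law of the Christoffel symbols as the symmetry of \<open>H\<close> in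
  \<open>christoffel_algebra\<close>.\<close>

lemma jac_commute:
 assumes W: "patch c W" "patch d W" and q: "q \<in> W"
 shows "partial c i (jac c d j a) q = partial c j (jac c d i a) q"
proof -
 have *: "partial c i (jac c d j a) q = partial c i (partial c j (coord d)) q $ a" for i j
 proof -
  obtain L where L: "((\<lambda>y. partial c j (coord d) (param c y)) has_derivative L) (at (coord c q))"
   "\<And>i. partial c i (partial c j (coord d)) q = L (axis i 1)"
   using csm_has_derivative[OF csm_partial[OF W(1) csm_coord[OF W]] q] by blast
  from partial_eqI[where H = "jac c d j a", OF bounded_linear.has_derivative[OF bounded_linear_vec_nth L(1), of a, folded jac_def]]
  show ?thesis by (simp add: L(2))
 qed
 show ?thesis unfolding * using partial_commute[OF W(1) q csm_coord[OF W]] by simp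
qed

end

section \<open>Covariant derivatives\<close>

text \<open>The index algebra behind the transformation law: \<open>J\<close> is the Jacobian of the
  change of chart and \<open>H\<close> its derivatives, \<open>G\<close> the metric in the second
  chart and \<open>D\<close> its derivatives, \<open>P\<close> and \<open>Q\<close> the inverse
  metrics in the first and second chart, and \<open>dg\<close> the derivatives of the first metric,
  expanded by the product rule.\<close>

lemma christoffel_algebra:
 fixes J G P Q :: "'n::finite \<Rightarrow> 'n \<Rightarrow> real" and H D dg :: "'n \<Rightarrow> 'n \<Rightarrow> 'n \<Rightarrow> real"
 assumes dg: "\<And>i j l. dg i j l = (\<Sum>a\<in>UNIV. \<Sum>b\<in>UNIV. H i j a * G a b * J l b
   + J j a * (\<Sum>e\<in>UNIV. J i e * D e a b) * J l b + J j a * G a b * H i l b)"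
  and H: "\<And>i j a. H i j a = H j i a" and G: "\<And>a b. G a b = G b a"
  and PQ: "\<And>a b. (\<Sum>l\<in>UNIV. \<Sum>m\<in>UNIV. J l a * P l m * J m b) = Q a b"
  and QG: "\<And>a b. (\<Sum>e\<in>UNIV. Q a e * G e b) = (if a = b then 1 else 0)"
 shows "(\<Sum>l\<in>UNIV. (\<Sum>m\<in>UNIV. P l m * (dg i j m + dg j i m - dg m i j)) / 2 * J l a) =
  (\<Sum>x\<in>UNIV. \<Sum>y\<in>UNIV. (\<Sum>e\<in>UNIV. Q a e * (D x y e + D y x e - D e x y)) / 2 * J i x * J j y) + H i j a"
proof -
 define B where "B u v = (\<Sum>a\<in>UNIV. \<Sum>b\<in>UNIV. u a * G a b * v b)" for u v :: "'n \<Rightarrow> real"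
 define C where "C w u v = (\<Sum>a\<in>UNIV. \<Sum>b\<in>UNIV. u a * (\<Sum>e\<in>UNIV. w e * D e a b) * v b)" for w u v :: "'n \<Rightarrow> real"
 define K where "K e = (\<Sum>b\<in>UNIV. G e b * H i j b)" for e
 define S where "S e = (\<Sum>x\<in>UNIV. \<Sum>y\<in>UNIV. J i x * J j y * (D x y e + D y x e - D e x y))" for e
 have dg': "dg i j l = B (H i j) (J l) + C (J i) (J j) (J l) + B (J j) (H i l)" for i j l
  by (simp add: dg sum.distrib B_def C_def)
 have Bs: "B u v = B v u" for u v
  unfolding B_def by (subst sum.swap) (simp add: G mult_ac)
 have Hs: "H i j = H j i" for i j using H by blast
 have C1: "C w u v = (\<Sum>e\<in>UNIV. v e * (\<Sum>x\<in>UNIV. \<Sum>y\<in>UNIV. w x * u y * D x y e))" for w u v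
 proof -
  have "C w u v = (\<Sum>y\<in>UNIV. \<Sum>e\<in>UNIV. \<Sum>x\<in>UNIV. v e * (w x * u y * D x y e))"
   by (simp add: C_def sum_distrib_left sum_distrib_right mult_ac)
  also have "\<dots> = (\<Sum>e\<in>UNIV. \<Sum>y\<in>UNIV. \<Sum>x\<in>UNIV. v e * (w x * u y * D x y e))" by (rule sum.swap)
  also have "\<dots> = (\<Sum>e\<in>UNIV. \<Sum>x\<in>UNIV. \<Sum>y\<in>UNIV. v e * (w x * u y * D x y e))"
   by (rule sum.cong[OF refl]) (rule sum.swap)
  finally show ?thesis by (simp add: sum_distrib_left)
 qed
 have C2: "C w u v = (\<Sum>e\<in>UNIV. v e * (\<Sum>x\<in>UNIV. \<Sum>y\<in>UNIV. u x * w y * D y x e))" for w u v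
  unfolding C1 by (rule sum.cong[OF refl], rule arg_cong2[where f = "(*)"], rule refl) (subst sum.swap, simp add: mult_ac)
 have C3: "C v u w = (\<Sum>e\<in>UNIV. v e * (\<Sum>x\<in>UNIV. \<Sum>y\<in>UNIV. u x * w y * D e x y))" for w u v
 proof -
  have "C v u w = (\<Sum>x\<in>UNIV. \<Sum>y\<in>UNIV. \<Sum>e\<in>UNIV. v e * (u x * w y * D e x y))"
   by (simp add: C_def sum_distrib_left sum_distrib_right mult_ac)
  also have "\<dots> = (\<Sum>x\<in>UNIV. \<Sum>e\<in>UNIV. \<Sum>y\<in>UNIV. v e * (u x * w y * D e x y))"
   by (rule sum.cong[OF refl]) (rule sum.swap)
  also have "\<dots> = (\<Sum>e\<in>UNIV. \<Sum>x\<in>UNIV. \<Sum>y\<in>UNIV. v e * (u x * w y * D e x y))" by (rule sum.swap)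
  finally show ?thesis by (simp add: sum_distrib_left)
 qed
 have CS: "C (J i) (J j) v + C (J j) (J i) v - C v (J i) (J j) = (\<Sum>e\<in>UNIV. v e * S e)" for v
  unfolding C1[of "J i" "J j"] C2[of "J j" "J i"] C3[of v "J i" "J j"] S_def
  by (simp add: sum.distrib sum_subtractf distrib_left right_diff_distrib)
 have BK: "B (H i j) v = (\<Sum>e\<in>UNIV. v e * K e)" for v
  by (subst Bs) (simp add: B_def K_def sum_distrib_left mult_ac)
 \<comment> \<open>In the Koszul combination the terms with \<open>H i m\<close> and
   \<open>H j m\<close> cancel in pairs, by symmetry of \<open>H\<close> and \<open>B\<close>, while
   those with \<open>H i j\<close> double.\<close>
 have dg2: "dg i j m + dg j i m - dg m i j = 2 * B (H i j) (J m) + (\<Sum>e\<in>UNIV. J m e * S e)" for m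
  unfolding CS[symmetric] dg' Hs[of j i] Hs[of m i] Hs[of m j] Bs[of "H i m" "J j"]
  by (simp add: Bs[of "J j"] Bs[of "J i"])
 define R where "R e = K e + S e / 2" for e
 have br: "dg i j m + dg j i m - dg m i j = 2 * (\<Sum>e\<in>UNIV. J m e * R e)" for m
  unfolding dg2 BK sum_distrib_left sum.distrib[symmetric] by (rule sum.cong[OF refl]) (simp add: R_def algebra_simps)
 have "(\<Sum>l\<in>UNIV. (\<Sum>m\<in>UNIV. P l m * (dg i j m + dg j i m - dg m i j)) / 2 * J l a) =
   (\<Sum>l\<in>UNIV. \<Sum>m\<in>UNIV. \<Sum>e\<in>UNIV. J l a * P l m * J m e * R e)"
  unfolding br by (simp add: sum_distrib_left sum_distrib_right sum_divide_distrib mult_ac)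
 also have "\<dots> = (\<Sum>l\<in>UNIV. \<Sum>e\<in>UNIV. \<Sum>m\<in>UNIV. J l a * P l m * J m e * R e)"
  by (rule sum.cong[OF refl]) (rule sum.swap)
 also have "\<dots> = (\<Sum>e\<in>UNIV. \<Sum>l\<in>UNIV. \<Sum>m\<in>UNIV. J l a * P l m * J m e * R e)" by (rule sum.swap)
 also have "\<dots> = (\<Sum>e\<in>UNIV. Q a e * R e)" by (simp add: PQ[symmetric] sum_distrib_right)
 also have "\<dots> = (\<Sum>e\<in>UNIV. Q a e * K e) + (\<Sum>e\<in>UNIV. Q a e * S e / 2)"
  by (simp add: R_def distrib_left sum.distrib)
 also have "(\<Sum>e\<in>UNIV. Q a e * K e) = H i j a"
 proof -
  have "(\<Sum>e\<in>UNIV. Q a e * K e) = (\<Sum>e\<in>UNIV. \<Sum>b\<in>UNIV. Q a e * G e b * H i j b)"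
   by (simp add: K_def sum_distrib_left mult_ac)
  also have "\<dots> = (\<Sum>b\<in>UNIV. \<Sum>e\<in>UNIV. Q a e * G e b * H i j b)" by (rule sum.swap)
  also have "\<dots> = (\<Sum>b\<in>UNIV. (if a = b then 1 else 0) * H i j b)" by (simp add: QG[symmetric] sum_distrib_right)
  also have "\<dots> = H i j a" by (simp add: if_distrib[of "\<lambda>x. x * _"] sum.delta cong: if_cong)
  finally show ?thesis .
 qed
 also have "(\<Sum>e\<in>UNIV. Q a e * S e / 2) =
   (\<Sum>x\<in>UNIV. \<Sum>y\<in>UNIV. (\<Sum>e\<in>UNIV. Q a e * (D x y e + D y x e - D e x y)) / 2 * J i x * J j y)"
 proof -
  let ?t = "\<lambda>e x y. Q a e * (D x y e + D y x e - D e x y) / 2 * J i x * J j y"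
  have "(\<Sum>e\<in>UNIV. Q a e * S e / 2) = (\<Sum>e\<in>UNIV. \<Sum>x\<in>UNIV. \<Sum>y\<in>UNIV. ?t e x y)"
   by (simp add: S_def sum_distrib_left sum_divide_distrib mult_ac)
  also have "\<dots> = (\<Sum>x\<in>UNIV. \<Sum>e\<in>UNIV. \<Sum>y\<in>UNIV. ?t e x y)" by (rule sum.swap)
  also have "\<dots> = (\<Sum>x\<in>UNIV. \<Sum>y\<in>UNIV. \<Sum>e\<in>UNIV. ?t e x y)" by (rule sum.cong[OF refl]) (rule sum.swap)
  finally show ?thesis by (simp add: sum_distrib_right sum_divide_distrib)
 qed
 finally show ?thesis by simp
qed


lemma sum_lists_Suc:
 "(\<Sum>is | length (is :: 'n::finite list) = Suc k. \<phi> is) = (\<Sum>i\<in>UNIV. \<Sum>is | length is = k. \<phi> (i # is))"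
proof -
 have "(\<Sum>is | length (is :: 'n list) = Suc k. \<phi> is) = (\<Sum>(i, is)\<in>UNIV \<times> {is. length is = k}. \<phi> (i # is))"
  by (rule sum.reindex_bij_witness[of _ "\<lambda>(i, is). i # is" "\<lambda>is. (hd is, tl is)"])
   (auto simp: length_Suc_conv)
 then show ?thesis by (simp add: sum.cartesian_product)
qed

lemma sum_lists_prod:
 fixes h :: "nat \<Rightarrow> 'n::finite \<Rightarrow> real"
 shows "(\<Sum>is | length is = k. \<Prod>m<k. h m (is ! m)) = (\<Prod>m<k. \<Sum>i\<in>UNIV. h m i)"
proof (induction k arbitrary: h)
 case (Suc k)
 have "(\<Sum>is | length is = Suc k. \<Prod>m<Suc k. h m (is ! m)) =
   (\<Sum>i\<in>UNIV. \<Sum>is | length is = k. h 0 i * (\<Prod>m<k. h (Suc m) (is ! m)))"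
  unfolding sum_lists_Suc prod.lessThan_Suc_shift by simp
 also have "\<dots> = (\<Sum>i\<in>UNIV. h 0 i) * (\<Prod>m<k. \<Sum>i\<in>UNIV. h (Suc m) i)"
  using Suc[of "\<lambda>m. h (Suc m)"] by (simp add: sum_distrib_left[symmetric] sum_distrib_right)
 finally show ?case unfolding prod.lessThan_Suc_shift .
qed simp

text \<open>Exchanging the entry at position m with the second summation variable is an involution
  on the pairs.\<close>

lemma sum_lists_swap_entry:
 assumes "m < k"
 shows "(\<Sum>as | length (as :: 'n::finite list) = k. \<Sum>l\<in>UNIV. \<phi> as l) =
  (\<Sum>as | length as = k. \<Sum>l\<in>UNIV. \<phi> (as[m := l]) (as ! m))"
 unfolding sum.cartesian_product
 by (rule sum.reindex_bij_witness[of _ "\<lambda>(as, l). (as[m := l], as ! m)" "\<lambda>(as, l). (as[m := l], as ! m)"])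
  (use assms in auto)

locale riemannian_manifold = smooth_manifold A for A :: "('a::t2_space, 'n::finite) chart set" +
 fixes g :: "('a, 'n) metric"
 assumes metric: "riemannian_metric A g"
begin

lemma metric_det:
 assumes "c \<in> A" "q \<in> domain c"
 shows "det (g c q) \<noteq> 0"
proof -
 have "v = 0" if "g c q *v v = 0" for v
 proof (rule ccontr)
  assume "v \<noteq> 0"
  then have "metric_inner g c q v v > 0" using metric assms unfolding riemannian_metric_def by blast
  then show False by (simp add: metric_inner_def that)
 qed
 then show ?thesis
  unfolding invertible_det_nz[symmetric] invertible_left_inverse matrix_left_invertible_ker by blast
qed

lemma metric_sym: "c \<in> A \<Longrightarrow> q \<in> domain c \<Longrightarrow> g c q $ i $ j = g c q $ j $ i"
proof -
 assume "c \<in> A" "q \<in> domain c"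
 then have "transpose (g c q) = g c q" using metric unfolding riemannian_metric_def by blast
 then have "transpose (g c q) $ i $ j = g c q $ i $ j" by simp
 then show ?thesis by (simp add: transpose_def)
qed

lemma metric_change:
 assumes "c \<in> A" "d \<in> A" "q \<in> domain c" "q \<in> domain d"
 shows "g c q $ i $ j = (\<Sum>a\<in>UNIV. \<Sum>b\<in>UNIV. jac c d i a q * g d q $ a $ b * jac c d j b q)"
proof -
 have "metric_inner g c q (axis i 1) (axis j 1) =
   metric_inner g d q (partial c i (coord d) q) (partial c j (coord d) q)"
  using metric assms unfolding riemannian_metric_def partial_def by blast
 moreover have "metric_inner g c q (axis i 1) (axis j 1) = g c q $ i $ j"
  by (simp add: metric_inner_def matrix_vector_mult_basis column_def inner_axis')
 ultimately show ?thesis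
  by (simp add: metric_inner_def inner_vec_def matrix_vector_mult_def jac_def sum_distrib_left mult.assoc)
qed

lemma csm_metric:
 assumes W: "patch c W"
 shows "csm k c W (\<lambda>q. g c q $ i $ j)"
proof -
 have c: "c \<in> A" and sub: "W \<subseteq> domain c" using W by (auto simp: patch_def)
 have "smooth_on (coord c ` domain c) (\<lambda>y. g c (param c y))"
  using metric c unfolding riemannian_metric_def o_def by blast
 then have "csm k c (domain c) (g c)" unfolding csm_def by (rule ck_smooth_on[OF chart(2)[OF c]])
 from csm_linear_image[OF W bounded_linear_compose[OF bounded_linear_vec_nth bounded_linear_vec_nth] csm_subset[OF this sub]]
 show ?thesis .
qed

lemma csm_metric_inv:
 assumes W: "patch c W"
 shows "csm k c W (\<lambda>q. matrix_inv (g c q) $ i $ j)"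
 unfolding csm_def
proof (rule ck_matrix_inv[OF _ patch_image[OF W]])
 show "ck k (coord c ` W) (\<lambda>y. g c (param c y) $ i $ j)" for i j
  using csm_metric[OF W] by (simp add: csm_def)
 show "det (g c (param c y)) \<noteq> 0" if "y \<in> coord c ` W" for y
  using patch_coord[OF W that] W by (intro metric_det) (auto simp: patch_def)
qed

lemma csm_christoffel:
 assumes W: "patch c W"
 shows "csm k c W (christoffel g c l i j)"
proof -
 have p: "csm k c W (partial c i (\<lambda>q. g c q $ a $ b))" for i a b
  by (rule csm_partial[OF W csm_metric[OF W]])
 have "csm k c W (\<lambda>q. (1 / 2) * (\<Sum>m\<in>UNIV. matrix_inv (g c q) $ l $ m *
    (partial c i (\<lambda>q. g c q $ j $ m) q + partial c j (\<lambda>q. g c q $ i $ m) q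
     - partial c m (\<lambda>q. g c q $ i $ j) q)))"
  by (intro csm_mult[OF W] csm_const csm_sum[OF W] csm_metric_inv[OF W] csm_diff[OF W] csm_add[OF W] p)
 then show ?thesis by (simp add: christoffel_def[abs_def])
qed

text \<open>With the Jacobian M, the metrics satisfy g_c = M g_d M^T. Since g_c is invertible, so is
  M, and therefore M^T g_c^-1 M is the inverse of g_d.\<close>

lemma metric_inv_change:
 assumes q: "c \<in> A" "d \<in> A" "q \<in> domain c" "q \<in> domain d"
 shows "matrix_inv (g d q) $ a $ b =
  (\<Sum>l\<in>UNIV. \<Sum>m\<in>UNIV. jac c d l a q * matrix_inv (g c q) $ l $ m * jac c d m b q)"
proof -
 define M where "M = (\<chi> i a. jac c d i a q)"
 have gc: "g c q = M ** g d q ** transpose M"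
 proof -
  have "(M ** g d q ** transpose M) $ i $ j = g c q $ i $ j" for i j
  proof -
   have "(M ** g d q ** transpose M) $ i $ j =
     (\<Sum>b\<in>UNIV. \<Sum>a\<in>UNIV. jac c d i a q * g d q $ a $ b * jac c d j b q)"
    by (simp add: matrix_matrix_mult_def transpose_def M_def sum_distrib_right)
   then show ?thesis unfolding metric_change[OF q] by (subst sum.swap) simp
  qed
  then show ?thesis by (simp add: vec_eq_iff)
 qed
 have "det M \<noteq> 0" using metric_det[OF q(1,3)] by (auto simp: gc det_mul)
 then obtain N where N: "N ** M = mat 1"
  unfolding invertible_det_nz[symmetric] invertible_left_inverse by blast
 let ?Q = "transpose M ** matrix_inv (g c q) ** M"
 have "g d q ** ?Q = (N ** M) ** (g d q ** ?Q)" by (simp add: N)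
 also have "\<dots> = N ** ((M ** g d q ** transpose M) ** matrix_inv (g c q)) ** M"
  by (simp only: matrix_mul_assoc)
 also have "\<dots> = mat 1" unfolding gc[symmetric] by (simp add: matrix_inv_right metric_det q N)
 finally have "matrix_inv (g d q) = ?Q" by (rule matrix_inv_eqI)
 then have "matrix_inv (g d q) $ a $ b =
   (\<Sum>m\<in>UNIV. \<Sum>l\<in>UNIV. jac c d l a q * matrix_inv (g c q) $ l $ m * jac c d m b q)"
  by (simp add: matrix_matrix_mult_def transpose_def M_def sum_distrib_right)
 then show ?thesis by (subst sum.swap) simp
qed

text \<open>The last term, a derivative of the Jacobian, is what compensates in
  \<open>cov_change\<close> for the derivatives falling on Jacobian factors.\<close>

lemma christoffel_change:
 assumes W: "patch c W" "patch d W" and q: "q \<in> W"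
 shows "(\<Sum>l\<in>UNIV. christoffel g c l i j q * jac c d l a q) =
  (\<Sum>x\<in>UNIV. \<Sum>y\<in>UNIV. christoffel g d a x y q * jac c d i x q * jac c d j y q) + partial c i (jac c d j a) q"
 unfolding christoffel_def
proof (rule christoffel_algebra[where H = "\<lambda>i j a. partial c i (jac c d j a) q" and G = "\<lambda>a b. g d q $ a $ b"])
 have cd: "c \<in> A" "d \<in> A" and sub: "W \<subseteq> domain c" "W \<subseteq> domain d" using W by (auto simp: patch_def)
 have qd: "q \<in> domain c" "q \<in> domain d" using q sub by auto
 note J = csm_jac[OF W] and G = csm_change[OF W(2,1) csm_metric[OF W(2)]]
 show "partial c i (\<lambda>q. g c q $ j $ l) q = (\<Sum>a\<in>UNIV. \<Sum>b\<in>UNIV.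
   partial c i (jac c d j a) q * g d q $ a $ b * jac c d l b q
   + jac c d j a q * (\<Sum>e\<in>UNIV. jac c d i e q * partial d e (\<lambda>q. g d q $ a $ b) q) * jac c d l b q
   + jac c d j a q * g d q $ a $ b * partial c i (jac c d l b) q)" for i j l
 proof -
  have "partial c i (\<lambda>q. g c q $ j $ l) q =
    partial c i (\<lambda>q. \<Sum>a\<in>UNIV. \<Sum>b\<in>UNIV. jac c d j a q * g d q $ a $ b * jac c d l b q) q"
   by (rule partial_cong[OF W(1) q]) (rule metric_change, use cd sub in auto)
  also have "\<dots> = (\<Sum>a\<in>UNIV. \<Sum>b\<in>UNIV. partial c i (\<lambda>q. jac c d j a q * g d q $ a $ b * jac c d l b q) q)"
   by (subst partial_sum[OF _ q], intro csm_sum[OF W(1)] csm_mult[OF W(1)] J G)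
    (intro sum.cong refl partial_sum[OF _ q] csm_mult[OF W(1)] J G)
  also have "\<dots> = (\<Sum>a\<in>UNIV. \<Sum>b\<in>UNIV. jac c d j a q * g d q $ a $ b * partial c i (jac c d l b) q
    + (jac c d j a q * (\<Sum>e\<in>UNIV. jac c d i e q *\<^sub>R partial d e (\<lambda>q. g d q $ a $ b) q)
      + partial c i (jac c d j a) q * g d q $ a $ b) * jac c d l b q)"
   by (intro sum.cong refl)
    (simp only: partial_mult[OF W(1) q csm_mult[OF W(1) J G] J] partial_mult[OF W(1) q J G]
     partial_change[OF W q csm_metric[OF W(2)]])
  finally show ?thesis by (simp add: algebra_simps)
 qed
 show "partial c i (jac c d j a) q = partial c j (jac c d i a) q" for i j a
  by (rule jac_commute[OF W q])
 show "g d q $ a $ b = g d q $ b $ a" for a b by (rule metric_sym[OF cd(2) qd(2)])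
 show "(\<Sum>l\<in>UNIV. \<Sum>m\<in>UNIV. jac c d l a q * matrix_inv (g c q) $ l $ m * jac c d m b q) = matrix_inv (g d q) $ a $ b" for a b
  by (rule metric_inv_change[OF cd qd, symmetric])
 show "(\<Sum>e\<in>UNIV. matrix_inv (g d q) $ a $ e * g d q $ e $ b) = (if a = b then 1 else 0)" for a b
 proof -
  have "matrix_inv (g d q) ** g d q = mat 1"
   using matrix_inv_right[OF metric_det[OF cd(2) qd(2)]] matrix_left_right_inverse by blast
  then have "(matrix_inv (g d q) ** g d q) $ a $ b = mat 1 $ a $ b" by simp
  then show ?thesis by (simp add: matrix_matrix_mult_def mat_def)
 qed
qed

abbreviation cov :: "('a, 'n) chart \<Rightarrow> ('a \<Rightarrow> 'b::euclidean_space) \<Rightarrow> 'n list \<Rightarrow> 'a \<Rightarrow> 'b" where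
 "cov c F \<equiv> cov_deriv g c (\<lambda>i q y. 0) F"

lemma cov_Cons: "cov c F (i # js) = (\<lambda>q. partial c i (cov c F js) q -
  (\<Sum>m<length js. \<Sum>l\<in>UNIV. christoffel g c l i (js ! m) q *\<^sub>R cov c F (js[m := l]) q))"
 by simp

text \<open>The recursion replaces entries of the index list, so its arguments are not just tails
  and the induction is over the length.\<close>

lemma csm_cov:
 assumes W: "patch c W"
 shows "csm (k + length js) c W F \<Longrightarrow> csm k c W (cov c F js)"
proof (induction js arbitrary: k rule: length_induct)
 case (1 js)
 show ?case
 proof (cases js)
  case Nil
  then show ?thesis using 1(2) by simp
 next
  case (Cons i js')
  have "csm (Suc k + length js') c W F" using 1(2) Cons by simp
  then have "csm (Suc k) c W (cov c F js')" using 1(1) Cons by auto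
  moreover have "csm k c W (cov c F (js'[m := l]))" for m l
   using 1(1) Cons csm_le[OF 1(2), of "k + length js'"] by auto
  ultimately show ?thesis
   unfolding Cons cov_Cons
   by (intro csm_diff[OF W] csm_sum[OF W] csm_scaleR[OF W] csm_christoffel[OF W] csm_partial[OF W])
 qed
qed

lemma prod_list_update:
 fixes h :: "'n \<Rightarrow> 'n \<Rightarrow> real"
 assumes "m < length js"
 shows "(\<Prod>m'<length js. h (js[m := l] ! m') (as ! m')) =
  h l (as ! m) * (\<Prod>m'\<in>{..<length js} - {m}. h (js ! m') (as ! m'))"
proof -
 have "(\<Prod>m'<length js. h (js[m := l] ! m') (as ! m')) =
   h (js[m := l] ! m) (as ! m) * (\<Prod>m'\<in>{..<length js} - {m}. h (js[m := l] ! m') (as ! m'))"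
  by (rule prod.remove) (use assms in auto)
 also have "(\<Prod>m'\<in>{..<length js} - {m}. h (js[m := l] ! m') (as ! m')) =
   (\<Prod>m'\<in>{..<length js} - {m}. h (js ! m') (as ! m'))"
  by (rule prod.cong) auto
 finally show ?thesis using assms by simp
qed

end

context riemannian_manifold
begin

text \<open>Tensoriality, with one Jacobian factor for each covariant index. The partial derivative
  of such a product also falls on the Jacobian factors, and these terms are exactly the ones that
  the inhomogeneous part of the Christoffel symbols subtracts.\<close>

lemma cov_change:
 assumes W: "patch c W" "patch d W"
 shows "csm (length js) c W F \<Longrightarrow> q \<in> W \<Longrightarrow> cov c F js q =
  (\<Sum>as | length as = length js. (\<Prod>m<length js. jac c d (js ! m) (as ! m) q) *\<^sub>R cov d F as q)"
proof (induction js arbitrary: q rule: length_induct)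
 case (1 js)
 show ?case
 proof (cases js)
  case Nil
  then show ?thesis by simp
 next
  case (Cons i js')
  define n where "n = length js'"
  define L where "L = {as :: 'n list. length as = n}"
  have F: "csm (Suc n) c W F" using 1(2) Cons by (simp add: n_def)
  have IH: "cov c F js'' q = (\<Sum>as\<in>L. (\<Prod>m<n. jac c d (js'' ! m) (as ! m) q) *\<^sub>R cov d F as q)"
   if "length js'' = n" "q \<in> W" for js'' q
   using 1(1) that csm_le[OF F, of n] Cons unfolding L_def n_def by fastforce
  have Td: "csm (Suc 0) d W (cov d F as)" if "as \<in> L" for as
   using that csm_change[OF W F] by (intro csm_cov[OF W(2)]) (simp add: L_def)
  have Tc: "csm (Suc 0) c W (cov d F as)" if "as \<in> L" for as
   using csm_change[OF W(2,1) Td[OF that]] .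
  have q: "q \<in> W" using 1(3) .
  \<comment> \<open>\<open>Pr\<close> is the product of all Jacobian factors, \<open>R m\<close> the
    product without the factor at position m, \<open>H m\<close> the derivative of that factor, and
    \<open>V m\<close> the Christoffel symbol of \<open>d\<close> contracted with it.\<close>
  define Pr where "Pr as = (\<Prod>m<n. jac c d (js' ! m) (as ! m) q)" for as
  define R where "R m as = (\<Prod>m'\<in>{..<n} - {m}. jac c d (js' ! m') (as ! m') q)" for m as
  define H where "H m a = partial c i (jac c d (js' ! m) a) q" for m a
  define V where "V m e a = (\<Sum>y\<in>UNIV. christoffel g d a e y q * jac c d (js' ! m) y q)" for m e a
  define T where "T as = cov d F as q" for as
  define J where "J e = jac c d i e q" for e
  note J' = csm_jac[OF W]
  have 1: "partial c i (cov c F js') q = (\<Sum>as\<in>L. (\<Sum>e\<in>UNIV. (Pr as * J e) *\<^sub>R partial d e (cov d F as) q)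
    + (\<Sum>m<n. R m as * H m (as ! m)) *\<^sub>R T as)"
  proof -
   have "partial c i (cov c F js') q =
     partial c i (\<lambda>q. \<Sum>as\<in>L. (\<Prod>m<n. jac c d (js' ! m) (as ! m) q) *\<^sub>R cov d F as q) q"
    by (rule partial_cong[OF W(1) q]) (simp add: IH n_def)
   also have "\<dots> = (\<Sum>as\<in>L. partial c i (\<lambda>q. (\<Prod>m<n. jac c d (js' ! m) (as ! m) q) *\<^sub>R cov d F as q) q)"
    by (rule partial_sum[OF _ q]) (intro csm_scaleR[OF W(1)] csm_prod[OF W(1)] J' Tc)
   also have "\<dots> = (\<Sum>as\<in>L. Pr as *\<^sub>R (\<Sum>e\<in>UNIV. J e *\<^sub>R partial d e (cov d F as) q)
    + (\<Sum>m<n. H m (as ! m) * R m as) *\<^sub>R T as)"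
   proof (rule sum.cong[OF refl])
    fix as assume as: "as \<in> L"
    show "partial c i (\<lambda>q. (\<Prod>m<n. jac c d (js' ! m) (as ! m) q) *\<^sub>R cov d F as q) q =
      Pr as *\<^sub>R (\<Sum>e\<in>UNIV. J e *\<^sub>R partial d e (cov d F as) q) + (\<Sum>m<n. H m (as ! m) * R m as) *\<^sub>R T as"
     unfolding partial_scaleR[OF W(1) q csm_prod[OF W(1) J'] Tc[OF as]] partial_prod[OF W(1) q J']
      partial_change[OF W q Td[OF as]] Pr_def J_def H_def R_def T_def ..
   qed
   finally show ?thesis by (simp add: scaleR_sum_right mult.commute)
  qed
  have upd: "cov c F (js'[m := l]) q = (\<Sum>as\<in>L. (jac c d l (as ! m) q * R m as) *\<^sub>R T as)" if "m < n" for m l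
  proof -
   have "length (js'[m := l]) = n" by (simp add: n_def)
   from IH[OF this q] show ?thesis
    using prod_list_update[of m js' "\<lambda>i a. jac c d i a q" l] that by (simp add: n_def R_def T_def)
  qed
  have 2: "(\<Sum>m<n. \<Sum>l\<in>UNIV. christoffel g c l i (js' ! m) q *\<^sub>R cov c F (js'[m := l]) q) =
    (\<Sum>as\<in>L. \<Sum>m<n. (R m as * (\<Sum>e\<in>UNIV. J e * V m e (as ! m)) + R m as * H m (as ! m)) *\<^sub>R T as)"
  proof -
   have "(\<Sum>l\<in>UNIV. christoffel g c l i (js' ! m) q *\<^sub>R cov c F (js'[m := l]) q) =
     (\<Sum>as\<in>L. (R m as * (\<Sum>e\<in>UNIV. J e * V m e (as ! m)) + R m as * H m (as ! m)) *\<^sub>R T as)" if m: "m < n" for m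
   proof -
    have "(\<Sum>l\<in>UNIV. christoffel g c l i (js' ! m) q *\<^sub>R cov c F (js'[m := l]) q) =
      (\<Sum>l\<in>UNIV. \<Sum>as\<in>L. (R m as * (christoffel g c l i (js' ! m) q * jac c d l (as ! m) q)) *\<^sub>R T as)"
     by (simp add: upd[OF m] scaleR_sum_right mult_ac)
    also have "\<dots> = (\<Sum>as\<in>L. \<Sum>l\<in>UNIV. (R m as * (christoffel g c l i (js' ! m) q * jac c d l (as ! m) q)) *\<^sub>R T as)"
     by (rule sum.swap)
    also have "\<dots> = (\<Sum>as\<in>L. (R m as * (\<Sum>l\<in>UNIV. christoffel g c l i (js' ! m) q * jac c d l (as ! m) q)) *\<^sub>R T as)"
     by (simp add: scaleR_sum_left sum_distrib_left)
    finally show ?thesis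
     unfolding christoffel_change[OF W q]
     by (simp add: V_def J_def H_def sum_distrib_left distrib_left mult_ac)
   qed
   then have "(\<Sum>m<n. \<Sum>l\<in>UNIV. christoffel g c l i (js' ! m) q *\<^sub>R cov c F (js'[m := l]) q) =
     (\<Sum>m<n. \<Sum>as\<in>L. (R m as * (\<Sum>e\<in>UNIV. J e * V m e (as ! m)) + R m as * H m (as ! m)) *\<^sub>R T as)" by simp
   then show ?thesis by (subst (asm) sum.swap)
  qed
  \<comment> \<open>The terms with \<open>H\<close> have cancelled here, so second derivatives of
    the transition map no longer occur.\<close>
  have 3: "cov c F js q = (\<Sum>as\<in>L. \<Sum>e\<in>UNIV. (Pr as * J e) *\<^sub>R partial d e (cov d F as) q)
    - (\<Sum>as\<in>L. \<Sum>m<n. \<Sum>e\<in>UNIV. (R m as * (J e * V m e (as ! m))) *\<^sub>R T as)"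
   unfolding Cons cov_Cons n_def[symmetric] 1 2
   by (simp add: sum.distrib sum_subtractf[symmetric] scaleR_add_left scaleR_sum_left sum_distrib_left)
  \<comment> \<open>Exchanging the entry at position m with the summation index moves the
    Christoffel symbol from components with a changed index list to the Jacobian factors of the
    unchanged one.\<close>
  have 4: "(\<Sum>as\<in>L. \<Sum>l\<in>UNIV. (Pr as * christoffel g d l e (as ! m) q) *\<^sub>R T (as[m := l])) =
    (\<Sum>as\<in>L. (R m as * V m e (as ! m)) *\<^sub>R T as)" if m: "m < n" for m e
  proof -
   have Pu: "Pr (as[m := l]) = jac c d (js' ! m) l q * R m as" if "as \<in> L" for as l
    using prod_list_update[of m as "\<lambda>a j. jac c d j a q" l js'] that m by (simp add: L_def Pr_def R_def)
   have "(\<Sum>as\<in>L. \<Sum>l\<in>UNIV. (Pr as * christoffel g d l e (as ! m) q) *\<^sub>R T (as[m := l])) =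
     (\<Sum>as\<in>L. \<Sum>l\<in>UNIV. (Pr (as[m := l]) * christoffel g d (as ! m) e (as[m := l] ! m) q) *\<^sub>R T (as[m := l, m := as ! m]))"
    unfolding L_def by (rule sum_lists_swap_entry[OF m])
   also have "\<dots> = (\<Sum>as\<in>L. \<Sum>l\<in>UNIV. (R m as * (christoffel g d (as ! m) e l q * jac c d (js' ! m) l q)) *\<^sub>R T as)"
    by (intro sum.cong) (use m Pu in \<open>auto simp: L_def mult_ac\<close>)
   finally show ?thesis by (simp add: V_def sum_distrib_left scaleR_sum_left)
  qed
  have "(\<Sum>as | length as = length js. (\<Prod>m<length js. jac c d (js ! m) (as ! m) q) *\<^sub>R cov d F as q) =
    (\<Sum>e\<in>UNIV. \<Sum>as\<in>L. (J e * Pr as) *\<^sub>R cov d F (e # as) q)"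
   unfolding Cons by (simp only: length_Cons n_def[symmetric] sum_lists_Suc prod.lessThan_Suc_shift
     nth_Cons_0 nth_Cons_Suc J_def Pr_def L_def)
  also have "\<dots> = (\<Sum>e\<in>UNIV. \<Sum>as\<in>L. (Pr as * J e) *\<^sub>R partial d e (cov d F as) q
    - (\<Sum>m<n. \<Sum>l\<in>UNIV. J e *\<^sub>R (Pr as * christoffel g d l e (as ! m) q) *\<^sub>R T (as[m := l])))"
   unfolding cov_Cons T_def
   by (intro sum.cong) (simp_all add: L_def scaleR_diff_right scaleR_sum_right mult_ac)
  also have "\<dots> = (\<Sum>e\<in>UNIV. \<Sum>as\<in>L. (Pr as * J e) *\<^sub>R partial d e (cov d F as) q)
    - (\<Sum>e\<in>UNIV. \<Sum>as\<in>L. \<Sum>m<n. \<Sum>l\<in>UNIV. J e *\<^sub>R (Pr as * christoffel g d l e (as ! m) q) *\<^sub>R T (as[m := l]))"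
   by (simp add: sum_subtractf)
  also have "(\<Sum>e\<in>UNIV. \<Sum>as\<in>L. (Pr as * J e) *\<^sub>R partial d e (cov d F as) q) =
    (\<Sum>as\<in>L. \<Sum>e\<in>UNIV. (Pr as * J e) *\<^sub>R partial d e (cov d F as) q)" by (rule sum.swap)
  also have "(\<Sum>e\<in>UNIV. \<Sum>as\<in>L. \<Sum>m<n. \<Sum>l\<in>UNIV. J e *\<^sub>R (Pr as * christoffel g d l e (as ! m) q) *\<^sub>R T (as[m := l])) =
    (\<Sum>as\<in>L. \<Sum>m<n. \<Sum>e\<in>UNIV. (R m as * (J e * V m e (as ! m))) *\<^sub>R T as)"
  proof -
   have "(\<Sum>as\<in>L. \<Sum>m<n. \<Sum>l\<in>UNIV. J e *\<^sub>R (Pr as * christoffel g d l e (as ! m) q) *\<^sub>R T (as[m := l])) =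
     (\<Sum>as\<in>L. \<Sum>m<n. (R m as * (J e * V m e (as ! m))) *\<^sub>R T as)" for e
   proof -
    have "(\<Sum>as\<in>L. \<Sum>m<n. \<Sum>l\<in>UNIV. J e *\<^sub>R (Pr as * christoffel g d l e (as ! m) q) *\<^sub>R T (as[m := l])) =
      (\<Sum>m<n. \<Sum>as\<in>L. \<Sum>l\<in>UNIV. J e *\<^sub>R (Pr as * christoffel g d l e (as ! m) q) *\<^sub>R T (as[m := l]))"
     by (rule sum.swap)
    also have "\<dots> = (\<Sum>m<n. J e *\<^sub>R (\<Sum>as\<in>L. \<Sum>l\<in>UNIV. (Pr as * christoffel g d l e (as ! m) q) *\<^sub>R T (as[m := l])))"
     by (simp only: scaleR_sum_right)
    also have "\<dots> = (\<Sum>m<n. J e *\<^sub>R (\<Sum>as\<in>L. (R m as * V m e (as ! m)) *\<^sub>R T as))"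
     by (rule sum.cong[OF refl]) (simp add: 4)
    also have "\<dots> = (\<Sum>m<n. \<Sum>as\<in>L. (R m as * (J e * V m e (as ! m))) *\<^sub>R T as)"
     by (simp add: scaleR_sum_right mult_ac)
    also have "\<dots> = (\<Sum>as\<in>L. \<Sum>m<n. (R m as * (J e * V m e (as ! m))) *\<^sub>R T as)" by (rule sum.swap)
    finally show ?thesis .
   qed
   then have "(\<Sum>e\<in>UNIV. \<Sum>as\<in>L. \<Sum>m<n. \<Sum>l\<in>UNIV. J e *\<^sub>R (Pr as * christoffel g d l e (as ! m) q) *\<^sub>R T (as[m := l])) =
     (\<Sum>e\<in>UNIV. \<Sum>as\<in>L. \<Sum>m<n. (R m as * (J e * V m e (as ! m))) *\<^sub>R T as)" by simp
   also have "\<dots> = (\<Sum>as\<in>L. \<Sum>e\<in>UNIV. \<Sum>m<n. (R m as * (J e * V m e (as ! m))) *\<^sub>R T as)" by (rule sum.swap)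
   also have "\<dots> = (\<Sum>as\<in>L. \<Sum>m<n. \<Sum>e\<in>UNIV. (R m as * (J e * V m e (as ! m))) *\<^sub>R T as)"
    by (rule sum.cong[OF refl]) (rule sum.swap)
   finally show ?thesis .
  qed
  finally show ?thesis using 3 by simp
 qed
qed

text \<open>Summed over all index lists, the product of Jacobians and inverse metrics factorises
  into one contraction per position, and each contraction is an entry of the inverse metric in the
  other chart.\<close>

lemma tensor_norm_change:
 fixes S T :: "'n list \<Rightarrow> 'b::real_inner"
 assumes q: "c \<in> A" "d \<in> A" "q \<in> domain c" "q \<in> domain d"
  and T: "\<And>is. length is = k \<Longrightarrow> T is = (\<Sum>as | length as = k. (\<Prod>m<k. jac c d (is ! m) (as ! m) q) *\<^sub>R S as)"
 shows "tensor_norm g c q inner k T = tensor_norm g d q inner k S"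
proof -
 let ?L = "{is :: 'n list. length is = k}" and ?P = "\<lambda>is as. \<Prod>m<k. jac c d (is ! m) (as ! m) q"
  and ?G = "\<lambda>is js. \<Prod>m<k. matrix_inv (g c q) $ (is ! m) $ (js ! m)"
 have inv: "(\<Sum>is\<in>?L. \<Sum>js\<in>?L. ?P is as * ?G is js * ?P js bs) =
   (\<Prod>m<k. matrix_inv (g d q) $ (as ! m) $ (bs ! m))" for as bs
 proof -
  have "(\<Sum>is\<in>?L. \<Sum>js\<in>?L. ?P is as * ?G is js * ?P js bs) =
    (\<Sum>is\<in>?L. \<Sum>js\<in>?L. \<Prod>m<k. jac c d (is ! m) (as ! m) q * matrix_inv (g c q) $ (is ! m) $ (js ! m) * jac c d (js ! m) (bs ! m) q)"
   by (simp add: prod.distrib)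
  also have "\<dots> = (\<Sum>is\<in>?L. \<Prod>m<k. \<Sum>j\<in>UNIV. jac c d (is ! m) (as ! m) q * matrix_inv (g c q) $ (is ! m) $ j * jac c d j (bs ! m) q)"
   by (rule sum.cong[OF refl]) (rule sum_lists_prod)
  also have "\<dots> = (\<Prod>m<k. \<Sum>i\<in>UNIV. \<Sum>j\<in>UNIV. jac c d i (as ! m) q * matrix_inv (g c q) $ i $ j * jac c d j (bs ! m) q)"
   by (rule sum_lists_prod)
  finally show ?thesis by (simp add: metric_inv_change[OF q])
 qed
 have TT: "?G is js * inner (T is) (T js) =
   (\<Sum>as\<in>?L. \<Sum>bs\<in>?L. (?P is as * ?G is js * ?P js bs) * inner (S as) (S bs))" if "is \<in> ?L" "js \<in> ?L" for "is" js
  using that by (subst sum.swap) (simp add: T inner_sum_left inner_sum_right sum_distrib_left mult_ac)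
 have "(\<Sum>is\<in>?L. \<Sum>js\<in>?L. ?G is js * inner (T is) (T js)) =
   (\<Sum>is\<in>?L. \<Sum>js\<in>?L. \<Sum>as\<in>?L. \<Sum>bs\<in>?L. (?P is as * ?G is js * ?P js bs) * inner (S as) (S bs))"
  by (intro sum.cong TT) auto
 also have "\<dots> = (\<Sum>is\<in>?L. \<Sum>as\<in>?L. \<Sum>js\<in>?L. \<Sum>bs\<in>?L. (?P is as * ?G is js * ?P js bs) * inner (S as) (S bs))"
  by (rule sum.cong[OF refl]) (rule sum.swap)
 also have "\<dots> = (\<Sum>as\<in>?L. \<Sum>is\<in>?L. \<Sum>js\<in>?L. \<Sum>bs\<in>?L. (?P is as * ?G is js * ?P js bs) * inner (S as) (S bs))"
  by (rule sum.swap)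
 also have "\<dots> = (\<Sum>as\<in>?L. \<Sum>is\<in>?L. \<Sum>bs\<in>?L. \<Sum>js\<in>?L. (?P is as * ?G is js * ?P js bs) * inner (S as) (S bs))"
  by (rule sum.cong[OF refl], rule sum.cong[OF refl]) (rule sum.swap)
 also have "\<dots> = (\<Sum>as\<in>?L. \<Sum>bs\<in>?L. \<Sum>is\<in>?L. \<Sum>js\<in>?L. (?P is as * ?G is js * ?P js bs) * inner (S as) (S bs))"
  by (rule sum.cong[OF refl]) (rule sum.swap)
 also have "\<dots> = (\<Sum>as\<in>?L. \<Sum>bs\<in>?L. (\<Prod>m<k. matrix_inv (g d q) $ (as ! m) $ (bs ! m)) * inner (S as) (S bs))"
  unfolding inv[symmetric] by (simp only: sum_distrib_right)
 finally show ?thesis by (simp add: tensor_norm_def)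
qed

lemma map_deriv_norm_eq:
 fixes F :: "'a \<Rightarrow> 'b::euclidean_space"
 assumes W: "patch d W" and q: "q \<in> W" and F: "csm k d W F"
 shows "map_deriv_norm A g k F q = tensor_norm g d q inner k (\<lambda>js. cov d F js q)"
proof -
 let ?c = "chart_at A q"
 have "\<exists>c. c \<in> A \<and> q \<in> domain c" using chart_exists by blast
 then have c: "?c \<in> A \<and> q \<in> domain ?c" unfolding chart_at_def by (rule someI_ex)
 define W' where "W' = W \<inter> domain ?c"
 have W': "patch ?c W'" "patch d W'" and q': "q \<in> W'"
  using W q c by (auto simp: patch_def W'_def intro!: open_Int chart)
 have "csm k ?c W' F"
  by (rule csm_change[OF W'(2,1)]) (rule csm_subset[OF F], simp add: W'_def)
 then have "cov ?c F is q = (\<Sum>as | length as = k. (\<Prod>m<k. jac ?c d (is ! m) (as ! m) q) *\<^sub>R cov d F as q)"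
  if "length is = k" for "is"
  using cov_change[OF W' _ q', of "is" F] that by simp
 then have "tensor_norm g ?c q inner k (\<lambda>js. cov ?c F js q) = tensor_norm g d q inner k (\<lambda>js. cov d F js q)"
  using W' q' c by (intro tensor_norm_change) (auto simp: patch_def)
 then show ?thesis by (simp add: map_deriv_norm_def Let_def)
qed

end

section \<open>Differential operators with smooth coefficients\<close>

primrec partials :: "('a, 'n::finite) chart \<Rightarrow> 'n list \<Rightarrow> ('a \<Rightarrow> 'b::real_normed_vector) \<Rightarrow> 'a \<Rightarrow> 'b" where
 "partials c [] F = F"
| "partials c (i # us) F = partial c i (partials c us F)"

context smooth_manifold
begin

lemma csm_partials: "patch c W \<Longrightarrow> csm (k + length us) c W F \<Longrightarrow> csm k c W (partials c us F)"
 by (induction us arbitrary: k) (auto intro!: csm_partial)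

lemma partials_conv_ddir:
 assumes W: "patch c W" and y: "y \<in> coord c ` W"
 shows "partials c us F (param c y) = ddir (\<lambda>y. F (param c y)) (map (\<lambda>i. axis i 1) us) y"
 using y
proof (induction us arbitrary: y)
 case (Cons i us)
 have "fd (\<lambda>y. partials c us F (param c y)) y = fd (ddir (\<lambda>y. F (param c y)) (map (\<lambda>i. axis i 1) us)) y"
  by (rule fd_cong[OF patch_image[OF W] Cons.prems Cons.IH])
 then show ?case
  using patch_coord[OF W Cons.prems] by (simp add: partial_def chart_deriv_def o_def)
qed simp

lemma partials_diff:
 assumes W: "patch c W"
 shows "csm (length us) c W F \<Longrightarrow> csm (length us) c W G \<Longrightarrow> q \<in> W \<Longrightarrow>
  partials c us (\<lambda>q. F q - G q) q = partials c us F q - partials c us G q"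
proof (induction us arbitrary: q)
 case (Cons i us)
 have 1: "csm (Suc 0) c W (partials c us F)" "csm (Suc 0) c W (partials c us G)"
  using Cons.prems by (auto intro!: csm_partials[OF W])
 obtain L where L: "((\<lambda>y. partials c us F (param c y)) has_derivative L) (at (coord c q))"
  "\<And>i. partial c i (partials c us F) q = L (axis i 1)"
  using csm_has_derivative[OF 1(1) Cons.prems(3)] by blast
 obtain M where M: "((\<lambda>y. partials c us G (param c y)) has_derivative M) (at (coord c q))"
  "\<And>i. partial c i (partials c us G) q = M (axis i 1)"
  using csm_has_derivative[OF 1(2) Cons.prems(3)] by blast
 have "csm (length us) c W F" "csm (length us) c W G"
  using Cons.prems csm_le[of "length (i # us)" c W _ "length us"] by auto
 then have "partial c i (partials c us (\<lambda>q. F q - G q)) q =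
   partial c i (\<lambda>q. partials c us F q - partials c us G q) q"
  by (intro partial_cong[OF W Cons.prems(3)] Cons.IH)
 then show ?case
  using partial_eqI[where i = i, OF has_derivative_diff[OF L(1) M(1)]] by (simp add: L(2) M(2))
qed simp

text \<open>The coefficients are smooth on the whole chart domain and therefore bounded on its
  compact subsets. The representation is demanded on every patch, because the maps to which it is
  applied are known to be regular only near a given point.\<close>

definition diffop_rep ::
 "('a, 'n) chart \<Rightarrow> nat \<Rightarrow> (('a \<Rightarrow> 'b::euclidean_space) \<Rightarrow> 'a \<Rightarrow> 'b) \<Rightarrow> (('a \<Rightarrow> real) \<times> 'n list) list \<Rightarrow> bool" where
 "diffop_rep c n P xs \<longleftrightarrow> (\<forall>(a, us)\<in>set xs. (\<forall>k. csm k c (domain c) a) \<and> length us \<le> n) \<and>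
   (\<forall>W F q. patch c W \<longrightarrow> csm n c W F \<longrightarrow> q \<in> W \<longrightarrow> P F q = (\<Sum>(a, us)\<leftarrow>xs. a q *\<^sub>R partials c us F q))"

definition diffop :: "('a, 'n) chart \<Rightarrow> nat \<Rightarrow> (('a \<Rightarrow> 'b::euclidean_space) \<Rightarrow> 'a \<Rightarrow> 'b) \<Rightarrow> bool" where
 "diffop c n P \<longleftrightarrow> (\<exists>xs. diffop_rep c n P xs)"

lemma diffopI:
 assumes "\<And>a us. (a, us) \<in> set xs \<Longrightarrow> (\<forall>k. csm k c (domain c) a) \<and> length us \<le> n"
  and "\<And>W F q. patch c W \<Longrightarrow> csm n c W F \<Longrightarrow> q \<in> W \<Longrightarrow> P F q = (\<Sum>(a, us)\<leftarrow>xs. a q *\<^sub>R partials c us F q)"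
 shows "diffop c n P"
 unfolding diffop_def diffop_rep_def using assms by (intro exI[of _ xs]) auto

lemma diffop_repD:
 assumes "diffop_rep c n P xs"
 shows "\<And>a us k. (a, us) \<in> set xs \<Longrightarrow> csm k c (domain c) a" "\<And>a us. (a, us) \<in> set xs \<Longrightarrow> length us \<le> n"
  "\<And>W F q. patch c W \<Longrightarrow> csm n c W F \<Longrightarrow> q \<in> W \<Longrightarrow> P F q = (\<Sum>(a, us)\<leftarrow>xs. a q *\<^sub>R partials c us F q)"
proof -
 note * = assms[unfolded diffop_rep_def]
 show "csm k c (domain c) a" "length us \<le> n" if "(a, us) \<in> set xs" for a us k
  using bspec[OF conjunct1[OF *] that] by simp_all
 show "P F q = (\<Sum>(a, us)\<leftarrow>xs. a q *\<^sub>R partials c us F q)" if "patch c W" "csm n c W F" "q \<in> W" for W F q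
  by (rule conjunct2[OF *, rule_format]) (fact that)+
qed

lemma diffop_id: "diffop c 0 (\<lambda>F. F)"
 by (rule diffopI[of "[(\<lambda>q. 1, [])]"]) (auto simp: csm_const)

lemma diffop_mono:
 assumes "diffop c m P" "m \<le> n"
 shows "diffop c n P"
proof -
 obtain xs where "diffop_rep c m P xs" using assms(1) unfolding diffop_def by blast
 note xs = diffop_repD[OF this]
 show ?thesis
 proof (rule diffopI[of xs])
  show "(\<forall>k. csm k c (domain c) a) \<and> length us \<le> n" if "(a, us) \<in> set xs" for a us
   using xs(1,2)[OF that] assms(2) by auto
  show "P F q = (\<Sum>(a, us)\<leftarrow>xs. a q *\<^sub>R partials c us F q)" if "patch c W" "csm n c W F" "q \<in> W" for W F q
   using xs(3)[OF that(1) csm_le[OF that(2) assms(2)] that(3)] .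
 qed
qed

lemma diffop_add:
 assumes "diffop c n P" "diffop c n Q"
 shows "diffop c n (\<lambda>F q. P F q + Q F q)"
proof -
 obtain xs where "diffop_rep c n P xs" using assms(1) unfolding diffop_def by blast
 note xs = diffop_repD[OF this]
 obtain ys where "diffop_rep c n Q ys" using assms(2) unfolding diffop_def by blast
 note ys = diffop_repD[OF this]
 show ?thesis
 proof (rule diffopI[of "xs @ ys"])
  show "(\<forall>k. csm k c (domain c) a) \<and> length us \<le> n" if "(a, us) \<in> set (xs @ ys)" for a us
   using that xs(1,2) ys(1,2) by auto
  show "P F q + Q F q = (\<Sum>(a, us)\<leftarrow>xs @ ys. a q *\<^sub>R partials c us F q)"
   if "patch c W" "csm n c W F" "q \<in> W" for W F q
   using xs(3)[OF that] ys(3)[OF that] by simp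
 qed
qed

lemma diffop_scaleR:
 assumes c: "c \<in> A" and P: "diffop c n P" and b: "\<And>k. csm k c (domain c) b"
 shows "diffop c n (\<lambda>F q. b q *\<^sub>R P F q)"
proof -
 obtain xs where "diffop_rep c n P xs" using P unfolding diffop_def by blast
 note xs = diffop_repD[OF this]
 show ?thesis
 proof (rule diffopI[of "map (\<lambda>(a, us). (\<lambda>q. b q * a q, us)) xs"])
  show "(\<forall>k. csm k c (domain c) a) \<and> length us \<le> n"
   if "(a, us) \<in> set (map (\<lambda>(a, us). (\<lambda>q. b q * a q, us)) xs)" for a us
   using that xs(1,2) b csm_mult[OF patch_domain[OF c]] by auto
  show "b q *\<^sub>R P F q = (\<Sum>(a, us)\<leftarrow>map (\<lambda>(a, us). (\<lambda>q. b q * a q, us)) xs. a q *\<^sub>R partials c us F q)"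
   if "patch c W" "csm n c W F" "q \<in> W" for W F q
   unfolding xs(3)[OF that] by (induction xs) (auto simp: scaleR_add_right)
 qed
qed

lemma diffop_sum:
 assumes "finite I" "\<And>x. x \<in> I \<Longrightarrow> diffop c n (P x)"
 shows "diffop c n (\<lambda>F q. \<Sum>x\<in>I. P x F q)"
 using assms
proof (induction I rule: finite_induct)
 case empty
 show ?case by (rule diffopI[of "[]"]) auto
next
 case (insert x I)
 then show ?case using diffop_add[of c n "P x" "\<lambda>F q. \<Sum>x\<in>I. P x F q"] by simp
qed

lemma diffop_diff:
 assumes "c \<in> A" "diffop c n P" "diffop c n Q"
 shows "diffop c n (\<lambda>F q. P F q - Q F q)"
 using diffop_add[OF assms(2) diffop_scaleR[OF assms(1,3), of "\<lambda>q. - 1"]] by (simp add: csm_const)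

lemma diffop_partial:
 assumes c: "c \<in> A" and P: "diffop c n P"
 shows "diffop c (Suc n) (\<lambda>F. partial c i (P F))"
proof -
 obtain xs where "diffop_rep c n P xs" using P unfolding diffop_def by blast
 note xs = diffop_repD[OF this]
 \<comment> \<open>By the product rule every term yields two: one with a further derivative of the
   argument, and one with a differentiated coefficient.\<close>
 define ys where "ys = map (\<lambda>(a, us). (a, i # us)) xs @ map (\<lambda>(a, us). (partial c i a, us)) xs"
 show ?thesis
 proof (rule diffopI[of ys])
  show "(\<forall>k. csm k c (domain c) a) \<and> length us \<le> Suc n" if "(a, us) \<in> set ys" for a us
   using that xs(1,2) csm_partial[OF patch_domain[OF c]] unfolding ys_def by fastforce
  show "partial c i (P F) q = (\<Sum>(a, us)\<leftarrow>ys. a q *\<^sub>R partials c us F q)"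
   if W: "patch c W" and F: "csm (Suc n) c W F" and q: "q \<in> W" for W F q
  proof -
   have a: "csm (Suc 0) c W a" and u: "csm (Suc 0) c W (partials c us F)" if "(a, us) \<in> set xs" for a us
   proof -
    show "csm (Suc 0) c W a"
     using csm_subset[OF xs(1)[OF that]] W by (simp add: patch_def)
    show "csm (Suc 0) c W (partials c us F)"
     by (rule csm_partials[OF W csm_le[OF F]]) (use xs(2)[OF that] in simp)
   qed
   have t: "csm (Suc 0) c W (\<lambda>q. (case xs ! m of (a, us) \<Rightarrow> a q *\<^sub>R partials c us F q))" if "m < length xs" for m
   proof -
    obtain a' us where e: "xs ! m = (a', us)" by fastforce
    then have "(a', us) \<in> set xs" using nth_mem[OF that] by simp
    from csm_scaleR[OF W a[OF this] u[OF this]] show ?thesis by (simp add: e)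
   qed
   have "partial c i (P F) q = partial c i (\<lambda>q. \<Sum>m<length xs. (case xs ! m of (a, us) \<Rightarrow> a q *\<^sub>R partials c us F q)) q"
    by (rule partial_cong[OF W q])
     (simp add: xs(3)[OF W csm_le[OF F]] sum_list_sum_nth atLeast0LessThan)
   also have "\<dots> = (\<Sum>m<length xs. partial c i (\<lambda>q. (case xs ! m of (a, us) \<Rightarrow> a q *\<^sub>R partials c us F q)) q)"
    by (rule partial_sum[OF t q]) simp
   also have "\<dots> = (\<Sum>m<length xs. (case xs ! m of (a, us) \<Rightarrow>
     a q *\<^sub>R partials c (i # us) F q + partial c i a q *\<^sub>R partials c us F q))"
   proof (rule sum.cong[OF refl])
    fix m assume "m \<in> {..<length xs}"
    then have m: "xs ! m \<in> set xs" by simp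
    obtain a' us where e: "xs ! m = (a', us)" by fastforce
    show "partial c i (\<lambda>q. (case xs ! m of (a, us) \<Rightarrow> a q *\<^sub>R partials c us F q)) q = (case xs ! m of (a, us) \<Rightarrow>
      a q *\<^sub>R partials c (i # us) F q + partial c i a q *\<^sub>R partials c us F q)"
     using partial_scaleR[OF W q a u, of a' us a' us i] m by (simp add: e)
   qed
   also have "\<dots> = (\<Sum>(a, us)\<leftarrow>xs. a q *\<^sub>R partials c (i # us) F q + partial c i a q *\<^sub>R partials c us F q)"
    by (simp add: sum_list_sum_nth atLeast0LessThan)
   also have "\<dots> = (\<Sum>(a, us)\<leftarrow>ys. a q *\<^sub>R partials c us F q)"
    unfolding ys_def by (induction xs) (auto simp: algebra_simps)
   finally show ?thesis .
  qed
 qed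
qed

lemma csm_bounded:
 fixes a :: "'a \<Rightarrow> real"
 assumes c: "c \<in> A" and a: "csm k c (domain c) a" and K: "compact K" "K \<subseteq> domain c"
 obtains M where "M \<ge> 0" "\<And>q. q \<in> K \<Longrightarrow> \<bar>a q\<bar> \<le> M"
proof -
 have "continuous_on (coord c ` domain c) (\<lambda>y. a (param c y))"
  using a unfolding csm_def by (rule ck_continuous)
 moreover have "compact (coord c ` K)"
  using continuous_on_subset[OF chart(3)[OF c] K(2)] K(1) by (rule compact_continuous_image)
 ultimately have "compact ((\<lambda>y. a (param c y)) ` coord c ` K)"
  using compact_continuous_image[OF continuous_on_subset[OF _ image_mono[OF K(2)]]] by blast
 then obtain M where "M > 0" "\<And>y. y \<in> coord c ` K \<Longrightarrow> \<bar>a (param c y)\<bar> \<le> M"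
  using compact_imp_bounded bounded_pos by (metis image_eqI real_norm_def)
 moreover have "param c (coord c q) = q" if "q \<in> K" for q using chart(5)[OF c] K(2) that by blast
 ultimately show ?thesis using that[of M] by (metis image_eqI less_imp_le)
qed

text \<open>The constant depends only on the operator and the compact set, not on the map, so it can
  be fixed before the approximating control is chosen.\<close>

lemma diffop_bound:
 assumes c: "c \<in> A" and P: "diffop c n P" and K: "compact K" "K \<subseteq> domain c"
 shows "\<exists>C\<ge>0. \<forall>W F q e. patch c W \<longrightarrow> csm n c W F \<longrightarrow> q \<in> W \<inter> K \<longrightarrow>
  (\<forall>us. length us \<le> n \<longrightarrow> norm (partials c us F q) \<le> e) \<longrightarrow> norm (P F q) \<le> C * e"
proof -
 obtain xs where "diffop_rep c n P xs" using P unfolding diffop_def by blast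
 note xs = diffop_repD[OF this]
 have "\<exists>C\<ge>0. \<forall>F q e. q \<in> K \<longrightarrow> (\<forall>us. length us \<le> n \<longrightarrow> norm (partials c us F q :: 'b) \<le> e) \<longrightarrow>
   norm (\<Sum>(a, us)\<leftarrow>xs. a q *\<^sub>R partials c us F q) \<le> C * e"
  using xs(1,2)
 proof (induction xs)
  case Nil
  then show ?case by (intro exI[of _ 0]) auto
 next
  case (Cons x xs)
  obtain a us where x: "x = (a, us)" by fastforce
  have "\<exists>C\<ge>0. \<forall>F q e. q \<in> K \<longrightarrow> (\<forall>us. length us \<le> n \<longrightarrow> norm (partials c us F q :: 'b) \<le> e) \<longrightarrow>
    norm (\<Sum>(a, us)\<leftarrow>xs. a q *\<^sub>R partials c us F q) \<le> C * e"
   by (rule Cons.IH; rule Cons.prems; erule list.set_intros(2))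
  then obtain C where C: "C \<ge> 0" "\<And>F q e. q \<in> K \<Longrightarrow> (\<And>us. length us \<le> n \<Longrightarrow> norm (partials c us F q :: 'b) \<le> e) \<Longrightarrow>
    norm (\<Sum>(a, us)\<leftarrow>xs. a q *\<^sub>R partials c us F q) \<le> C * e" by blast
  have ax: "csm 0 c (domain c) a" and l: "length us \<le> n"
   using Cons.prems(1)[of a us] Cons.prems(2)[of a us] x by auto
  obtain M where M: "M \<ge> 0" "\<And>q. q \<in> K \<Longrightarrow> \<bar>a q\<bar> \<le> M" by (rule csm_bounded[OF c ax K]) blast
  have "norm (\<Sum>(a, us)\<leftarrow>x # xs. a q *\<^sub>R partials c us F q) \<le> (M + C) * e"
   if q: "q \<in> K" and e: "\<And>us. length us \<le> n \<Longrightarrow> norm (partials c us F q :: 'b) \<le> e" for F q e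
  proof -
   have "norm (a q *\<^sub>R partials c us F q) \<le> M * e"
    using M(2)[OF q] e[OF l] M(1) by (simp add: mult_mono)
   then show ?thesis
    using C(2)[OF q e] norm_triangle_ineq[of "a q *\<^sub>R partials c us F q" "\<Sum>(a, us)\<leftarrow>xs. a q *\<^sub>R partials c us F q"]
    by (simp add: x distrib_right)
  qed
  then show ?case using C(1) M(1) by (intro exI[of _ "M + C"]) auto
 qed
 then obtain C where C: "C \<ge> 0" "\<And>F q e. q \<in> K \<Longrightarrow> (\<And>us. length us \<le> n \<Longrightarrow> norm (partials c us F q :: 'b) \<le> e) \<Longrightarrow>
   norm (\<Sum>(a, us)\<leftarrow>xs. a q *\<^sub>R partials c us F q) \<le> C * e" by blast
 have "norm (P F q) \<le> C * e" if "patch c W" "csm n c W F" "q \<in> W \<inter> K" "\<forall>us. length us \<le> n \<longrightarrow> norm (partials c us F q) \<le> e" for W F q e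
  using C(2)[of q F e] xs(3)[OF that(1,2)] that(3,4) by auto
 then show ?thesis using C(1) by blast
qed

end

context riemannian_manifold
begin

lemma diffop_cov:
 assumes c: "c \<in> A"
 shows "diffop c (length js) (\<lambda>F :: 'a \<Rightarrow> 'b::euclidean_space. cov c F js)"
proof (induction js rule: length_induct)
 case (1 js)
 show ?case
 proof (cases js)
  case Nil
  then show ?thesis using diffop_id by simp
 next
  case (Cons i js')
  have IH: "diffop c (length js') (\<lambda>F :: 'a \<Rightarrow> 'b. cov c F js'')" if "length js'' = length js'" for js''
   using 1[rule_format, of js''] that Cons by simp
  note \<Gamma> = csm_christoffel[OF patch_domain[OF c]]
  have "diffop c (Suc (length js')) (\<lambda>(F :: 'a \<Rightarrow> 'b) q. partial c i (cov c F js') q -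
    (\<Sum>m<length js'. \<Sum>l\<in>UNIV. christoffel g c l i (js' ! m) q *\<^sub>R cov c F (js'[m := l]) q))"
  proof (rule diffop_diff[OF c diffop_partial[OF c IH[OF refl]]])
   have "diffop c (Suc (length js')) (\<lambda>(F :: 'a \<Rightarrow> 'b) q. christoffel g c l i (js' ! m) q *\<^sub>R cov c F (js'[m := l]) q)" for m l
    by (rule diffop_scaleR[OF c diffop_mono[OF IH[of "js'[m := l]"]] \<Gamma>]) simp_all
   then show "diffop c (Suc (length js')) (\<lambda>(F :: 'a \<Rightarrow> 'b) q.
     \<Sum>m<length js'. \<Sum>l\<in>UNIV. christoffel g c l i (js' ! m) q *\<^sub>R cov c F (js'[m := l]) q)"
    by (intro diffop_sum) simp_all
  qed
  then show ?thesis unfolding Cons cov_Cons by simp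
 qed
qed

lemma map_deriv_norm_le:
 assumes c: "c \<in> A" and K: "compact K" "K \<subseteq> domain c"
 shows "\<exists>C\<ge>0. \<forall>W (F :: 'a \<Rightarrow> 'b::euclidean_space) q e. patch c W \<longrightarrow> csm k c W F \<longrightarrow> q \<in> W \<inter> K \<longrightarrow>
  (\<forall>us. length us \<le> k \<longrightarrow> norm (partials c us F q) \<le> e) \<longrightarrow> map_deriv_norm A g k F q \<le> C * e"
proof -
 let ?L = "{js :: 'n list. length js = k}"
 have "\<forall>js. \<exists>C\<ge>0. \<forall>W (F :: 'a \<Rightarrow> 'b) q e. patch c W \<longrightarrow> csm (length js) c W F \<longrightarrow> q \<in> W \<inter> K \<longrightarrow>
   (\<forall>us. length us \<le> length js \<longrightarrow> norm (partials c us F q) \<le> e) \<longrightarrow> norm (cov c F js q) \<le> C * e"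
  using diffop_bound[OF c diffop_cov[OF c] K] by blast
 then obtain C where C: "\<And>js. C js \<ge> 0" "\<And>js W (F :: 'a \<Rightarrow> 'b) q e. patch c W \<Longrightarrow> csm (length js) c W F \<Longrightarrow> q \<in> W \<inter> K \<Longrightarrow>
   (\<forall>us. length us \<le> length js \<longrightarrow> norm (partials c us F q) \<le> e) \<Longrightarrow> norm (cov c F js q) \<le> C js * e"
  by metis
 have "\<forall>i j. \<exists>M\<ge>0. \<forall>q\<in>K. \<bar>matrix_inv (g c q) $ i $ j\<bar> \<le> M"
  using csm_bounded[OF c csm_metric_inv[OF patch_domain[OF c]] K] by metis
 then obtain M where M: "\<And>i j. M i j \<ge> 0" "\<And>i j q. q \<in> K \<Longrightarrow> \<bar>matrix_inv (g c q) $ i $ j\<bar> \<le> M i j" by metis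
 define D where "D = (\<Sum>is\<in>?L. \<Sum>js\<in>?L. (\<Prod>m<k. M (is ! m) (js ! m)) * (C is * C js))"
 have D: "D \<ge> 0" unfolding D_def by (intro sum_nonneg mult_nonneg_nonneg prod_nonneg) (auto simp: M C)
 have "map_deriv_norm A g k F q \<le> sqrt D * e"
  if W: "patch c W" and F: "csm k c W F" and q: "q \<in> W \<inter> K"
   and e: "\<forall>us. length us \<le> k \<longrightarrow> norm (partials c us F q) \<le> e" for W and F :: "'a \<Rightarrow> 'b" and q e
 proof -
  have e0: "e \<ge> 0" using order_trans[OF norm_ge_zero e[rule_format, of "[]"]] by simp
  have n: "norm (cov c F js q) \<le> C js * e" if "js \<in> ?L" for js
   using C(2)[OF W _ q, of js F e] F e that by simp
  have "(\<Prod>m<k. matrix_inv (g c q) $ (is ! m) $ (js ! m)) * inner (cov c F is q) (cov c F js q) \<le>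
    (\<Prod>m<k. M (is ! m) (js ! m)) * (C is * C js) * e\<^sup>2" if "is \<in> ?L" "js \<in> ?L" for "is" js
  proof -
   have 1: "\<bar>\<Prod>m<k. matrix_inv (g c q) $ (is ! m) $ (js ! m)\<bar> \<le> (\<Prod>m<k. M (is ! m) (js ! m))"
    unfolding abs_prod by (rule prod_mono) (use M q in auto)
   have "\<bar>inner (cov c F is q) (cov c F js q)\<bar> \<le> norm (cov c F is q) * norm (cov c F js q)"
    by (rule Cauchy_Schwarz_ineq2)
   also have "\<dots> \<le> (C is * e) * (C js * e)"
    using n that C(1) e0 by (intro mult_mono) auto
   finally have 2: "\<bar>inner (cov c F is q) (cov c F js q)\<bar> \<le> (C is * e) * (C js * e)" .
   have "\<bar>(\<Prod>m<k. matrix_inv (g c q) $ (is ! m) $ (js ! m)) * inner (cov c F is q) (cov c F js q)\<bar> \<le>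
     (\<Prod>m<k. M (is ! m) (js ! m)) * ((C is * e) * (C js * e))"
    unfolding abs_mult by (rule mult_mono[OF 1 2]) (auto intro!: prod_nonneg M)
   then show ?thesis by (simp add: power2_eq_square mult_ac)
  qed
  then have "(\<Sum>is\<in>?L. \<Sum>js\<in>?L. (\<Prod>m<k. matrix_inv (g c q) $ (is ! m) $ (js ! m)) * inner (cov c F is q) (cov c F js q)) \<le> D * e\<^sup>2"
   unfolding D_def sum_distrib_right by (intro sum_mono) auto
  then have "tensor_norm g c q inner k (\<lambda>js. cov c F js q) \<le> sqrt (D * e\<^sup>2)"
   unfolding tensor_norm_def by (rule real_sqrt_le_mono)
  then show ?thesis
   using map_deriv_norm_eq[OF W _ F, of q] q e0 by (simp add: real_sqrt_mult)
 qed
 then show ?thesis using D by (intro exI[of _ "sqrt D"]) auto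
qed

end

section \<open>The approximation theorem\<close>

lemma (in smooth_manifold) compact_chart_nbhd:
 obtains c C V where "c \<in> A" "compact C" "C \<subseteq> domain c" "open V" "p \<in> V" "V \<subseteq> C"
proof -
 obtain c where c: "c \<in> A" "p \<in> domain c" using chart_exists by blast
 obtain \<delta> where \<delta>: "\<delta> > 0" "cball (coord c p) \<delta> \<subseteq> coord c ` domain c"
  using open_contains_cball chart(2)[OF c(1)] c(2) by blast
 let ?C = "param c ` cball (coord c p) \<delta>" and ?V = "domain c \<inter> coord c -` ball (coord c p) \<delta>"
 show ?thesis
 proof (rule that[OF c(1), of ?C ?V])
  show "compact ?C"
   using continuous_on_subset[OF chart(4)[OF c(1)] \<delta>(2)] compact_cball by (rule compact_continuous_image)
  show "?C \<subseteq> domain c" using \<delta>(2) chart(6)[OF c(1)] by blast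
  show "open ?V" by (intro continuous_open_preimage chart c(1) open_ball)
  show "p \<in> ?V" using c \<delta> by simp
  show "?V \<subseteq> ?C"
  proof
   fix q assume q: "q \<in> ?V"
   then have "q = param c (coord c q)" using chart(5)[OF c(1)] by simp
   then show "q \<in> ?C" using q by (intro image_eqI) auto
  qed
 qed
qed

text \<open>Words outside \<open>B\<close> receive the zero control, which embeds the given system
  into the one indexed by the larger set \<open>J\<close>. Bounded measurable functions are
  integrable in the gauge sense used for the integral equations.\<close>

lemma admissible_control:
 assumes "is_control T B v"
 shows "admissible J (\<lambda>\<beta> t. if \<beta> \<in> B then v \<beta> t else 0) 0 T"
 unfolding admissible_def
proof (intro ballI conjI)
 fix \<beta>
 show "bounded ((\<lambda>t. if \<beta> \<in> B then v \<beta> t else 0) ` {0..T})"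
 proof (cases "\<beta> \<in> B")
  case False
  then have "(\<lambda>t. if \<beta> \<in> B then v \<beta> t else 0) ` {0..T} \<subseteq> {0}" by auto
  then show ?thesis by (rule bounded_subset[rotated]) simp
 qed (use assms in \<open>simp add: is_control_def\<close>)
 show "(\<lambda>t. if \<beta> \<in> B then v \<beta> t else 0) integrable_on {0..T}"
 proof (cases "\<beta> \<in> B")
  case True
  then have v: "v \<beta> \<in> borel_measurable (lebesgue_on {0..T})" "bounded (v \<beta> ` {0..T})"
   using assms by (auto simp: is_control_def)
  obtain M where "\<forall>x\<in>v \<beta> ` {0..T}. norm x \<le> M" using v(2) unfolding bounded_iff by blast
  then have "v \<beta> integrable_on {0..T}"
   by (intro measurable_bounded_by_integrable_imp_integrable[OF v(1), of "\<lambda>t. M"]) auto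
  then show ?thesis using True by simp
 qed (simp add: integrable_0)
qed

context
 fixes A :: "('a::t2_space, 'n::finite) chart set" and g :: "('a, 'n) metric"
  and f :: "nat \<Rightarrow> ('a, 'n) vfield" and J :: "nat list set" and T :: real and \<iota> :: "'a \<Rightarrow> real ^ 'm"
 assumes control: "control_manifold A f J" and riem: "riemannian_manifold A g"
  and T: "0 \<le> T" and \<iota>: "smooth_map A \<iota>"
begin

interpretation control_manifold A f J T by (rule control)
interpretation riemannian_manifold A g by (rule riem)

lemma csm_flow:
 assumes c: "c \<in> A" and w: "admissible J w 0 T" and q: "q \<in> mdom w 0 T" "q \<in> domain c" and t: "t \<in> {0..T}"
 shows "\<exists>W. patch c W \<and> q \<in> W \<and> csm k c W (\<lambda>x. \<iota> (mflow w 0 T t x))"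
proof -
 obtain U where U: "open U" "coord c q \<in> U" "good k (prj -` U) (elift (\<lambda>y. \<iota> (mflow w 0 T t (param c y))))"
  by (rule flow_good[OF w T \<iota> c q, where k = k]) (use t in blast)
 define W where "W = domain c \<inter> coord c -` U"
 have "patch c W" using c U(1) by (auto simp: patch_def W_def intro!: continuous_open_preimage chart)
 moreover have "csm k c W (\<lambda>x. \<iota> (mflow w 0 T t x))"
  unfolding csm_def by (rule ck_subset[OF U(3)[folded ck_def]]) (auto simp: W_def)
 ultimately show ?thesis using q(2) U(2) by (auto simp: W_def)
qed

lemma cr_seminorm_approximation:
 assumes v: "admissible J v 0 T" and dom: "mdom v 0 T = UNIV" and K: "compact K" and \<epsilon>: "\<epsilon> > 0"
 obtains u where "\<And>j. elementary (u j)" "\<And>\<beta>. \<beta> \<in> J \<Longrightarrow> 2 \<le> length \<beta> \<Longrightarrow> u \<beta> = (\<lambda>t. 0)"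
  "K \<subseteq> interior (mdom u 0 T)"
  "\<And>t. t \<in> {0..T} \<Longrightarrow> cr_seminorm A g r K (\<lambda>x. \<iota> (mflow v 0 T t x) - \<iota> (mflow u 0 T t x)) < ennreal \<epsilon>"
proof -
 have "\<forall>p. \<exists>c C V. c \<in> A \<and> compact C \<and> C \<subseteq> domain c \<and> open V \<and> p \<in> V \<and> V \<subseteq> C"
  using compact_chart_nbhd by metis
 then obtain c C V where cov: "\<And>p. c p \<in> A" "\<And>p. compact (C p)" "\<And>p. C p \<subseteq> domain (c p)"
  "\<And>p. open (V p)" "\<And>p. p \<in> V p" "\<And>p. V p \<subseteq> C p" by metis
 have "K \<subseteq> (\<Union>p\<in>K. V p)" using cov(5) by blast
 then obtain D where D: "D \<subseteq> K" "finite D" "K \<subseteq> (\<Union>p\<in>D. V p)"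
  using compactE_image[OF K, of K V] cov(4) by metis
 have "\<exists>M\<ge>0. \<forall>W (F :: 'a \<Rightarrow> real ^ 'm) q e. patch (c p) W \<longrightarrow> csm k (c p) W F \<longrightarrow> q \<in> W \<inter> C p \<longrightarrow>
   (\<forall>us. length us \<le> k \<longrightarrow> norm (partials (c p) us F q) \<le> e) \<longrightarrow> map_deriv_norm A g k F q \<le> M * e" for p k
  by (rule map_deriv_norm_le[OF cov(1-3)])
 then obtain M where M: "\<And>p k. M p k \<ge> 0" "\<And>p k W (F :: 'a \<Rightarrow> real ^ 'm) q e. patch (c p) W \<Longrightarrow> csm k (c p) W F \<Longrightarrow> q \<in> W \<inter> C p \<Longrightarrow>
   (\<forall>us. length us \<le> k \<longrightarrow> norm (partials (c p) us F q) \<le> e) \<Longrightarrow> map_deriv_norm A g k F q \<le> M p k * e"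
  by metis
 define N where "N = 1 + (\<Sum>p\<in>D. \<Sum>k\<le>r. M p k)"
 have N: "N \<ge> 1" "\<And>p. p \<in> D \<Longrightarrow> (\<Sum>k\<le>r. M p k) \<le> N"
 proof -
  have nn: "(\<Sum>k\<le>r. M p k) \<ge> 0" for p by (intro sum_nonneg M)
  then show "N \<ge> 1" by (simp add: N_def sum_nonneg)
  show "(\<Sum>k\<le>r. M p k) \<le> N" if "p \<in> D" for p
   using member_le_sum[OF that, of "\<lambda>p. \<Sum>k\<le>r. M p k"] nn D(2) by (simp add: N_def)
 qed
 \<comment> \<open>\<open>N\<close> bounds, in each of the finitely many charts, the sum of the
   constants over all orders up to \<open>r\<close>. The extra factor 2 leaves room for the strict
   inequality after the supremum is taken.\<close>
 define e where "e = \<epsilon> / (2 * N)"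
 have e: "e > 0" using N \<epsilon> by (simp add: e_def)
 let ?P = "(\<lambda>p. (c p, C p)) ` D" and ?VS = "map (\<lambda>i. axis i 1) ` {us :: 'n list. length us \<le> r}"
 have fP: "finite ?P" using D(2) by simp
 have VS: "finite ?VS" using finite_lists_length_le[of "UNIV :: 'n set" r] by simp
 have P: "c' \<in> A \<and> compact C' \<and> C' \<subseteq> domain c' \<and> C' \<subseteq> mdom v 0 T" if "(c', C') \<in> ?P" for c' C'
  using that cov dom by auto
 obtain u where u: "\<And>j. elementary (u j)" "\<And>\<beta>. \<beta> \<in> J \<Longrightarrow> 2 \<le> length \<beta> \<Longrightarrow> u \<beta> = (\<lambda>t. 0)"
  "jets_close \<iota> ?P ?VS e v u"
  by (rule approximate_control[OF T \<iota> fP _ VS v e]) (erule P, rule that)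
 have close: "C p \<subseteq> interior (mdom u 0 T)"
  "\<And>us q t. length us \<le> r \<Longrightarrow> q \<in> C p \<Longrightarrow> t \<in> {0..T} \<Longrightarrow>
   jet_dist \<iota> (c p) (map (\<lambda>i. axis i 1) us) u v t q < e" if "p \<in> D" for p
  using u(3) that unfolding jets_close_def by auto
 have KC: "\<exists>p\<in>D. q \<in> C p" if "q \<in> K" for q using D(3) cov(6) that by blast
 show ?thesis
 proof (rule that[OF u(1,2)])
  show "K \<subseteq> interior (mdom u 0 T)" using KC close(1) by blast
  fix t assume t: "t \<in> {0..T}"
  let ?F = "\<lambda>x. \<iota> (mflow v 0 T t x) - \<iota> (mflow u 0 T t x)"
  have "(\<Sum>k\<le>r. map_deriv_norm A g k ?F q) \<le> \<epsilon> / 2" if q: "q \<in> K" for q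
  proof -
   obtain p where p: "p \<in> D" "q \<in> C p" using KC[OF q] by blast
   have qd: "q \<in> domain (c p)" and qv: "q \<in> mdom v 0 T" and qu: "q \<in> mdom u 0 T"
    using p cov(3) close(1)[OF p(1)] interior_subset dom by blast+
   have adm: "admissible J u 0 T" by (intro admissible_continuous elementary_continuous u(1))
   obtain W1 where W1: "patch (c p) W1" "q \<in> W1" "csm r (c p) W1 (\<lambda>x. \<iota> (mflow v 0 T t x))"
    using csm_flow[OF cov(1) v qv qd t] by blast
   obtain W2 where W2: "patch (c p) W2" "q \<in> W2" "csm r (c p) W2 (\<lambda>x. \<iota> (mflow u 0 T t x))"
    using csm_flow[OF cov(1) adm qu qd t] by blast
   have W: "patch (c p) (W1 \<inter> W2)" "q \<in> W1 \<inter> W2" using W1 W2 by (auto simp: patch_def)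
   have g1: "csm r (c p) (W1 \<inter> W2) (\<lambda>x. \<iota> (mflow v 0 T t x))" by (rule csm_subset[OF W1(3)]) blast
   have g2: "csm r (c p) (W1 \<inter> W2) (\<lambda>x. \<iota> (mflow u 0 T t x))" by (rule csm_subset[OF W2(3)]) blast
   have F: "csm r (c p) (W1 \<inter> W2) ?F" by (rule csm_diff[OF W(1) g1 g2])
   have n: "norm (partials (c p) us ?F q) \<le> e" if us: "length us \<le> r" for us
   proof -
    have conv: "partials (c p) us (\<lambda>x. \<iota> (mflow w 0 T t x)) q =
      ddir (\<lambda>y. \<iota> (mflow w 0 T t (param (c p) y))) (map (\<lambda>i. axis i 1) us) (coord (c p) q)" for w
     using partials_conv_ddir[OF W(1) imageI[OF W(2)], of us "\<lambda>x. \<iota> (mflow w 0 T t x)"]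
     by (simp add: patch_param[OF W])
    have "partials (c p) us ?F q = partials (c p) us (\<lambda>x. \<iota> (mflow v 0 T t x)) q
      - partials (c p) us (\<lambda>x. \<iota> (mflow u 0 T t x)) q"
     by (rule partials_diff[OF W(1) csm_le[OF g1 us] csm_le[OF g2 us] W(2)])
    then show ?thesis
     using close(2)[OF p(1) us p(2) t] by (simp add: conv norm_minus_commute)
   qed
   have "map_deriv_norm A g k ?F q \<le> M p k * e" if "k \<le> r" for k
    by (rule M(2)[OF W(1) csm_le[OF F that]]) (use W(2) p(2) n that in auto)
   then have "(\<Sum>k\<le>r. map_deriv_norm A g k ?F q) \<le> (\<Sum>k\<le>r. M p k * e)" by (intro sum_mono) simp
   also have "\<dots> = (\<Sum>k\<le>r. M p k) * e" by (simp add: sum_distrib_right)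
   also have "\<dots> \<le> N * e" using N(2)[OF p(1)] e by (intro mult_right_mono) auto
   also have "\<dots> = \<epsilon> / 2" using N(1) by (simp add: e_def)
   finally show ?thesis .
  qed
  then have "cr_seminorm A g r K ?F \<le> ennreal (\<epsilon> / 2)"
   unfolding cr_seminorm_def by (intro SUP_least ennreal_leI)
  also have "\<dots> < ennreal \<epsilon>" using \<epsilon> by (intro ennreal_lessI) auto
  finally show "cr_seminorm A g r K ?F < ennreal \<epsilon>" .
 qed
qed

end

theorem theorem3:
 fixes A :: "('a::{t2_space, second_countable_topology}, 'n::finite) chart set"
  and g :: "('a, 'n) metric"
  and \<iota> :: "'a \<Rightarrow> real ^ 'm"
  and s :: nat
  and f :: "nat \<Rightarrow> ('a, 'n) vfield"
  and B :: "nat list set"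
  and T :: real
  and v :: "nat list \<Rightarrow> real \<Rightarrow> real"
  and Pv :: "real \<Rightarrow> 'a \<Rightarrow> 'a"
  and \<epsilon> :: real
  and r :: nat
  and K :: "'a set"
 assumes "smooth_atlas A"
  and "connected (UNIV :: 'a set)"
  and "CARD('n) \<ge> 2"
  and "riemannian_metric A g"
  and "smooth_closed_embedding A \<iota>"
  and "\<And>j. j \<in> {1..s} \<Longrightarrow> smooth_vfield A (f j)"
  and "\<And>j. j \<in> {1..s} \<Longrightarrow> bounded_with_derivatives A g (f j)"
  and "finite B"
  and "\<And>\<beta>. \<beta> \<in> B \<Longrightarrow> \<beta> \<noteq> [] \<and> set \<beta> \<subseteq> {1..s}"
  and "\<And>j. j \<in> {1..s} \<Longrightarrow> [j] \<in> B"
  and "T \<ge> 0"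
  and "is_control T B v"
  and "flow_domain A T (control_field B (iterated_bracket f) v) = UNIV"
  and "is_flow A T (control_field B (iterated_bracket f) v) Pv"
  and "\<epsilon> > 0"
  and "compact K"
 shows "\<exists>u :: nat \<Rightarrow> real \<Rightarrow> real. is_control T {1..s} u \<and>
  K \<subseteq> interior (flow_domain A T (control_field {1..s} f u)) \<and>
  (\<exists>Pu. is_flow A T (control_field {1..s} f u) Pu \<and>
   (\<forall>t\<in>{0..T}. cr_seminorm A g r K (\<lambda>x. \<iota> (Pv t x) - \<iota> (Pu t x)) < ennreal \<epsilon>))"
proof -
 \<comment> \<open>The nonempty tails of the words in \<open>B\<close>: eliminating a bracket puts a
   control on its tail, which need not itself belong to \<open>B\<close>.\<close>
 define J where "J = (\<Union>\<beta>\<in>B. (\<lambda>k. drop k \<beta>) ` {..<length \<beta>})"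
 have finJ: "finite J" using assms(8) by (simp add: J_def)
 have J: "\<gamma> \<noteq> [] \<and> set \<gamma> \<subseteq> {1..s}" if \<gamma>: "\<gamma> \<in> J" for \<gamma>
 proof -
  obtain \<beta> k where h: "\<beta> \<in> B" "k < length \<beta>" "\<gamma> = drop k \<beta>" using \<gamma> unfolding J_def by blast
  then show ?thesis using assms(9)[OF h(1)] set_drop_subset[of k \<beta>] by auto
 qed
 have BJ: "B \<subseteq> J"
 proof
  fix \<beta> assume "\<beta> \<in> B"
  then have "\<beta> = drop 0 \<beta>" "0 < length \<beta>" using assms(9) by auto
  then show "\<beta> \<in> J" using \<open>\<beta> \<in> B\<close> unfolding J_def by blast
 qed
 have tl: "\<gamma> \<in> J" if i: "i # \<gamma> \<in> J" "\<gamma> \<noteq> []" for i \<gamma>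
 proof -
  obtain \<beta> k where h: "\<beta> \<in> B" "k < length \<beta>" "i # \<gamma> = drop k \<beta>" using i(1) by (auto simp: J_def)
  have "drop (Suc k) \<beta> = \<gamma>" by (metis h(3) drop_Suc tl_drop list.sel(3))
  moreover then have "Suc k < length \<beta>" using i(2) by (metis drop_all not_le)
  ultimately show ?thesis using h(1) by (auto simp: J_def)
 qed
 have cm: "control_manifold A f J"
 proof unfold_locales
  show "[i] \<in> J \<and> \<gamma> \<in> J" if i: "i # \<gamma> \<in> J" "\<gamma> \<noteq> []" for i \<gamma>
   using tl[OF i] J[OF i(1)] assms(10)[of i] BJ by auto
  show "smooth_vfield A (f i)" if "[i] \<in> J" for i using J[OF that] assms(6) by simp
 qed (use assms(1) finJ J in auto)
 interpret control_manifold A f J T by (rule cm)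
 have rm: "riemannian_manifold A g" using assms(1,4) by unfold_locales
 have \<iota>: "smooth_map A \<iota>" using assms(5) by (simp add: smooth_closed_embedding_def)
 define w where "w = (\<lambda>\<beta> t. if \<beta> \<in> B then v \<beta> t else 0)"
 have w: "admissible J w 0 T" unfolding w_def by (rule admissible_control[OF assms(12)])
 have fw: "control_field B (iterated_bracket f) v = control_field J (iterated_bracket f) w"
 proof (intro ext)
  fix t c p
  show "control_field B (iterated_bracket f) v t c p = control_field J (iterated_bracket f) w t c p"
   unfolding control_field_def using finJ BJ by (intro sum.mono_neutral_cong_left) (auto simp: w_def)
 qed
 have dom: "mdom w 0 T = UNIV" using assms(13) flow_domain_eq[OF assms(11), of w] by (simp add: fw)
 have Pv: "Pv t x = mflow w 0 T t x" if "t \<in> {0..T}" for t x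
  by (rule is_flow_eq[OF assms(11) w _ _ that]) (use assms(14) dom in \<open>simp_all add: fw\<close>)
 obtain u where u: "\<And>j. elementary (u j)" "\<And>\<beta>. \<beta> \<in> J \<Longrightarrow> 2 \<le> length \<beta> \<Longrightarrow> u \<beta> = (\<lambda>t. 0)"
  "K \<subseteq> interior (mdom u 0 T)"
  "\<And>t. t \<in> {0..T} \<Longrightarrow> cr_seminorm A g r K (\<lambda>x. \<iota> (mflow w 0 T t x) - \<iota> (mflow u 0 T t x)) < ennreal \<epsilon>"
  by (rule cr_seminorm_approximation[OF cm rm assms(11) \<iota> w dom assms(16,15)]) blast
 define u1 where "u1 j = u [j]" for j :: nat
 \<comment> \<open>The controls of all words with at least two letters vanish, so the sum over
   \<open>J\<close> reduces to the single letters and is the field of the original control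
   system.\<close>
 have fu: "control_field {1..s} f u1 = control_field J (iterated_bracket f) u"
 proof (intro ext)
  fix t c p
  have "(\<Sum>\<beta>\<in>J. u \<beta> t *\<^sub>R iterated_bracket f \<beta> c p) = (\<Sum>\<beta>\<in>(\<lambda>j. [j]) ` {1..s}. u \<beta> t *\<^sub>R iterated_bracket f \<beta> c p)"
  proof (rule sum.mono_neutral_right[OF finJ])
   show "(\<lambda>j. [j]) ` {1..s} \<subseteq> J" using assms(10) BJ by auto
   show "\<forall>\<beta>\<in>J - (\<lambda>j. [j]) ` {1..s}. u \<beta> t *\<^sub>R iterated_bracket f \<beta> c p = 0"
   proof
    fix \<beta> assume \<beta>: "\<beta> \<in> J - (\<lambda>j. [j]) ` {1..s}"
    then have "\<beta> \<noteq> []" "set \<beta> \<subseteq> {1..s}" using J[of \<beta>] by auto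
    moreover then have "\<beta> \<noteq> [j]" for j using \<beta> by auto
    ultimately have "2 \<le> length \<beta>" by (cases \<beta>; cases "tl \<beta>") auto
    then have "u \<beta> = (\<lambda>t. 0)" using u(2) \<beta> by blast
    then show "u \<beta> t *\<^sub>R iterated_bracket f \<beta> c p = 0" by simp
   qed
  qed
  also have "\<dots> = (\<Sum>j\<in>{1..s}. u1 j t *\<^sub>R f j c p)" by (subst sum.reindex) (auto simp: inj_on_def u1_def)
  finally show "control_field {1..s} f u1 t c p = control_field J (iterated_bracket f) u t c p"
   by (simp add: control_field_def)
 qed
 have "is_control T {1..s} u1"
  unfolding is_control_def u1_def
  by (auto intro!: continuous_imp_measurable_on_sets_lebesgue compact_imp_bounded compact_continuous_image
    elementary_continuous u(1))
 moreover have "K \<subseteq> interior (flow_domain A T (control_field {1..s} f u1))"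
  unfolding fu flow_domain_eq[OF assms(11)] by (rule u(3))
 moreover have "is_flow A T (control_field {1..s} f u1) (mflow u 0 T)"
  unfolding fu by (rule is_flow_mflow[OF assms(11)])
 moreover have "\<forall>t\<in>{0..T}. cr_seminorm A g r K (\<lambda>x. \<iota> (Pv t x) - \<iota> (mflow u 0 T t x)) < ennreal \<epsilon>"
  using u(4) Pv by simp
 ultimately show ?thesis by blast
qed

end
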